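(* Let $G$ be a locally compact group. Let $\mathcal{C}(G)$ be the stereotype space of all continuous functions $f:G\to\mathbb{C}$, with the topology of uniform convergence on compact subsets of $G$, and let $\mathcal{C}^\star(G)$ be its stereotype dual space (the space of measures with compact support on $G$). Then both stereotype spaces $\mathcal{C}(G)$ and $\mathcal{C}^\star(G)$ have the stereotype approximation property.
   Context: Locally compact groups and locally convex spaces are Hausdorff; all vector spaces are over $\mathbb{C}$. **Stereotype dual and stereotype spaces.** For a locally convex space $X$, the stereotype dual $X^\star$ is the space of all continuous linear functionals $X\to\mathbb{C}$ with the topology of uniform convergence on totally bounded subsets of $X$. The space $X$ is called stereotype if the natural map $X\to (X^\star)^\star$, $x\mapsto (f\mapsto f(x))$, is an isomorphism of locally convex spaces (a linear homeomorphism). In a stereotype space the closure of each totally bounded set is compact, so "totally bounded" may be replaced by "compact" in such topologies of uniform convergence. **The spaces $\mathcal{C}(G)$ and $\mathcal{C}^\star(G)$.** $\mathcal{C}(G)$ is the space of all continuous functions $G\to\mathbb{C}$ with the topology generated by the seminorms $f\mapsto\sup_{t\in K}|f(t)|$, where $K\subseteq G$ is compact. $\mathcal{C}^\star(G):=(\mathcal{C}(G))^\star$ is its stereotype dual; its elements are identified with the complex Radon measures with compact support on $G$, and its topology is that of uniform convergence on totally bounded (equivalently, compact) subsets of $\mathcal{C}(G)$. It is known that both spaces are stereotype. **Pseudosaturation.** A subset $D$ of a locally convex space $X$ is called capacious if for each totally bounded set $A\subseteq X$ there is a finite set $F\subseteq X$ such that $A\subseteq D+F$. The space $X$ is called pseudosaturated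 if each closed convex balanced capacious set in $X$ is a neighbourhood of zero. The pseudosaturation $X^\vartriangle$ of $X$ is the vector space $X$ with the coarsest among all pseudosaturated locally convex topologies that are finer than (or equal to) the original topology of $X$. **Spaces of operators.** For a stereotype space $X$, denote by $X:X$ the space of all continuous linear operators $\varphi:X\to X$ with the topology of uniform convergence on totally bounded (equivalently, compact) subsets of $X$, and put $\mathcal{L}(X):=(X:X)^\vartriangle$, the pseudosaturation of $X:X$. **Stereotype approximation property.** A stereotype space $X$ has the stereotype approximation property if each continuous linear operator $\varphi:X\to X$ is the limit in $\mathcal{L}(X)$ of a net of continuous linear operators of finite rank, i.e. the continuous operators of finite rank are dense in $\mathcal{L}(X)$. Equivalently, the identity operator $\mathrm{id}_X$ lies in the closure in $\mathcal{L}(X)$ of the set of continuous operators of finite rank. *)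

theory Defs
  imports "HOL-Analysis.Analysis" "HOL-Library.Function_Algebras"
begin

section \<open>Complex vector spaces\<close>

class complex_vector = real_vector +
  fixes scaleC :: "complex \<Rightarrow> 'a \<Rightarrow> 'a"  (infixr \<open>*\<^sub>C\<close> 75)
  assumes scaleC_add_right: "a *\<^sub>C (x + y) = a *\<^sub>C x + a *\<^sub>C y"
    and scaleC_add_left: "(a + b) *\<^sub>C x = a *\<^sub>C x + b *\<^sub>C x"
    and scaleC_scaleC: "a *\<^sub>C b *\<^sub>C x = (a * b) *\<^sub>C x"
    and scaleC_of_real: "complex_of_real r *\<^sub>C x = r *\<^sub>R x"

global_interpretation complex_vector: vector_space "scaleC :: complex \<Rightarrow> 'a \<Rightarrow> 'a::complex_vector"
  defines csubspace = complex_vector.subspace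
    and cspan = complex_vector.span
proof
  show "1 *\<^sub>C x = x" for x :: 'a
    using scaleC_of_real [of 1 x] by simp
qed (simp_all add: scaleC_add_right scaleC_add_left scaleC_scaleC)

instantiation complex :: complex_vector
begin
definition scaleC_complex :: "complex \<Rightarrow> complex \<Rightarrow> complex" where
  "scaleC_complex c z = c * z"
instance
  by standard (simp_all add: scaleC_complex_def algebra_simps scaleR_conv_of_real)
end

instantiation "fun" :: (type, real_vector) real_vector
begin
definition scaleR_fun :: "real \<Rightarrow> ('a \<Rightarrow> 'b) \<Rightarrow> 'a \<Rightarrow> 'b" where
  "scaleR_fun r f = (\<lambda>x. r *\<^sub>R f x)"
instance
  by standard (simp_all add: scaleR_fun_def fun_eq_iff scaleR_add_right scaleR_add_left)
end

instantiation "fun" :: (type, complex_vector) complex_vector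
begin
definition scaleC_fun :: "complex \<Rightarrow> ('a \<Rightarrow> 'b) \<Rightarrow> 'a \<Rightarrow> 'b" where
  "scaleC_fun c f = (\<lambda>x. c *\<^sub>C f x)"
instance
  by standard
    (simp_all add: scaleC_fun_def scaleR_fun_def fun_eq_iff
      scaleC_add_right scaleC_add_left scaleC_scaleC scaleC_of_real)
end


section \<open>Locally convex spaces\<close>

text \<open>
  A locally convex space is given by its topology \<open>X\<close>; the underlying vector space is
  \<open>topspace X\<close>, a linear subspace of the ambient type. (A function type also carries the
  type-class topology of pointwise convergence; that topology is never used here.)
\<close>

definition locally_convex_space :: "'a::complex_vector topology \<Rightarrow> bool" where
  "locally_convex_space X \<longleftrightarrow>
     csubspace (topspace X) \<and>
     Hausdorff_space X \<and>
     continuous_map (prod_topology X X) X (\<lambda>(x, y). x + y) \<and>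
     continuous_map (prod_topology euclidean X) X (\<lambda>(c, x). c *\<^sub>C x) \<and>
     neighbourhood_base_at 0 convex X"

definition balanced :: "'a::complex_vector set \<Rightarrow> bool" where
  "balanced D \<longleftrightarrow> (\<forall>c. \<forall>x\<in>D. cmod c \<le> 1 \<longrightarrow> c *\<^sub>C x \<in> D)"

definition totally_bounded_in :: "'a::complex_vector topology \<Rightarrow> 'a set \<Rightarrow> bool" where
  "totally_bounded_in X A \<longleftrightarrow>
     A \<subseteq> topspace X \<and>
     (\<forall>U. openin X U \<and> 0 \<in> U \<longrightarrow> (\<exists>F. finite F \<and> F \<subseteq> topspace X \<and> A \<subseteq> U + F))"


section \<open>Uniform convergence, operators and the stereotype dual\<close>

text \<open>
  The space \<open>V\<close> of maps into \<open>Y\<close> with the topology of uniform convergence on the members of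
  \<open>\<A>\<close>. Only families closed under finite unions occur, so the sets
  \<open>{g \<in> V. \<forall>x\<in>A. g x - f x \<in> W}\<close> form a base of neighbourhoods of \<open>f\<close>.
\<close>

definition unif_conv_topology ::
    "('s \<Rightarrow> 'b::complex_vector) set \<Rightarrow> 's set set \<Rightarrow> 'b topology \<Rightarrow> ('s \<Rightarrow> 'b) topology" where
  "unif_conv_topology V \<A> Y = topology (\<lambda>U. U \<subseteq> V \<and>
     (\<forall>f\<in>U. \<exists>A\<in>\<A>. \<exists>W. openin Y W \<and> 0 \<in> W \<and> {g \<in> V. \<forall>x\<in>A. g x - f x \<in> W} \<subseteq> U))"

lemma istopology_neighbourhoods:
  assumes ex: "\<And>x. x \<in> V \<Longrightarrow> \<exists>B. P x B \<and> B \<subseteq> V"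
    and Int: "\<And>x A B. P x A \<Longrightarrow> P x B \<Longrightarrow> P x (A \<inter> B)"
  shows "istopology (\<lambda>U. U \<subseteq> V \<and> (\<forall>x\<in>U. \<exists>B. P x B \<and> B \<subseteq> U))"
  unfolding istopology_def
proof (intro conjI allI impI ballI)
  fix S T x
  assume "S \<subseteq> V \<and> (\<forall>x\<in>S. \<exists>B. P x B \<and> B \<subseteq> S)" "T \<subseteq> V \<and> (\<forall>x\<in>T. \<exists>B. P x B \<and> B \<subseteq> T)"
    and "x \<in> S \<inter> T"
  then obtain A B where "P x A" "A \<subseteq> S" "P x B" "B \<subseteq> T" by blast
  then show "\<exists>B. P x B \<and> B \<subseteq> S \<inter> T"
    using Int by (intro exI [of _ "A \<inter> B"]) auto
qed (auto, meson Union_upper subset_trans)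

lemma openin_unif_conv_topology:
  assumes ne: "\<A> \<noteq> {}" and Un: "\<And>A B. A \<in> \<A> \<Longrightarrow> B \<in> \<A> \<Longrightarrow> A \<union> B \<in> \<A>"
    and 0: "0 \<in> topspace Y"
  shows "openin (unif_conv_topology V \<A> Y) U \<longleftrightarrow> U \<subseteq> V \<and>
     (\<forall>f\<in>U. \<exists>A\<in>\<A>. \<exists>W. openin Y W \<and> 0 \<in> W \<and> {g \<in> V. \<forall>x\<in>A. g x - f x \<in> W} \<subseteq> U)"
proof -
  define P where "P f B \<longleftrightarrow>
    (\<exists>A\<in>\<A>. \<exists>W. openin Y W \<and> 0 \<in> W \<and> {g \<in> V. \<forall>x\<in>A. g x - f x \<in> W} \<subseteq> B)" for f B
  have P_Int: "P f (B \<inter> C)" if B: "P f B" and C: "P f C" for f B C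
  proof -
    from B obtain A W where 1: "A \<in> \<A>" "openin Y W" "0 \<in> W"
      "{g \<in> V. \<forall>x\<in>A. g x - f x \<in> W} \<subseteq> B" unfolding P_def by blast
    from C obtain A' W' where 2: "A' \<in> \<A>" "openin Y W'" "0 \<in> W'"
      "{g \<in> V. \<forall>x\<in>A'. g x - f x \<in> W'} \<subseteq> C" unfolding P_def by blast
    have "{g \<in> V. \<forall>x\<in>A \<union> A'. g x - f x \<in> W \<inter> W'} \<subseteq> B \<inter> C"
      using 1(4) 2(4) by auto
    moreover have "A \<union> A' \<in> \<A>" "openin Y (W \<inter> W')" "0 \<in> W \<inter> W'"
      using 1 2 Un by auto
    ultimately show ?thesis unfolding P_def by blast
  qed
  have P_V: "P f V" for f
    unfolding P_def using ne 0 openin_topspace [of Y] by blast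
  have P_mono: "P f C" if "P f B" "B \<subseteq> C" for f B C
    using that unfolding P_def by (meson subset_trans)
  have "istopology (\<lambda>U. U \<subseteq> V \<and> (\<forall>f\<in>U. \<exists>B. P f B \<and> B \<subseteq> U))"
    by (rule istopology_neighbourhoods) (use P_V P_Int in blast)+
  moreover have "(\<exists>B. P f B \<and> B \<subseteq> U) \<longleftrightarrow> P f U" for f U
    using P_mono by blast
  ultimately have "istopology (\<lambda>U. U \<subseteq> V \<and> (\<forall>f\<in>U. P f U))"
    by simp
  then show ?thesis
    unfolding unif_conv_topology_def P_def by (simp add: topology_inverse')
qed

text \<open>
  Linear maps on \<open>topspace X\<close> are extended by \<open>0\<close> to the ambient type, so that they are
  determined by their restriction and form a linear subspace of the function type.
\<close>

definition continuous_linear_maps ::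
    "'a::complex_vector topology \<Rightarrow> 'b::complex_vector topology \<Rightarrow> ('a \<Rightarrow> 'b) set" where
  "continuous_linear_maps X Y =
     {f. continuous_map X Y f \<and>
         (\<forall>x\<in>topspace X. \<forall>y\<in>topspace X. f (x + y) = f x + f y) \<and>
         (\<forall>c. \<forall>x\<in>topspace X. f (c *\<^sub>C x) = c *\<^sub>C f x) \<and>
         (\<forall>x. x \<notin> topspace X \<longrightarrow> f x = 0)}"

definition operator_space ::
    "'a::complex_vector topology \<Rightarrow> 'b::complex_vector topology \<Rightarrow> ('a \<Rightarrow> 'b) topology" where
  "operator_space X Y =
     unif_conv_topology (continuous_linear_maps X Y) {A. totally_bounded_in X A} Y"

definition stereotype_dual :: "'a::complex_vector topology \<Rightarrow> ('a \<Rightarrow> complex) topology" where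
  "stereotype_dual X = operator_space X euclidean"

definition stereotype_space :: "'a::complex_vector topology \<Rightarrow> bool" where
  "stereotype_space X \<longleftrightarrow>
     locally_convex_space X \<and>
     homeomorphic_map X (stereotype_dual (stereotype_dual X))
       (\<lambda>x f. if f \<in> topspace (stereotype_dual X) then f x else 0)"


section \<open>Pseudosaturation\<close>

definition capacious :: "'a::complex_vector topology \<Rightarrow> 'a set \<Rightarrow> bool" where
  "capacious X D \<longleftrightarrow>
     D \<subseteq> topspace X \<and>
     (\<forall>A. totally_bounded_in X A \<longrightarrow> (\<exists>F. finite F \<and> F \<subseteq> topspace X \<and> A \<subseteq> D + F))"

definition pseudosaturated :: "'a::complex_vector topology \<Rightarrow> bool" where
  "pseudosaturated X \<longleftrightarrow>
     (\<forall>D. closedin X D \<and> convex D \<and> balanced D \<and> capacious X D \<longrightarrow>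
        (\<exists>U. openin X U \<and> 0 \<in> U \<and> U \<subseteq> D))"

definition finer_topology :: "'a topology \<Rightarrow> 'a topology \<Rightarrow> bool" where
  "finer_topology T X \<longleftrightarrow> topspace T = topspace X \<and> (\<forall>U. openin X U \<longrightarrow> openin T U)"

definition pseudosaturated_refinement ::
    "'a::complex_vector topology \<Rightarrow> 'a topology \<Rightarrow> bool" where
  "pseudosaturated_refinement X T \<longleftrightarrow>
     locally_convex_space T \<and> pseudosaturated T \<and> finer_topology T X"

text \<open>
  The coarsest pseudosaturated locally convex topology finer than \<open>X\<close>. It is unique by
  antisymmetry, and it exists for every locally convex \<open>X\<close>: the locally convex infimum of all
  pseudosaturated refinements is again one (the finest locally convex topology is one).
\<close>

definition pseudosaturation :: "'a::complex_vector topology \<Rightarrow> 'a topology" where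
  "pseudosaturation X =
     (THE T. pseudosaturated_refinement X T \<and>
             (\<forall>S. pseudosaturated_refinement X S \<longrightarrow> finer_topology S T))"


section \<open>The stereotype approximation property\<close>

definition operator_algebra :: "'a::complex_vector topology \<Rightarrow> ('a \<Rightarrow> 'a) topology" where
  "operator_algebra X = pseudosaturation (operator_space X X)"

definition finite_rank_operators :: "'a::complex_vector topology \<Rightarrow> ('a \<Rightarrow> 'a) set" where
  "finite_rank_operators X =
     {f \<in> continuous_linear_maps X X. \<exists>B. finite B \<and> f ` topspace X \<subseteq> cspan B}"

definition stereotype_approximation_property :: "'a::complex_vector topology \<Rightarrow> bool" where
  "stereotype_approximation_property X \<longleftrightarrow>
     stereotype_space X \<and>
     continuous_linear_maps X X \<subseteq> operator_algebra X closure_of finite_rank_operators X"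


section \<open>Continuous functions and measures with compact support\<close>

text \<open>
  For a topological group the class \<open>topological_group_add\<close> is used; the operation is written
  additively but, as in \<open>group_add\<close>, it need not be commutative. The elements of
  \<open>compact_support_measures\<close> are the continuous functionals on the continuous functions, which
  represent the complex Radon measures with compact support.
\<close>

definition continuous_functions :: "('g::topological_space \<Rightarrow> complex) topology" where
  "continuous_functions =
     unif_conv_topology {f. continuous_on UNIV f} {K. compact K} euclidean"

definition compact_support_measures ::
    "(('g::topological_space \<Rightarrow> complex) \<Rightarrow> complex) topology" where
  "compact_support_measures = stereotype_dual continuous_functions"

end

theory Submission
  imports Defs
begin

text \<open>
The pseudosaturation of \<open>X:X\<close> is defined from outside, as a coarsest refinement, and it is hard to
recognise its neighbourhoods. The proof goes around this by a second topology, which is finer and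
explicit. For a locally convex space \<open>Y\<close> let a convex balanced set \<open>U\<close> be a neighbourhood of zero if
each totally bounded set \<open>A\<close> of \<open>Y\<close> admits a neighbourhood \<open>N\<close> in \<open>Y\<close> with \<open>N \<inter> A \<subseteq> U\<close>. This is the
locally convex topology \<open>tb_topology Y\<close>. It has the same totally bounded sets as \<open>Y\<close> and is
pseudosaturated (\<open>pseudosaturated_tb_topology\<close>), so it refines the pseudosaturation of \<open>Y\<close>, and density
of the finite rank operators may be proved in it. There a limit in \<open>Y\<close> of operators that stay in one
totally bounded set remains a limit (\<open>tb_topology_closure_approx\<close>), and such passages to the limit may
be repeated. As composition with a fixed operator is continuous, only the identity has to be
approximated.

On \<open>C(G)\<close> two such passages suffice. The first writes the identity as a limit of the operators
\<open>R f (t) = \<integral> p(s) f(t + s) ds\<close>, where \<open>p \<ge> 0\<close> has integral 1 and its support shrinks to \<open>0\<close>. As long as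
all supports stay in one compact set, these operators are equicontinuous and the functions \<open>R f\<close> are
equicontinuous for each \<open>f\<close>, so by Ascoli's theorem they form a totally bounded set. The second fixes
\<open>p\<close>. By left invariance of the Haar integral \<open>R f (t) = \<integral> p(-t + s) f(s) ds\<close>, now with a kernel that is
continuous in \<open>t\<close> and does not involve translates of \<open>f\<close>, and the Riemann sums
\<open>\<Sum>\<^sub>i c\<^sub>i p(-t + s\<^sub>i) f(s\<^sub>i)\<close> have finite rank. If the point masses \<open>c\<^sub>i\<close> put a bounded total mass on the
translates of one compact set, the Riemann sums form a totally bounded set, and by invariance a
partition of unity produces masses with this property (\<open>quadrature\<close>). The Haar integral is
obtained on compactly supported continuous functions by Haar's covering numbers
(\<open>haar_functional_pos\<close>).

The dual space inherits the property, because for a stereotype space \<open>X\<close> the adjoint is a continuous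
linear map of \<open>X:X\<close> onto the operators of the dual that preserves finite rank
(\<open>tb_approximation_property_dual\<close>). Finally \<open>C(G)\<close> is stereotype, since totally bounded sets of
functionals are equicontinuous (\<open>tb_measures_equicontinuous\<close>, a gliding hump argument) and the
combinations of point masses are dense among the functionals (\<open>measure_approx_point_masses\<close>); duals of
stereotype spaces are stereotype (\<open>stereotype_space_dual\<close>).
\<close>

section \<open>Neighbourhoods of zero\<close>

definition zero_nbhd :: "'a::complex_vector topology \<Rightarrow> 'a set \<Rightarrow> bool" where
  "zero_nbhd X N \<longleftrightarrow> N \<subseteq> topspace X \<and> (\<exists>U. openin X U \<and> 0 \<in> U \<and> U \<subseteq> N)"

lemma scaleR_scaleC: "r *\<^sub>R x = complex_of_real r *\<^sub>C x"
  by (simp add: scaleC_of_real)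

lemma balanced_scaleC: "balanced D \<Longrightarrow> x \<in> D \<Longrightarrow> cmod c \<le> 1 \<Longrightarrow> c *\<^sub>C x \<in> D"
  by (auto simp: balanced_def)

lemma balanced_uminus: "balanced D \<Longrightarrow> x \<in> D \<Longrightarrow> - x \<in> D"
  using balanced_scaleC [of D x "-1"] by simp

lemma convex_half_sum:
  assumes "convex D" "x \<in> D" "y \<in> D"
  shows "(1/2) *\<^sub>C x + (1/2) *\<^sub>C y \<in> D"
proof -
  have "(1/2) *\<^sub>R x + (1/2) *\<^sub>R y \<in> D"
    using assms by (auto simp: convex_def)
  then show ?thesis by (simp add: scaleR_scaleC)
qed

lemma balanced_image_scaleC:
  assumes "balanced D" shows "balanced ((*\<^sub>C) c ` D)"
  unfolding balanced_def
proof (intro allI ballI impI)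
  fix d x assume "x \<in> (*\<^sub>C) c ` D" "cmod d \<le> 1"
  then obtain y where y: "y \<in> D" "x = c *\<^sub>C y" by auto
  have "d *\<^sub>C x = c *\<^sub>C d *\<^sub>C y" by (simp add: y mult.commute scaleC_scaleC)
  then show "d *\<^sub>C x \<in> (*\<^sub>C) c ` D"
    using balanced_scaleC [OF assms y(1) \<open>cmod d \<le> 1\<close>] by (rule image_eqI)
qed

lemma convex_image_scaleC:
  assumes "convex D" shows "convex ((*\<^sub>C) c ` (D::'a::complex_vector set))"
  unfolding convex_def
proof (intro allI ballI impI)
  fix x y and u v :: real
  assume "x \<in> (*\<^sub>C) c ` D" "y \<in> (*\<^sub>C) c ` D" "0 \<le> u" "0 \<le> v" "u + v = 1"
  then obtain a b where ab: "a \<in> D" "x = c *\<^sub>C a" "b \<in> D" "y = c *\<^sub>C b" by auto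
  have "u *\<^sub>R a + v *\<^sub>R b \<in> D"
    using assms ab \<open>0 \<le> u\<close> \<open>0 \<le> v\<close> \<open>u + v = 1\<close> by (auto simp: convex_def)
  moreover have "u *\<^sub>R x + v *\<^sub>R y = c *\<^sub>C (u *\<^sub>R a + v *\<^sub>R b)"
    by (simp add: ab scaleR_scaleC scaleC_scaleC scaleC_add_right mult.commute)
  ultimately show "u *\<^sub>R x + v *\<^sub>R y \<in> (*\<^sub>C) c ` D" by (intro image_eqI)
qed

context
  fixes X :: "'a::complex_vector topology"
  assumes lcs: "locally_convex_space X"
begin

lemma lcs_subspace: "csubspace (topspace X)"
  using lcs by (simp add: locally_convex_space_def)

lemma lcs_zero: "0 \<in> topspace X"
  using complex_vector.subspace_0 [OF lcs_subspace] .

lemma lcs_add: "x \<in> topspace X \<Longrightarrow> y \<in> topspace X \<Longrightarrow> x + y \<in> topspace X"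
  using complex_vector.subspace_add [OF lcs_subspace] .

lemma lcs_diff: "x \<in> topspace X \<Longrightarrow> y \<in> topspace X \<Longrightarrow> x - y \<in> topspace X"
  using complex_vector.subspace_diff [OF lcs_subspace] .

lemma lcs_scaleC: "x \<in> topspace X \<Longrightarrow> c *\<^sub>C x \<in> topspace X"
  using complex_vector.subspace_scale [OF lcs_subspace] .

lemma lcs_uminus: "x \<in> topspace X \<Longrightarrow> - x \<in> topspace X"
  using complex_vector.subspace_neg [OF lcs_subspace] .

lemma continuous_map_translate:
  assumes "a \<in> topspace X" shows "continuous_map X X (\<lambda>x. a + x)"
proof -
  have "continuous_map X (prod_topology X X) (\<lambda>x. (a, x))"
    using assms by (intro continuous_map_pairedI) auto
  then have "continuous_map X X ((\<lambda>(x, y). x + y) \<circ> (\<lambda>x. (a, x)))"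
    using lcs by (intro continuous_map_compose) (auto simp: locally_convex_space_def)
  then show ?thesis by (simp add: o_def)
qed

lemma continuous_map_scale: "continuous_map X X (\<lambda>x. c *\<^sub>C x)"
proof -
  have "continuous_map X (prod_topology euclidean X) (\<lambda>x. (c, x))"
    by (intro continuous_map_pairedI) auto
  then have "continuous_map X X ((\<lambda>(c, x). c *\<^sub>C x) \<circ> (\<lambda>x. (c, x)))"
    using lcs by (intro continuous_map_compose) (auto simp: locally_convex_space_def)
  then show ?thesis by (simp add: o_def)
qed

lemma openin_translate:
  assumes "a \<in> topspace X" "openin X U" shows "openin X ((+) a ` U)"
proof -
  have "openin X {x \<in> topspace X. - a + x \<in> U}"
    by (rule openin_continuous_map_preimage [OF continuous_map_translate]) (use assms lcs_uminus in auto)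
  moreover have "{x \<in> topspace X. - a + x \<in> U} = (+) a ` U"
    using assms openin_subset [OF assms(2)]
    by (auto simp: image_iff lcs_add intro!: bexI [of _ "- a + _"])
  ultimately show ?thesis by simp
qed

lemma openin_scale:
  assumes "c \<noteq> 0" "openin X U" shows "openin X ((*\<^sub>C) c ` U)"
proof -
  have "openin X {x \<in> topspace X. inverse c *\<^sub>C x \<in> U}"
    by (rule openin_continuous_map_preimage [OF continuous_map_scale assms(2)])
  moreover have "{x \<in> topspace X. inverse c *\<^sub>C x \<in> U} = (*\<^sub>C) c ` U"
    using assms openin_subset [OF assms(2)]
    by (auto simp: image_iff lcs_scaleC scaleC_scaleC intro!: bexI [of _ "inverse c *\<^sub>C _"])
  ultimately show ?thesis by simp
qed

lemma zero_nbhd_subset: "zero_nbhd X N \<Longrightarrow> N \<subseteq> topspace X"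
  by (simp add: zero_nbhd_def)

lemma zero_nbhd_zero: "zero_nbhd X N \<Longrightarrow> 0 \<in> N"
  by (auto simp: zero_nbhd_def)

lemma zero_nbhd_mono: "zero_nbhd X N \<Longrightarrow> N \<subseteq> M \<Longrightarrow> M \<subseteq> topspace X \<Longrightarrow> zero_nbhd X M"
  by (meson zero_nbhd_def order_trans)

lemma zero_nbhd_Int: "zero_nbhd X N \<Longrightarrow> zero_nbhd X M \<Longrightarrow> zero_nbhd X (N \<inter> M)"
  unfolding zero_nbhd_def by (metis IntI Int_mono inf.coboundedI1 openin_Int)

lemma zero_nbhd_topspace: "zero_nbhd X (topspace X)"
  using lcs_zero by (auto simp: zero_nbhd_def)

lemma zero_nbhd_openin: "openin X U \<Longrightarrow> 0 \<in> U \<Longrightarrow> zero_nbhd X U"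
  by (auto simp: zero_nbhd_def openin_subset)

lemma zero_nbhd_scale:
  assumes "c \<noteq> 0" "zero_nbhd X N" shows "zero_nbhd X ((*\<^sub>C) c ` N)"
proof -
  from assms(2) obtain U where U: "openin X U" "0 \<in> U" "U \<subseteq> N" and N: "N \<subseteq> topspace X"
    by (auto simp: zero_nbhd_def)
  have "0 \<in> (*\<^sub>C) c ` U" using U(2) by (auto simp: image_iff intro!: bexI [of _ 0])
  with openin_scale [OF assms(1) U(1)] show ?thesis
    using U N by (auto simp: zero_nbhd_def lcs_scaleC intro!: exI [of _ "(*\<^sub>C) c ` U"])
qed

lemma openin_iff_zero_nbhd:
  "openin X U \<longleftrightarrow> U \<subseteq> topspace X \<and> (\<forall>x\<in>U. \<exists>N. zero_nbhd X N \<and> (+) x ` N \<subseteq> U)"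
proof (intro iffI conjI ballI)
  fix x assume U: "openin X U" and x: "x \<in> U"
  have xt: "x \<in> topspace X" using U x openin_subset by auto
  have "zero_nbhd X ((+) (- x) ` U)"
    by (rule zero_nbhd_openin [OF openin_translate [OF lcs_uminus [OF xt] U]]) (use x in \<open>auto simp: image_iff intro!: bexI [of _ x]\<close>)
  moreover have "(+) x ` (+) (- x) ` U \<subseteq> U" by (auto simp: image_iff)
  ultimately show "\<exists>N. zero_nbhd X N \<and> (+) x ` N \<subseteq> U" by blast
next
  assume *: "U \<subseteq> topspace X \<and> (\<forall>x\<in>U. \<exists>N. zero_nbhd X N \<and> (+) x ` N \<subseteq> U)"
  show "openin X U"
  proof (subst openin_subopen, intro ballI)
    fix x assume x: "x \<in> U"
    with * obtain N where N: "zero_nbhd X N" "(+) x ` N \<subseteq> U" by blast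
    then obtain V where V: "openin X V" "0 \<in> V" "V \<subseteq> N" by (auto simp: zero_nbhd_def)
    have "openin X ((+) x ` V)" using openin_translate * x V(1) by blast
    moreover have "x \<in> (+) x ` V" using V(2) by (auto simp: image_iff intro!: bexI [of _ 0])
    ultimately show "\<exists>T. openin X T \<and> x \<in> T \<and> T \<subseteq> U" using N V by blast
  qed
qed (auto simp: openin_subset)

lemma zero_nbhd_absorbing:
  assumes N: "zero_nbhd X N" and x: "x \<in> topspace X"
  obtains r where "r > 0" "\<forall>c. cmod c \<le> r \<longrightarrow> c *\<^sub>C x \<in> N"
proof -
  from N obtain U where U: "openin X U" "0 \<in> U" "U \<subseteq> N" by (auto simp: zero_nbhd_def)
  have "continuous_map euclidean (prod_topology euclidean X) (\<lambda>c::complex. (c, x))"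
    using x by (intro continuous_map_pairedI) auto
  then have "continuous_map euclidean X ((\<lambda>(c, x). c *\<^sub>C x) \<circ> (\<lambda>c. (c, x)))"
    using lcs by (intro continuous_map_compose) (auto simp: locally_convex_space_def)
  then have "openin euclidean {c \<in> topspace euclidean. c *\<^sub>C x \<in> U}"
    by (intro openin_continuous_map_preimage [OF _ U(1)]) (auto simp: o_def)
  then have "open {c. c *\<^sub>C x \<in> U}" by simp
  moreover have "0 \<in> {c. c *\<^sub>C x \<in> U}" using U by simp
  ultimately obtain r where "r > 0" "cball 0 r \<subseteq> {c. c *\<^sub>C x \<in> U}"
    by (rule open_contains_cball [THEN iffD1, THEN bspec, THEN exE]) blast
  then have "c *\<^sub>C x \<in> N" if "cmod c \<le> r" for c
  proof -
    have "c \<in> cball 0 r" using that by simp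
    then show ?thesis using \<open>cball 0 r \<subseteq> _\<close> U(3) by blast
  qed
  then show ?thesis using that \<open>r > 0\<close> by blast
qed

text \<open>
Continuity of the scalar multiplication gives a balanced neighbourhood inside a convex one; its convex
hull stays inside the convex one and is still balanced.
\<close>

lemma zero_nbhd_convex_balanced:
  assumes N: "zero_nbhd X N"
  obtains M where "zero_nbhd X M" "convex M" "balanced M" "M \<subseteq> N"
proof -
  obtain O1 where O1: "openin X O1" "0 \<in> O1" "O1 \<subseteq> N" using N by (auto simp: zero_nbhd_def)
  from lcs have "neighbourhood_base_at 0 convex X" by (simp add: locally_convex_space_def)
  then obtain U V where UV: "openin X U" "convex V" "0 \<in> U" "U \<subseteq> V" "V \<subseteq> O1"
    using O1 unfolding neighbourhood_base_at_def by meson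
  have "continuous_map (prod_topology euclidean X) X (\<lambda>(c, x). c *\<^sub>C x)"
    using lcs by (simp add: locally_convex_space_def)
  from openin_continuous_map_preimage [OF this UV(1)]
  have op: "openin (prod_topology euclidean X) {p \<in> topspace (prod_topology euclidean X). (\<lambda>(c::complex, x). c *\<^sub>C x) p \<in> U}"
    (is "openin _ ?S") .
  have "(0, 0) \<in> ?S" using lcs_zero UV by simp
  then obtain C W where CW: "openin euclidean C" "openin X W" "0 \<in> C" "0 \<in> W" "C \<times> W \<subseteq> ?S"
    using op [unfolded openin_prod_topology_alt, rule_format, of 0 0] by meson
  have "open C" using CW(1) by simp
  then obtain r where r: "r > 0" "cball 0 r \<subseteq> C"
    by (rule open_contains_cball [THEN iffD1, THEN bspec, THEN exE]) (use CW(3) in blast)+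
  define B where "B = {c *\<^sub>C x | c x. cmod c \<le> r \<and> x \<in> W}"
  have BU: "B \<subseteq> U" using CW(5) r by (auto simp: B_def subset_iff)
  have balB: "balanced B" unfolding balanced_def B_def
  proof clarsimp
    fix c d x assume "cmod c \<le> 1" "cmod d \<le> r" "x \<in> W"
    then show "\<exists>ca xa. (c * d) *\<^sub>C x = ca *\<^sub>C xa \<and> cmod ca \<le> r \<and> xa \<in> W"
      using r(1) mult_mono [of "cmod c" 1 "cmod d" r]
      by (intro exI [of _ "c * d"] exI [of _ x]) (auto simp: norm_mult)
  qed
  define M where "M = convex hull B"
  have bal: "balanced M" unfolding balanced_def
  proof (intro allI ballI impI)
    fix c x assume c: "cmod c \<le> 1" and x: "x \<in> M"
    let ?P = "{x. c *\<^sub>C x \<in> M}"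
    have "convex ?P" unfolding convex_def
    proof (intro allI ballI impI)
      fix x y and u v :: real
      assume a: "x \<in> ?P" "y \<in> ?P" "0 \<le> u" "0 \<le> v" "u + v = 1"
      have "u *\<^sub>R (c *\<^sub>C x) + v *\<^sub>R (c *\<^sub>C y) \<in> M"
        using a convex_convex_hull [of B] unfolding M_def convex_def by blast
      then show "u *\<^sub>R x + v *\<^sub>R y \<in> ?P"
        by (simp add: scaleR_scaleC scaleC_scaleC scaleC_add_right mult.commute)
    qed
    moreover have "B \<subseteq> ?P" using balanced_scaleC [OF balB _ c] hull_subset [of B convex] by (auto simp: M_def)
    ultimately have "M \<subseteq> ?P" unfolding M_def by (rule hull_minimal [rotated])
    then show "c *\<^sub>C x \<in> M" using x by auto
  qed
  have MV: "M \<subseteq> V" unfolding M_def using BU UV by (intro hull_minimal) auto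
  have sub: "(*\<^sub>C) (complex_of_real r) ` W \<subseteq> M"
    using hull_subset [of B convex] r by (force simp: M_def B_def)
  have "zero_nbhd X ((*\<^sub>C) (complex_of_real r) ` W)"
    using r CW by (intro zero_nbhd_scale zero_nbhd_openin) auto
  then have "zero_nbhd X M"
    by (rule zero_nbhd_mono [OF _ sub]) (use MV UV O1 openin_subset in blast)
  then show ?thesis
    by (rule that) (use MV UV O1 bal in \<open>auto simp: M_def\<close>)
qed

lemma zero_nbhd_sum:
  assumes N: "zero_nbhd X N"
  obtains M where "zero_nbhd X M" "convex M" "balanced M" "\<And>x y. x \<in> M \<Longrightarrow> y \<in> M \<Longrightarrow> x + y \<in> N"
    "\<And>x y. x \<in> M \<Longrightarrow> y \<in> M \<Longrightarrow> x - y \<in> N" "M \<subseteq> N"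
proof -
  obtain P where P: "zero_nbhd X P" "convex P" "balanced P" "P \<subseteq> N"
    using zero_nbhd_convex_balanced [OF N] .
  let ?M = "(*\<^sub>C) (1/2) ` P"
  have sum: "x + y \<in> N" if "x \<in> ?M" "y \<in> ?M" for x y
    using that convex_half_sum [OF P(2)] P(4) by auto
  have bal: "balanced ?M" by (rule balanced_image_scaleC [OF P(3)])
  show ?thesis
  proof (rule that [of ?M])
    show "x - y \<in> N" if "x \<in> ?M" "y \<in> ?M" for x y
      using sum [OF that(1) balanced_uminus [OF bal that(2)]] by simp
    have "zero_nbhd X ?M" using P by (intro zero_nbhd_scale) auto
    then have "0 \<in> ?M" by (rule zero_nbhd_zero)
    then show "?M \<subseteq> N" using sum [of _ 0] by fastforce
    show "zero_nbhd X ?M" by fact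
    show "convex ?M" using P(2) by (rule convex_image_scaleC)
    show "x + y \<in> N" if "x \<in> ?M" "y \<in> ?M" for x y using sum that .
  qed (rule bal)
qed

lemma zero_nbhd_separating:
  assumes "x \<in> topspace X" "x \<noteq> 0" obtains N where "zero_nbhd X N" "x \<notin> N"
proof -
  have "Hausdorff_space X" using lcs by (simp add: locally_convex_space_def)
  then obtain U V where "openin X U" "openin X V" "0 \<in> U" "x \<in> V" "disjnt U V"
    using assms lcs_zero unfolding Hausdorff_space_def by metis
  then show ?thesis using that [OF zero_nbhd_openin, of U] by (auto simp: disjnt_iff)
qed

lemma in_closure_of_iff_zero_nbhd:
  assumes S: "S \<subseteq> topspace X"
  shows "x \<in> X closure_of S \<longleftrightarrow> x \<in> topspace X \<and> (\<forall>N. zero_nbhd X N \<longrightarrow> (\<exists>y\<in>S. y - x \<in> N))"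
proof safe
  assume x: "x \<in> X closure_of S"
  then show xt: "x \<in> topspace X" by (simp add: in_closure_of)
  fix N assume N: "zero_nbhd X N"
  then obtain U where U: "openin X U" "0 \<in> U" "U \<subseteq> N" by (auto simp: zero_nbhd_def)
  have "openin X ((+) x ` U)" "x \<in> (+) x ` U"
    using openin_translate [OF xt U(1)] U(2) by (auto simp: image_iff intro!: bexI [of _ 0])
  then obtain y where "y \<in> S" "y \<in> (+) x ` U" using x by (auto simp: in_closure_of)
  then show "\<exists>y\<in>S. y - x \<in> N" using U(3) by (intro bexI [of _ y]) auto
next
  assume xt: "x \<in> topspace X" and *: "\<forall>N. zero_nbhd X N \<longrightarrow> (\<exists>y\<in>S. y - x \<in> N)"
  show "x \<in> X closure_of S" unfolding in_closure_of
  proof (intro conjI allI impI xt)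
    fix T assume T: "x \<in> T \<and> openin X T"
    then obtain N where N: "zero_nbhd X N" "(+) x ` N \<subseteq> T" using openin_iff_zero_nbhd by blast
    with * obtain y where "y \<in> S" "y - x \<in> N" by blast
    moreover from this have "x + (y - x) \<in> T" by (intro subsetD [OF N(2)] imageI)
    ultimately show "\<exists>y. y \<in> S \<and> y \<in> T" by auto
  qed
qed

end

lemma continuous_map_iff_zero_nbhd:
  assumes X: "locally_convex_space X" and Y: "locally_convex_space Y"
    and f: "f \<in> topspace X \<rightarrow> topspace Y"
    and add: "\<And>x y. x \<in> topspace X \<Longrightarrow> y \<in> topspace X \<Longrightarrow> f (x + y) = f x + f y"
  shows "continuous_map X Y f \<longleftrightarrow> (\<forall>N. zero_nbhd Y N \<longrightarrow> (\<exists>M. zero_nbhd X M \<and> f ` M \<subseteq> N))"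
proof -
  have f0: "f 0 = 0" using add [of 0 0] lcs_zero [OF X] by simp
  show ?thesis
  proof (intro iffI allI impI)
    fix N assume c: "continuous_map X Y f" and N: "zero_nbhd Y N"
    then obtain U where U: "openin Y U" "0 \<in> U" "U \<subseteq> N" by (auto simp: zero_nbhd_def)
    have "zero_nbhd X {x \<in> topspace X. f x \<in> U}"
      using openin_continuous_map_preimage [OF c U(1)] U f0 lcs_zero [OF X]
      by (intro zero_nbhd_openin [OF X]) auto
    then show "\<exists>M. zero_nbhd X M \<and> f ` M \<subseteq> N" using U by (intro exI conjI) auto
  next
    assume *: "\<forall>N. zero_nbhd Y N \<longrightarrow> (\<exists>M. zero_nbhd X M \<and> f ` M \<subseteq> N)"
    show "continuous_map X Y f" unfolding continuous_map_def
    proof (intro conjI f allI impI)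
      fix U assume U: "openin Y U"
      show "openin X {x \<in> topspace X. f x \<in> U}"
        unfolding openin_iff_zero_nbhd [OF X]
      proof (intro conjI ballI)
        fix x assume x: "x \<in> {x \<in> topspace X. f x \<in> U}"
        then obtain N where N: "zero_nbhd Y N" "(+) (f x) ` N \<subseteq> U"
          using U unfolding openin_iff_zero_nbhd [OF Y] by blast
        with * obtain M where M: "zero_nbhd X M" "f ` M \<subseteq> N" by blast
        have "(+) x ` M \<subseteq> {x \<in> topspace X. f x \<in> U}"
        proof clarsimp
          fix m assume m: "m \<in> M"
          then have mt: "m \<in> topspace X" using M zero_nbhd_subset [OF X] by blast
          then have "f (x + m) = f x + f m" using add x by simp
          moreover have "f x + f m \<in> U" using N(2) M(2) m by blast
          ultimately show "x + m \<in> topspace X \<and> f (x + m) \<in> U" using lcs_add [OF X] x mt by simp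
        qed
        then show "\<exists>N. zero_nbhd X N \<and> (+) x ` N \<subseteq> {x \<in> topspace X. f x \<in> U}" using M by blast
      qed auto
    qed
  qed
qed

section \<open>Locally convex topologies from a base at zero\<close>

text \<open>
Real scalars are enough here: together with balancedness they give the usual notion.
\<close>

definition absorbing_in :: "'a::complex_vector set \<Rightarrow> 'a set \<Rightarrow> bool" where
  "absorbing_in V N \<longleftrightarrow> (\<forall>x\<in>V. \<exists>r>0. r *\<^sub>R x \<in> N)"

text \<open>
The conditions on a family of sets under which their translates form a Hausdorff locally convex
topology. Stability under halving takes the place of the usual condition on sums because the sets are
convex.
\<close>

definition zero_base :: "'a::complex_vector set \<Rightarrow> 'a set set \<Rightarrow> bool" where
  "zero_base V \<U> \<longleftrightarrow> csubspace V \<and> \<U> \<noteq> {} \<and>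
     (\<forall>N\<in>\<U>. N \<subseteq> V \<and> convex N \<and> balanced N \<and> absorbing_in V N \<and> (\<exists>M\<in>\<U>. (*\<^sub>C) 2 ` M \<subseteq> N)) \<and>
     (\<forall>N\<in>\<U>. \<forall>M\<in>\<U>. \<exists>P\<in>\<U>. P \<subseteq> N \<inter> M) \<and>
     (\<forall>x\<in>V. x \<noteq> 0 \<longrightarrow> (\<exists>N\<in>\<U>. x \<notin> N))"

lemma zero_baseD:
  assumes "zero_base V \<U>"
  shows "csubspace V" "\<U> \<noteq> {}" "\<And>N. N \<in> \<U> \<Longrightarrow> N \<subseteq> V" "\<And>N. N \<in> \<U> \<Longrightarrow> convex N"
    "\<And>N. N \<in> \<U> \<Longrightarrow> balanced N" "\<And>N. N \<in> \<U> \<Longrightarrow> absorbing_in V N"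
    "\<And>N. N \<in> \<U> \<Longrightarrow> \<exists>M\<in>\<U>. (*\<^sub>C) 2 ` M \<subseteq> N"
    "\<And>N M. N \<in> \<U> \<Longrightarrow> M \<in> \<U> \<Longrightarrow> \<exists>P\<in>\<U>. P \<subseteq> N \<inter> M"
    "\<And>x. x \<in> V \<Longrightarrow> x \<noteq> 0 \<Longrightarrow> \<exists>N\<in>\<U>. x \<notin> N"
  using assms by (simp_all add: zero_base_def)

definition base_topology :: "'a::complex_vector set \<Rightarrow> 'a set set \<Rightarrow> 'a topology" where
  "base_topology V \<U> = topology (\<lambda>U. U \<subseteq> V \<and> (\<forall>x\<in>U. \<exists>N\<in>\<U>. (+) x ` N \<subseteq> U))"

lemma openin_base_topology:
  assumes "zero_base V \<U>"
  shows "openin (base_topology V \<U>) U \<longleftrightarrow> U \<subseteq> V \<and> (\<forall>x\<in>U. \<exists>N\<in>\<U>. (+) x ` N \<subseteq> U)"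
proof -
  define P where "P x B \<longleftrightarrow> (\<exists>N\<in>\<U>. (+) x ` N \<subseteq> B) \<and> x \<in> V" for x B
  have "istopology (\<lambda>U. U \<subseteq> V \<and> (\<forall>x\<in>U. \<exists>B. P x B \<and> B \<subseteq> U))"
  proof (rule istopology_neighbourhoods)
    fix x assume x: "x \<in> V"
    obtain N where N: "N \<in> \<U>" using assms by (auto simp: zero_base_def)
    then have "(+) x ` N \<subseteq> V"
      using assms x complex_vector.subspace_add by (fastforce simp: zero_base_def)
    then show "\<exists>B. P x B \<and> B \<subseteq> V" using N x by (auto simp: P_def)
  next
    fix x A B assume "P x A" "P x B"
    then obtain N M where "N \<in> \<U>" "M \<in> \<U>" "(+) x ` N \<subseteq> A" "(+) x ` M \<subseteq> B" "x \<in> V" by (auto simp: P_def)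
    moreover from this obtain Q where "Q \<in> \<U>" "Q \<subseteq> N \<inter> M" using zero_baseD(8) [OF assms] by meson
    ultimately show "P x (A \<inter> B)" unfolding P_def by (intro conjI bexI [of _ Q]) blast+
  qed
  moreover have "(U \<subseteq> V \<and> (\<forall>x\<in>U. \<exists>B. P x B \<and> B \<subseteq> U)) \<longleftrightarrow> U \<subseteq> V \<and> (\<forall>x\<in>U. \<exists>N\<in>\<U>. (+) x ` N \<subseteq> U)" for U
    unfolding P_def by (meson subset_iff)
  ultimately show ?thesis unfolding base_topology_def by (simp add: topology_inverse')
qed

lemma topspace_base_topology:
  assumes "zero_base V \<U>" shows "topspace (base_topology V \<U>) = V"
proof
  have "openin (base_topology V \<U>) V"
    unfolding openin_base_topology [OF assms]
  proof (intro conjI ballI)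
    fix x assume x: "x \<in> V"
    obtain N where N: "N \<in> \<U>" using assms by (auto simp: zero_base_def)
    then have "(+) x ` N \<subseteq> V"
      using assms x complex_vector.subspace_add by (fastforce simp: zero_base_def)
    then show "\<exists>N\<in>\<U>. (+) x ` N \<subseteq> V" using N by auto
  qed simp
  then show "V \<subseteq> topspace (base_topology V \<U>)" by (rule openin_subset)
  show "topspace (base_topology V \<U>) \<subseteq> V"
    using openin_topspace [of "base_topology V \<U>"] unfolding openin_base_topology [OF assms] by simp
qed

context
  fixes V :: "'a::complex_vector set" and \<U>
  assumes base: "zero_base V \<U>"
begin

lemma zero_base_half_sum:
  assumes "N \<in> \<U>" obtains M where "M \<in> \<U>" "\<And>x y. x \<in> M \<Longrightarrow> y \<in> M \<Longrightarrow> x + y \<in> N"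
proof -
  obtain M where M: "M \<in> \<U>" "(*\<^sub>C) 2 ` M \<subseteq> N" "convex N"
    using zero_baseD(4,7) [OF base assms] by meson
  have "x + y \<in> N" if "x \<in> M" "y \<in> M" for x y
    using convex_half_sum [OF M(3), of "2 *\<^sub>C x" "2 *\<^sub>C y"] that M(2) by (auto simp: scaleC_scaleC)
  then show ?thesis using that M by blast
qed

lemma zero_base_zero: assumes "N \<in> \<U>" shows "0 \<in> N"
proof -
  have "absorbing_in V N" "0 \<in> V"
    using zero_baseD(6) [OF base assms] complex_vector.subspace_0 [OF zero_baseD(1) [OF base]] by auto
  then show ?thesis by (auto simp: absorbing_in_def)
qed

lemma zero_nbhd_base_topology:
  "zero_nbhd (base_topology V \<U>) N \<longleftrightarrow> N \<subseteq> V \<and> (\<exists>M\<in>\<U>. M \<subseteq> N)"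
proof
  assume "zero_nbhd (base_topology V \<U>) N"
  then obtain U where "U \<subseteq> N" "0 \<in> U" "openin (base_topology V \<U>) U" "N \<subseteq> V"
    by (auto simp: zero_nbhd_def topspace_base_topology [OF base])
  then show "N \<subseteq> V \<and> (\<exists>M\<in>\<U>. M \<subseteq> N)"
    unfolding openin_base_topology [OF base] by (metis add_0 image_ident order_trans image_cong)
next
  assume N: "N \<subseteq> V \<and> (\<exists>M\<in>\<U>. M \<subseteq> N)"
  define U where "U = {x \<in> V. \<exists>M\<in>\<U>. (+) x ` M \<subseteq> N}"
  have "U \<subseteq> N" using zero_base_zero by (force simp: U_def)
  moreover have "0 \<in> U" using N base complex_vector.subspace_0 by (auto simp: U_def zero_base_def)
  moreover have "openin (base_topology V \<U>) U" unfolding openin_base_topology [OF base]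
  proof (intro conjI ballI)
    fix x assume "x \<in> U"
    then obtain M where M: "M \<in> \<U>" "(+) x ` M \<subseteq> N" "x \<in> V" by (auto simp: U_def)
    obtain Q where Q: "Q \<in> \<U>" "\<And>x y. x \<in> Q \<Longrightarrow> y \<in> Q \<Longrightarrow> x + y \<in> M"
      using zero_base_half_sum [OF M(1)] by metis
    have "x + q \<in> U" if "q \<in> Q" for q
    proof -
      have "q \<in> V" using Q that base by (auto simp: zero_base_def)
      then have "x + q \<in> V" using M(3) complex_vector.subspace_add [OF zero_baseD(1) [OF base]] by blast
      moreover have "(+) (x + q) ` Q \<subseteq> N" using M(2) Q(2) [OF that] by (auto simp: add.assoc)
      ultimately show ?thesis using Q by (auto simp: U_def)
    qed
    then show "\<exists>N\<in>\<U>. (+) x ` N \<subseteq> U" using Q by auto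
  qed (auto simp: U_def)
  ultimately show "zero_nbhd (base_topology V \<U>) N"
    using N by (auto simp: zero_nbhd_def topspace_base_topology [OF base])
qed

lemma translate_interior_base:
  assumes "N \<in> \<U>" "x \<in> V"
  obtains O' where "openin (base_topology V \<U>) O'" "x \<in> O'" "O' \<subseteq> (+) x ` N"
proof -
  have sub: "csubspace V" and NV: "N \<subseteq> V" using base assms by (auto simp: zero_base_def)
  obtain U where U: "openin (base_topology V \<U>) U" "0 \<in> U" "U \<subseteq> N"
    using zero_nbhd_base_topology [of N] assms NV by (auto simp: zero_nbhd_def)
  have "openin (base_topology V \<U>) ((+) x ` U)"
    unfolding openin_base_topology [OF base]
  proof (intro conjI ballI)
    show "(+) x ` U \<subseteq> V" using U NV assms complex_vector.subspace_add [OF sub] by auto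
    fix y assume "y \<in> (+) x ` U"
    then obtain u where u: "u \<in> U" "y = x + u" by auto
    obtain M where M: "M \<in> \<U>" "(+) u ` M \<subseteq> U" using U u openin_base_topology [OF base] by auto
    then have "(+) y ` M \<subseteq> (+) x ` U" by (force simp: u add.assoc)
    then show "\<exists>M\<in>\<U>. (+) y ` M \<subseteq> (+) x ` U" using M by auto
  qed
  then show ?thesis using that [of "(+) x ` U"] U by (force simp: image_iff)
qed

theorem locally_convex_space_base_topology: "locally_convex_space (base_topology V \<U>)"
proof -
  let ?T = "base_topology V \<U>"
  have sub: "csubspace V" using base by (simp add: zero_base_def)
  note top = topspace_base_topology [OF base]
  have haus: "Hausdorff_space ?T" unfolding Hausdorff_space_def top
  proof (intro allI impI)
    fix x y assume xy: "x \<in> V \<and> y \<in> V \<and> x \<noteq> y"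
    then have "x - y \<in> V" "x - y \<noteq> 0" using complex_vector.subspace_diff [OF sub] by auto
    then obtain N where N: "N \<in> \<U>" "x - y \<notin> N" using zero_baseD(9) [OF base] by meson
    obtain M where M: "M \<in> \<U>" "\<And>x y. x \<in> M \<Longrightarrow> y \<in> M \<Longrightarrow> x + y \<in> N" using zero_base_half_sum [OF N(1)] by metis
    have bal: "balanced M" using base M by (auto simp: zero_base_def)
    obtain O1 where O1: "openin ?T O1" "x \<in> O1" "O1 \<subseteq> (+) x ` M"
        using translate_interior_base [OF M(1), of x] xy by metis
    obtain O2 where O2: "openin ?T O2" "y \<in> O2" "O2 \<subseteq> (+) y ` M"
        using translate_interior_base [OF M(1), of y] xy by metis
    have "disjnt O1 O2" unfolding disjnt_iff
    proof (intro allI notI)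
      fix z assume "z \<in> O1 \<and> z \<in> O2"
      then obtain m n where mn: "m \<in> M" "n \<in> M" "z = x + m" "z = y + n" using O1 O2 by blast
      then have "x - y = n + (- m)" by (simp add: algebra_simps)
      then show False using M(2) [OF mn(2) balanced_uminus [OF bal mn(1)]] N by simp
    qed
    then show "\<exists>U Va. openin ?T U \<and> openin ?T Va \<and> x \<in> U \<and> y \<in> Va \<and> disjnt U Va" using O1 O2 by blast
  qed
  have plus: "continuous_map (prod_topology ?T ?T) ?T (\<lambda>(x, y). x + y)"
    unfolding continuous_map_def
  proof (intro conjI allI impI)
    fix U assume U: "openin ?T U"
    show "openin (prod_topology ?T ?T) {p \<in> topspace (prod_topology ?T ?T). (\<lambda>(x, y). x + y) p \<in> U}"
      unfolding openin_prod_topology_alt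
    proof (intro allI impI)
      fix x y assume "(x, y) \<in> {p \<in> topspace (prod_topology ?T ?T). (\<lambda>(x, y). x + y) p \<in> U}"
      then have xy: "x \<in> V" "y \<in> V" "x + y \<in> U" by (auto simp: top)
      obtain N where N: "N \<in> \<U>" "(+) (x + y) ` N \<subseteq> U" using U xy openin_base_topology [OF base] by auto
      obtain M where M: "M \<in> \<U>" "\<And>x y. x \<in> M \<Longrightarrow> y \<in> M \<Longrightarrow> x + y \<in> N" using zero_base_half_sum [OF N(1)] by metis
      obtain O1 where O1: "openin ?T O1" "x \<in> O1" "O1 \<subseteq> (+) x ` M"
        using translate_interior_base [OF M(1), of x] xy by metis
      obtain O2 where O2: "openin ?T O2" "y \<in> O2" "O2 \<subseteq> (+) y ` M"
        using translate_interior_base [OF M(1), of y] xy by metis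
      have "a + b \<in> U" if "a \<in> O1" "b \<in> O2" for a b
      proof -
        have "a \<in> (+) x ` M" "b \<in> (+) y ` M" using that O1(3) O2(3) by (simp_all add: subsetD)
        then obtain m n where mn: "m \<in> M" "n \<in> M" "a = x + m" "b = y + n" by (elim imageE) simp
        have "(x + y) + (m + n) \<in> U" by (rule subsetD [OF N(2)]) (rule imageI, rule M(2) [OF mn(1,2)])
        then show ?thesis by (simp add: mn algebra_simps)
      qed
      moreover have "O1 \<subseteq> V" "O2 \<subseteq> V" using O1 O2 openin_subset top by blast+
      ultimately show "\<exists>U' V'. openin ?T U' \<and> openin ?T V' \<and> x \<in> U' \<and> y \<in> V' \<and>
         U' \<times> V' \<subseteq> {p \<in> topspace (prod_topology ?T ?T). (\<lambda>(x, y). x + y) p \<in> U}"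
        using O1 O2 by (intro exI [of _ O1] exI [of _ O2]) (auto simp: top)
    qed
  qed (auto simp: top complex_vector.subspace_add [OF sub])
  have scale: "continuous_map (prod_topology euclidean ?T) ?T (\<lambda>(c, x). c *\<^sub>C x)"
    unfolding continuous_map_def
  proof (intro conjI allI impI)
    fix U assume U: "openin ?T U"
    show "openin (prod_topology euclidean ?T) {p \<in> topspace (prod_topology euclidean ?T). (\<lambda>(c, x). c *\<^sub>C x) p \<in> U}"
      unfolding openin_prod_topology_alt
    proof (intro allI impI)
      fix c :: complex and x
      assume "(c, x) \<in> {p \<in> topspace (prod_topology euclidean ?T). (\<lambda>(c, x). c *\<^sub>C x) p \<in> U}"
      then have x: "x \<in> V" and cx: "c *\<^sub>C x \<in> U" by (auto simp: top)
      obtain N where N: "N \<in> \<U>" "(+) (c *\<^sub>C x) ` N \<subseteq> U" using U cx openin_base_topology [OF base] by auto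
      obtain M where M: "M \<in> \<U>" "\<And>x y. x \<in> M \<Longrightarrow> y \<in> M \<Longrightarrow> x + y \<in> N" using zero_base_half_sum [OF N(1)] by metis
      have Mp: "balanced M" "absorbing_in V M" using base M by (auto simp: zero_base_def)
      obtain r where r: "r > 0" "r *\<^sub>R x \<in> M" using Mp x by (auto simp: absorbing_in_def)
      obtain k :: nat where k: "cmod c + r \<le> 2 ^ k"
        using real_arch_pow [of 2 "cmod c + r"] by (auto intro: less_imp_le)
      have "\<exists>Q\<in>\<U>. (*\<^sub>C) (2 ^ k) ` Q \<subseteq> M" for k :: nat
      proof (induction k)
        case 0 show ?case using M by (intro bexI [of _ M]) auto
      next
        case (Suc k)
        then obtain Q where Q: "Q \<in> \<U>" "(*\<^sub>C) (2 ^ k) ` Q \<subseteq> M" by auto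
        moreover obtain Q' where Q': "Q' \<in> \<U>" "(*\<^sub>C) 2 ` Q' \<subseteq> Q" using Q zero_baseD(7) [OF base] by meson
        ultimately have "(2 ^ k) *\<^sub>C 2 *\<^sub>C x \<in> M" if "x \<in> Q'" for x using that by blast
        then show ?case using Q' by (intro bexI [of _ Q']) (auto simp: mult.commute)
      qed
      then obtain Q where Q: "Q \<in> \<U>" "(*\<^sub>C) (2 ^ k) ` Q \<subseteq> M" by (meson bexE)
      obtain O2 where O2: "openin ?T O2" "x \<in> O2" "O2 \<subseteq> (+) x ` Q"
        using translate_interior_base [OF Q(1) x] by metis
      have in_U: "d *\<^sub>C y \<in> U" if d: "d \<in> ball c r" and y: "y \<in> O2" for d y
      proof -
        obtain q where q: "q \<in> Q" "y = x + q" using subsetD [OF O2(3) y] by (elim imageE) simp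
        have dc: "cmod (d - c) < r" using d by (simp add: dist_norm norm_minus_commute)
        have "(complex_of_real (1 / r) * (d - c)) *\<^sub>C (r *\<^sub>R x) \<in> M"
          using dc r by (intro balanced_scaleC [OF Mp(1)]) (auto simp: norm_mult norm_divide divide_simps)
        then have 1: "(d - c) *\<^sub>C x \<in> M" using r by (simp add: scaleR_scaleC scaleC_scaleC)
        have "cmod d \<le> 2 ^ k" using norm_triangle_ineq [of "d - c" c] dc k by simp
        then have "cmod (d / 2 ^ k) \<le> 1" by (simp add: norm_divide norm_power)
        moreover have "(2 ^ k) *\<^sub>C q \<in> M" using q(1) Q(2) by blast
        ultimately have "(d / 2 ^ k) *\<^sub>C ((2 ^ k) *\<^sub>C q) \<in> M" using balanced_scaleC [OF Mp(1)] by blast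
        then have 2: "d *\<^sub>C q \<in> M" by (simp add: scaleC_scaleC)
        have "c *\<^sub>C x + ((d - c) *\<^sub>C x + d *\<^sub>C q) \<in> U" by (rule subsetD [OF N(2)]) (rule imageI, rule M(2) [OF 1 2])
        moreover have "c *\<^sub>C x + ((d - c) *\<^sub>C x + d *\<^sub>C q) = d *\<^sub>C y"
          by (simp add: q complex_vector.scale_left_diff_distrib scaleC_add_right)
        ultimately show ?thesis by simp
      qed
      have "O2 \<subseteq> V" using O2 openin_subset top by blast
      then show "\<exists>U' V'. openin euclidean U' \<and> openin ?T V' \<and> c \<in> U' \<and> x \<in> V' \<and>
         U' \<times> V' \<subseteq> {p \<in> topspace (prod_topology euclidean ?T). (\<lambda>(c, x). c *\<^sub>C x) p \<in> U}"
        using O2 r in_U by (intro exI [of _ "ball c r"] exI [of _ O2]) (auto simp: top)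
    qed
  qed (auto simp: top complex_vector.subspace_scale [OF sub])
  have "neighbourhood_base_at 0 convex ?T" unfolding neighbourhood_base_at_def
  proof (intro allI impI)
    fix W assume W: "openin ?T W \<and> 0 \<in> W"
    then obtain N where N: "N \<in> \<U>" "(+) 0 ` N \<subseteq> W" using openin_base_topology [OF base] by blast
    moreover obtain O1 where "openin ?T O1" "0 \<in> O1" "O1 \<subseteq> (+) 0 ` N"
      using translate_interior_base [OF N(1) complex_vector.subspace_0 [OF sub]] by blast
    moreover have "convex N" using N base by (auto simp: zero_base_def)
    ultimately show "\<exists>U V. openin ?T U \<and> convex V \<and> 0 \<in> U \<and> U \<subseteq> V \<and> V \<subseteq> W"
      by (intro exI [of _ O1] exI [of _ N]) auto
  qed
  then show ?thesis using sub haus plus scale by (simp add: locally_convex_space_def top)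
qed

end

section \<open>Totally bounded sets\<close>

text \<open>
Pigeonhole: send \<open>h\<close> to the function that selects a net point for each \<open>f\<close>. There are finitely many such
functions, and two elements with the same function are close at every \<open>f\<close>.
\<close>

lemma finite_simultaneous_net:
  assumes F: "finite F" and G: "\<forall>f\<in>F. \<exists>G. finite G \<and> (\<forall>h\<in>H. \<exists>g\<in>G. R f h g)"
  shows "\<exists>K. finite K \<and> K \<subseteq> H \<and> (\<forall>h\<in>H. \<exists>k\<in>K. \<forall>f\<in>F. \<exists>g. R f h g \<and> R f k g)"
proof -
  from bchoice [OF G] obtain G' where G': "\<forall>f\<in>F. finite (G' f) \<and> (\<forall>h\<in>H. \<exists>g\<in>G' f. R f h g)" by auto
  define c where "c h = (\<lambda>f\<in>F. SOME g. g \<in> G' f \<and> R f h g)" for h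
  have c: "c h f \<in> G' f \<and> R f h (c h f)" if "f \<in> F" "h \<in> H" for h f
    unfolding c_def restrict_apply using that G' by simp (rule someI_ex, blast)
  have "c ` H \<subseteq> PiE F G'" using c by (auto simp: PiE_iff) (auto simp: c_def)
  moreover have "finite (PiE F G')" using F G' by (intro finite_PiE) auto
  ultimately have fin: "finite (c ` H)" by (rule finite_subset)
  then obtain K where K: "K \<subseteq> H" "finite K" "c ` H = c ` K" by (meson finite_subset_image order_refl subset_antisym)
  have "\<exists>k\<in>K. \<forall>f\<in>F. \<exists>g. R f h g \<and> R f k g" if h: "h \<in> H" for h
  proof -
    obtain k where k: "k \<in> K" "c h = c k" using K h by (metis imageE imageI)
    have "R f h (c h f) \<and> R f k (c h f)" if "f \<in> F" for f
      using c [OF that h] c [OF that, of k] k K(1) by auto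
    then show ?thesis using k(1) by auto
  qed
  then show ?thesis using K by auto
qed

lemma subset_set_plus_iff:
  "A \<subseteq> U + F \<longleftrightarrow> (\<forall>a\<in>A. \<exists>f\<in>F. a - f \<in> U)" for U F :: "'a::ab_group_add set"
proof
  assume AUF: "A \<subseteq> U + F"
  show "\<forall>a\<in>A. \<exists>f\<in>F. a - f \<in> U"
  proof
    fix a assume "a \<in> A"
    then have "a \<in> U + F" using AUF by blast
    then obtain u f where "a = u + f" "u \<in> U" "f \<in> F" by (rule set_plus_elim)
    then show "\<exists>f\<in>F. a - f \<in> U" by (intro bexI [of _ f]) auto
  qed
next
  assume R: "\<forall>a\<in>A. \<exists>f\<in>F. a - f \<in> U"
  show "A \<subseteq> U + F"
  proof
    fix a assume "a \<in> A"
    with R obtain f where "f \<in> F" "a - f \<in> U" by blast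
    then have "(a - f) + f \<in> U + F" by blast
    then show "a \<in> U + F" by simp
  qed
qed

lemma totally_bounded_iff:
  assumes X: "locally_convex_space X"
  shows "totally_bounded_in X A \<longleftrightarrow> A \<subseteq> topspace X \<and>
    (\<forall>N. zero_nbhd X N \<longrightarrow> (\<exists>F. finite F \<and> F \<subseteq> topspace X \<and> (\<forall>a\<in>A. \<exists>f\<in>F. a - f \<in> N)))"
    (is "_ \<longleftrightarrow> _ \<and> ?R")
proof -
  have "(\<forall>U. openin X U \<and> 0 \<in> U \<longrightarrow> (\<exists>F. finite F \<and> F \<subseteq> topspace X \<and> A \<subseteq> U + F)) \<longleftrightarrow> ?R"
    unfolding subset_set_plus_iff
  proof (intro iffI allI impI)
    fix N assume *: "\<forall>U. openin X U \<and> 0 \<in> U \<longrightarrow> (\<exists>F. finite F \<and> F \<subseteq> topspace X \<and> (\<forall>a\<in>A. \<exists>f\<in>F. a - f \<in> U))"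
      and "zero_nbhd X N"
    then obtain U where "openin X U" "0 \<in> U" "U \<subseteq> N" by (auto simp: zero_nbhd_def)
    with * show "\<exists>F. finite F \<and> F \<subseteq> topspace X \<and> (\<forall>a\<in>A. \<exists>f\<in>F. a - f \<in> N)" by (meson subsetD)
  qed (use zero_nbhd_openin [OF X] in blast)
  then show ?thesis unfolding totally_bounded_in_def by blast
qed

text \<open>
Operators are total functions on the ambient type, so linearity is required on the underlying space only.
\<close>

definition linear_on :: "'a::complex_vector set \<Rightarrow> ('a \<Rightarrow> 'b::complex_vector) \<Rightarrow> bool" where
  "linear_on V f \<longleftrightarrow> (\<forall>x\<in>V. \<forall>y\<in>V. f (x + y) = f x + f y) \<and> (\<forall>c. \<forall>x\<in>V. f (c *\<^sub>C x) = c *\<^sub>C f x)"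

lemma linear_on_add: "linear_on V f \<Longrightarrow> x \<in> V \<Longrightarrow> y \<in> V \<Longrightarrow> f (x + y) = f x + f y"
  and linear_on_scaleC: "linear_on V f \<Longrightarrow> x \<in> V \<Longrightarrow> f (c *\<^sub>C x) = c *\<^sub>C f x"
  by (auto simp: linear_on_def)

lemma linear_on_diff:
  assumes "linear_on V f" "csubspace V" "x \<in> V" "y \<in> V"
  shows "f (x - y) = f x - f y"
proof -
  have "f ((x - y) + y) = f (x - y) + f y"
    by (rule linear_on_add [OF assms(1) complex_vector.subspace_diff [OF assms(2,3,4)] assms(4)])
  then show ?thesis by simp
qed

lemma linear_on_zero: "linear_on V f \<Longrightarrow> csubspace V \<Longrightarrow> f 0 = 0"
  using linear_on_diff [of V f 0 0] complex_vector.subspace_0 [of V] by simp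

context
  fixes X :: "'a::complex_vector topology"
  assumes lcs: "locally_convex_space X"
begin

lemma tb_subset_topspace: "totally_bounded_in X A \<Longrightarrow> A \<subseteq> topspace X"
  by (simp add: totally_bounded_in_def)

lemma tb_subset: "totally_bounded_in X A \<Longrightarrow> B \<subseteq> A \<Longrightarrow> totally_bounded_in X B"
  unfolding totally_bounded_iff [OF lcs] by (meson order_trans subsetD)

text \<open>
Each useful net point is replaced by a point of \<open>A\<close> near it, at the price of doubling the distance.
\<close>

lemma tb_net_inside:
  assumes A: "totally_bounded_in X A" and N: "zero_nbhd X N"
  obtains F where "finite F" "F \<subseteq> A" "\<forall>a\<in>A. \<exists>f\<in>F. a - f \<in> N"
proof -
  obtain M where M: "zero_nbhd X M" "\<And>x y. x \<in> M \<Longrightarrow> y \<in> M \<Longrightarrow> x - y \<in> N"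
    using zero_nbhd_sum [OF lcs N] by metis
  obtain F where F: "finite F" "\<forall>a\<in>A. \<exists>f\<in>F. a - f \<in> M"
    using A M(1) unfolding totally_bounded_iff [OF lcs] by meson
  define c where "c f = (SOME a. a \<in> A \<and> a - f \<in> M)" for f
  define G where "G = c ` {f \<in> F. \<exists>a\<in>A. a - f \<in> M}"
  have c: "c f \<in> A \<and> c f - f \<in> M" if "\<exists>a\<in>A. a - f \<in> M" for f
    unfolding c_def by (rule someI_ex) (use that in blast)
  show ?thesis
  proof (rule that [of G]; (intro ballI)?)
    show "finite G" using F by (simp add: G_def)
    show "G \<subseteq> A" using c by (auto simp: G_def)
    fix a assume a: "a \<in> A"
    then obtain f where f: "f \<in> F" "a - f \<in> M" using F by blast
    then have "c f \<in> G" "c f - f \<in> M" using c [of f] a by (auto simp: G_def)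
    moreover have "a - c f = (a - f) - (c f - f)" by simp
    ultimately show "\<exists>f\<in>G. a - f \<in> N" using M(2) f(2) by metis
  qed
qed

lemma tb_finite: "finite A \<Longrightarrow> A \<subseteq> topspace X \<Longrightarrow> totally_bounded_in X A"
  unfolding totally_bounded_iff [OF lcs]
  by (metis cancel_comm_monoid_add_class.diff_cancel zero_nbhd_zero [OF lcs])

lemma tb_Un:
  assumes "totally_bounded_in X A" "totally_bounded_in X B" shows "totally_bounded_in X (A \<union> B)"
  unfolding totally_bounded_iff [OF lcs]
proof (intro conjI allI impI)
  fix N assume N: "zero_nbhd X N"
  obtain F where "finite F" "F \<subseteq> A" "\<forall>a\<in>A. \<exists>f\<in>F. a - f \<in> N" using tb_net_inside [OF assms(1) N] .
  moreover obtain G where "finite G" "G \<subseteq> B" "\<forall>a\<in>B. \<exists>f\<in>G. a - f \<in> N" using tb_net_inside [OF assms(2) N] .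
  ultimately show "\<exists>F. finite F \<and> F \<subseteq> topspace X \<and> (\<forall>a\<in>A \<union> B. \<exists>f\<in>F. a - f \<in> N)"
    using assms [THEN tb_subset_topspace] by (intro exI [of _ "F \<union> G"]) blast
qed (use assms [THEN tb_subset_topspace] in blast)

lemma tb_diff:
  assumes "totally_bounded_in X A" "totally_bounded_in X B"
  shows "totally_bounded_in X {a - b | a b. a \<in> A \<and> b \<in> B}"
  unfolding totally_bounded_iff [OF lcs]
proof (intro conjI allI impI)
  note AB = assms [THEN tb_subset_topspace]
  show "{a - b |a b. a \<in> A \<and> b \<in> B} \<subseteq> topspace X" using AB lcs_diff [OF lcs] by blast
  fix N assume N: "zero_nbhd X N"
  obtain M where M: "zero_nbhd X M" "\<And>x y. x \<in> M \<Longrightarrow> y \<in> M \<Longrightarrow> x - y \<in> N"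
    using zero_nbhd_sum [OF lcs N] by metis
  obtain F where F: "finite F" "F \<subseteq> A" "\<forall>a\<in>A. \<exists>f\<in>F. a - f \<in> M" using tb_net_inside [OF assms(1) M(1)] .
  obtain G where G: "finite G" "G \<subseteq> B" "\<forall>a\<in>B. \<exists>f\<in>G. a - f \<in> M" using tb_net_inside [OF assms(2) M(1)] .
  have "\<exists>h\<in>(\<lambda>(f, g). f - g) ` (F \<times> G). x - h \<in> N" if "x \<in> {a - b |a b. a \<in> A \<and> b \<in> B}" for x
  proof -
    from that obtain a b where ab: "x = a - b" "a \<in> A" "b \<in> B" by (elim CollectE exE conjE) (rule that)
    obtain f where f: "f \<in> F" "a - f \<in> M" using F ab by blast
    obtain g where g: "g \<in> G" "b - g \<in> M" using G ab by blast
    have "x - (f - g) = (a - f) - (b - g)" by (simp add: ab)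
    then have "x - (f - g) \<in> N" using M(2) f g by metis
    then show ?thesis using f g by blast
  qed
  moreover have "(\<lambda>(f, g). f - g) ` (F \<times> G) \<subseteq> topspace X"
  proof clarify
    fix f g assume "f \<in> F" "g \<in> G"
    then show "f - g \<in> topspace X" using F(2) G(2) AB by (intro lcs_diff [OF lcs]) auto
  qed
  moreover have "finite ((\<lambda>(f, g). f - g) ` (F \<times> G))" using F(1) G(1) by simp
  ultimately show "\<exists>F. finite F \<and> F \<subseteq> topspace X \<and> (\<forall>x\<in>{a - b |a b. a \<in> A \<and> b \<in> B}. \<exists>f\<in>F. x - f \<in> N)"
    by (intro exI [of _ "(\<lambda>(f, g). f - g) ` (F \<times> G)"] conjI ballI)
qed

lemma tb_null_sequence:
  assumes g: "\<And>n::nat. g n \<in> topspace X" and null: "\<And>N. zero_nbhd X N \<Longrightarrow> \<exists>m. \<forall>n\<ge>m. g n \<in> N"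
  shows "totally_bounded_in X (range g)"
  unfolding totally_bounded_iff [OF lcs]
proof (intro conjI allI impI)
  fix N assume N: "zero_nbhd X N"
  then obtain m where m: "\<forall>n\<ge>m. g n \<in> N" using null by blast
  have "\<exists>f\<in>insert 0 (g ` {..<m}). g n - f \<in> N" for n
  proof (cases "n < m")
    case True
    then show ?thesis using zero_nbhd_zero [OF lcs N] by (intro bexI [of _ "g n"]) auto
  next
    case False
    then show ?thesis using m by (intro bexI [of _ 0]) auto
  qed
  then show "\<exists>F. finite F \<and> F \<subseteq> topspace X \<and> (\<forall>a\<in>range g. \<exists>f\<in>F. a - f \<in> N)"
    using g lcs_zero [OF lcs] by (intro exI [of _ "insert 0 (g ` {..<m})"]) auto
qed (use g in auto)

lemma tb_absorbed:
  assumes A: "totally_bounded_in X A" and N: "zero_nbhd X N"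
  obtains r where "r > 0" "\<forall>c. \<forall>a\<in>A. cmod c \<le> r \<longrightarrow> c *\<^sub>C a \<in> N"
proof -
  obtain M where M: "zero_nbhd X M" "balanced M" "\<And>x y. x \<in> M \<Longrightarrow> y \<in> M \<Longrightarrow> x + y \<in> N"
    using zero_nbhd_sum [OF lcs N] by metis
  obtain F where F: "finite F" "F \<subseteq> A" "\<forall>a\<in>A. \<exists>f\<in>F. a - f \<in> M" using tb_net_inside [OF A M(1)] .
  have "\<forall>f\<in>F. \<exists>r. r > 0 \<and> (\<forall>c. cmod c \<le> r \<longrightarrow> c *\<^sub>C f \<in> M)"
  proof
    fix f assume "f \<in> F"
    then have "f \<in> topspace X" using F(2) tb_subset_topspace [OF A] by blast
    from zero_nbhd_absorbing [OF lcs M(1) this] obtain r where "r > 0" "\<forall>c. cmod c \<le> r \<longrightarrow> c *\<^sub>C f \<in> M" .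
    then show "\<exists>r. r > 0 \<and> (\<forall>c. cmod c \<le> r \<longrightarrow> c *\<^sub>C f \<in> M)" by blast
  qed
  from bchoice [OF this] obtain \<rho>
    where \<rho>: "\<And>f. f \<in> F \<Longrightarrow> \<rho> f > 0 \<and> (\<forall>c. cmod c \<le> \<rho> f \<longrightarrow> c *\<^sub>C f \<in> M)" by blast
  \<comment> \<open>\<open>r \<le> 1\<close> takes care of the remainders \<open>a - f\<close>, which lie in the balanced set \<open>M\<close>\<close>
  define r where "r = Min (insert 1 (\<rho> ` F))"
  have r: "r > 0" "r \<le> 1" "\<And>f. f \<in> F \<Longrightarrow> r \<le> \<rho> f"
    using F(1) \<rho> by (auto simp: r_def)
  show ?thesis
  proof (rule that [of r]; (intro allI ballI impI)?)
    fix c a assume c: "cmod c \<le> r" and a: "a \<in> A"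
    obtain f where f: "f \<in> F" "a - f \<in> M" using F a by blast
    have "c *\<^sub>C f \<in> M" using \<rho> [OF f(1)] r(3) [OF f(1)] c by auto
    moreover have "c *\<^sub>C (a - f) \<in> M" using balanced_scaleC [OF M(2) f(2)] c r by auto
    ultimately have "c *\<^sub>C f + c *\<^sub>C (a - f) \<in> N" by (rule M(3))
    then show "c *\<^sub>C a \<in> N" by (simp add: complex_vector.scale_right_diff_distrib)
  qed (rule r)
qed

end

lemma tb_image:
  assumes X: "locally_convex_space X" and Y: "locally_convex_space Y"
    and f: "continuous_map X Y f" "linear_on (topspace X) f" and A: "totally_bounded_in X A"
  shows "totally_bounded_in Y (f ` A)"
  unfolding totally_bounded_iff [OF Y]
proof (intro conjI allI impI)
  note AX = tb_subset_topspace [OF X A]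
  have fY: "f \<in> topspace X \<rightarrow> topspace Y" using f(1) by (simp add: continuous_map_def)
  show "f ` A \<subseteq> topspace Y" using fY AX by blast
  fix N assume N: "zero_nbhd Y N"
  have cont: "\<forall>N. zero_nbhd Y N \<longrightarrow> (\<exists>M. zero_nbhd X M \<and> f ` M \<subseteq> N)"
    using continuous_map_iff_zero_nbhd [OF X Y fY] linear_on_add [OF f(2)] f(1) by blast
  then obtain M where M: "zero_nbhd X M" "f ` M \<subseteq> N" using N by blast
  obtain F where F: "finite F" "F \<subseteq> A" "\<forall>a\<in>A. \<exists>f\<in>F. a - f \<in> M" using tb_net_inside [OF X A M(1)] .
  have "\<exists>b\<in>f ` F. f a - b \<in> N" if a: "a \<in> A" for a
  proof -
    obtain x where x: "x \<in> F" "a - x \<in> M" using F a by blast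
    have "f (a - x) = f a - f x" by (rule linear_on_diff [OF f(2) lcs_subspace [OF X]]) (use a x F AX in auto)
    then have "f a - f x \<in> N" using M(2) x(2) by (metis imageI subsetD)
    then show ?thesis using x by blast
  qed
  then show "\<exists>F. finite F \<and> F \<subseteq> topspace Y \<and> (\<forall>a\<in>f ` A. \<exists>f\<in>F. a - f \<in> N)"
    using F fY AX by (intro exI [of _ "f ` F"]) blast
qed

lemma finer_topology_iff_zero_nbhd:
  assumes S: "locally_convex_space S" and T: "locally_convex_space T" and top: "topspace S = topspace T"
  shows "finer_topology S T \<longleftrightarrow> (\<forall>N. zero_nbhd T N \<longrightarrow> zero_nbhd S N)"
proof
  assume "finer_topology S T"
  then show "\<forall>N. zero_nbhd T N \<longrightarrow> zero_nbhd S N" unfolding zero_nbhd_def finer_topology_def by metis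
next
  assume "\<forall>N. zero_nbhd T N \<longrightarrow> zero_nbhd S N"
  then show "finer_topology S T"
    unfolding finer_topology_def openin_iff_zero_nbhd [OF S] openin_iff_zero_nbhd [OF T] top by metis
qed

lemma tb_finer:
  assumes "finer_topology S T" "totally_bounded_in S A" shows "totally_bounded_in T A"
  using assms unfolding totally_bounded_in_def finer_topology_def by metis

section \<open>Topologies of uniform convergence\<close>

text \<open>
The boundedness condition makes the neighbourhoods of uniform convergence absorbing, and the last
condition makes the topology Hausdorff. Both \<open>C(G)\<close> and the spaces of operators are instances.
\<close>

definition unif_conv_admissible ::
    "('s \<Rightarrow> 'b::complex_vector) set \<Rightarrow> 's set set \<Rightarrow> 'b topology \<Rightarrow> bool" where
  "unif_conv_admissible V \<A> Y \<longleftrightarrow> locally_convex_space Y \<and> csubspace V \<and> \<A> \<noteq> {} \<and>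
     (\<forall>A\<in>\<A>. \<forall>B\<in>\<A>. A \<union> B \<in> \<A>) \<and>
     (\<forall>h\<in>V. \<forall>A\<in>\<A>. \<forall>N. zero_nbhd Y N \<longrightarrow> (\<exists>r>0. \<forall>x\<in>A. r *\<^sub>R h x \<in> N)) \<and>
     (\<forall>h\<in>V. \<forall>A\<in>\<A>. \<forall>x\<in>A. h x \<in> topspace Y) \<and>
     (\<forall>h\<in>V. h \<noteq> 0 \<longrightarrow> (\<exists>A\<in>\<A>. \<exists>x\<in>A. h x \<noteq> 0))"

definition unif_conv_base where
  "unif_conv_base V \<A> Y =
     {{h \<in> V. \<forall>x\<in>A. h x \<in> N} | A N. A \<in> \<A> \<and> zero_nbhd Y N \<and> convex N \<and> balanced N}"

context
  fixes V :: "('s \<Rightarrow> 'b::complex_vector) set" and \<A> and Y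
  assumes adm: "unif_conv_admissible V \<A> Y"
begin

lemma uc_Y: "locally_convex_space Y" and uc_V: "csubspace V" and uc_ne: "\<A> \<noteq> {}"
  and uc_Un: "\<And>A B. A \<in> \<A> \<Longrightarrow> B \<in> \<A> \<Longrightarrow> A \<union> B \<in> \<A>"
  and uc_bdd: "\<And>h A N. h \<in> V \<Longrightarrow> A \<in> \<A> \<Longrightarrow> zero_nbhd Y N \<Longrightarrow> \<exists>r>0. \<forall>x\<in>A. r *\<^sub>R h x \<in> N"
  and uc_in: "\<And>h A x. h \<in> V \<Longrightarrow> A \<in> \<A> \<Longrightarrow> x \<in> A \<Longrightarrow> h x \<in> topspace Y"
  and uc_sep: "\<And>h. h \<in> V \<Longrightarrow> h \<noteq> 0 \<Longrightarrow> \<exists>A\<in>\<A>. \<exists>x\<in>A. h x \<noteq> 0"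
  using adm by (simp_all add: unif_conv_admissible_def)

lemma unif_conv_base_refine:
  assumes "A \<in> \<A>" "zero_nbhd Y N"
  shows "\<exists>P\<in>unif_conv_base V \<A> Y. P \<subseteq> {h \<in> V. \<forall>x\<in>A. h x \<in> N}"
proof -
  obtain M where M: "zero_nbhd Y M" "convex M" "balanced M" "M \<subseteq> N"
    using zero_nbhd_convex_balanced [OF uc_Y assms(2)] .
  then show ?thesis
    using assms by (intro bexI [of _ "{h \<in> V. \<forall>x\<in>A. h x \<in> M}"]) (auto simp: unif_conv_base_def)
qed

lemma zero_base_unif_conv_base: "zero_base V (unif_conv_base V \<A> Y)"
  unfolding zero_base_def
proof (intro conjI ballI impI uc_V)
  obtain A where "A \<in> \<A>" using uc_ne by blast
  then show "unif_conv_base V \<A> Y \<noteq> {}" using unif_conv_base_refine [OF _ zero_nbhd_topspace [OF uc_Y]] by blast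
next
  fix P assume "P \<in> unif_conv_base V \<A> Y"
  then obtain A N where AN: "P = {h \<in> V. \<forall>x\<in>A. h x \<in> N}" "A \<in> \<A>" "zero_nbhd Y N" "convex N" "balanced N"
    unfolding unif_conv_base_def by blast
  show "P \<subseteq> V" using AN by blast
  show "convex P" unfolding convex_def
  proof (intro ballI allI impI)
    fix f g u v assume fg: "f \<in> P" "g \<in> P" and uv: "0 \<le> u" "0 \<le> v" "u + v = (1::real)"
    have "u *\<^sub>R f + v *\<^sub>R g \<in> V"
      using fg AN unfolding scaleR_scaleC
      by (intro complex_vector.subspace_add [OF uc_V] complex_vector.subspace_scale [OF uc_V]) auto
    moreover have "(u *\<^sub>R f + v *\<^sub>R g) x \<in> N" if "x \<in> A" for x
      using fg AN(1,4) uv that by (auto simp: scaleR_fun_def convex_def)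
    ultimately show "u *\<^sub>R f + v *\<^sub>R g \<in> P" using AN by simp
  qed
  show "balanced P" unfolding balanced_def
  proof (intro allI ballI impI)
    fix c h assume "h \<in> P" "cmod c \<le> 1"
    then show "c *\<^sub>C h \<in> P"
      using AN complex_vector.subspace_scale [OF uc_V] balanced_scaleC [OF AN(5)] by (auto simp: scaleC_fun_def)
  qed
  show "absorbing_in V P" unfolding absorbing_in_def
  proof
    fix h assume h: "h \<in> V"
    then obtain r where "r > 0" "\<forall>x\<in>A. r *\<^sub>R h x \<in> N" using uc_bdd AN by blast
    moreover have "r *\<^sub>R h \<in> V" using h unfolding scaleR_scaleC by (intro complex_vector.subspace_scale [OF uc_V])
    ultimately show "\<exists>r>0. r *\<^sub>R h \<in> P" using AN by (auto simp: scaleR_fun_def)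
  qed
  obtain M where M: "zero_nbhd Y M" "convex M" "balanced M" "\<And>x y. x \<in> M \<Longrightarrow> y \<in> M \<Longrightarrow> x + y \<in> N"
    using zero_nbhd_sum [OF uc_Y AN(3)] by metis
  have "2 *\<^sub>C x \<in> N" if "x \<in> M" for x
  proof -
    have "(1 + 1) *\<^sub>C x = x + x" by (subst scaleC_add_left) simp
    then show ?thesis using M(4) [OF that that] by simp
  qed
  then have "(*\<^sub>C) 2 ` {h \<in> V. \<forall>x\<in>A. h x \<in> M} \<subseteq> P"
    using AN complex_vector.subspace_scale [OF uc_V] by (auto simp: scaleC_fun_def)
  moreover have "{h \<in> V. \<forall>x\<in>A. h x \<in> M} \<in> unif_conv_base V \<A> Y" using M AN(2) by (auto simp: unif_conv_base_def)
  ultimately show "\<exists>M\<in>unif_conv_base V \<A> Y. (*\<^sub>C) 2 ` M \<subseteq> P" by blast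
next
  fix P Q assume "P \<in> unif_conv_base V \<A> Y" "Q \<in> unif_conv_base V \<A> Y"
  then obtain A N B M where AN: "P = {h \<in> V. \<forall>x\<in>A. h x \<in> N}" "A \<in> \<A>" "zero_nbhd Y N"
    and BM: "Q = {h \<in> V. \<forall>x\<in>B. h x \<in> M}" "B \<in> \<A>" "zero_nbhd Y M"
    unfolding unif_conv_base_def by blast
  obtain R where "R \<in> unif_conv_base V \<A> Y" "R \<subseteq> {h \<in> V. \<forall>x\<in>A \<union> B. h x \<in> N \<inter> M}"
    using unif_conv_base_refine [OF uc_Un zero_nbhd_Int [OF uc_Y]] AN BM by meson
  then show "\<exists>R\<in>unif_conv_base V \<A> Y. R \<subseteq> P \<inter> Q" using AN BM by (intro bexI [of _ R]) auto
next
  fix h assume h: "h \<in> V" "h \<noteq> 0"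
  then obtain A x where Ax: "A \<in> \<A>" "x \<in> A" "h x \<noteq> 0" using uc_sep by blast
  then obtain N where N: "zero_nbhd Y N" "h x \<notin> N"
    using zero_nbhd_separating [OF uc_Y, of "h x"] uc_in [OF h(1)] by metis
  obtain P where "P \<in> unif_conv_base V \<A> Y" "P \<subseteq> {h \<in> V. \<forall>x\<in>A. h x \<in> N}"
    using unif_conv_base_refine [OF Ax(1) N(1)] by blast
  then show "\<exists>N\<in>unif_conv_base V \<A> Y. h \<notin> N" using Ax N by blast
qed

lemma unif_conv_topology_eq_base: "unif_conv_topology V \<A> Y = base_topology V (unif_conv_base V \<A> Y)"
proof (rule topology_eq [THEN iffD2], intro allI)
  fix U
  have 1: "{g \<in> V. \<forall>x\<in>A. g x - f x \<in> W} = (+) f ` {h \<in> V. \<forall>x\<in>A. h x \<in> W}" if "f \<in> V" for f A W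
  proof
    show "{g \<in> V. \<forall>x\<in>A. g x - f x \<in> W} \<subseteq> (+) f ` {h \<in> V. \<forall>x\<in>A. h x \<in> W}"
    proof
      fix g assume "g \<in> {g \<in> V. \<forall>x\<in>A. g x - f x \<in> W}"
      then have "g - f \<in> {h \<in> V. \<forall>x\<in>A. h x \<in> W}" using complex_vector.subspace_diff [OF uc_V _ that] by auto
      then have "f + (g - f) \<in> (+) f ` {h \<in> V. \<forall>x\<in>A. h x \<in> W}" by (rule imageI)
      then show "g \<in> (+) f ` {h \<in> V. \<forall>x\<in>A. h x \<in> W}" by simp
    qed
    show "(+) f ` {h \<in> V. \<forall>x\<in>A. h x \<in> W} \<subseteq> {g \<in> V. \<forall>x\<in>A. g x - f x \<in> W}"
    proof (rule image_subsetI)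
      fix h assume "h \<in> {h \<in> V. \<forall>x\<in>A. h x \<in> W}"
      then show "f + h \<in> {g \<in> V. \<forall>x\<in>A. g x - f x \<in> W}"
        using complex_vector.subspace_add [OF uc_V that, of h] by simp
    qed
  qed
  have "(\<exists>A\<in>\<A>. \<exists>W. openin Y W \<and> 0 \<in> W \<and> (+) f ` {h \<in> V. \<forall>x\<in>A. h x \<in> W} \<subseteq> U) \<longleftrightarrow>
    (\<exists>N\<in>unif_conv_base V \<A> Y. (+) f ` N \<subseteq> U)" for f
  proof
    assume "\<exists>A\<in>\<A>. \<exists>W. openin Y W \<and> 0 \<in> W \<and> (+) f ` {h \<in> V. \<forall>x\<in>A. h x \<in> W} \<subseteq> U"
    then obtain A W where AW: "A \<in> \<A>" "openin Y W" "0 \<in> W" "(+) f ` {h \<in> V. \<forall>x\<in>A. h x \<in> W} \<subseteq> U" by blast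
    obtain P where "P \<in> unif_conv_base V \<A> Y" "P \<subseteq> {h \<in> V. \<forall>x\<in>A. h x \<in> W}"
      using unif_conv_base_refine [OF AW(1) zero_nbhd_openin [OF uc_Y AW(2,3)]] by blast
    then show "\<exists>N\<in>unif_conv_base V \<A> Y. (+) f ` N \<subseteq> U"
      by (intro bexI [of _ P] order_trans [OF image_mono AW(4)])
  next
    assume "\<exists>N\<in>unif_conv_base V \<A> Y. (+) f ` N \<subseteq> U"
    then obtain A N where AN: "A \<in> \<A>" "zero_nbhd Y N" "(+) f ` {h \<in> V. \<forall>x\<in>A. h x \<in> N} \<subseteq> U"
      unfolding unif_conv_base_def by blast
    then obtain W where W: "openin Y W" "0 \<in> W" "W \<subseteq> N" by (auto simp: zero_nbhd_def)
    then have "{h \<in> V. \<forall>x\<in>A. h x \<in> W} \<subseteq> {h \<in> V. \<forall>x\<in>A. h x \<in> N}" by blast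
    then have "(+) f ` {h \<in> V. \<forall>x\<in>A. h x \<in> W} \<subseteq> U" by (intro order_trans [OF image_mono AN(3)])
    then show "\<exists>A\<in>\<A>. \<exists>W. openin Y W \<and> 0 \<in> W \<and> (+) f ` {h \<in> V. \<forall>x\<in>A. h x \<in> W} \<subseteq> U"
      using AN(1) W(1,2) by (intro bexI [of _ A] exI [of _ W] conjI)
  qed
  note 2 = this
  have "(U \<subseteq> V \<and> (\<forall>f\<in>U. \<exists>A\<in>\<A>. \<exists>W. openin Y W \<and> 0 \<in> W \<and> {g \<in> V. \<forall>x\<in>A. g x - f x \<in> W} \<subseteq> U)) \<longleftrightarrow>
     (U \<subseteq> V \<and> (\<forall>f\<in>U. \<exists>N\<in>unif_conv_base V \<A> Y. (+) f ` N \<subseteq> U))"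
  proof (intro conj_cong ball_cong refl)
    fix f assume "U \<subseteq> V" "f \<in> U"
    then have "f \<in> V" by blast
    then show "(\<exists>A\<in>\<A>. \<exists>W. openin Y W \<and> 0 \<in> W \<and> {g \<in> V. \<forall>x\<in>A. g x - f x \<in> W} \<subseteq> U) \<longleftrightarrow>
      (\<exists>N\<in>unif_conv_base V \<A> Y. (+) f ` N \<subseteq> U)" by (simp only: 1 2)
  qed
  then show "openin (unif_conv_topology V \<A> Y) U \<longleftrightarrow> openin (base_topology V (unif_conv_base V \<A> Y)) U"
    unfolding openin_base_topology [OF zero_base_unif_conv_base]
    by (rule trans [OF openin_unif_conv_topology [OF uc_ne _ lcs_zero [OF uc_Y]], rotated]) (rule uc_Un)
qed

lemma locally_convex_space_unif_conv: "locally_convex_space (unif_conv_topology V \<A> Y)"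
  unfolding unif_conv_topology_eq_base by (rule locally_convex_space_base_topology [OF zero_base_unif_conv_base])

lemma topspace_unif_conv: "topspace (unif_conv_topology V \<A> Y) = V"
  unfolding unif_conv_topology_eq_base by (rule topspace_base_topology [OF zero_base_unif_conv_base])

lemma zero_nbhd_unif_conv:
  "zero_nbhd (unif_conv_topology V \<A> Y) P \<longleftrightarrow>
     P \<subseteq> V \<and> (\<exists>A\<in>\<A>. \<exists>N. zero_nbhd Y N \<and> {h \<in> V. \<forall>x\<in>A. h x \<in> N} \<subseteq> P)"
  unfolding unif_conv_topology_eq_base zero_nbhd_base_topology [OF zero_base_unif_conv_base]
proof (intro conj_cong refl iffI)
  assume "\<exists>M\<in>unif_conv_base V \<A> Y. M \<subseteq> P"
  then show "\<exists>A\<in>\<A>. \<exists>N. zero_nbhd Y N \<and> {h \<in> V. \<forall>x\<in>A. h x \<in> N} \<subseteq> P" unfolding unif_conv_base_def by blast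
next
  assume "\<exists>A\<in>\<A>. \<exists>N. zero_nbhd Y N \<and> {h \<in> V. \<forall>x\<in>A. h x \<in> N} \<subseteq> P"
  then show "\<exists>M\<in>unif_conv_base V \<A> Y. M \<subseteq> P" 
  proof (elim bexE exE conjE)
    fix A N assume AN: "A \<in> \<A>" "zero_nbhd Y N" and sub: "{h \<in> V. \<forall>x\<in>A. h x \<in> N} \<subseteq> P"
    obtain Q where "Q \<in> unif_conv_base V \<A> Y" "Q \<subseteq> {h \<in> V. \<forall>x\<in>A. h x \<in> N}"
      using unif_conv_base_refine [OF AN] by (elim bexE)
    then show "\<exists>M\<in>unif_conv_base V \<A> Y. M \<subseteq> P" using sub by (intro bexI [of _ Q] order_trans [OF _ sub])
  qed
qed

end

section \<open>Spaces of operators\<close>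

lemma continuous_linear_mapsD:
  assumes "f \<in> continuous_linear_maps X Y"
  shows "continuous_map X Y f" "linear_on (topspace X) f" "\<And>x. x \<notin> topspace X \<Longrightarrow> f x = 0"
    "f \<in> topspace X \<rightarrow> topspace Y"
  using assms by (auto simp: continuous_linear_maps_def linear_on_def continuous_map_def)

lemma continuous_linear_mapsI:
  assumes X: "locally_convex_space X" and Y: "locally_convex_space Y"
    and f: "f \<in> topspace X \<rightarrow> topspace Y" "linear_on (topspace X) f" "\<And>x. x \<notin> topspace X \<Longrightarrow> f x = 0"
    and cont: "\<And>N. zero_nbhd Y N \<Longrightarrow> \<exists>M. zero_nbhd X M \<and> f ` M \<subseteq> N"
  shows "f \<in> continuous_linear_maps X Y"
proof -
  have "continuous_map X Y f"
    by (rule continuous_map_iff_zero_nbhd [OF X Y f(1), THEN iffD2]) (use linear_on_add [OF f(2)] cont in auto)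
  then show ?thesis using f by (simp add: continuous_linear_maps_def linear_on_def)
qed

lemma continuous_linear_maps_nbhd:
  assumes X: "locally_convex_space X" and Y: "locally_convex_space Y"
    and f: "f \<in> continuous_linear_maps X Y" and N: "zero_nbhd Y N"
  obtains M where "zero_nbhd X M" "\<forall>x\<in>M. f x \<in> N"
proof -
  have "\<forall>N. zero_nbhd Y N \<longrightarrow> (\<exists>M. zero_nbhd X M \<and> f ` M \<subseteq> N)"
    by (rule continuous_map_iff_zero_nbhd [OF X Y continuous_linear_mapsD(4) [OF f], THEN iffD1])
      (use continuous_linear_mapsD(1,2) [OF f] linear_on_add in auto)
  with N obtain M where "zero_nbhd X M" "f ` M \<subseteq> N" by blast
  then show ?thesis by (intro that [of M]) auto
qed

lemma continuous_linear_maps_in: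
  assumes Y: "locally_convex_space Y" and f: "f \<in> continuous_linear_maps X Y"
  shows "f x \<in> topspace Y"
  using continuous_linear_mapsD(3,4) [OF f] lcs_zero [OF Y] by (cases "x \<in> topspace X") auto

lemma csubspace_continuous_linear_maps:
  assumes X: "locally_convex_space X" and Y: "locally_convex_space Y"
  shows "csubspace (continuous_linear_maps X Y)"
  unfolding complex_vector.subspace_def
proof (intro conjI ballI allI)
  show "0 \<in> continuous_linear_maps X Y"
  proof (rule continuous_linear_mapsI [OF X Y])
    show "\<exists>M. zero_nbhd X M \<and> (0::'a \<Rightarrow> 'b) ` M \<subseteq> N" if "zero_nbhd Y N" for N
      using zero_nbhd_zero [OF Y that] zero_nbhd_topspace [OF X] by (intro exI conjI) auto
  qed (use lcs_zero [OF Y] in \<open>auto simp: linear_on_def\<close>)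
next
  fix f g assume fg: "f \<in> continuous_linear_maps X Y" "g \<in> continuous_linear_maps X Y"
  note f = continuous_linear_mapsD [OF fg(1)] and g = continuous_linear_mapsD [OF fg(2)]
  show "f + g \<in> continuous_linear_maps X Y"
  proof (rule continuous_linear_mapsI [OF X Y])
    show "f + g \<in> topspace X \<rightarrow> topspace Y" using f(4) g(4) by (auto simp: Pi_iff intro: lcs_add [OF Y])
    show "linear_on (topspace X) (f + g)"
      using f(2) g(2) by (simp add: linear_on_def scaleC_add_right algebra_simps)
    show "(f + g) x = 0" if "x \<notin> topspace X" for x using f(3) g(3) that by simp
    fix N assume N: "zero_nbhd Y N"
    obtain M where M: "zero_nbhd Y M" "\<And>x y. x \<in> M \<Longrightarrow> y \<in> M \<Longrightarrow> x + y \<in> N"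
      using zero_nbhd_sum [OF Y N] by metis
    obtain P where P: "zero_nbhd X P" "\<forall>x\<in>P. f x \<in> M" using continuous_linear_maps_nbhd [OF X Y fg(1) M(1)] .
    obtain Q where Q: "zero_nbhd X Q" "\<forall>x\<in>Q. g x \<in> M" using continuous_linear_maps_nbhd [OF X Y fg(2) M(1)] .
    show "\<exists>M. zero_nbhd X M \<and> (f + g) ` M \<subseteq> N"
      using zero_nbhd_Int [OF X P(1) Q(1)] P(2) Q(2) M(2) by (intro exI [of _ "P \<inter> Q"]) auto
  qed
next
  fix c f assume fg: "f \<in> continuous_linear_maps X Y"
  note f = continuous_linear_mapsD [OF fg]
  show "c *\<^sub>C f \<in> continuous_linear_maps X Y"
  proof (rule continuous_linear_mapsI [OF X Y])
    show "c *\<^sub>C f \<in> topspace X \<rightarrow> topspace Y" using f(4) by (auto simp: scaleC_fun_def Pi_iff intro: lcs_scaleC [OF Y])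
    show "linear_on (topspace X) (c *\<^sub>C f)"
      using f(2) by (simp add: linear_on_def scaleC_fun_def scaleC_add_right mult.commute)
    show "(c *\<^sub>C f) x = 0" if "x \<notin> topspace X" for x using f(3) that by (simp add: scaleC_fun_def)
    fix N assume N: "zero_nbhd Y N"
    show "\<exists>M. zero_nbhd X M \<and> (c *\<^sub>C f) ` M \<subseteq> N"
    proof (cases "c = 0")
      case True
      then show ?thesis using zero_nbhd_zero [OF Y N] zero_nbhd_topspace [OF X] 
        by (intro exI [of _ "topspace X"]) (auto simp: scaleC_fun_def)
    next
      case False
      obtain P where P: "zero_nbhd X P" "\<forall>x\<in>P. f x \<in> (*\<^sub>C) (inverse c) ` N"
        using continuous_linear_maps_nbhd [OF X Y fg zero_nbhd_scale [OF Y _ N]] False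
        by (metis inverse_nonzero_iff_nonzero)
      have "c *\<^sub>C f x \<in> N" if x: "x \<in> P" for x
        using bspec [OF P(2) x] False by (auto simp: scaleC_scaleC)
      then show ?thesis using P(1) by (intro exI [of _ P]) (auto simp: scaleC_fun_def)
    qed
  qed
qed

lemma operator_space_admissible:
  assumes X: "locally_convex_space X" and Y: "locally_convex_space Y"
  shows "unif_conv_admissible (continuous_linear_maps X Y) {A. totally_bounded_in X A} Y"
  unfolding unif_conv_admissible_def
proof (intro conjI ballI allI impI csubspace_continuous_linear_maps Y X)
  show "{A. totally_bounded_in X A} \<noteq> {}" using tb_finite [OF X, of "{}"] by auto
  show "A \<union> B \<in> {A. totally_bounded_in X A}" if "A \<in> {A. totally_bounded_in X A}" "B \<in> {A. totally_bounded_in X A}" for A B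
    using that tb_Un [OF X] by auto
next
  fix h A N assume h: "h \<in> continuous_linear_maps X Y" and "A \<in> {A. totally_bounded_in X A}" and N: "zero_nbhd Y N"
  then have A: "totally_bounded_in X A" by simp
  obtain M where M: "zero_nbhd X M" "\<forall>x\<in>M. h x \<in> N" using continuous_linear_maps_nbhd [OF X Y h N] .
  obtain r where r: "r > 0" "\<forall>c. \<forall>a\<in>A. cmod c \<le> r \<longrightarrow> c *\<^sub>C a \<in> M" using tb_absorbed [OF X A M(1)] .
  have "r *\<^sub>R h x \<in> N" if x: "x \<in> A" for x
  proof -
    have "h (complex_of_real r *\<^sub>C x) \<in> N" using M(2) r x by simp
    then show ?thesis
      using linear_on_scaleC [OF continuous_linear_mapsD(2) [OF h]] x tb_subset_topspace [OF X A]
      by (simp add: scaleR_scaleC subset_iff)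
  qed
  then show "\<exists>r>0. \<forall>x\<in>A. r *\<^sub>R h x \<in> N" using r by blast
next
  show "h x \<in> topspace Y" if "h \<in> continuous_linear_maps X Y" for h x using continuous_linear_maps_in [OF Y that] .
next
  fix h assume h: "h \<in> continuous_linear_maps X Y" "h \<noteq> 0"
  then obtain x where x: "h x \<noteq> 0" by (auto simp: fun_eq_iff)
  then have "x \<in> topspace X" using continuous_linear_mapsD(3) [OF h(1)] by blast
  then show "\<exists>A\<in>{A. totally_bounded_in X A}. \<exists>x\<in>A. h x \<noteq> 0"
    using x tb_finite [OF X, of "{x}"] by (intro bexI [of _ "{x}"]) auto
qed

context
  fixes X :: "'a::complex_vector topology" and Y :: "'b::complex_vector topology"
  assumes X: "locally_convex_space X" and Y: "locally_convex_space Y"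
begin

lemma locally_convex_space_operator_space: "locally_convex_space (operator_space X Y)"
  unfolding operator_space_def by (rule locally_convex_space_unif_conv [OF operator_space_admissible [OF X Y]])

lemma topspace_operator_space: "topspace (operator_space X Y) = continuous_linear_maps X Y"
  unfolding operator_space_def by (rule topspace_unif_conv [OF operator_space_admissible [OF X Y]])

lemma zero_nbhd_operator_space:
  "zero_nbhd (operator_space X Y) P \<longleftrightarrow> P \<subseteq> continuous_linear_maps X Y \<and>
     (\<exists>A N. totally_bounded_in X A \<and> zero_nbhd Y N \<and> {h \<in> continuous_linear_maps X Y. \<forall>x\<in>A. h x \<in> N} \<subseteq> P)"
  unfolding operator_space_def zero_nbhd_unif_conv [OF operator_space_admissible [OF X Y]] by blast

text \<open>
A version of Ascoli's theorem. On a totally bounded set equicontinuity reduces uniform closeness to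
closeness at finitely many points, where the values of the operators have finite nets.
\<close>

lemma tb_operator_space:
  assumes H: "H \<subseteq> continuous_linear_maps X Y"
    and equi: "\<And>N. zero_nbhd Y N \<Longrightarrow> \<exists>M. zero_nbhd X M \<and> (\<forall>h\<in>H. \<forall>x\<in>M. h x \<in> N)"
    and pw: "\<And>x. x \<in> topspace X \<Longrightarrow> totally_bounded_in Y ((\<lambda>h. h x) ` H)"
  shows "totally_bounded_in (operator_space X Y) H"
  unfolding totally_bounded_iff [OF locally_convex_space_operator_space] topspace_operator_space
proof (intro conjI H allI impI)
  fix P assume "zero_nbhd (operator_space X Y) P"
  then obtain A N where A: "totally_bounded_in X A" and N: "zero_nbhd Y N"
    and sub: "{h \<in> continuous_linear_maps X Y. \<forall>x\<in>A. h x \<in> N} \<subseteq> P"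
    unfolding zero_nbhd_operator_space by blast
  note AX = tb_subset_topspace [OF X A]
  obtain N1 where N1: "zero_nbhd Y N1" "\<And>x y. x \<in> N1 \<Longrightarrow> y \<in> N1 \<Longrightarrow> x + y \<in> N"
    using zero_nbhd_sum [OF Y N] by metis
  obtain N2 where N2: "zero_nbhd Y N2" "\<And>x y. x \<in> N2 \<Longrightarrow> y \<in> N2 \<Longrightarrow> x - y \<in> N1"
    using zero_nbhd_sum [OF Y N1(1)] by metis
  obtain N3 where N3: "zero_nbhd Y N3" "\<And>x y. x \<in> N3 \<Longrightarrow> y \<in> N3 \<Longrightarrow> x - y \<in> N1"
    using zero_nbhd_sum [OF Y N1(1)] by metis
  obtain M where M: "zero_nbhd X M" "\<And>h x. h \<in> H \<Longrightarrow> x \<in> M \<Longrightarrow> h x \<in> N2" using equi [OF N2(1)] by blast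
  obtain F where F: "finite F" "F \<subseteq> A" "\<forall>a\<in>A. \<exists>f\<in>F. a - f \<in> M" using tb_net_inside [OF X A M(1)] .
  have "\<exists>G. finite G \<and> (\<forall>h\<in>H. \<exists>g\<in>G. h f - g \<in> N3)" if "f \<in> F" for f
  proof -
    have "totally_bounded_in Y ((\<lambda>h. h f) ` H)" using pw that F(2) AX by blast
    then obtain G where "finite G" "\<forall>a\<in>(\<lambda>h. h f) ` H. \<exists>g\<in>G. a - g \<in> N3"
      using tb_net_inside [OF Y _ N3(1)] by metis
    then show ?thesis by blast
  qed
  then obtain K where K: "finite K" "K \<subseteq> H" "\<forall>h\<in>H. \<exists>k\<in>K. \<forall>f\<in>F. \<exists>g. h f - g \<in> N3 \<and> k f - g \<in> N3"
    using finite_simultaneous_net [of F H "\<lambda>f h g. h f - g \<in> N3"] F(1) by metis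
  have "\<exists>k\<in>K. h - k \<in> P" if h: "h \<in> H" for h
  proof -
    obtain k where k: "k \<in> K" "\<forall>f\<in>F. \<exists>g. h f - g \<in> N3 \<and> k f - g \<in> N3" using K(3) h by auto
    have kH: "k \<in> H" using k K by auto
    have "h x - k x \<in> N" if x: "x \<in> A" for x
    proof -
      obtain f where f: "f \<in> F" "x - f \<in> M" using F(3) x by blast
      have ft: "f \<in> topspace X" "x \<in> topspace X" using f F x AX by auto
      obtain g where "h f - g \<in> N3" "k f - g \<in> N3" using k(2) f(1) by auto
      then have "h f - k f \<in> N1" using N3(2) [of "h f - g" "k f - g"] by simp
      moreover have "h (x - f) - k (x - f) \<in> N1" using N2(2) M(2) f(2) h kH by blast
      moreover have "h (x - f) = h x - h f" "k (x - f) = k x - k f"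
        using linear_on_diff [OF continuous_linear_mapsD(2) lcs_subspace [OF X] ft(2,1)] H h kH by blast+
      ultimately have "(h f - k f) + ((h x - h f) - (k x - k f)) \<in> N" using N1(2) by metis
      then show ?thesis by simp
    qed
    moreover have "h - k \<in> continuous_linear_maps X Y"
      using H h kH complex_vector.subspace_diff [OF csubspace_continuous_linear_maps [OF X Y]] by blast
    ultimately show ?thesis using sub k by (intro bexI [of _ k]) auto
  qed
  then show "\<exists>F. finite F \<and> F \<subseteq> continuous_linear_maps X Y \<and> (\<forall>a\<in>H. \<exists>f\<in>F. a - f \<in> P)"
    using K H by (intro exI [of _ K]) auto
qed

end

lemma convex_csubspace: "csubspace V \<Longrightarrow> convex V"
  unfolding convex_def scaleR_scaleC
  by (auto intro: complex_vector.subspace_add complex_vector.subspace_scale)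

lemma balanced_csubspace: "csubspace V \<Longrightarrow> balanced V"
  unfolding balanced_def by (auto intro: complex_vector.subspace_scale)

lemma balanced_Int: "balanced A \<Longrightarrow> balanced B \<Longrightarrow> balanced (A \<inter> B)"
  by (auto simp: balanced_def)

lemma zero_nbhd_INT:
  assumes X: "locally_convex_space X" and F: "finite F" and N: "\<And>f. f \<in> F \<Longrightarrow> zero_nbhd X (N f)"
  shows "\<exists>M. zero_nbhd X M \<and> (\<forall>f\<in>F. M \<subseteq> N f)"
  using F N
proof (induction F rule: finite_induct)
  case empty
  then show ?case using zero_nbhd_topspace [OF X] by auto
next
  case (insert f F)
  then obtain M where "zero_nbhd X M" "\<forall>f\<in>F. M \<subseteq> N f" by auto
  then show ?case using zero_nbhd_Int [OF X, of M "N f"] insert.prems [of f]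
    by (intro exI [of _ "M \<inter> N f"]) auto
qed

lemma tb_scale:
  assumes X: "locally_convex_space X" and A: "totally_bounded_in X A"
  shows "totally_bounded_in X ((*\<^sub>C) c ` A)"
  by (rule tb_image [OF X X continuous_map_scale [OF X] _ A])
    (simp add: linear_on_def scaleC_add_right mult.commute)

lemma tb_translate:
  assumes X: "locally_convex_space X" and A: "totally_bounded_in X A" and x: "x \<in> topspace X"
  shows "totally_bounded_in X ((\<lambda>a. a - x) ` A)"
proof -
  have "totally_bounded_in X {x}" by (rule tb_finite [OF X]) (use x in auto)
  from tb_diff [OF X A this] show ?thesis by (rule tb_subset [OF X]) auto
qed

section \<open>The finest topology that agrees on totally bounded sets\<close>

text \<open>
The neighbourhoods of zero of the finest locally convex topology that is coarser than the topology of
\<open>Y\<close> on each totally bounded set. Since differences of totally bounded sets are totally bounded, it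
suffices to compare the topologies at zero.
\<close>

definition tb_base :: "'a::complex_vector topology \<Rightarrow> 'a set set" where
  "tb_base Y = {U. U \<subseteq> topspace Y \<and> convex U \<and> balanced U \<and>
     (\<forall>A. totally_bounded_in Y A \<longrightarrow> (\<exists>N. zero_nbhd Y N \<and> N \<inter> A \<subseteq> U))}"

definition tb_topology :: "'a::complex_vector topology \<Rightarrow> 'a topology" where
  "tb_topology Y = base_topology (topspace Y) (tb_base Y)"

lemma tb_baseD:
  assumes "U \<in> tb_base Y"
  shows "U \<subseteq> topspace Y" "convex U" "balanced U"
    "\<And>A. totally_bounded_in Y A \<Longrightarrow> \<exists>N. zero_nbhd Y N \<and> N \<inter> A \<subseteq> U"
  using assms by (auto simp: tb_base_def)

context
  fixes Y :: "'a::complex_vector topology"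
  assumes Y: "locally_convex_space Y"
begin

text \<open>
A neighbourhood in the new topology is known only on totally bounded sets; the multiples \<open>x / (n + 1)\<close>
are such a set and show that it absorbs \<open>x\<close>.
\<close>

lemma tb_null_multiples:
  assumes x: "x \<in> topspace Y"
  shows "totally_bounded_in Y (range (\<lambda>n. (1 / of_nat (Suc n)) *\<^sub>C x))"
    and "zero_nbhd Y N \<Longrightarrow> \<exists>m. \<forall>n\<ge>m. (1 / of_nat (Suc n)) *\<^sub>C x \<in> N"
proof -
  show *: "\<exists>m. \<forall>n\<ge>m. (1 / of_nat (Suc n)) *\<^sub>C x \<in> N" if N: "zero_nbhd Y N" for N
  proof -
    obtain r where r: "r > 0" "\<forall>c. cmod c \<le> r \<longrightarrow> c *\<^sub>C x \<in> N" using zero_nbhd_absorbing [OF Y N x] .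
    obtain m where m: "1 / real (Suc m) < r" using nat_approx_posE [OF r(1)] by metis
    have "(1 / of_nat (Suc n)) *\<^sub>C x \<in> N" if "n \<ge> m" for n
    proof -
      have "1 / real (Suc n) \<le> 1 / real (Suc m)" using that by (simp add: frac_le)
      then have "cmod (1 / of_nat (Suc n)) \<le> r" using m by (simp only: norm_divide norm_of_nat norm_one)
      then show ?thesis using r(2) by blast
    qed
    then show ?thesis by blast
  qed
  show "totally_bounded_in Y (range (\<lambda>n. (1 / of_nat (Suc n)) *\<^sub>C x))"
    by (rule tb_null_sequence [OF Y lcs_scaleC [OF Y x] *])
qed

lemma zero_nbhd_in_tb_base:
  assumes "zero_nbhd Y N" "convex N" "balanced N" shows "N \<in> tb_base Y"
  using assms zero_nbhd_subset [OF Y] by (auto simp: tb_base_def)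

lemma tb_base_Int:
  assumes "U \<in> tb_base Y" "W \<in> tb_base Y" shows "U \<inter> W \<in> tb_base Y"
  unfolding tb_base_def
proof (intro CollectI conjI allI impI)
  note U = tb_baseD [OF assms(1)] and W = tb_baseD [OF assms(2)]
  show "U \<inter> W \<subseteq> topspace Y" "convex (U \<inter> W)" "balanced (U \<inter> W)"
    using U W by (auto intro: convex_Int balanced_Int)
  fix A assume A: "totally_bounded_in Y A"
  obtain N M where "zero_nbhd Y N" "N \<inter> A \<subseteq> U" "zero_nbhd Y M" "M \<inter> A \<subseteq> W"
    using U(4) [OF A] W(4) [OF A] by auto
  then show "\<exists>N. zero_nbhd Y N \<and> N \<inter> A \<subseteq> U \<inter> W"
    by (intro exI [of _ "N \<inter> M"] conjI zero_nbhd_Int [OF Y]) auto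
qed

lemma tb_base_half:
  assumes "U \<in> tb_base Y" shows "(*\<^sub>C) (1/2) ` U \<in> tb_base Y"
  unfolding tb_base_def
proof (intro CollectI conjI allI impI)
  note U = tb_baseD [OF assms]
  show "(*\<^sub>C) (1/2) ` U \<subseteq> topspace Y" using U(1) by (auto intro: lcs_scaleC [OF Y])
  show "convex ((*\<^sub>C) (1/2) ` U)" by (rule convex_image_scaleC [OF U(2)])
  show "balanced ((*\<^sub>C) (1/2) ` U)" by (rule balanced_image_scaleC [OF U(3)])
  fix A assume A: "totally_bounded_in Y A"
  obtain N where N: "zero_nbhd Y N" "N \<inter> (*\<^sub>C) 2 ` A \<subseteq> U" using U(4) [OF tb_scale [OF Y A, of 2]] by auto
  have "x \<in> (*\<^sub>C) (1/2) ` U" if x: "x \<in> (*\<^sub>C) (1/2) ` N" "x \<in> A" for x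
  proof -
    obtain n where n: "n \<in> N" "x = (1/2) *\<^sub>C n" using x(1) by (rule imageE)
    then have "2 *\<^sub>C x = n" by simp
    then have "2 *\<^sub>C x \<in> N \<inter> (*\<^sub>C) 2 ` A" using n(1) x(2) by (metis IntI imageI)
    then have "n \<in> U" using N(2) \<open>2 *\<^sub>C x = n\<close> by auto
    then show ?thesis using n(2) by (rule image_eqI [rotated])
  qed
  moreover have "zero_nbhd Y ((*\<^sub>C) (1/2) ` N)" by (rule zero_nbhd_scale [OF Y _ N(1)]) simp
  ultimately show "\<exists>N. zero_nbhd Y N \<and> N \<inter> A \<subseteq> (*\<^sub>C) (1/2) ` U"
    by (intro exI [of _ "(*\<^sub>C) (1/2) ` N"]) auto
qed

lemma zero_base_tb_base: "zero_base (topspace Y) (tb_base Y)"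
  unfolding zero_base_def
proof (intro conjI ballI impI lcs_subspace [OF Y])
  have "topspace Y \<in> tb_base Y"
    by (intro zero_nbhd_in_tb_base zero_nbhd_topspace [OF Y] convex_csubspace balanced_csubspace lcs_subspace [OF Y])
  then show "tb_base Y \<noteq> {}" by blast
next
  fix U assume U: "U \<in> tb_base Y"
  show "U \<subseteq> topspace Y" "convex U" "balanced U" using tb_baseD [OF U] by auto
  show "absorbing_in (topspace Y) U" unfolding absorbing_in_def
  proof
    fix x assume x: "x \<in> topspace Y"
    obtain N where N: "zero_nbhd Y N" "N \<inter> range (\<lambda>n. (1 / of_nat (Suc n)) *\<^sub>C x) \<subseteq> U"
      using tb_baseD(4) [OF U tb_null_multiples(1) [OF x]] by auto
    obtain m where "\<forall>n\<ge>m. (1 / of_nat (Suc n)) *\<^sub>C x \<in> N" using tb_null_multiples(2) [OF x N(1)] by auto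
    then have "(1 / of_nat (Suc m)) *\<^sub>C x \<in> N" by simp
    then have "(1 / of_nat (Suc m)) *\<^sub>C x \<in> U" using N(2) by blast
    then have "(1 / real (Suc m)) *\<^sub>R x \<in> U" by (simp add: scaleR_scaleC)
    then show "\<exists>r>0. r *\<^sub>R x \<in> U" by (intro exI [of _ "1 / real (Suc m)"] conjI) auto
  qed
  have "(*\<^sub>C) 2 ` (*\<^sub>C) (1/2) ` U \<subseteq> U" by auto
  then show "\<exists>M\<in>tb_base Y. (*\<^sub>C) 2 ` M \<subseteq> U" using tb_base_half [OF U] by (intro bexI)
next
  fix U W assume "U \<in> tb_base Y" "W \<in> tb_base Y"
  from tb_base_Int [OF this] show "\<exists>P\<in>tb_base Y. P \<subseteq> U \<inter> W" by (intro bexI) auto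
next
  fix x assume "x \<in> topspace Y" "x \<noteq> 0"
  from zero_nbhd_separating [OF Y this] obtain N where N: "zero_nbhd Y N" "x \<notin> N" .
  obtain M where "zero_nbhd Y M" "convex M" "balanced M" "M \<subseteq> N" using zero_nbhd_convex_balanced [OF Y N(1)] .
  then show "\<exists>N\<in>tb_base Y. x \<notin> N" using N(2) by (intro bexI [of _ M] zero_nbhd_in_tb_base) auto
qed

lemma locally_convex_space_tb_topology: "locally_convex_space (tb_topology Y)"
  unfolding tb_topology_def by (rule locally_convex_space_base_topology [OF zero_base_tb_base])

lemma topspace_tb_topology: "topspace (tb_topology Y) = topspace Y"
  unfolding tb_topology_def by (rule topspace_base_topology [OF zero_base_tb_base])

lemma zero_nbhd_tb_topology: "zero_nbhd (tb_topology Y) N \<longleftrightarrow> N \<subseteq> topspace Y \<and> (\<exists>U\<in>tb_base Y. U \<subseteq> N)"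
  unfolding tb_topology_def by (rule zero_nbhd_base_topology [OF zero_base_tb_base])

lemma finer_tb_topology: "finer_topology (tb_topology Y) Y"
  unfolding finer_topology_iff_zero_nbhd [OF locally_convex_space_tb_topology Y topspace_tb_topology]
proof (intro allI impI)
  fix N assume N: "zero_nbhd Y N"
  obtain M where M: "zero_nbhd Y M" "convex M" "balanced M" "M \<subseteq> N" using zero_nbhd_convex_balanced [OF Y N] .
  then show "zero_nbhd (tb_topology Y) N"
    unfolding zero_nbhd_tb_topology using zero_nbhd_in_tb_base zero_nbhd_subset [OF Y N] by auto
qed

text \<open>
A net of \<open>A\<close> for \<open>Y\<close> with points in \<open>A\<close> has all its differences in the totally bounded set \<open>A - A\<close>, and
on this set the two topologies have the same small neighbourhoods.
\<close>

lemma tb_tb_topology: "totally_bounded_in (tb_topology Y) A \<longleftrightarrow> totally_bounded_in Y A"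
proof
  show "totally_bounded_in Y A" if "totally_bounded_in (tb_topology Y) A"
    using tb_finer [OF finer_tb_topology that] .
next
  assume A: "totally_bounded_in Y A"
  note AY = tb_subset_topspace [OF Y A]
  show "totally_bounded_in (tb_topology Y) A"
    unfolding totally_bounded_iff [OF locally_convex_space_tb_topology] topspace_tb_topology
  proof (intro conjI AY allI impI)
    fix N assume "zero_nbhd (tb_topology Y) N"
    then obtain U where U: "U \<in> tb_base Y" "U \<subseteq> N" unfolding zero_nbhd_tb_topology by auto
    obtain M where M: "zero_nbhd Y M" "M \<inter> {a - b |a b. a \<in> A \<and> b \<in> A} \<subseteq> U"
      using tb_baseD(4) [OF U(1) tb_diff [OF Y A A]] by auto
    obtain F where F: "finite F" "F \<subseteq> A" "\<forall>a\<in>A. \<exists>f\<in>F. a - f \<in> M" using tb_net_inside [OF Y A M(1)] .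
    have "\<exists>f\<in>F. a - f \<in> N" if a: "a \<in> A" for a
    proof -
      obtain f where f: "f \<in> F" "a - f \<in> M" using F(3) a by auto
      then have "a - f \<in> M \<inter> {a - b |a b. a \<in> A \<and> b \<in> A}" using F(2) a by auto
      then show ?thesis using M(2) U(2) f(1) by auto
    qed
    then show "\<exists>F. finite F \<and> F \<subseteq> topspace Y \<and> (\<forall>a\<in>A. \<exists>f\<in>F. a - f \<in> N)"
      using F(1,2) AY by (intro exI [of _ F]) auto
  qed
qed

text \<open>
Let \<open>D\<close> be closed, convex, balanced and capacious, and \<open>A\<close> totally bounded. Then \<open>2A\<close> is covered by
finitely many translates \<open>f + D\<close>. These are closed, so the translates that miss zero stay away from zero.
Hence a point of \<open>2A\<close> near zero lies in some \<open>f + D\<close> that contains zero; then \<open>f \<in> D\<close>, and the point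
lies in \<open>D + D\<close>, that is in \<open>2D\<close>.
\<close>

lemma pseudosaturated_tb_topology: "pseudosaturated (tb_topology Y)"
  unfolding pseudosaturated_def
proof (intro allI impI, elim conjE)
  let ?S = "tb_topology Y"
  note S = locally_convex_space_tb_topology
  fix D assume D: "closedin ?S D" "convex D" "balanced D" "capacious ?S D"
  have DY: "D \<subseteq> topspace Y" using D(1) closedin_subset topspace_tb_topology by metis
  have "\<exists>N. zero_nbhd Y N \<and> N \<inter> A \<subseteq> D" if A: "totally_bounded_in Y A" for A
  proof -
    let ?A2 = "(*\<^sub>C) 2 ` A"
    have A2: "totally_bounded_in Y ?A2" by (rule tb_scale [OF Y A])
    then obtain F where F: "finite F" "F \<subseteq> topspace Y" "\<forall>a\<in>?A2. \<exists>f\<in>F. a - f \<in> D"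
      using D(4) unfolding capacious_def tb_tb_topology topspace_tb_topology subset_set_plus_iff by meson
    have "\<exists>N. zero_nbhd ?S N \<and> (\<forall>u\<in>N. u - f \<notin> D)" if f: "f \<in> F" "- f \<notin> D" for f
    proof -
      have "- f \<in> topspace ?S" using f F lcs_uminus [OF Y] topspace_tb_topology by auto
      then have "- f \<in> topspace ?S - D" using f by simp
      moreover have "openin ?S (topspace ?S - D)" using D(1) by (simp add: closedin_def)
      ultimately obtain N where N: "zero_nbhd ?S N" "(+) (- f) ` N \<subseteq> topspace ?S - D"
        using openin_iff_zero_nbhd [OF S, of "topspace ?S - D"] by meson
      have "u - f \<notin> D" if "u \<in> N" for u
      proof -
        have "- f + u \<in> topspace ?S - D" using N(2) that by (meson imageI subsetD)
        then show ?thesis by simp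
      qed
      then show ?thesis using N(1) by auto
    qed
    then have "\<forall>f\<in>{f\<in>F. - f \<notin> D}. \<exists>N. zero_nbhd ?S N \<and> (\<forall>u\<in>N. u - f \<notin> D)" by simp
    from bchoice [OF this] obtain K where K: "\<forall>f\<in>{f\<in>F. - f \<notin> D}. zero_nbhd ?S (K f) \<and> (\<forall>u\<in>K f. u - f \<notin> D)" by auto
    have "\<exists>M. zero_nbhd ?S M \<and> (\<forall>f\<in>{f\<in>F. - f \<notin> D}. M \<subseteq> K f)"
      by (rule zero_nbhd_INT [OF S]) (use F(1) K in auto)
    then obtain M where M: "zero_nbhd ?S M" "\<forall>f\<in>{f\<in>F. - f \<notin> D}. M \<subseteq> K f" by auto
    then obtain U where U: "U \<in> tb_base Y" "U \<subseteq> M" unfolding zero_nbhd_tb_topology by auto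
    obtain N where N: "zero_nbhd Y N" "N \<inter> ?A2 \<subseteq> U" using tb_baseD(4) [OF U(1) A2] by auto
    have "x \<in> D" if x: "x \<in> (*\<^sub>C) (1/2) ` N" "x \<in> A" for x
    proof -
      obtain n where n: "n \<in> N" "x = (1/2) *\<^sub>C n" using x(1) by (rule imageE)
      then have xn: "2 *\<^sub>C x = n" by simp
      have nA: "n \<in> ?A2" using x(2) xn by (metis imageI)
      then obtain f where f: "f \<in> F" "n - f \<in> D" using F(3) by blast
      have "n \<in> M" using N(2) U(2) n(1) nA by auto
      have "- f \<in> D"
      proof (rule ccontr)
        assume "- f \<notin> D"
        then have "f \<in> {f\<in>F. - f \<notin> D}" using f(1) by simp
        then have "n \<in> K f" "\<forall>u\<in>K f. u - f \<notin> D" using M(2) K \<open>n \<in> M\<close> by auto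
        then show False using f(2) by auto
      qed
      then have "f \<in> D" using balanced_uminus [OF D(3), of "- f"] by simp
      have "(1/2) *\<^sub>C (n - f) + (1/2) *\<^sub>C f \<in> D" by (rule convex_half_sum [OF D(2) f(2) \<open>f \<in> D\<close>])
      then show ?thesis using n(2) by (simp add: complex_vector.scale_right_diff_distrib)
    qed
    moreover have "zero_nbhd Y ((*\<^sub>C) (1/2) ` N)" by (rule zero_nbhd_scale [OF Y _ N(1)]) simp
    ultimately show ?thesis by (intro exI [of _ "(*\<^sub>C) (1/2) ` N"]) auto
  qed
  then have "D \<in> tb_base Y" using D DY by (simp add: tb_base_def)
  then have "zero_nbhd ?S D" using DY zero_nbhd_tb_topology by auto
  then show "\<exists>U. openin ?S U \<and> 0 \<in> U \<and> U \<subseteq> D" by (simp add: zero_nbhd_def)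
qed

lemma refinement_tb_topology: "pseudosaturated_refinement Y (tb_topology Y)"
  unfolding pseudosaturated_refinement_def
  using locally_convex_space_tb_topology pseudosaturated_tb_topology finer_tb_topology by simp

section \<open>Existence of the pseudosaturation\<close>

text \<open>
The sets that are neighbourhoods of zero for every pseudosaturated refinement: they describe the
infimum of all refinements in the lattice of locally convex topologies.
\<close>

definition refinement_base :: "'a set set" where
  "refinement_base = {N. N \<subseteq> topspace Y \<and> convex N \<and> balanced N \<and>
     (\<forall>S. pseudosaturated_refinement Y S \<longrightarrow> zero_nbhd S N)}"

lemma refinementD:
  assumes "pseudosaturated_refinement Y S"
  shows "locally_convex_space S" "pseudosaturated S" "finer_topology S Y" "topspace S = topspace Y"
  using assms by (auto simp: pseudosaturated_refinement_def finer_topology_def)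

lemma zero_nbhd_in_refinement_base:
  assumes "zero_nbhd Y N" "convex N" "balanced N" shows "N \<in> refinement_base"
  unfolding refinement_base_def
proof (intro CollectI conjI allI impI assms zero_nbhd_subset [OF Y])
  fix S assume S: "pseudosaturated_refinement Y S"
  then show "zero_nbhd S N"
    using assms(1) finer_topology_iff_zero_nbhd [OF refinementD(1) [OF S] Y refinementD(4) [OF S]] refinementD(3) [OF S]
    by auto
qed

lemma zero_base_refinement_base: "zero_base (topspace Y) refinement_base"
  unfolding zero_base_def
proof (intro conjI ballI impI lcs_subspace [OF Y])
  have "topspace Y \<in> refinement_base"
    by (intro zero_nbhd_in_refinement_base zero_nbhd_topspace [OF Y] convex_csubspace balanced_csubspace lcs_subspace [OF Y])
  then show "refinement_base \<noteq> {}" by blast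
next
  fix U assume "U \<in> refinement_base"
  then have U: "U \<subseteq> topspace Y" "convex U" "balanced U"
    "\<forall>S. pseudosaturated_refinement Y S \<longrightarrow> zero_nbhd S U" by (auto simp: refinement_base_def)
  then show "U \<subseteq> topspace Y" "convex U" "balanced U" by auto
  show "absorbing_in (topspace Y) U" unfolding absorbing_in_def
  proof
    fix x assume "x \<in> topspace Y"
    then have x: "x \<in> topspace (tb_topology Y)" by (simp add: topspace_tb_topology)
    obtain r where r: "r > 0" "\<forall>c. cmod c \<le> r \<longrightarrow> c *\<^sub>C x \<in> U"
      using zero_nbhd_absorbing [OF locally_convex_space_tb_topology _ x] U(4) refinement_tb_topology by metis
    then have "complex_of_real r *\<^sub>C x \<in> U" by simp
    then show "\<exists>r>0. r *\<^sub>R x \<in> U" using r(1) by (intro exI [of _ r]) (simp add: scaleR_scaleC)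
  qed
  have "(*\<^sub>C) (1/2) ` U \<in> refinement_base"
    unfolding refinement_base_def
  proof (intro CollectI conjI allI impI)
    show "(*\<^sub>C) (1/2) ` U \<subseteq> topspace Y" using U(1) by (auto intro: lcs_scaleC [OF Y])
    show "convex ((*\<^sub>C) (1/2) ` U)" by (rule convex_image_scaleC [OF U(2)])
    show "balanced ((*\<^sub>C) (1/2) ` U)" by (rule balanced_image_scaleC [OF U(3)])
    fix S assume S: "pseudosaturated_refinement Y S"
    show "zero_nbhd S ((*\<^sub>C) (1/2) ` U)"
      by (rule zero_nbhd_scale [OF refinementD(1) [OF S]]) (use U(4) S in auto)
  qed
  moreover have "(*\<^sub>C) 2 ` (*\<^sub>C) (1/2) ` U \<subseteq> U" by auto
  ultimately show "\<exists>M\<in>refinement_base. (*\<^sub>C) 2 ` M \<subseteq> U" by (intro bexI)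
next
  fix U W assume UW: "U \<in> refinement_base" "W \<in> refinement_base"
  have "U \<inter> W \<in> refinement_base"
    unfolding refinement_base_def
  proof (intro CollectI conjI allI impI)
    fix S assume S: "pseudosaturated_refinement Y S"
    show "zero_nbhd S (U \<inter> W)"
      by (rule zero_nbhd_Int [OF refinementD(1) [OF S]]) (use UW S in \<open>auto simp: refinement_base_def\<close>)
  qed (use UW in \<open>auto simp: refinement_base_def intro: convex_Int balanced_Int\<close>)
  then show "\<exists>P\<in>refinement_base. P \<subseteq> U \<inter> W" by (intro bexI) auto
next
  fix x assume "x \<in> topspace Y" "x \<noteq> 0"
  from zero_nbhd_separating [OF Y this] obtain N where N: "zero_nbhd Y N" "x \<notin> N" .
  obtain M where "zero_nbhd Y M" "convex M" "balanced M" "M \<subseteq> N" using zero_nbhd_convex_balanced [OF Y N(1)] .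
  then show "\<exists>N\<in>refinement_base. x \<notin> N" using N(2) by (intro bexI [of _ M] zero_nbhd_in_refinement_base) auto
qed

text \<open>
The infimum of the pseudosaturated refinements is itself pseudosaturated. A set that is closed and
capacious for the infimum is so for each refinement, because a finer topology has more closed sets and
fewer totally bounded sets; hence it is a neighbourhood of zero for every refinement.
\<close>

lemma pseudosaturation_properties:
  "pseudosaturated_refinement Y (pseudosaturation Y)"
  "pseudosaturated_refinement Y S \<Longrightarrow> finer_topology S (pseudosaturation Y)"
proof -
  define P where "P = base_topology (topspace Y) refinement_base"
  have lcP: "locally_convex_space P" and topP: "topspace P = topspace Y"
    unfolding P_def by (rule locally_convex_space_base_topology topspace_base_topology, rule zero_base_refinement_base)+
  have nbP: "zero_nbhd P N \<longleftrightarrow> N \<subseteq> topspace Y \<and> (\<exists>U\<in>refinement_base. U \<subseteq> N)" for N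
    unfolding P_def by (rule zero_nbhd_base_topology [OF zero_base_refinement_base])
  have coarsest: "finer_topology S P" if S: "pseudosaturated_refinement Y S" for S
  proof -
    note lS = refinementD(1) [OF S] and tS = refinementD(4) [OF S]
    have tSP: "topspace S = topspace P" by (simp add: tS topP)
    show ?thesis unfolding finer_topology_iff_zero_nbhd [OF lS lcP tSP]
    proof (intro allI impI)
      fix N assume "zero_nbhd P N"
      then obtain U where U: "U \<in> refinement_base" "U \<subseteq> N" "N \<subseteq> topspace Y" unfolding nbP by auto
      then have "zero_nbhd S U" using S by (simp add: refinement_base_def)
      then show "zero_nbhd S N" by (rule zero_nbhd_mono [OF lS]) (use U tS in auto)
    qed
  qed
  have "finer_topology P Y"
    unfolding finer_topology_iff_zero_nbhd [OF lcP Y topP]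
  proof (intro allI impI)
    fix N assume N: "zero_nbhd Y N"
    obtain M where M: "zero_nbhd Y M" "convex M" "balanced M" "M \<subseteq> N" using zero_nbhd_convex_balanced [OF Y N] .
    then show "zero_nbhd P N"
      unfolding nbP using zero_nbhd_in_refinement_base zero_nbhd_subset [OF Y N] by auto
  qed
  moreover have "pseudosaturated P" unfolding pseudosaturated_def
  proof (intro allI impI, elim conjE)
    fix D assume D: "closedin P D" "convex D" "balanced D" "capacious P D"
    have DY: "D \<subseteq> topspace Y" using D(1) closedin_subset topP by metis
    have "zero_nbhd S D" if S: "pseudosaturated_refinement Y S" for S
    proof -
      note lS = refinementD(1) [OF S] and tS = refinementD(4) [OF S]
      have "closedin S D"
        using coarsest [OF S] D(1) by (auto simp: closedin_def finer_topology_def)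
      moreover have "capacious S D" unfolding capacious_def
      proof (intro conjI allI impI)
        fix A assume "totally_bounded_in S A"
        then have "totally_bounded_in P A" by (rule tb_finer [OF coarsest [OF S]])
        then show "\<exists>F. finite F \<and> F \<subseteq> topspace S \<and> A \<subseteq> D + F"
          using D(4) unfolding capacious_def tS topP by blast
      qed (use DY tS in simp)
      ultimately have "\<exists>U. openin S U \<and> 0 \<in> U \<and> U \<subseteq> D"
        using refinementD(2) [OF S] D(2,3) unfolding pseudosaturated_def by blast
      then show ?thesis using DY tS by (simp add: zero_nbhd_def)
    qed
    then have "D \<in> refinement_base" using DY D by (simp add: refinement_base_def)
    then have "zero_nbhd P D" unfolding nbP using DY by auto
    then show "\<exists>U. openin P U \<and> 0 \<in> U \<and> U \<subseteq> D" by (simp add: zero_nbhd_def)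
  qed
  ultimately have P: "pseudosaturated_refinement Y P"
    using lcP by (simp add: pseudosaturated_refinement_def)
  have "pseudosaturation Y = P" unfolding pseudosaturation_def
  proof (rule the_equality)
    show "pseudosaturated_refinement Y P \<and> (\<forall>S. pseudosaturated_refinement Y S \<longrightarrow> finer_topology S P)"
      using P coarsest by simp
    fix T assume T: "pseudosaturated_refinement Y T \<and> (\<forall>S. pseudosaturated_refinement Y S \<longrightarrow> finer_topology S T)"
    then have "finer_topology P T" "finer_topology T P" using P coarsest by auto
    then show "T = P" by (auto simp: topology_eq finer_topology_def)
  qed
  then show "pseudosaturated_refinement Y (pseudosaturation Y)"
    "pseudosaturated_refinement Y S \<Longrightarrow> finer_topology S (pseudosaturation Y)"
    using P coarsest by auto
qed

lemma closure_of_tb_topology_subset_pseudosaturation: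
  "tb_topology Y closure_of C \<subseteq> pseudosaturation Y closure_of C"
proof -
  have f: "finer_topology (tb_topology Y) (pseudosaturation Y)"
    by (rule pseudosaturation_properties(2) [OF refinement_tb_topology])
  show ?thesis
  proof
    fix x assume "x \<in> tb_topology Y closure_of C"
    then show "x \<in> pseudosaturation Y closure_of C"
      using f unfolding in_closure_of finer_topology_def by metis
  qed
qed

text \<open>
The set \<open>A - x\<close> is totally bounded, so on it a neighbourhood for the finer topology contains one for
\<open>Y\<close>.
\<close>

lemma tb_topology_closure_approx:
  assumes A: "totally_bounded_in Y A" and C: "C \<subseteq> topspace Y" and x: "x \<in> Y closure_of (A \<inter> C)"
  shows "x \<in> tb_topology Y closure_of C"
proof -
  have ACY: "A \<inter> C \<subseteq> topspace Y" using C by auto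
  have CS: "C \<subseteq> topspace (tb_topology Y)" using C by (simp add: topspace_tb_topology)
  have xY: "x \<in> topspace Y" using x by (simp add: in_closure_of)
  show ?thesis
    unfolding in_closure_of_iff_zero_nbhd [OF locally_convex_space_tb_topology CS] topspace_tb_topology
  proof (intro conjI xY allI impI)
    fix N assume "zero_nbhd (tb_topology Y) N"
    then obtain U where U: "U \<in> tb_base Y" "U \<subseteq> N" unfolding zero_nbhd_tb_topology by auto
    obtain M where M: "zero_nbhd Y M" "M \<inter> (\<lambda>a. a - x) ` A \<subseteq> U"
      using tb_baseD(4) [OF U(1) tb_translate [OF Y A xY]] by auto
    obtain y where y: "y \<in> A \<inter> C" "y - x \<in> M"
      using x M(1) unfolding in_closure_of_iff_zero_nbhd [OF Y ACY] by blast
    then have "y - x \<in> M \<inter> (\<lambda>a. a - x) ` A" by auto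
    then show "\<exists>y\<in>C. y - x \<in> N" using M(2) U(2) y(1) by auto
  qed
qed

end

lemma continuous_map_tb_topology:
  assumes X: "locally_convex_space X" and Y: "locally_convex_space Y"
    and T: "continuous_map X Y T" "linear_on (topspace X) T"
  shows "continuous_map (tb_topology X) (tb_topology Y) T"
proof -
  have TXY: "T \<in> topspace X \<rightarrow> topspace Y" using T(1) by (simp add: continuous_map_def)
  have TXY': "T \<in> topspace (tb_topology X) \<rightarrow> topspace (tb_topology Y)"
    using TXY by (simp add: topspace_tb_topology [OF X] topspace_tb_topology [OF Y])
  have nb: "\<forall>N. zero_nbhd Y N \<longrightarrow> (\<exists>M. zero_nbhd X M \<and> T ` M \<subseteq> N)"
    by (rule continuous_map_iff_zero_nbhd [OF X Y TXY, THEN iffD1]) (use T linear_on_add in auto)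
  have "\<exists>M. zero_nbhd (tb_topology X) M \<and> T ` M \<subseteq> N" if N: "zero_nbhd (tb_topology Y) N" for N
  proof -
    obtain U where U: "U \<in> tb_base Y" "U \<subseteq> N" using N unfolding zero_nbhd_tb_topology [OF Y] by auto
    let ?P = "{x \<in> topspace X. T x \<in> U}"
    have "?P \<in> tb_base X" unfolding tb_base_def
    proof (intro CollectI conjI allI impI)
      show "?P \<subseteq> topspace X" by auto
      show "convex ?P" unfolding convex_def scaleR_scaleC
      proof (intro ballI allI impI)
        fix x y u v assume xy: "x \<in> ?P" "y \<in> ?P" and uv: "0 \<le> u" "0 \<le> v" "u + v = (1::real)"
        let ?u = "complex_of_real u" and ?v = "complex_of_real v"
        have m: "?u *\<^sub>C x \<in> topspace X" "?v *\<^sub>C y \<in> topspace X" using xy lcs_scaleC [OF X] by auto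
        have "T (?u *\<^sub>C x + ?v *\<^sub>C y) = ?u *\<^sub>C T x + ?v *\<^sub>C T y"
          using linear_on_add [OF T(2) m] linear_on_scaleC [OF T(2)] xy by simp
        also have "\<dots> = u *\<^sub>R T x + v *\<^sub>R T y" by (simp add: scaleR_scaleC)
        also have "\<dots> \<in> U" using tb_baseD(2) [OF U(1)] xy uv by (simp add: convex_def)
        finally show "?u *\<^sub>C x + ?v *\<^sub>C y \<in> ?P" using lcs_add [OF X m] by simp
      qed
      show "balanced ?P" unfolding balanced_def
        using balanced_scaleC [OF tb_baseD(3) [OF U(1)]] lcs_scaleC [OF X] linear_on_scaleC [OF T(2)] by simp
      fix A assume A: "totally_bounded_in X A"
      obtain N where N: "zero_nbhd Y N" "N \<inter> T ` A \<subseteq> U"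
        using tb_baseD(4) [OF U(1) tb_image [OF X Y T A]] by auto
      obtain M where M: "zero_nbhd X M" "T ` M \<subseteq> N" using nb N(1) by auto
      have "M \<inter> A \<subseteq> ?P"
      proof
        fix x assume x: "x \<in> M \<inter> A"
        then have "T x \<in> N \<inter> T ` A" using M(2) by auto
        then show "x \<in> ?P" using N(2) x zero_nbhd_subset [OF X M(1)] by auto
      qed
      then show "\<exists>N. zero_nbhd X N \<and> N \<inter> A \<subseteq> ?P" using M(1) by auto
    qed
    then have "zero_nbhd (tb_topology X) ?P" unfolding zero_nbhd_tb_topology [OF X] by auto
    moreover have "T ` ?P \<subseteq> N" using U(2) by auto
    ultimately show ?thesis by auto
  qed
  then show ?thesis
    by (intro continuous_map_iff_zero_nbhd [OF locally_convex_space_tb_topology [OF X]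
        locally_convex_space_tb_topology [OF Y] TXY', THEN iffD2] allI impI)
      (use linear_on_add [OF T(2)] topspace_tb_topology [OF X] in auto)
qed

section \<open>Operators of finite rank\<close>

lemma linear_on_sum:
  assumes f: "linear_on V f" and V: "csubspace V" and B: "finite B" "\<And>b. b \<in> B \<Longrightarrow> g b \<in> V"
  shows "f (\<Sum>b\<in>B. c b *\<^sub>C g b) = (\<Sum>b\<in>B. c b *\<^sub>C f (g b))"
  using B
proof (induction B rule: finite_induct)
  case empty
  then show ?case using linear_on_zero [OF f V] by simp
next
  case (insert b B)
  have "(\<Sum>b\<in>B. c b *\<^sub>C g b) \<in> V"
    by (intro complex_vector.subspace_sum [OF V] complex_vector.subspace_scale [OF V]) (use insert in auto)
  moreover have "c b *\<^sub>C g b \<in> V" by (intro complex_vector.subspace_scale [OF V]) (use insert in auto)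
  ultimately have "f (c b *\<^sub>C g b + (\<Sum>b\<in>B. c b *\<^sub>C g b)) = c b *\<^sub>C f (g b) + f (\<Sum>b\<in>B. c b *\<^sub>C g b)"
    using linear_on_add [OF f] linear_on_scaleC [OF f] insert.prems by simp
  then show ?case using insert by simp
qed

lemma continuous_linear_maps_scaleC:
  "f \<in> continuous_linear_maps X Y \<Longrightarrow> x \<in> topspace X \<Longrightarrow> f (c *\<^sub>C x) = c *\<^sub>C f x"
  and continuous_linear_maps_add:
  "f \<in> continuous_linear_maps X Y \<Longrightarrow> x \<in> topspace X \<Longrightarrow> y \<in> topspace X \<Longrightarrow> f (x + y) = f x + f y"
  by (simp_all add: continuous_linear_maps_def)

lemma linear_on_zero_outside:
  assumes "locally_convex_space X" "f \<in> continuous_linear_maps X Y"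
  shows "f 0 = 0"
  using linear_on_zero [OF continuous_linear_mapsD(2) [OF assms(2)] lcs_subspace [OF assms(1)]] .

lemma continuous_linear_maps_comp:
  assumes X: "locally_convex_space X" and Y: "locally_convex_space Y" and Z: "locally_convex_space Z"
    and f: "f \<in> continuous_linear_maps X Y" and g: "g \<in> continuous_linear_maps Y Z"
  shows "g \<circ> f \<in> continuous_linear_maps X Z"
proof (rule continuous_linear_mapsI [OF X Z])
  note f' = continuous_linear_mapsD [OF f] and g' = continuous_linear_mapsD [OF g]
  note fY = continuous_linear_maps_in [OF Y f]
  show "g \<circ> f \<in> topspace X \<rightarrow> topspace Z" using continuous_linear_maps_in [OF Z g] by auto
  show "linear_on (topspace X) (g \<circ> f)"
    unfolding linear_on_def
    using linear_on_add [OF f'(2)] linear_on_add [OF g'(2)] linear_on_scaleC [OF f'(2)] linear_on_scaleC [OF g'(2)] fY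
    by simp
  show "(g \<circ> f) x = 0" if "x \<notin> topspace X" for x
    using f'(3) [OF that] linear_on_zero_outside [OF Y g] by simp
  fix N assume N: "zero_nbhd Z N"
  obtain M where M: "zero_nbhd Y M" "\<forall>y\<in>M. g y \<in> N" using continuous_linear_maps_nbhd [OF Y Z g N] .
  obtain L where L: "zero_nbhd X L" "\<forall>x\<in>L. f x \<in> M" using continuous_linear_maps_nbhd [OF X Y f M(1)] .
  show "\<exists>M. zero_nbhd X M \<and> (g \<circ> f) ` M \<subseteq> N" using L M by (intro exI [of _ L]) auto
qed

lemma continuous_map_from_operators:
  assumes X: "locally_convex_space X" and Y: "locally_convex_space Y" and Z: "locally_convex_space Z" and W: "locally_convex_space W"
    and T: "\<And>f. f \<in> continuous_linear_maps X Y \<Longrightarrow> T f \<in> continuous_linear_maps Z W"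
    and lin: "linear_on (continuous_linear_maps X Y) T"
    and nb: "\<And>A N. totally_bounded_in Z A \<Longrightarrow> zero_nbhd W N \<Longrightarrow> \<exists>B M. totally_bounded_in X B \<and> zero_nbhd Y M \<and>
       (\<forall>f\<in>continuous_linear_maps X Y. (\<forall>x\<in>B. f x \<in> M) \<longrightarrow> (\<forall>z\<in>A. T f z \<in> N))"
  shows "continuous_map (operator_space X Y) (operator_space Z W) T"
proof (rule continuous_map_iff_zero_nbhd [OF locally_convex_space_operator_space [OF X Y]
      locally_convex_space_operator_space [OF Z W], THEN iffD2]; (intro allI impI)?)
  show "T \<in> topspace (operator_space X Y) \<rightarrow> topspace (operator_space Z W)"
    using T by (simp add: topspace_operator_space [OF X Y] topspace_operator_space [OF Z W])
  show "T (x + y) = T x + T y" if "x \<in> topspace (operator_space X Y)" "y \<in> topspace (operator_space X Y)" for x y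
    using linear_on_add [OF lin] that by (simp add: topspace_operator_space [OF X Y])
  fix P assume "zero_nbhd (operator_space Z W) P"
  then obtain A N where AN: "totally_bounded_in Z A" "zero_nbhd W N"
    and P: "{h \<in> continuous_linear_maps Z W. \<forall>x\<in>A. h x \<in> N} \<subseteq> P"
    unfolding zero_nbhd_operator_space [OF Z W] by auto
  obtain B M where BM: "totally_bounded_in X B" "zero_nbhd Y M"
    and *: "\<forall>f\<in>continuous_linear_maps X Y. (\<forall>x\<in>B. f x \<in> M) \<longrightarrow> (\<forall>z\<in>A. T f z \<in> N)" using nb [OF AN] by auto
  let ?Q = "{f \<in> continuous_linear_maps X Y. \<forall>x\<in>B. f x \<in> M}"
  have "T ` ?Q \<subseteq> P"
  proof (rule image_subsetI)
    fix f assume "f \<in> ?Q"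
    then have "T f \<in> {h \<in> continuous_linear_maps Z W. \<forall>x\<in>A. h x \<in> N}" using * T by simp
    then show "T f \<in> P" using P by auto
  qed
  moreover have "zero_nbhd (operator_space X Y) ?Q" unfolding zero_nbhd_operator_space [OF X Y] using BM by auto
  ultimately show "\<exists>M. zero_nbhd (operator_space X Y) M \<and> T ` M \<subseteq> P" by (intro exI [of _ ?Q]) simp
qed

text \<open>
A finite set that spans the range of \<open>f\<close> in the ambient type may lie outside the space, where operators
vanish. A maximal independent subset of the range avoids this.
\<close>

lemma finite_rank_expansion:
  assumes X: "locally_convex_space X" and f: "f \<in> finite_rank_operators X"
  obtains B r where "finite B" "B \<subseteq> topspace X" "\<forall>x. f x = (\<Sum>b\<in>B. r x b *\<^sub>C b)"
proof -
  obtain C where C: "finite C" "f ` topspace X \<subseteq> cspan C" and fc: "f \<in> continuous_linear_maps X X"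
    using f unfolding finite_rank_operators_def by auto
  let ?W = "f ` topspace X"
  obtain B where B: "B \<subseteq> ?W" "\<not> complex_vector.dependent B" "?W \<subseteq> cspan B"
    using complex_vector.maximal_independent_subset [of ?W] by metis
  have fin: "finite B"
    using complex_vector.independent_span_bound [OF C(1) B(2)] B(1) C(2) by auto
  have BX: "B \<subseteq> topspace X" using B(1) continuous_linear_maps_in [OF X fc] by auto
  have "f x = (\<Sum>b\<in>B. complex_vector.representation B (f x) b *\<^sub>C b)" for x
  proof -
    have "f x \<in> cspan B"
    proof (cases "x \<in> topspace X")
      case True then show ?thesis using B(3) by auto
    next
      case False then show ?thesis using continuous_linear_mapsD(3) [OF fc] complex_vector.span_zero by simp
    qed
    then show ?thesis using complex_vector.sum_representation_eq [OF B(2) _ fin order_refl] by simp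
  qed
  then show ?thesis by (intro that [OF fin BX, of "\<lambda>x. complex_vector.representation B (f x)"] allI)
qed

lemma finite_rank_operatorsI:
  assumes f: "f \<in> continuous_linear_maps X X" and B: "finite B" and eq: "\<And>x. x \<in> topspace X \<Longrightarrow> f x = (\<Sum>b\<in>B. r x b *\<^sub>C g b)"
  shows "f \<in> finite_rank_operators X"
proof -
  have "f x \<in> cspan (g ` B)" if "x \<in> topspace X" for x
    unfolding eq [OF that]
    by (intro complex_vector.span_sum complex_vector.span_scale complex_vector.span_base) auto
  then show ?thesis using f B unfolding finite_rank_operators_def by (auto intro!: exI [of _ "g ` B"])
qed

section \<open>The approximation property in the finer topology\<close>

text \<open>
Density in the finer topology, where it can be checked on totally bounded families of operators.
\<close>

definition tb_approximation_property :: "'a::complex_vector topology \<Rightarrow> bool" where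
  "tb_approximation_property X \<longleftrightarrow>
     continuous_linear_maps X X \<subseteq> tb_topology (operator_space X X) closure_of finite_rank_operators X"

lemma stereotype_approximation_propertyI:
  assumes X: "stereotype_space X" and tb: "tb_approximation_property X"
  shows "stereotype_approximation_property X"
proof -
  have lX: "locally_convex_space X" using X by (simp add: stereotype_space_def)
  show ?thesis
    unfolding stereotype_approximation_property_def operator_algebra_def
    using X tb closure_of_tb_topology_subset_pseudosaturation [OF locally_convex_space_operator_space [OF lX lX]]
    unfolding tb_approximation_property_def by (meson order_trans)
qed

lemma finite_rank_subset: "finite_rank_operators X \<subseteq> continuous_linear_maps X X"
  by (auto simp: finite_rank_operators_def)

text \<open>
The form in which results are moved between spaces of operators: along composition with a fixed
operator, and along the adjoint.
\<close>

lemma tb_closure_image: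
  assumes X: "locally_convex_space X" and Z: "locally_convex_space Z"
    and T: "continuous_map (operator_space X X) (operator_space Z Z) T" "linear_on (continuous_linear_maps X X) T"
    and fin: "\<And>f. f \<in> finite_rank_operators X \<Longrightarrow> T f \<in> finite_rank_operators Z"
    and h: "h \<in> tb_topology (operator_space X X) closure_of finite_rank_operators X"
  shows "T h \<in> tb_topology (operator_space Z Z) closure_of finite_rank_operators Z"
proof -
  have "continuous_map (tb_topology (operator_space X X)) (tb_topology (operator_space Z Z)) T"
    by (rule continuous_map_tb_topology [OF locally_convex_space_operator_space [OF X X]
      locally_convex_space_operator_space [OF Z Z] T(1)]) (simp add: T(2) topspace_operator_space [OF X X])
  from continuous_map_image_closure_subset [OF this]
  have "T h \<in> tb_topology (operator_space Z Z) closure_of (T ` finite_rank_operators X)" using h by auto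
  moreover have "T ` finite_rank_operators X \<subseteq> finite_rank_operators Z" using fin by auto
  ultimately show ?thesis using closure_of_mono by blast
qed

lemma tb_approximation_propertyI:
  assumes X: "locally_convex_space X"
    and one: "(\<lambda>x. if x \<in> topspace X then x else 0) \<in> tb_topology (operator_space X X) closure_of finite_rank_operators X"
  shows "tb_approximation_property X"
  unfolding tb_approximation_property_def
proof
  fix p assume p: "p \<in> continuous_linear_maps X X"
  note p' = continuous_linear_mapsD [OF p]
  let ?T = "\<lambda>f. p \<circ> f"
  have lin: "linear_on (continuous_linear_maps X X) ?T"
    unfolding linear_on_def
  proof (intro conjI ballI allI ext)
    show "(p \<circ> (f + g)) x = ((p \<circ> f) + (p \<circ> g)) x"
      if "f \<in> continuous_linear_maps X X" "g \<in> continuous_linear_maps X X" for f g x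
      using linear_on_add [OF p'(2) continuous_linear_maps_in [OF X that(1)] continuous_linear_maps_in [OF X that(2)]]
      by simp
    show "(p \<circ> c *\<^sub>C f) x = (c *\<^sub>C (p \<circ> f)) x" if "f \<in> continuous_linear_maps X X" for c f x
      using linear_on_scaleC [OF p'(2) continuous_linear_maps_in [OF X that]] by (simp add: scaleC_fun_def)
  qed
  have "continuous_map (operator_space X X) (operator_space X X) ?T"
  proof (rule continuous_map_from_operators [OF X X X X _ lin])
    show "p \<circ> f \<in> continuous_linear_maps X X" if "f \<in> continuous_linear_maps X X" for f
      using continuous_linear_maps_comp [OF X X X that p] .
    fix A N assume A: "totally_bounded_in X A" and N: "zero_nbhd X N"
    obtain M where "zero_nbhd X M" "\<forall>y\<in>M. p y \<in> N" using continuous_linear_maps_nbhd [OF X X p N] .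
    then show "\<exists>B M. totally_bounded_in X B \<and> zero_nbhd X M \<and>
          (\<forall>f\<in>continuous_linear_maps X X. (\<forall>x\<in>B. f x \<in> M) \<longrightarrow> (\<forall>z\<in>A. (p \<circ> f) z \<in> N))"
      using A by (intro exI [of _ A] exI [of _ M]) auto
  qed
  moreover have "p \<circ> f \<in> finite_rank_operators X" if f: "f \<in> finite_rank_operators X" for f
  proof -
    obtain B r where B: "finite B" "B \<subseteq> topspace X" "\<forall>x. f x = (\<Sum>b\<in>B. r x b *\<^sub>C b)"
      using finite_rank_expansion [OF X f] .
    show ?thesis
    proof (rule finite_rank_operatorsI)
      show "p \<circ> f \<in> continuous_linear_maps X X"
        using continuous_linear_maps_comp [OF X X X _ p] f finite_rank_subset by blast
      show "(p \<circ> f) x = (\<Sum>b\<in>B. r x b *\<^sub>C p b)" for x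
        using linear_on_sum [OF p'(2) lcs_subspace [OF X] B(1), of "\<lambda>b. b"] B(2,3) by auto
    qed (rule B)
  qed
  ultimately have "p \<circ> (\<lambda>x. if x \<in> topspace X then x else 0) \<in> tb_topology (operator_space X X) closure_of finite_rank_operators X"
    by (rule tb_closure_image [OF X X _ lin _ one])
  moreover have "p \<circ> (\<lambda>x. if x \<in> topspace X then x else 0) = p"
    using p'(3) linear_on_zero_outside [OF X p] by (auto simp: fun_eq_iff)
  ultimately show "p \<in> tb_topology (operator_space X X) closure_of finite_rank_operators X" by simp
qed

section \<open>Duals\<close>

lemma zero_nbhd_complex: "zero_nbhd (euclidean :: complex topology) N \<longleftrightarrow> (\<exists>e>0. ball 0 e \<subseteq> N)"
proof
  assume "zero_nbhd (euclidean :: complex topology) N"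
  then obtain U where "open U" "0 \<in> U" "U \<subseteq> N" by (auto simp: zero_nbhd_def)
  then obtain e where "e > 0" "ball 0 e \<subseteq> U" by (meson openE)
  then show "\<exists>e>0. ball 0 e \<subseteq> N" using \<open>U \<subseteq> N\<close> by auto
next
  assume "\<exists>e>0. ball 0 e \<subseteq> N"
  then obtain e where "e > 0" "ball 0 e \<subseteq> N" by auto
  then show "zero_nbhd (euclidean :: complex topology) N"
    by (auto simp: zero_nbhd_def intro!: exI [of _ "ball 0 e"])
qed

lemma locally_convex_space_complex: "locally_convex_space (euclidean :: complex topology)"
  unfolding locally_convex_space_def
proof (intro conjI)
  show "csubspace (topspace (euclidean :: complex topology))" by (simp add: complex_vector.subspace_UNIV)
  show "Hausdorff_space (euclidean :: complex topology)" by simp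
  have "continuous_on UNIV (\<lambda>(x::complex, y). x + y)"
    unfolding case_prod_beta by (intro continuous_intros)
  then show "continuous_map (prod_topology euclidean euclidean) euclidean (\<lambda>(x::complex, y). x + y)"
    by (simp add: euclidean_product_topology)
  have "continuous_on UNIV (\<lambda>(c::complex, x). c * x)"
    unfolding case_prod_beta by (intro continuous_intros)
  then show "continuous_map (prod_topology euclidean euclidean) euclidean (\<lambda>(c, x::complex). c *\<^sub>C x)"
    by (simp add: euclidean_product_topology scaleC_complex_def)
  show "neighbourhood_base_at 0 convex (euclidean :: complex topology)"
    unfolding neighbourhood_base_at_def
  proof (intro allI impI)
    fix W :: "complex set" assume "openin euclidean W \<and> 0 \<in> W"
    then have "open W" "0 \<in> W" by auto
    then obtain e where "e > 0" "ball 0 e \<subseteq> W" by (meson openE)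
    then show "\<exists>U V. openin euclidean U \<and> convex V \<and> 0 \<in> U \<and> U \<subseteq> V \<and> V \<subseteq> W"
      by (intro exI [of _ "ball 0 e"]) auto
  qed
qed

lemma tb_complex:
  fixes A :: "complex set"
  assumes "\<And>a. a \<in> A \<Longrightarrow> cmod a \<le> C"
  shows "totally_bounded_in euclidean A"
  unfolding totally_bounded_iff [OF locally_convex_space_complex]
proof (intro conjI allI impI)
  fix N assume "zero_nbhd (euclidean :: complex topology) N"
  then obtain e where e: "e > 0" "ball 0 e \<subseteq> N" by (auto simp: zero_nbhd_complex)
  have "compact (cball (0::complex) C)" by simp
  then obtain k where k: "finite k" "cball (0::complex) C \<subseteq> (\<Union>x\<in>k. ball x e)"
    using compact_eq_totally_bounded e(1) by metis
  have "\<exists>f\<in>k. a - f \<in> N" if "a \<in> A" for a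
  proof -
    have "a \<in> cball 0 C" using assms [OF that] by simp
    then have "a \<in> (\<Union>x\<in>k. ball x e)" by (rule subsetD [OF k(2)])
    then obtain f where "f \<in> k" "a \<in> ball f e" by auto
    then show ?thesis using e(2) by (intro bexI [of _ f]) (auto simp: dist_norm norm_minus_commute)
  qed
  then show "\<exists>F. finite F \<and> F \<subseteq> topspace euclidean \<and> (\<forall>a\<in>A. \<exists>f\<in>F. a - f \<in> N)" using k(1) by auto
qed simp

context
  fixes X :: "'a::complex_vector topology"
  assumes X: "locally_convex_space X"
begin

abbreviation "cts_dual \<equiv> continuous_linear_maps X (euclidean :: complex topology)"

lemma locally_convex_space_dual: "locally_convex_space (stereotype_dual X)"
  unfolding stereotype_dual_def by (rule locally_convex_space_operator_space [OF X locally_convex_space_complex])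

lemma topspace_dual: "topspace (stereotype_dual X) = cts_dual"
  unfolding stereotype_dual_def by (rule topspace_operator_space [OF X locally_convex_space_complex])

lemma zero_nbhd_dual:
  "zero_nbhd (stereotype_dual X) P \<longleftrightarrow> P \<subseteq> cts_dual \<and>
     (\<exists>A e. totally_bounded_in X A \<and> e > 0 \<and> {h \<in> cts_dual. \<forall>x\<in>A. cmod (h x) < e} \<subseteq> P)"
  unfolding stereotype_dual_def zero_nbhd_operator_space [OF X locally_convex_space_complex]
proof (intro conj_cong refl iffI)
  assume "\<exists>A N. totally_bounded_in X A \<and> zero_nbhd euclidean N \<and> {h \<in> cts_dual. \<forall>x\<in>A. h x \<in> N} \<subseteq> P"
  then obtain A N where A: "totally_bounded_in X A" "zero_nbhd (euclidean::complex topology) N"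
    and P: "{h \<in> cts_dual. \<forall>x\<in>A. h x \<in> N} \<subseteq> P" by auto
  then obtain e where e: "e > 0" "ball 0 e \<subseteq> N" unfolding zero_nbhd_complex by auto
  have "{h \<in> cts_dual. \<forall>x\<in>A. cmod (h x) < e} \<subseteq> {h \<in> cts_dual. \<forall>x\<in>A. h x \<in> N}"
    using e(2) by auto
  then show "\<exists>A e. totally_bounded_in X A \<and> e > 0 \<and> {h \<in> cts_dual. \<forall>x\<in>A. cmod (h x) < e} \<subseteq> P"
    using order_trans [OF _ P] A(1) e(1) by (intro exI [of _ A] exI [of _ e] conjI) simp_all
next
  assume "\<exists>A e. totally_bounded_in X A \<and> e > 0 \<and> {h \<in> cts_dual. \<forall>x\<in>A. cmod (h x) < e} \<subseteq> P"
  then obtain A e where A: "totally_bounded_in X A" "e > 0" "{h \<in> cts_dual. \<forall>x\<in>A. cmod (h x) < e} \<subseteq> P" by auto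
  then show "\<exists>A N. totally_bounded_in X A \<and> zero_nbhd euclidean N \<and> {h \<in> cts_dual. \<forall>x\<in>A. h x \<in> N} \<subseteq> P"
    by (intro exI [of _ A] exI [of _ "ball 0 e"]) (auto simp: zero_nbhd_complex)
qed

lemma dual_nbhd:
  assumes h: "h \<in> cts_dual" and e: "e > 0"
  obtains M where "zero_nbhd X M" "\<forall>x\<in>M. cmod (h x) < e"
proof -
  have "zero_nbhd (euclidean::complex topology) (ball 0 e)" using e by (auto simp: zero_nbhd_complex)
  from continuous_linear_maps_nbhd [OF X locally_convex_space_complex h this]
  obtain M where "zero_nbhd X M" "\<forall>x\<in>M. h x \<in> ball 0 e" .
  then show ?thesis using that by auto
qed

lemma cts_dualI:
  assumes "linear_on (topspace X) h" "\<And>x. x \<notin> topspace X \<Longrightarrow> h x = 0"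
    and "\<And>e. e > 0 \<Longrightarrow> \<exists>M. zero_nbhd X M \<and> (\<forall>x\<in>M. cmod (h x) < e)"
  shows "h \<in> cts_dual"
proof (rule continuous_linear_mapsI [OF X locally_convex_space_complex _ assms(1,2)])
  fix N assume "zero_nbhd (euclidean::complex topology) N"
  then obtain e where e: "e > 0" "ball 0 e \<subseteq> N" unfolding zero_nbhd_complex by auto
  obtain M where "zero_nbhd X M" "\<forall>x\<in>M. cmod (h x) < e" using assms(3) [OF e(1)] by auto
  then show "\<exists>M. zero_nbhd X M \<and> h ` M \<subseteq> N" using e(2) by (intro exI [of _ M]) auto
qed auto

text \<open>
Equicontinuous sets of functionals are pointwise bounded, and bounded sets of scalars are totally
bounded.
\<close>

lemma tb_dual:
  assumes H: "H \<subseteq> cts_dual" and M: "zero_nbhd X M" and bd: "\<And>h x. h \<in> H \<Longrightarrow> x \<in> M \<Longrightarrow> cmod (h x) \<le> 1"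
  shows "totally_bounded_in (stereotype_dual X) H"
  unfolding stereotype_dual_def
proof (rule tb_operator_space [OF X locally_convex_space_complex H])
  fix N assume "zero_nbhd (euclidean::complex topology) N"
  then obtain e where e: "e > 0" "ball 0 e \<subseteq> N" unfolding zero_nbhd_complex by auto
  let ?c = "complex_of_real (e/2)"
  have "h x \<in> N" if h: "h \<in> H" and x: "x \<in> (*\<^sub>C) ?c ` M" for h x
  proof -
    obtain m where m: "m \<in> M" "x = ?c *\<^sub>C m" using x by (rule imageE)
    have "h \<in> cts_dual" "m \<in> topspace X" using h H m zero_nbhd_subset [OF X M] by auto
    from continuous_linear_maps_scaleC [OF this, of ?c]
    have "h x = ?c * h m" unfolding m(2) scaleC_complex_def .
    then have "cmod (h x) = cmod ?c * cmod (h m)" by (simp only: norm_mult)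
    also have "cmod ?c = e/2" using e(1) by simp
    finally have "cmod (h x) = (e/2) * cmod (h m)" .
    also have "\<dots> \<le> (e/2) * 1" using bd [OF h m(1)] e(1) by (intro mult_left_mono) auto
    finally show ?thesis using e by auto
  qed
  moreover have "zero_nbhd X ((*\<^sub>C) ?c ` M)" using e by (intro zero_nbhd_scale [OF X _ M]) auto
  ultimately show "\<exists>M. zero_nbhd X M \<and> (\<forall>h\<in>H. \<forall>x\<in>M. h x \<in> N)" by (intro exI conjI ballI) assumption+
next
  fix x assume x: "x \<in> topspace X"
  obtain r where r: "r > 0" "\<forall>c. cmod c \<le> r \<longrightarrow> c *\<^sub>C x \<in> M" using zero_nbhd_absorbing [OF X M x] .
  show "totally_bounded_in euclidean ((\<lambda>h. h x) ` H)"
  proof (rule tb_complex)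
    fix a assume "a \<in> (\<lambda>h. h x) ` H"
    then obtain h where h: "h \<in> H" "a = h x" by auto
    have "complex_of_real r *\<^sub>C x \<in> M" using r by simp
    from bd [OF h(1) this] have "cmod (complex_of_real r * h x) \<le> 1"
      using continuous_linear_maps_scaleC [OF subsetD [OF H h(1)] x] by (simp add: scaleC_complex_def)
    then show "cmod a \<le> 1 / r" using r h by (simp add: norm_mult field_simps)
  qed
qed

end

section \<open>Stereotype duality\<close>

definition evaluation :: "'a::complex_vector topology \<Rightarrow> 'a \<Rightarrow> ('a \<Rightarrow> complex) \<Rightarrow> complex" where
  "evaluation X = (\<lambda>x f. if f \<in> topspace (stereotype_dual X) then f x else 0)"

lemma stereotype_space_iff:
  "stereotype_space X \<longleftrightarrow> locally_convex_space X \<and>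
     homeomorphic_map X (stereotype_dual (stereotype_dual X)) (evaluation X)"
  by (simp add: stereotype_space_def evaluation_def)

context
  fixes X :: "'a::complex_vector topology"
  assumes X: "locally_convex_space X"
begin

lemma evaluation_apply: "f \<in> cts_dual X \<Longrightarrow> evaluation X x f = f x"
  by (simp add: evaluation_def topspace_dual [OF X])

lemma evaluation_in_bidual:
  assumes x: "x \<in> topspace X"
  shows "evaluation X x \<in> cts_dual (stereotype_dual X)"
proof (rule cts_dualI [OF locally_convex_space_dual [OF X]])
  note sub = csubspace_continuous_linear_maps [OF X locally_convex_space_complex]
  show "linear_on (topspace (stereotype_dual X)) (evaluation X x)"
    unfolding linear_on_def topspace_dual [OF X]
    using complex_vector.subspace_add [OF sub] complex_vector.subspace_scale [OF sub]
    by (simp add: evaluation_apply scaleC_fun_def)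
  show "evaluation X x f = 0" if "f \<notin> topspace (stereotype_dual X)" for f using that by (simp add: evaluation_def)
  fix e :: real assume e: "e > 0"
  have "zero_nbhd (stereotype_dual X) {h \<in> cts_dual X. \<forall>y\<in>{x}. cmod (h y) < e}"
    unfolding zero_nbhd_dual [OF X] using tb_finite [OF X, of "{x}"] x e
    by (intro conjI exI [of _ "{x}"] exI [of _ e]) auto
  then show "\<exists>M. zero_nbhd (stereotype_dual X) M \<and> (\<forall>f\<in>M. cmod (evaluation X x f) < e)"
    by (intro exI [of _ "{h \<in> cts_dual X. \<forall>y\<in>{x}. cmod (h y) < e}"] conjI) (simp_all add: evaluation_apply)
qed

lemma linear_on_evaluation: "linear_on (topspace X) (evaluation X)"
  unfolding linear_on_def
proof (intro conjI ballI allI ext)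
  fix x y f assume "x \<in> topspace X" "y \<in> topspace X"
  then show "evaluation X (x + y) f = (evaluation X x + evaluation X y) f"
    using continuous_linear_maps_add [of f X euclidean x y] by (simp add: evaluation_def topspace_dual [OF X])
next
  fix c x f assume "x \<in> topspace X"
  then show "evaluation X (c *\<^sub>C x) f = (c *\<^sub>C evaluation X x) f"
    using continuous_linear_maps_scaleC [of f X euclidean x c]
    by (simp add: evaluation_def topspace_dual [OF X] scaleC_fun_def)
qed

text \<open>
Reflexivity split into three parts: continuity of the evaluation map, openness onto its
image, and surjectivity. Injectivity follows from the second part, as the topology is Hausdorff.
\<close>

theorem stereotype_spaceI:
  assumes equi: "\<And>B e. totally_bounded_in (stereotype_dual X) B \<Longrightarrow> e > 0 \<Longrightarrow>
      \<exists>N. zero_nbhd X N \<and> (\<forall>x\<in>N. \<forall>f\<in>B. cmod (f x) < e)"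
    and polar: "\<And>N. zero_nbhd X N \<Longrightarrow> \<exists>B e. totally_bounded_in (stereotype_dual X) B \<and> e > 0 \<and>
      (\<forall>x\<in>topspace X. (\<forall>f\<in>B. cmod (f x) < e) \<longrightarrow> x \<in> N)"
    and surj: "\<And>P. P \<in> cts_dual (stereotype_dual X) \<Longrightarrow> \<exists>x\<in>topspace X. \<forall>f\<in>cts_dual X. P f = f x"
  shows "stereotype_space X"
proof -
  let ?D = "stereotype_dual X" and ?DD = "stereotype_dual (stereotype_dual X)"
  note lD = locally_convex_space_dual [OF X]
  note lDD = locally_convex_space_dual [OF lD]
  note topDD = topspace_dual [OF lD]
  let ?i = "evaluation X"
  have iDD: "?i \<in> topspace X \<rightarrow> topspace ?DD" using evaluation_in_bidual by (simp add: topDD)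
  have cont: "continuous_map X ?DD ?i"
  proof (rule continuous_map_iff_zero_nbhd [OF X lDD iDD, THEN iffD2]; (intro allI impI)?)
    show "?i (x + y) = ?i x + ?i y" if "x \<in> topspace X" "y \<in> topspace X" for x y
      using linear_on_add [OF linear_on_evaluation that] .
    fix P assume "zero_nbhd ?DD P"
    then obtain B e where B: "totally_bounded_in ?D B" "e > 0" "{h \<in> cts_dual ?D. \<forall>f\<in>B. cmod (h f) < e} \<subseteq> P"
      unfolding zero_nbhd_dual [OF lD] by auto
    obtain N where N: "zero_nbhd X N" "\<forall>x\<in>N. \<forall>f\<in>B. cmod (f x) < e" using equi [OF B(1,2)] by auto
    have "?i x \<in> P" if x: "x \<in> N" for x
    proof -
      have xX: "x \<in> topspace X" using zero_nbhd_subset [OF X N(1)] x by auto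
      have "cmod (?i x f) < e" if "f \<in> B" for f
        using N(2) x that tb_subset_topspace [OF lD B(1)] by (auto simp: evaluation_def)
      then have "?i x \<in> {h \<in> cts_dual ?D. \<forall>f\<in>B. cmod (h f) < e}" using evaluation_in_bidual [OF xX] by simp
      then show ?thesis using B(3) by (rule subsetD [rotated])
    qed
    then show "\<exists>M. zero_nbhd X M \<and> ?i ` M \<subseteq> P" using N(1) by auto
  qed
  have "inj_on ?i (topspace X)"
  proof
    fix x y assume xy: "x \<in> topspace X" "y \<in> topspace X" "?i x = ?i y"
    show "x = y"
    proof (rule ccontr)
      assume "x \<noteq> y"
      then have "x - y \<noteq> 0" by simp
      obtain N where N: "zero_nbhd X N" "x - y \<notin> N" using zero_nbhd_separating [OF X lcs_diff [OF X xy(1,2)] \<open>x - y \<noteq> 0\<close>] .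
      obtain B e where B: "totally_bounded_in ?D B" "e > 0" "\<forall>x\<in>topspace X. (\<forall>f\<in>B. cmod (f x) < e) \<longrightarrow> x \<in> N"
        using polar [OF N(1)] by auto
      have "cmod (f (x - y)) < e" if "f \<in> B" for f
      proof -
        have f: "f \<in> cts_dual X" using tb_subset_topspace [OF lD B(1)] that by (auto simp: topspace_dual [OF X])
        have "?i x f = ?i y f" by (simp add: xy(3))
        then have "f x = f y" by (simp add: evaluation_apply [OF f])
        moreover have "f (x - y) = f x - f y"
          by (rule linear_on_diff [OF continuous_linear_mapsD(2) [OF f] lcs_subspace [OF X] xy(1,2)])
        ultimately show ?thesis using B(2) by simp
      qed
      then show False using B(3) N(2) lcs_diff [OF X xy(1,2)] by auto
    qed
  qed
  moreover have im: "?i ` topspace X = topspace ?DD"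
  proof
    show "?i ` topspace X \<subseteq> topspace ?DD" using iDD by auto
    show "topspace ?DD \<subseteq> ?i ` topspace X"
    proof
      fix P assume P: "P \<in> topspace ?DD"
      then have P': "P \<in> cts_dual ?D" by (simp add: topDD)
      obtain x where x: "x \<in> topspace X" "\<forall>f\<in>cts_dual X. P f = f x" using surj [OF P'] by auto
      have "P = ?i x"
      proof
        fix f show "P f = ?i x f"
          using x(2) continuous_linear_mapsD(3) [OF P', of f] by (auto simp: evaluation_def topspace_dual [OF X])
      qed
      then show "P \<in> ?i ` topspace X" using x(1) by (rule image_eqI)
    qed
  qed
  ultimately have bij: "bij_betw ?i (topspace X) (topspace ?DD)" by (simp add: bij_betw_def)
  define k where "k = inv_into (topspace X) ?i"
  have ki: "k (?i x) = x" if "x \<in> topspace X" for x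
    unfolding k_def using bij that by (rule bij_betw_inv_into_left)
  have ik: "?i (k P) = P" if "P \<in> topspace ?DD" for P
    unfolding k_def using bij that by (rule bij_betw_inv_into_right)
  have kX: "k P \<in> topspace X" if "P \<in> topspace ?DD" for P
    unfolding k_def using that im by (metis inv_into_into)
  have "continuous_map ?DD X k"
  proof (rule continuous_map_iff_zero_nbhd [OF lDD X, THEN iffD2]; (intro allI impI)?)
    show "k \<in> topspace ?DD \<rightarrow> topspace X" using kX by auto
    fix P Q assume PQ: "P \<in> topspace ?DD" "Q \<in> topspace ?DD"
    have "?i (k P + k Q) = P + Q" using linear_on_add [OF linear_on_evaluation kX kX] PQ ik by simp
    then show "k (P + Q) = k P + k Q" using ki [OF lcs_add [OF X kX kX]] PQ by metis
  next
    fix N assume N: "zero_nbhd X N"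
    obtain B e where B: "totally_bounded_in ?D B" "e > 0" "\<forall>x\<in>topspace X. (\<forall>f\<in>B. cmod (f x) < e) \<longrightarrow> x \<in> N"
      using polar [OF N(1)] by auto
    let ?M = "{h \<in> cts_dual ?D. \<forall>f\<in>B. cmod (h f) < e}"
    have "zero_nbhd ?DD ?M" unfolding zero_nbhd_dual [OF lD] using B(1,2) by auto
    moreover have "k P \<in> N" if P: "P \<in> ?M" for P
    proof -
      have PD: "P \<in> topspace ?DD" using P by (simp add: topDD)
      have "cmod (f (k P)) < e" if f: "f \<in> B" for f
      proof -
        have "f \<in> cts_dual X" using tb_subset_topspace [OF lD B(1)] f by (auto simp: topspace_dual [OF X])
        then have "f (k P) = P f" using evaluation_apply [of f "k P"] ik [OF PD] by simp
        then show ?thesis using P f by simp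
      qed
      then show ?thesis using B(3) kX [OF PD] by auto
    qed
    ultimately show "\<exists>M. zero_nbhd ?DD M \<and> k ` M \<subseteq> N" by (intro exI [of _ ?M]) auto
  qed
  then have "homeomorphic_maps X ?DD ?i k" using cont ki ik by (simp add: homeomorphic_maps_def)
  then show ?thesis using X homeomorphic_map_maps by (auto simp: stereotype_space_iff)
qed

end

text \<open>
The inverse of the evaluation map, extended by zero so that it is again an operator in the sense of
\<open>continuous_linear_maps\<close>.
\<close>

lemma stereotype_spaceD:
  assumes S: "stereotype_space X"
  obtains k where "continuous_map X (stereotype_dual (stereotype_dual X)) (evaluation X)"
    "k \<in> continuous_linear_maps (stereotype_dual (stereotype_dual X)) X"
    "\<forall>x\<in>topspace X. k (evaluation X x) = x"
    "\<forall>P\<in>cts_dual (stereotype_dual X). evaluation X (k P) = P"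
proof -
  let ?D = "stereotype_dual X" and ?DD = "stereotype_dual (stereotype_dual X)" and ?i = "evaluation X"
  have X: "locally_convex_space X" using S by (simp add: stereotype_space_def)
  note lD = locally_convex_space_dual [OF X]
  note lDD = locally_convex_space_dual [OF lD]
  note topDD = topspace_dual [OF lD]
  obtain k0 where "homeomorphic_maps X ?DD ?i k0"
    using S unfolding stereotype_space_iff homeomorphic_map_maps by auto
  then have c: "continuous_map X ?DD ?i" "continuous_map ?DD X k0"
    and ki: "\<forall>x\<in>topspace X. k0 (?i x) = x" and ik: "\<forall>P\<in>topspace ?DD. ?i (k0 P) = P"
    unfolding homeomorphic_maps_def by auto
  have k0X: "k0 P \<in> topspace X" if "P \<in> topspace ?DD" for P using c(2) that by (auto simp: continuous_map_def)
  define k where "k P = (if P \<in> topspace ?DD then k0 P else 0)" for P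
  have addDD: "P + Q \<in> topspace ?DD" if "P \<in> topspace ?DD" "Q \<in> topspace ?DD" for P Q using lcs_add [OF lDD that] .
  have "k \<in> continuous_linear_maps ?DD X"
    unfolding continuous_linear_maps_def
  proof (intro CollectI conjI ballI allI impI)
    show "continuous_map ?DD X k" by (rule continuous_map_eq [OF c(2)]) (simp add: k_def)
    fix P Q assume PQ: "P \<in> topspace ?DD" "Q \<in> topspace ?DD"
    have "?i (k0 P + k0 Q) = P + Q" using linear_on_add [OF linear_on_evaluation [OF X] k0X k0X] PQ ik by simp
    then have "k0 (P + Q) = k0 P + k0 Q" using ki lcs_add [OF X k0X k0X] PQ by metis
    then show "k (P + Q) = k P + k Q" using PQ addDD by (simp add: k_def)
  next
    fix c P assume P: "P \<in> topspace ?DD"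
    have "?i (c *\<^sub>C k0 P) = c *\<^sub>C P" using linear_on_scaleC [OF linear_on_evaluation [OF X] k0X] P ik by simp
    then have "k0 (c *\<^sub>C P) = c *\<^sub>C k0 P" using ki lcs_scaleC [OF X k0X] P by metis
    then show "k (c *\<^sub>C P) = c *\<^sub>C k P" using P lcs_scaleC [OF lDD P] by (simp add: k_def)
  qed (simp add: k_def)
  moreover have "\<forall>x\<in>topspace X. k (?i x) = x" "\<forall>P\<in>cts_dual ?D. ?i (k P) = P"
    using ki ik evaluation_in_bidual [OF X] by (auto simp: k_def topDD)
  ultimately show ?thesis using that c(1) by blast
qed

lemma stereotype_equicontinuous:
  assumes S: "stereotype_space X" and B: "totally_bounded_in (stereotype_dual X) B" and e: "e > 0"
  shows "\<exists>N. zero_nbhd X N \<and> (\<forall>x\<in>N. \<forall>f\<in>B. cmod (f x) < e)"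
proof -
  let ?D = "stereotype_dual X" and ?DD = "stereotype_dual (stereotype_dual X)" and ?i = "evaluation X"
  have X: "locally_convex_space X" using S by (simp add: stereotype_space_def)
  note lD = locally_convex_space_dual [OF X]
  note lDD = locally_convex_space_dual [OF lD]
  have c: "continuous_map X ?DD ?i" using stereotype_spaceD [OF S] by metis
  then have iDD: "?i \<in> topspace X \<rightarrow> topspace ?DD" by (simp add: continuous_map_def)
  have nb: "\<forall>N. zero_nbhd ?DD N \<longrightarrow> (\<exists>M. zero_nbhd X M \<and> ?i ` M \<subseteq> N)"
    by (rule continuous_map_iff_zero_nbhd [OF X lDD iDD, THEN iffD1])
      (use c linear_on_add [OF linear_on_evaluation [OF X]] in auto)
  let ?M = "{h \<in> cts_dual ?D. \<forall>f\<in>B. cmod (h f) < e}"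
  have "zero_nbhd ?DD ?M" unfolding zero_nbhd_dual [OF lD] using B e by auto
  then obtain N where N: "zero_nbhd X N" "?i ` N \<subseteq> ?M" using nb by meson
  have "cmod (f x) < e" if "x \<in> N" "f \<in> B" for x f
  proof -
    have "f \<in> cts_dual X" using tb_subset_topspace [OF lD B] that by (auto simp: topspace_dual [OF X])
    moreover have "?i x \<in> ?M" using N(2) that by (meson image_subset_iff)
    ultimately show ?thesis using that(2) evaluation_apply [OF X, of f x] by auto
  qed
  then show ?thesis using N(1) by auto
qed

text \<open>
Totally bounded sets of the bidual are images of totally bounded sets of \<open>X\<close>, so the dual of the bidual
carries the topology of the dual; a functional on the bidual is evaluation at its restriction to \<open>X\<close>.
\<close>

theorem stereotype_space_dual:
  assumes S: "stereotype_space X"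
  shows "stereotype_space (stereotype_dual X)"
proof -
  let ?D = "stereotype_dual X" and ?DD = "stereotype_dual (stereotype_dual X)" and ?i = "evaluation X"
  have X: "locally_convex_space X" using S by (simp add: stereotype_space_def)
  note lD = locally_convex_space_dual [OF X]
  note lDD = locally_convex_space_dual [OF lD]
  note topD = topspace_dual [OF X]
  note topDD = topspace_dual [OF lD]
  obtain k where ci: "continuous_map X ?DD ?i" and k: "k \<in> continuous_linear_maps ?DD X"
    and ki: "\<forall>x\<in>topspace X. k (?i x) = x" and ik: "\<forall>P\<in>cts_dual ?D. ?i (k P) = P"
    using stereotype_spaceD [OF S] .
  have app: "P f = f (k P)" if "P \<in> cts_dual ?D" "f \<in> cts_dual X" for P f
    using ik that evaluation_apply [OF X that(2), of "k P"] by simp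
  show ?thesis
  proof (rule stereotype_spaceI [OF lD])
    fix B and e :: real assume B: "totally_bounded_in ?DD B" and e: "e > 0"
    have A: "totally_bounded_in X (k ` B)" by (rule tb_image [OF lDD X continuous_linear_mapsD(1,2) [OF k] B])
    let ?N = "{h \<in> cts_dual X. \<forall>x\<in>k ` B. cmod (h x) < e}"
    have "zero_nbhd ?D ?N" unfolding zero_nbhd_dual [OF X] using A e by (intro conjI exI [of _ "k ` B"] exI [of _ e]) auto
    moreover have "cmod (P f) < e" if "f \<in> ?N" "P \<in> B" for f P
      using that app [of P f] tb_subset_topspace [OF lDD B] by (auto simp: topDD)
    ultimately show "\<exists>N. zero_nbhd ?D N \<and> (\<forall>x\<in>N. \<forall>f\<in>B. cmod (f x) < e)" by (intro exI [of _ ?N]) auto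
  next
    fix N assume "zero_nbhd ?D N"
    then obtain A e where A: "totally_bounded_in X A" "e > 0" "{h \<in> cts_dual X. \<forall>x\<in>A. cmod (h x) < e} \<subseteq> N"
      unfolding zero_nbhd_dual [OF X] by auto
    have "totally_bounded_in ?DD (?i ` A)" by (rule tb_image [OF X lDD ci linear_on_evaluation [OF X] A(1)])
    moreover have "f \<in> N" if f: "f \<in> topspace ?D" "\<forall>P\<in>?i ` A. cmod (P f) < e" for f
    proof -
      have "f \<in> cts_dual X" using f(1) by (simp add: topD)
      then have "f \<in> {h \<in> cts_dual X. \<forall>x\<in>A. cmod (h x) < e}" using f(2) by (simp add: evaluation_apply [OF X])
      then show ?thesis using A(3) by (rule subsetD [rotated])
    qed
    ultimately show "\<exists>B e. totally_bounded_in ?DD B \<and> e > 0 \<and> (\<forall>x\<in>topspace ?D. (\<forall>f\<in>B. cmod (f x) < e) \<longrightarrow> x \<in> N)"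
      using A(2) by (intro exI [of _ "?i ` A"] exI [of _ e] conjI ballI impI) simp_all
  next
    fix Q assume Q: "Q \<in> cts_dual ?DD"
    define f where "f x = (if x \<in> topspace X then Q (?i x) else 0)" for x
    have iDD: "?i x \<in> topspace ?DD" if "x \<in> topspace X" for x using evaluation_in_bidual [OF X that] by (simp add: topDD)
    have "f \<in> cts_dual X" unfolding continuous_linear_maps_def
    proof (intro CollectI conjI ballI allI impI)
      have "continuous_map X euclidean (Q \<circ> ?i)" using continuous_map_compose [OF ci continuous_linear_mapsD(1) [OF Q]] .
      then show "continuous_map X euclidean f" by (rule continuous_map_eq) (simp add: f_def)
      show "f (x + y) = f x + f y" if "x \<in> topspace X" "y \<in> topspace X" for x y
        using that lcs_add [OF X that] linear_on_add [OF linear_on_evaluation [OF X] that]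
          continuous_linear_maps_add [OF Q iDD iDD] by (simp add: f_def)
      show "f (c *\<^sub>C x) = c *\<^sub>C f x" if "x \<in> topspace X" for c x
        using that lcs_scaleC [OF X that] linear_on_scaleC [OF linear_on_evaluation [OF X] that]
          continuous_linear_maps_scaleC [OF Q iDD] by (simp add: f_def)
    qed (simp add: f_def)
    moreover have "Q P = P f" if P: "P \<in> cts_dual ?D" for P
    proof -
      have "k P \<in> topspace X" using continuous_linear_maps_in [OF X k] .
      then have "f (k P) = Q P" using ik P by (simp add: f_def)
      then show ?thesis using app [OF P] \<open>f \<in> cts_dual X\<close> by simp
    qed
    ultimately show "\<exists>x\<in>topspace ?D. \<forall>f\<in>cts_dual ?D. Q f = f x" by (intro bexI [of _ f]) (auto simp: topD)
  qed
qed

text \<open>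
The value \<open>0\<close> off the dual makes the adjoint an operator in the sense of \<open>continuous_linear_maps\<close>.
\<close>

definition adjoint_map :: "'a::complex_vector topology \<Rightarrow> ('a \<Rightarrow> 'a) \<Rightarrow> ('a \<Rightarrow> complex) \<Rightarrow> 'a \<Rightarrow> complex" where
  "adjoint_map X T = (\<lambda>f. if f \<in> cts_dual X then f \<circ> T else 0)"

lemma adjoint_map_in:
  assumes X: "locally_convex_space X" and T: "T \<in> continuous_linear_maps X X"
  shows "adjoint_map X T \<in> continuous_linear_maps (stereotype_dual X) (stereotype_dual X)"
proof (rule continuous_linear_mapsI [OF locally_convex_space_dual [OF X] locally_convex_space_dual [OF X]])
  note sub = csubspace_continuous_linear_maps [OF X locally_convex_space_complex]
  have comp: "f \<circ> T \<in> cts_dual X" if "f \<in> cts_dual X" for f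
    using continuous_linear_maps_comp [OF X X locally_convex_space_complex T that] .
  then show "adjoint_map X T \<in> topspace (stereotype_dual X) \<rightarrow> topspace (stereotype_dual X)"
    by (simp add: adjoint_map_def topspace_dual [OF X])
  show "linear_on (topspace (stereotype_dual X)) (adjoint_map X T)"
    unfolding linear_on_def topspace_dual [OF X]
    using complex_vector.subspace_add [OF sub] complex_vector.subspace_scale [OF sub]
    by (simp add: adjoint_map_def fun_eq_iff scaleC_fun_def)
  show "adjoint_map X T f = 0" if "f \<notin> topspace (stereotype_dual X)" for f
    using that by (simp add: adjoint_map_def topspace_dual [OF X])
  fix N assume "zero_nbhd (stereotype_dual X) N"
  then obtain A e where A: "totally_bounded_in X A" "e > 0" "{h \<in> cts_dual X. \<forall>x\<in>A. cmod (h x) < e} \<subseteq> N"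
    unfolding zero_nbhd_dual [OF X] by auto
  have TA: "totally_bounded_in X (T ` A)" by (rule tb_image [OF X X continuous_linear_mapsD(1,2) [OF T] A(1)])
  let ?M = "{h \<in> cts_dual X. \<forall>x\<in>T ` A. cmod (h x) < e}"
  have "zero_nbhd (stereotype_dual X) ?M"
    unfolding zero_nbhd_dual [OF X] using TA A(2) by (intro conjI exI [of _ "T ` A"] exI [of _ e]) auto
  moreover have "adjoint_map X T f \<in> N" if "f \<in> ?M" for f
    using that comp [of f] by (intro subsetD [OF A(3)]) (simp add: adjoint_map_def)
  ultimately show "\<exists>M. zero_nbhd (stereotype_dual X) M \<and> adjoint_map X T ` M \<subseteq> N" by (intro exI [of _ ?M]) auto
qed

lemma fun_sum_apply: "(\<Sum>b\<in>B. g b) x = (\<Sum>b\<in>B. g b (x::'a) :: 'b::comm_monoid_add)"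
  by (induction B rule: infinite_finite_induct) auto

text \<open>
The adjoint is continuous because totally bounded sets of functionals are equicontinuous. It is onto by
reflexivity: an operator on the dual has an adjoint on the bidual, which is an operator on \<open>X\<close>.
It preserves finite rank since a functional only enters through its values on a basis of the range.
\<close>

theorem tb_approximation_property_dual:
  assumes S: "stereotype_space X" and tb: "tb_approximation_property X"
  shows "tb_approximation_property (stereotype_dual X)"
  unfolding tb_approximation_property_def
proof
  let ?D = "stereotype_dual X" and ?DD = "stereotype_dual (stereotype_dual X)" and ?i = "evaluation X"
  have X: "locally_convex_space X" using S by (simp add: stereotype_space_def)
  note lD = locally_convex_space_dual [OF X]
  note lDD = locally_convex_space_dual [OF lD]
  note topD = topspace_dual [OF X]
  note topDD = topspace_dual [OF lD]
  obtain k where ci: "continuous_map X ?DD ?i" and k: "k \<in> continuous_linear_maps ?DD X"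
    and ki: "\<forall>x\<in>topspace X. k (?i x) = x" and ik: "\<forall>P\<in>cts_dual ?D. ?i (k P) = P"
    using stereotype_spaceD [OF S] .
  have app: "P f = f (k P)" if "P \<in> cts_dual ?D" "f \<in> cts_dual X" for P f
    using ik that evaluation_apply [OF X that(2), of "k P"] by simp
  have lin: "linear_on (continuous_linear_maps X X) (adjoint_map X)"
    unfolding linear_on_def
  proof (intro conjI ballI allI ext)
    fix S T :: "'a \<Rightarrow> 'a" and f x assume ST: "S \<in> continuous_linear_maps X X" "T \<in> continuous_linear_maps X X"
    show "adjoint_map X (S + T) f x = (adjoint_map X S + adjoint_map X T) f x"
      using continuous_linear_maps_add [OF _ continuous_linear_maps_in [OF X ST(1)] continuous_linear_maps_in [OF X ST(2)], of f euclidean]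
      by (simp add: adjoint_map_def)
  next
    fix c and T :: "'a \<Rightarrow> 'a" and f x assume T: "T \<in> continuous_linear_maps X X"
    show "adjoint_map X (c *\<^sub>C T) f x = (c *\<^sub>C adjoint_map X T) f x"
      using continuous_linear_maps_scaleC [OF _ continuous_linear_maps_in [OF X T], of f euclidean c]
      by (simp add: adjoint_map_def scaleC_fun_def scaleC_complex_def)
  qed
  have cont: "continuous_map (operator_space X X) (operator_space ?D ?D) (adjoint_map X)"
  proof (rule continuous_map_from_operators [OF X X lD lD adjoint_map_in [OF X] lin])
    fix B N assume B: "totally_bounded_in ?D B" and "zero_nbhd ?D N"
    then obtain A e where A: "totally_bounded_in X A" "e > 0" "{h \<in> cts_dual X. \<forall>x\<in>A. cmod (h x) < e} \<subseteq> N"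
      unfolding zero_nbhd_dual [OF X] by auto
    obtain M where M: "zero_nbhd X M" "\<forall>x\<in>M. \<forall>f\<in>B. cmod (f x) < e" using stereotype_equicontinuous [OF S B A(2)] by auto
    have "adjoint_map X T f \<in> N" if T: "T \<in> continuous_linear_maps X X" "\<forall>x\<in>A. T x \<in> M" and f: "f \<in> B" for T f
    proof -
      have "f \<in> cts_dual X" using tb_subset_topspace [OF lD B] f by (auto simp: topD)
      then have "adjoint_map X T f \<in> {h \<in> cts_dual X. \<forall>x\<in>A. cmod (h x) < e}"
        using continuous_linear_maps_comp [OF X X locally_convex_space_complex T(1)] T(2) M(2) f
        by (simp add: adjoint_map_def)
      then show ?thesis using A(3) by (rule subsetD [rotated])
    qed
    then show "\<exists>A M. totally_bounded_in X A \<and> zero_nbhd X M \<and>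
       (\<forall>T\<in>continuous_linear_maps X X. (\<forall>x\<in>A. T x \<in> M) \<longrightarrow> (\<forall>f\<in>B. adjoint_map X T f \<in> N))"
      using A(1) M(1) by (intro exI [of _ A] exI [of _ M] conjI ballI impI) simp_all
  qed
  have fin: "adjoint_map X T \<in> finite_rank_operators ?D" if T: "T \<in> finite_rank_operators X" for T
  proof -
    obtain B r where B: "finite B" "B \<subseteq> topspace X" "\<forall>x. T x = (\<Sum>b\<in>B. r x b *\<^sub>C b)"
      using finite_rank_expansion [OF X T] .
    show ?thesis
    proof (rule finite_rank_operatorsI [OF adjoint_map_in [OF X] B(1)])
      show "T \<in> continuous_linear_maps X X" using T finite_rank_subset by blast
      fix f assume "f \<in> topspace ?D"
      then have f: "f \<in> cts_dual X" by (simp add: topD)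
      show "adjoint_map X T f = (\<Sum>b\<in>B. f b *\<^sub>C (\<lambda>x. r x b))"
      proof
        fix x
        have "f (\<Sum>b\<in>B. r x b *\<^sub>C b) = (\<Sum>b\<in>B. r x b *\<^sub>C f b)"
          by (rule linear_on_sum [OF continuous_linear_mapsD(2) [OF f] lcs_subspace [OF X] B(1), of "\<lambda>b. b"]) (use B(2) in auto)
        then show "adjoint_map X T f x = (\<Sum>b\<in>B. f b *\<^sub>C (\<lambda>x. r x b)) x"
          using f B(3) by (simp add: adjoint_map_def fun_sum_apply scaleC_fun_def scaleC_complex_def mult.commute)
      qed
    qed
  qed
  fix U assume U: "U \<in> continuous_linear_maps ?D ?D"
  define T where "T x = (if x \<in> topspace X then k (adjoint_map ?D U (?i x)) else 0)" for x
  note aU = adjoint_map_in [OF lD U]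
  have iDD: "?i x \<in> topspace ?DD" if "x \<in> topspace X" for x using evaluation_in_bidual [OF X that] by (simp add: topDD)
  have kaU: "k \<circ> adjoint_map ?D U \<in> continuous_linear_maps ?DD X"
    by (rule continuous_linear_maps_comp [OF lDD lDD X aU k])
  have Tc: "T \<in> continuous_linear_maps X X" unfolding continuous_linear_maps_def
  proof (intro CollectI conjI ballI allI impI)
    have "continuous_map X X ((k \<circ> adjoint_map ?D U) \<circ> ?i)"
      by (rule continuous_map_compose [OF ci continuous_linear_mapsD(1) [OF kaU]])
    then show "continuous_map X X T" by (rule continuous_map_eq) (simp add: T_def)
    show "T (x + y) = T x + T y" if "x \<in> topspace X" "y \<in> topspace X" for x y
      using that lcs_add [OF X that] linear_on_add [OF linear_on_evaluation [OF X] that]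
        continuous_linear_maps_add [OF kaU iDD iDD] by (simp add: T_def)
    show "T (c *\<^sub>C x) = c *\<^sub>C T x" if "x \<in> topspace X" for c x
      using that lcs_scaleC [OF X that] linear_on_scaleC [OF linear_on_evaluation [OF X] that]
        continuous_linear_maps_scaleC [OF kaU iDD] by (simp add: T_def)
  qed (simp add: T_def)
  have "adjoint_map X T = U"
  proof (intro ext)
    fix f x
    show "adjoint_map X T f x = U f x"
    proof (cases "f \<in> cts_dual X")
      case False
      then show ?thesis using continuous_linear_mapsD(3) [OF U] by (simp add: adjoint_map_def topD)
    next
      case f: True
      have Uf: "U f \<in> cts_dual X" using continuous_linear_maps_in [OF lD U] by (simp add: topD)
      show ?thesis
      proof (cases "x \<in> topspace X")
        case False
        then show ?thesis using f linear_on_zero_outside [OF X f] continuous_linear_mapsD(3) [OF Uf]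
          by (simp add: adjoint_map_def T_def)
      next
        case x: True
        have ix: "?i x \<in> cts_dual ?D" using evaluation_in_bidual [OF X x] .
        have "adjoint_map ?D U (?i x) \<in> cts_dual ?D" using continuous_linear_maps_in [OF lDD aU] by (simp add: topDD)
        from app [OF this f] have "f (T x) = adjoint_map ?D U (?i x) f" using x by (simp add: T_def)
        also have "\<dots> = U f x" using ix evaluation_apply [OF X Uf] by (simp add: adjoint_map_def)
        finally show ?thesis using f by (simp add: adjoint_map_def)
      qed
    qed
  qed
  moreover have "adjoint_map X T \<in> tb_topology (operator_space ?D ?D) closure_of finite_rank_operators ?D"
    by (rule tb_closure_image [OF X lD cont lin fin]) (use tb Tc in \<open>auto simp: tb_approximation_property_def\<close>)
  ultimately show "U \<in> tb_topology (operator_space ?D ?D) closure_of finite_rank_operators ?D" by simp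
qed

section \<open>The space of continuous functions\<close>

abbreviation cfun :: "('g::topological_space \<Rightarrow> complex) set" where
  "cfun \<equiv> {f. continuous_on UNIV f}"

lemma csubspace_cfun: "csubspace (cfun :: ('g::topological_space \<Rightarrow> complex) set)"
  unfolding complex_vector.subspace_def
  by (auto simp: scaleC_fun_def scaleC_complex_def plus_fun_def zero_fun_def intro!: continuous_intros)

lemma cfun_bounded_on_compact:
  assumes "continuous_on UNIV (f :: 'g::topological_space \<Rightarrow> complex)" "compact K"
  obtains C where "C > 0" "\<forall>x\<in>K. cmod (f x) \<le> C"
proof -
  have "compact (f ` K)" using assms by (intro compact_continuous_image continuous_on_subset [OF assms(1)]) auto
  then have "bounded (f ` K)" by (rule compact_imp_bounded)
  then show ?thesis using that unfolding bounded_pos by auto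
qed

lemma cfun_admissible:
  "unif_conv_admissible (cfun :: ('g::topological_space \<Rightarrow> complex) set) {K. compact K} euclidean"
  unfolding unif_conv_admissible_def
proof (intro conjI ballI allI impI locally_convex_space_complex csubspace_cfun)
  show "{K. compact K} \<noteq> ({} :: 'g set set)" using compact_empty by auto
  show "A \<union> B \<in> {K. compact K}" if "A \<in> {K. compact K}" "B \<in> {K. compact K}" for A B :: "'g set"
    using that by auto
next
  fix h :: "'g \<Rightarrow> complex" and K :: "'g set" and N :: "complex set"
  assume h: "h \<in> cfun" and K: "K \<in> {K. compact K}" and "zero_nbhd euclidean N"
  then obtain e where e: "e > 0" "ball 0 e \<subseteq> N" by (auto simp: zero_nbhd_complex)
  obtain C where C: "C > 0" "\<forall>x\<in>K. cmod (h x) \<le> C" using cfun_bounded_on_compact [of h K] h K by auto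
  have "(e / (2 * C)) *\<^sub>R h x \<in> N" if "x \<in> K" for x
  proof -
    have "cmod (h x) \<le> C" using C that by auto
    then have "cmod ((e / (2 * C)) *\<^sub>R h x) \<le> (e / (2 * C)) * C"
      using e C by (simp add: pos_divide_le_eq)
    also have "\<dots> < e" using e C by simp
    finally show ?thesis using e(2) by (auto simp: subset_iff)
  qed
  then show "\<exists>r>0. \<forall>x\<in>K. r *\<^sub>R h x \<in> N" using e C by (intro exI [of _ "e / (2 * C)"]) auto
next
  fix h :: "'g \<Rightarrow> complex" assume "h \<noteq> 0"
  then obtain x where "h x \<noteq> 0" by (auto simp: fun_eq_iff)
  then show "\<exists>A\<in>{K. compact K}. \<exists>x\<in>A. h x \<noteq> 0" by (intro bexI [of _ "{x}"]) auto
qed auto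

lemma locally_convex_space_cfun: "locally_convex_space (continuous_functions :: ('g::topological_space \<Rightarrow> complex) topology)"
  unfolding continuous_functions_def by (rule locally_convex_space_unif_conv [OF cfun_admissible])

lemma topspace_cfun: "topspace (continuous_functions :: ('g::topological_space \<Rightarrow> complex) topology) = cfun"
  unfolding continuous_functions_def by (rule topspace_unif_conv [OF cfun_admissible])

lemma zero_nbhd_cfun:
  "zero_nbhd (continuous_functions :: ('g::topological_space \<Rightarrow> complex) topology) P \<longleftrightarrow> P \<subseteq> cfun \<and>
     (\<exists>K e. compact K \<and> e > 0 \<and> {h \<in> cfun. \<forall>x\<in>K. cmod (h x) < e} \<subseteq> P)"
  unfolding continuous_functions_def zero_nbhd_unif_conv [OF cfun_admissible]
proof (intro conj_cong refl iffI)
  assume "\<exists>A\<in>{K. compact K}. \<exists>N. zero_nbhd euclidean N \<and> {h \<in> cfun. \<forall>x\<in>A. h x \<in> N} \<subseteq> P"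
  then obtain A N where A: "compact A" "zero_nbhd (euclidean::complex topology) N"
    and P: "{h \<in> cfun. \<forall>x\<in>A. h x \<in> N} \<subseteq> P" by auto
  then obtain e where e: "e > 0" "ball 0 e \<subseteq> N" unfolding zero_nbhd_complex by auto
  have "{h \<in> cfun. \<forall>x\<in>A. cmod (h x) < e} \<subseteq> {h \<in> cfun. \<forall>x\<in>A. h x \<in> N}"
    using e(2) by auto
  then show "\<exists>A e. compact A \<and> e > 0 \<and> {h \<in> cfun. \<forall>x\<in>A. cmod (h x) < e} \<subseteq> P"
    using order_trans [OF _ P] A(1) e(1) by (intro exI [of _ A] exI [of _ e] conjI) simp_all
next
  assume "\<exists>A e. compact A \<and> e > 0 \<and> {h \<in> cfun. \<forall>x\<in>A. cmod (h x) < e} \<subseteq> P"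
  then obtain A e where A: "compact A" "e > 0" "{h \<in> cfun. \<forall>x\<in>A. cmod (h x) < e} \<subseteq> P" by auto
  then show "\<exists>A\<in>{K. compact K}. \<exists>N. zero_nbhd euclidean N \<and> {h \<in> cfun. \<forall>x\<in>A. h x \<in> N} \<subseteq> P"
    by (intro bexI [of _ A] exI [of _ "ball 0 e"]) (auto simp: zero_nbhd_complex)
qed

lemma zero_nbhd_cfunI:
  "compact K \<Longrightarrow> e > 0 \<Longrightarrow> zero_nbhd continuous_functions {h \<in> cfun. \<forall>x\<in>K. cmod (h x) < e}"
  unfolding zero_nbhd_cfun by auto

lemma tb_cfun_subset: "totally_bounded_in continuous_functions H \<Longrightarrow> h \<in> H \<Longrightarrow> continuous_on UNIV h"
  using tb_subset_topspace [OF locally_convex_space_cfun] by (auto simp: topspace_cfun)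

lemma tb_cfun_net:
  assumes H: "totally_bounded_in continuous_functions H" and K: "compact K" and e: "e > 0"
  obtains F where "finite F" "F \<subseteq> H" "\<forall>h\<in>H. \<exists>f\<in>F. \<forall>x\<in>K. cmod (h x - f x) < e"
proof -
  obtain F where F: "finite F" "F \<subseteq> H" "\<forall>h\<in>H. \<exists>f\<in>F. h - f \<in> {h \<in> cfun. \<forall>x\<in>K. cmod (h x) < e}"
    using tb_net_inside [OF locally_convex_space_cfun H zero_nbhd_cfunI [OF K e]] .
  show ?thesis
  proof (rule that [OF F(1,2)], intro ballI)
    fix h assume "h \<in> H"
    then obtain f where "f \<in> F" "h - f \<in> {h \<in> cfun. \<forall>x\<in>K. cmod (h x) < e}" using F(3) by auto
    then show "\<exists>f\<in>F. \<forall>x\<in>K. cmod (h x - f x) < e" by (intro bexI [of _ f]) auto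
  qed
qed

lemma tb_cfun_bounded:
  assumes H: "totally_bounded_in continuous_functions H" and K: "compact K"
  obtains C where "C > 0" "\<forall>h\<in>H. \<forall>x\<in>K. cmod (h x) \<le> C"
proof -
  obtain r where r: "r > 0" "\<forall>c. \<forall>h\<in>H. cmod c \<le> r \<longrightarrow> c *\<^sub>C h \<in> {h \<in> cfun. \<forall>x\<in>K. cmod (h x) < 1}"
    using tb_absorbed [OF locally_convex_space_cfun H zero_nbhd_cfunI [OF K zero_less_one]] .
  have "cmod (h x) \<le> 1 / r" if "h \<in> H" "x \<in> K" for h x
  proof -
    have "complex_of_real r *\<^sub>C h \<in> {h \<in> cfun. \<forall>x\<in>K. cmod (h x) < 1}" using r that by simp
    then have "cmod (complex_of_real r * h x) < 1" using that by (simp add: scaleC_fun_def scaleC_complex_def)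
    then show ?thesis using r(1) by (simp add: norm_mult field_simps)
  qed
  then show ?thesis using r(1) by (intro that [of "1 / r"]) auto
qed

text \<open>
Ascoli's theorem.
\<close>

lemma tb_cfunI:
  fixes H :: "('g::topological_space \<Rightarrow> complex) set"
  assumes H: "H \<subseteq> cfun"
    and equi: "\<And>x e. e > 0 \<Longrightarrow> \<exists>U. open U \<and> x \<in> U \<and> (\<forall>h\<in>H. \<forall>y\<in>U. cmod (h y - h x) < e)"
    and bd: "\<And>x. \<exists>C. \<forall>h\<in>H. cmod (h x) \<le> C"
  shows "totally_bounded_in continuous_functions H"
  unfolding totally_bounded_iff [OF locally_convex_space_cfun] topspace_cfun
proof (intro conjI H allI impI)
  fix P assume "zero_nbhd (continuous_functions :: ('g \<Rightarrow> complex) topology) P"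
  then obtain K e where K: "compact K" and e: "e > 0" and P: "{h \<in> cfun. \<forall>x\<in>K. cmod (h x) < e} \<subseteq> P"
    unfolding zero_nbhd_cfun by auto
  have e4: "e / 4 > 0" using e by simp
  have "\<forall>x. \<exists>U. open U \<and> x \<in> U \<and> (\<forall>h\<in>H. \<forall>y\<in>U. cmod (h y - h x) < e/4)" using equi [OF e4] by simp
  from choice [OF this] obtain U where U: "\<forall>x. open (U x) \<and> x \<in> U x \<and> (\<forall>h\<in>H. \<forall>y\<in>U x. cmod (h y - h x) < e/4)" by auto
  have KU: "K \<subseteq> (\<Union>x\<in>K. U x)" using U by auto
  obtain F where F: "F \<subseteq> K" "finite F" "K \<subseteq> (\<Union>x\<in>F. U x)"
    by (rule compactE_image [OF K _ KU]) (use U in auto)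
  have "\<exists>G. finite G \<and> (\<forall>h\<in>H. \<exists>g\<in>G. cmod (h x - g) < e/4)" for x
  proof -
    obtain C where "\<forall>h\<in>H. cmod (h x) \<le> C" using bd by auto
    then have "totally_bounded_in euclidean ((\<lambda>h. h x) ` H)" by (intro tb_complex [of _ C]) auto
    moreover have "zero_nbhd euclidean (ball (0::complex) (e/4))" using e4 unfolding zero_nbhd_complex by (intro exI [of _ "e/4"]) auto
    ultimately obtain G where "finite G" "\<forall>a\<in>(\<lambda>h. h x) ` H. \<exists>g\<in>G. a - g \<in> ball 0 (e/4)"
      using tb_net_inside [OF locally_convex_space_complex] by metis
    then show ?thesis by (intro exI [of _ G]) auto
  qed
  then obtain Z where Z: "finite Z" "Z \<subseteq> H" "\<forall>h\<in>H. \<exists>k\<in>Z. \<forall>x\<in>F. \<exists>g. cmod (h x - g) < e/4 \<and> cmod (k x - g) < e/4"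
    using finite_simultaneous_net [of F H "\<lambda>x h g. cmod (h x - g) < e/4"] F(2) by metis
  have "\<exists>k\<in>Z. h - k \<in> P" if h: "h \<in> H" for h
  proof -
    obtain k where k: "k \<in> Z" "\<forall>x\<in>F. \<exists>g. cmod (h x - g) < e/4 \<and> cmod (k x - g) < e/4" using Z(3) h by auto
    have kH: "k \<in> H" using k Z by auto
    have "cmod (h y - k y) < e" if y: "y \<in> K" for y
    proof -
      obtain x where x: "x \<in> F" "y \<in> U x" using F(3) y by auto
      obtain g where g: "cmod (h x - g) < e/4" "cmod (k x - g) < e/4" using k x by auto
      have "cmod (h y - h x) < e/4" "cmod (k y - k x) < e/4" using U x h kH by auto
      then have "cmod ((h y - h x) + (h x - g) - ((k y - k x) + (k x - g))) < e"
        using g norm_triangle_ineq4 [of "(h y - h x) + (h x - g)" "(k y - k x) + (k x - g)"]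
          norm_triangle_ineq [of "h y - h x" "h x - g"] norm_triangle_ineq [of "k y - k x" "k x - g"] by linarith
      then show ?thesis by simp
    qed
    moreover have "h - k \<in> cfun" using H h kH complex_vector.subspace_diff [OF csubspace_cfun] by blast
    ultimately show ?thesis using k(1) by (intro bexI [of _ k] subsetD [OF P]) simp_all
  qed
  then show "\<exists>F. finite F \<and> F \<subseteq> cfun \<and> (\<forall>a\<in>H. \<exists>f\<in>F. a - f \<in> P)"
    using Z(1,2) H by (intro exI [of _ Z]) auto
qed

section \<open>Uniformity in compact parameters\<close>

lemma continuous_on_left_translate:
  fixes p :: "'g::topological_group_add \<Rightarrow> 'b::topological_space"
  assumes "continuous_on UNIV p" shows "continuous_on UNIV (\<lambda>t. p (a + t))"
  by (rule continuous_on_compose2 [OF assms]) (auto intro!: continuous_intros)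

lemma compact_uniform:
  fixes g :: "'a::topological_space \<times> 'b::topological_space \<Rightarrow> complex"
  assumes K: "compact K" and g: "continuous_on UNIV g" and e: "e > 0"
  obtains U where "open U" "y0 \<in> U" "\<forall>x\<in>K. \<forall>y\<in>U. cmod (g (x, y) - g (x, y0)) < e"
proof -
  have "\<exists>A B. open A \<and> open B \<and> x \<in> A \<and> y0 \<in> B \<and> (\<forall>a\<in>A. \<forall>b\<in>B. cmod (g (a, b) - g (x, y0)) < e/2)" for x
  proof -
    let ?S = "g -` ball (g (x, y0)) (e/2)"
    have "open ?S" using g by (intro open_vimage) auto
    moreover have "(x, y0) \<in> ?S" using e by simp
    ultimately obtain A B where "open A" "open B" "(x, y0) \<in> A \<times> B" "A \<times> B \<subseteq> ?S"
      by (rule open_prod_elim)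
    then show ?thesis by (intro exI [of _ A] exI [of _ B]) (auto simp: dist_norm norm_minus_commute)
  qed
  then obtain A B where AB: "\<And>x. open (A x) \<and> open (B x) \<and> x \<in> A x \<and> y0 \<in> B x \<and>
      (\<forall>a\<in>A x. \<forall>b\<in>B x. cmod (g (a, b) - g (x, y0)) < e/2)" by metis
  have KA: "K \<subseteq> (\<Union>x\<in>K. A x)" using AB by auto
  obtain F where F: "F \<subseteq> K" "finite F" "K \<subseteq> (\<Union>x\<in>F. A x)"
    by (rule compactE_image [OF K _ KA]) (use AB in auto)
  show ?thesis
  proof (rule that [of "\<Inter>x\<in>F. B x"])
    show "open (\<Inter>x\<in>F. B x)" using F(2) AB by auto
    show "y0 \<in> (\<Inter>x\<in>F. B x)" using AB by auto
    show "\<forall>x\<in>K. \<forall>y\<in>\<Inter>x\<in>F. B x. cmod (g (x, y) - g (x, y0)) < e"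
    proof (intro ballI)
      fix a b assume a: "a \<in> K" and b: "b \<in> (\<Inter>x\<in>F. B x)"
      obtain x where x: "x \<in> F" "a \<in> A x" using F(3) a by auto
      have "cmod (g (a, b) - g (x, y0)) < e/2" "cmod (g (a, y0) - g (x, y0)) < e/2"
        using AB [of x] x b by auto
      then have "cmod ((g (a, b) - g (x, y0)) - (g (a, y0) - g (x, y0))) < e"
        using norm_triangle_ineq4 [of "g (a, b) - g (x, y0)" "g (a, y0) - g (x, y0)"] by linarith
      then show "cmod (g (a, b) - g (a, y0)) < e" by simp
    qed
  qed
qed

context
  assumes lc: "locally_compact_space (euclidean :: 'g::{topological_group_add, t2_space} topology)"
begin

lemma compact_neighbourhood:
  fixes x :: 'g obtains U W where "open U" "compact W" "x \<in> U" "U \<subseteq> W"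
proof -
  have "\<forall>x::'g. \<exists>U K. open U \<and> compact K \<and> x \<in> U \<and> U \<subseteq> K"
    using lc by (simp add: locally_compact_space_def)
  then show ?thesis using that by meson
qed

text \<open>
On the compact image of \<open>K \<times> W\<close>, where \<open>W\<close> is a compact neighbourhood of \<open>y0\<close>, the functions in \<open>H\<close> are
uniformly close to finitely many of them, and these are handled one by one.
\<close>

lemma compact_uniform_tb:
  fixes g :: "'a::topological_space \<times> 'g \<Rightarrow> 'g"
  assumes K: "compact K" and g: "continuous_on UNIV g" and e: "e > 0"
    and H: "totally_bounded_in continuous_functions H"
  obtains U where "open U" "y0 \<in> U" "\<forall>h\<in>H. \<forall>x\<in>K. \<forall>y\<in>U. cmod (h (g (x, y)) - h (g (x, y0))) < e"
proof -
  obtain U0 W where W: "open U0" "compact W" "y0 \<in> U0" "U0 \<subseteq> W" using compact_neighbourhood .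
  have gK: "compact (g ` (K \<times> W))"
    using K W g by (intro compact_continuous_image compact_Times) (auto intro: continuous_on_subset)
  have e3: "e / 3 > 0" using e by simp
  obtain F where F: "finite F" "F \<subseteq> H" "\<forall>h\<in>H. \<exists>f\<in>F. \<forall>x\<in>g ` (K \<times> W). cmod (h x - f x) < e/3"
    using tb_cfun_net [OF H gK e3] .
  have "\<exists>U. open U \<and> y0 \<in> U \<and> (\<forall>x\<in>K. \<forall>y\<in>U. cmod (f (g (x, y)) - f (g (x, y0))) < e/3)" if "f \<in> F" for f
  proof -
    have "continuous_on UNIV f" using tb_cfun_subset [OF H] F(2) that by auto
    then have "continuous_on UNIV (\<lambda>p. f (g p))" by (rule continuous_on_compose2 [OF _ g]) simp
    from compact_uniform [OF K this e3, of y0]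
    obtain U where "open U" "y0 \<in> U" "\<forall>x\<in>K. \<forall>y\<in>U. cmod (f (g (x, y)) - f (g (x, y0))) < e/3" .
    then show ?thesis by auto
  qed
  then obtain U where U: "\<And>f. f \<in> F \<Longrightarrow> open (U f) \<and> y0 \<in> U f \<and> (\<forall>x\<in>K. \<forall>y\<in>U f. cmod (f (g (x, y)) - f (g (x, y0))) < e/3)"
    by metis
  show ?thesis
  proof (rule that [of "U0 \<inter> (\<Inter>f\<in>F. U f)"])
    show "open (U0 \<inter> (\<Inter>f\<in>F. U f))" using W(1) F(1) U by auto
    show "y0 \<in> U0 \<inter> (\<Inter>f\<in>F. U f)" using W U by auto
    show "\<forall>h\<in>H. \<forall>x\<in>K. \<forall>y\<in>U0 \<inter> (\<Inter>f\<in>F. U f). cmod (h (g (x, y)) - h (g (x, y0))) < e"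
    proof (intro ballI)
      fix h x y assume h: "h \<in> H" and x: "x \<in> K" and y: "y \<in> U0 \<inter> (\<Inter>f\<in>F. U f)"
      obtain f where f: "f \<in> F" "\<forall>x\<in>g ` (K \<times> W). cmod (h x - f x) < e/3" using F(3) h by auto
      have "y \<in> W" "y0 \<in> W" using W y by auto
      then have "cmod (h (g (x, y)) - f (g (x, y))) < e/3" "cmod (h (g (x, y0)) - f (g (x, y0))) < e/3"
        using f(2) x by auto
      moreover have "cmod (f (g (x, y)) - f (g (x, y0))) < e/3" using U [OF f(1)] x y f(1) by auto
      ultimately have "cmod ((h (g (x, y)) - f (g (x, y))) - (h (g (x, y0)) - f (g (x, y0))) + (f (g (x, y)) - f (g (x, y0)))) < e"
        using norm_triangle_ineq [of "(h (g (x, y)) - f (g (x, y))) - (h (g (x, y0)) - f (g (x, y0)))" "f (g (x, y)) - f (g (x, y0))"]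
          norm_triangle_ineq4 [of "h (g (x, y)) - f (g (x, y))" "h (g (x, y0)) - f (g (x, y0))"] by linarith
      then show "cmod (h (g (x, y)) - h (g (x, y0))) < e" by simp
    qed
  qed
qed

lemma tb_cfun_equicontinuous:
  assumes H: "totally_bounded_in continuous_functions H" and e: "e > 0"
  obtains U where "open U" "(x::'g) \<in> U" "\<forall>h\<in>H. \<forall>y\<in>U. cmod (h y - h x) < e"
proof -
  have c: "continuous_on UNIV (snd :: 'g \<times> 'g \<Rightarrow> 'g)" by (intro continuous_intros)
  show ?thesis
  proof (rule compact_uniform_tb [OF compact_sing c e H, of x])
    fix U :: "'g set"
    assume U: "open U" "x \<in> U"
    assume "\<forall>h\<in>H. \<forall>a\<in>{x}. \<forall>y\<in>U. cmod (h (snd (a, y)) - h (snd (a, x))) < e"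
    then have "\<forall>h\<in>H. \<forall>y\<in>U. cmod (h y - h x) < e" by simp
    then show thesis using that U by simp
  qed
qed

lemma tb_cfun_right_uniform:
  assumes H: "totally_bounded_in continuous_functions H" and e: "e > 0" and K: "compact (K :: 'g set)"
  obtains U where "open U" "0 \<in> U" "\<forall>h\<in>H. \<forall>t\<in>K. \<forall>s\<in>U. cmod (h (t + s) - h t) < e"
proof -
  have c: "continuous_on UNIV (\<lambda>p :: 'g \<times> 'g. fst p + snd p)" by (intro continuous_intros)
  show ?thesis
  proof (rule compact_uniform_tb [OF K c e H, of 0])
    fix U :: "'g set"
    assume U: "open U" "0 \<in> U"
    assume "\<forall>h\<in>H. \<forall>x\<in>K. \<forall>y\<in>U. cmod (h (fst (x, y) + snd (x, y)) - h (fst (x, 0) + snd (x, 0))) < e"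
    then have "\<forall>h\<in>H. \<forall>t\<in>K. \<forall>s\<in>U. cmod (h (t + s) - h t) < e" by simp
    then show thesis using that U by simp
  qed
qed

section \<open>Bump functions and partitions of unity\<close>

lemma compact_plus: "compact A \<Longrightarrow> compact B \<Longrightarrow> compact {a + b | a b. a \<in> A \<and> b \<in> (B :: 'g set)}"
proof -
  assume "compact A" "compact B"
  then have "compact ((\<lambda>p. fst p + snd p) ` (A \<times> B))"
    by (intro compact_continuous_image compact_Times continuous_intros)
  moreover have "(\<lambda>p. fst p + snd p) ` (A \<times> B) = {a + b | a b. a \<in> A \<and> b \<in> B}" by force
  ultimately show ?thesis by simp
qed

lemma compact_superset_interior:
  assumes "compact (K :: 'g set)"
  obtains U L where "open U" "compact L" "K \<subseteq> U" "U \<subseteq> L"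
proof -
  have "\<forall>x::'g. \<exists>p. open (fst p) \<and> x \<in> fst p \<and> compact (snd p) \<and> fst p \<subseteq> snd p"
  proof
    fix x :: 'g
    obtain U W where "open U" "compact W" "x \<in> U" "U \<subseteq> W" using compact_neighbourhood .
    then show "\<exists>p. open (fst p) \<and> x \<in> fst p \<and> compact (snd p) \<and> fst p \<subseteq> snd p" by (intro exI [of _ "(U, W)"]) simp
  qed
  from choice [OF this] obtain p :: "'g \<Rightarrow> 'g set \<times> 'g set"
    where p: "\<forall>x. open (fst (p x)) \<and> x \<in> fst (p x) \<and> compact (snd (p x)) \<and> fst (p x) \<subseteq> snd (p x)" by auto
  define U W where "U x = fst (p x)" and "W x = snd (p x)" for x
  have U: "\<And>x. open (U x) \<and> x \<in> U x" and W: "\<And>x. compact (W x) \<and> U x \<subseteq> W x" using p by (auto simp: U_def W_def)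
  have KU: "K \<subseteq> (\<Union>x\<in>K. U x)" using U by auto
  obtain F where F: "F \<subseteq> K" "finite F" "K \<subseteq> (\<Union>x\<in>F. U x)"
    by (rule compactE_image [OF assms _ KU]) (use U in auto)
  show ?thesis
  proof (rule that [of "\<Union>x\<in>F. U x" "\<Union>x\<in>F. W x"])
    show "(\<Union>x\<in>F. U x) \<subseteq> (\<Union>x\<in>F. W x)" using W by (intro UN_mono) auto
  qed (use F U W in \<open>auto intro!: compact_UN\<close>)
qed

lemma bump_function:
  assumes K: "compact (K :: 'g set)" and V: "open V" "K \<subseteq> V"
  obtains p :: "'g \<Rightarrow> real" and L where "continuous_on UNIV p" "\<forall>x. 0 \<le> p x \<and> p x \<le> 1" "\<forall>x\<in>K. p x = 1"
    "compact L" "\<forall>x. x \<notin> V \<inter> L \<longrightarrow> p x = 0"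
proof -
  have haus: "Hausdorff_space (euclidean :: 'g topology)"
    unfolding Hausdorff_space_def by (simp add: disjnt_def) (metis hausdorff)
  have cr: "completely_regular_space (euclidean :: 'g topology)"
    using lc haus by (simp add: locally_compact_regular_imp_completely_regular_space)
  obtain U L where UL: "open U" "compact L" "K \<subseteq> U" "U \<subseteq> L" using compact_superset_interior [OF K] .
  have cl: "closedin euclidean (- (U \<inter> V))" using UL V by auto
  have "disjnt K (- (U \<inter> V))" using UL V by (auto simp: disjnt_iff)
  then obtain p where p: "continuous_map euclidean (top_of_set {0..1::real}) p" "p ` (- (U \<inter> V)) \<subseteq> {0}" "p ` K \<subseteq> {1}"
    using Urysohn_completely_regular_compact_closed [OF zero_le_one cr _ cl, of K] K by auto
  show ?thesis
  proof (rule that [of p L])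
    show "continuous_on UNIV p" using p(1) by (simp add: continuous_map_in_subtopology)
    show "\<forall>x. 0 \<le> p x \<and> p x \<le> 1" using p(1) by (auto simp: continuous_map_in_subtopology Pi_iff)
    show "\<forall>x\<in>K. p x = 1" using p(3) by auto
    show "\<forall>x. x \<notin> V \<inter> L \<longrightarrow> p x = 0" using p(2) UL(4) by auto
  qed (rule UL)
qed

text \<open>
Finitely many left translates of one bump function cover \<open>K\<close>; they are divided by their sum. Truncating
the divisor below at \<open>1/2\<close> keeps the quotients continuous on the whole group and changes nothing on \<open>K\<close>,
where the sum exceeds \<open>1/2\<close>.
\<close>

lemma partition_of_unity:
  assumes K: "compact (K :: 'g set)" and V: "open V" "0 \<in> V"
  obtains S :: "'g set" and u :: "'g \<Rightarrow> 'g \<Rightarrow> real" and L where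
    "finite S" "S \<subseteq> K" "\<forall>s. continuous_on UNIV (u s)" "\<forall>s t. 0 \<le> u s t"
    "\<forall>s t. u s t \<noteq> 0 \<longrightarrow> - s + t \<in> V \<inter> L" "compact L" "\<forall>t\<in>K. (\<Sum>s\<in>S. u s t) = 1" "\<forall>t. (\<Sum>s\<in>S. u s t) \<le> 1"
proof -
  have "compact {0::'g}" "{0} \<subseteq> V" using V by auto
  from bump_function [OF this(1) V(1) this(2)]
  obtain p :: "'g \<Rightarrow> real" and L where p: "continuous_on UNIV p" "\<forall>x. 0 \<le> p x \<and> p x \<le> 1" "\<forall>x\<in>{0}. p x = 1"
    "compact L" "\<forall>x. x \<notin> V \<inter> L \<longrightarrow> p x = 0" .
  have opn: "open {t. p (- s + t) > 1/2}" for s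
    by (intro open_Collect_less continuous_on_left_translate [OF p(1)] continuous_intros)
  have KS: "K \<subseteq> (\<Union>s\<in>K. {t. p (- s + t) > 1/2})" using p(3) by auto
  obtain S where S: "S \<subseteq> K" "finite S" "K \<subseteq> (\<Union>s\<in>S. {t. p (- s + t) > 1/2})"
    by (rule compactE_image [OF K opn KS])
  define \<sigma> where "\<sigma> t = (\<Sum>s\<in>S. p (- s + t))" for t
  define u where "u s t = p (- s + t) / max (1/2) (\<sigma> t)" for s t
  have c\<sigma>: "continuous_on UNIV \<sigma>"
    unfolding \<sigma>_def by (intro continuous_intros continuous_on_left_translate [OF p(1)])
  have sum_u: "(\<Sum>s\<in>S. u s t) = \<sigma> t / max (1/2) (\<sigma> t)" for t
    unfolding u_def \<sigma>_def by (simp add: sum_divide_distrib)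
  have \<sigma>K: "\<sigma> t > 1/2" if tK: "t \<in> K" for t
  proof -
    obtain s where s: "s \<in> S" "p (- s + t) > 1/2" using subsetD [OF S(3) tK] by (elim UN_E CollectE)
    have "p (- s + t) \<le> \<sigma> t" unfolding \<sigma>_def using s(1) S(2) p(2)
      by (intro member_le_sum) auto
    then show ?thesis using s by simp
  qed
  show ?thesis
  proof (rule that [OF S(2,1), of u L])
    have "continuous_on UNIV (u s)" for s
      unfolding u_def by (intro continuous_intros continuous_on_left_translate [OF p(1)] c\<sigma>) (auto simp: max_def)
    then show "\<forall>s. continuous_on UNIV (u s)" by simp
    show "\<forall>s t. 0 \<le> u s t" using p(2) by (auto simp: u_def)
    show "\<forall>s t. u s t \<noteq> 0 \<longrightarrow> - s + t \<in> V \<inter> L"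
    proof (intro allI impI)
      fix s t assume "u s t \<noteq> 0"
      then have "p (- s + t) \<noteq> 0" by (auto simp: u_def)
      then show "- s + t \<in> V \<inter> L" using p(5) by auto
    qed
    show "\<forall>t\<in>K. (\<Sum>s\<in>S. u s t) = 1" unfolding sum_u
    proof
      fix t assume "t \<in> K"
      then have "max (1/2) (\<sigma> t) = \<sigma> t" "\<sigma> t \<noteq> 0" using \<sigma>K [of t] by (auto simp: max_def)
      then show "\<sigma> t / max (1/2) (\<sigma> t) = 1" by simp
    qed
    show "\<forall>t. (\<Sum>s\<in>S. u s t) \<le> 1" unfolding sum_u by (auto simp: divide_simps max_def)
  qed (rule p)
qed

end

section \<open>Functionals on continuous functions\<close>

text \<open>
The value \<open>0\<close> at discontinuous functions is the convention of \<open>continuous_linear_maps\<close>.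
\<close>

definition dirac :: "'g::topological_space \<Rightarrow> ('g \<Rightarrow> complex) \<Rightarrow> complex" where
  "dirac t = (\<lambda>f. if continuous_on UNIV f then f t else 0)"

abbreviation "radon_functionals \<equiv> cts_dual (continuous_functions :: ('g::topological_space \<Rightarrow> complex) topology)"

lemma measure_add: "m \<in> radon_functionals \<Longrightarrow> continuous_on UNIV f \<Longrightarrow> continuous_on UNIV g \<Longrightarrow> m (\<lambda>x. f x + g x) = m f + m g"
  using continuous_linear_maps_add [of m continuous_functions euclidean f g]
  by (simp add: topspace_cfun plus_fun_def)

lemma measure_scale: "m \<in> radon_functionals \<Longrightarrow> continuous_on UNIV f \<Longrightarrow> m (\<lambda>x. c * f x) = c * m f"
  using continuous_linear_maps_scaleC [of m continuous_functions euclidean f c]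
  by (simp add: topspace_cfun scaleC_fun_def scaleC_complex_def)

lemma measure_diff:
  assumes m: "m \<in> radon_functionals" and f: "continuous_on UNIV f" and g: "continuous_on UNIV g"
  shows "m (\<lambda>x. f x - g x) = m f - m g"
proof -
  have "continuous_on UNIV (\<lambda>x. (-1) * g x)" using g by (intro continuous_intros)
  from measure_add [OF m f this] measure_scale [OF m g, of "-1"] show ?thesis by simp
qed

lemma measure_sum:
  assumes m: "m \<in> radon_functionals" and S: "finite S" and u: "\<And>s. s \<in> S \<Longrightarrow> continuous_on UNIV (u s)"
  shows "m (\<lambda>x. \<Sum>s\<in>S. c s * u s x) = (\<Sum>s\<in>S. c s * m (u s))"
  using S u
proof (induction S rule: finite_induct)
  case empty
  have "m (\<lambda>x. 0 * (0::complex)) = 0 * m (\<lambda>x. 0)" by (rule measure_scale [OF m]) simp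
  then show ?case by simp
next
  case (insert s S)
  have 1: "continuous_on UNIV (\<lambda>x. c s * u s x)" using insert by (intro continuous_intros) auto
  have 2: "continuous_on UNIV (\<lambda>x. \<Sum>s\<in>S. c s * u s x)" using insert by (intro continuous_intros) auto
  have "m (\<lambda>x. c s * u s x + (\<Sum>s\<in>S. c s * u s x)) = m (\<lambda>x. c s * u s x) + m (\<lambda>x. \<Sum>s\<in>S. c s * u s x)"
    by (rule measure_add [OF m 1 2])
  also have "m (\<lambda>x. c s * u s x) = c s * m (u s)" by (rule measure_scale [OF m]) (use insert in auto)
  finally show ?case using insert by simp
qed

text \<open>
Continuity at zero in homogeneous form, with \<open>K\<close> and \<open>d\<close> independent of \<open>e\<close>.
\<close>

lemma measure_bound:
  assumes m: "m \<in> (radon_functionals :: (('g::topological_space \<Rightarrow> complex) \<Rightarrow> complex) set)"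
  obtains K d where "compact K" "d > 0"
    "\<forall>h e. continuous_on UNIV h \<longrightarrow> e > 0 \<longrightarrow> (\<forall>x\<in>K. cmod (h x) < d * e) \<longrightarrow> cmod (m h) < e"
proof -
  obtain P where P: "zero_nbhd (continuous_functions :: ('g \<Rightarrow> complex) topology) P" "\<forall>h\<in>P. cmod (m h) < 1"
    using dual_nbhd [OF locally_convex_space_cfun m zero_less_one] .
  obtain K d where K: "compact K" "d > 0" "{h \<in> cfun. \<forall>x\<in>K. cmod (h x) < d} \<subseteq> P"
    using P(1) unfolding zero_nbhd_cfun by auto
  have "cmod (m h) < e" if h: "continuous_on UNIV h" and e: "e > 0" and le: "\<forall>x\<in>K. cmod (h x) < d * e" for h e
  proof -
    let ?c = "complex_of_real (1/e)"
    have "cmod (?c * h x) < d" if "x \<in> K" for x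
    proof -
      have "cmod (?c * h x) = cmod (h x) / e" using e by (simp add: norm_mult norm_divide)
      also have "\<dots> < d" using le that e by (simp add: pos_divide_less_eq)
      finally show ?thesis .
    qed
    moreover have "continuous_on UNIV (\<lambda>x. ?c * h x)" using h by (intro continuous_intros)
    ultimately have "(\<lambda>x. ?c * h x) \<in> P" by (intro subsetD [OF K(3)]) simp
    then have "cmod (m (\<lambda>x. ?c * h x)) < 1" using P(2) by auto
    then have "cmod (?c * m h) < 1" by (simp only: measure_scale [OF m h])
    then show ?thesis using e by (simp add: norm_mult norm_divide)
  qed
  then show ?thesis using that K by auto
qed

lemma dirac_in_measures: "dirac t \<in> (radon_functionals :: (('g::topological_space \<Rightarrow> complex) \<Rightarrow> complex) set)"
proof (rule cts_dualI [OF locally_convex_space_cfun])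
  have sub: "csubspace {f :: 'g \<Rightarrow> complex. continuous_on UNIV f}" by (rule csubspace_cfun)
  show "linear_on (topspace continuous_functions) (dirac t)"
    unfolding linear_on_def topspace_cfun
    using complex_vector.subspace_add [OF sub] complex_vector.subspace_scale [OF sub]
    by (simp add: dirac_def scaleC_fun_def)
  show "dirac t x = 0" if "x \<notin> topspace continuous_functions" for x using that by (simp add: dirac_def topspace_cfun)
  fix e :: real assume "e > 0"
  then show "\<exists>M. zero_nbhd continuous_functions M \<and> (\<forall>x\<in>M. cmod (dirac t x) < e)"
    using zero_nbhd_cfunI [of "{t}" e] by (intro exI [of _ "{h \<in> cfun. \<forall>x\<in>{t}. cmod (h x) < e}"]) (auto simp: dirac_def)
qed

lemma tb_dirac:
  assumes K: "compact (K :: 'g::topological_space set)"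
  shows "totally_bounded_in (stereotype_dual continuous_functions) (dirac ` K)"
proof (rule tb_dual [OF locally_convex_space_cfun _ zero_nbhd_cfunI [OF K zero_less_one]])
  show "dirac ` K \<subseteq> radon_functionals" using dirac_in_measures by auto
  show "cmod (h x) \<le> 1" if "h \<in> dirac ` K" "x \<in> {h \<in> cfun. \<forall>x\<in>K. cmod (h x) < 1}" for h x
    using that by (auto simp: dirac_def less_imp_le)
qed

context
  assumes lc: "locally_compact_space (euclidean :: 'g::{topological_group_add, t2_space} topology)"
begin

text \<open>
If \<open>u\<^sub>s\<close> is a fine partition of unity on a compact set that carries \<open>m\<close>, then \<open>h\<close> is close to
\<open>\<Sum>\<^sub>s h(s) u\<^sub>s\<close> on this set, uniformly for \<open>h \<in> A\<close> because \<open>A\<close> is equicontinuous. Applying \<open>m\<close> gives the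
coefficients \<open>m(u\<^sub>s)\<close>.
\<close>

lemma measure_approx_point_masses:
  fixes A :: "('g \<Rightarrow> complex) set"
  assumes m: "m \<in> radon_functionals" and A: "totally_bounded_in continuous_functions A" and e: "e > 0"
  obtains S c where "finite S" "\<forall>h\<in>A. cmod (m h - (\<Sum>s\<in>S. c s * h s)) < e"
proof -
  obtain K d where K: "compact K" "d > 0"
    "\<forall>h e. continuous_on UNIV h \<longrightarrow> e > 0 \<longrightarrow> (\<forall>x\<in>K. cmod (h x) < d * e) \<longrightarrow> cmod (m h) < e"
    using measure_bound [OF m] .
  have de: "d * e / 2 > 0" using K(2) e by simp
  obtain V where V: "open V" "0 \<in> V" "\<forall>h\<in>A. \<forall>t\<in>K. \<forall>s\<in>V. cmod (h (t + s) - h t) < d * e / 2"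
    using tb_cfun_right_uniform [OF lc A de K(1)] .
  obtain S :: "'g set" and u :: "'g \<Rightarrow> 'g \<Rightarrow> real" and L where
    u: "finite S" "S \<subseteq> K" "\<forall>s. continuous_on UNIV (u s)" "\<forall>s t. 0 \<le> u s t"
    "\<forall>s t. u s t \<noteq> 0 \<longrightarrow> - s + t \<in> V \<inter> L" "compact L" "\<forall>t\<in>K. (\<Sum>s\<in>S. u s t) = 1" "\<forall>t. (\<Sum>s\<in>S. u s t) \<le> 1"
    using partition_of_unity [OF lc K(1) V(1,2)] .
  have cu: "continuous_on UNIV (\<lambda>t. complex_of_real (u s t))" for s using u(3) by (intro continuous_intros) auto
  show ?thesis
  proof (rule that [of S "\<lambda>s. m (\<lambda>t. complex_of_real (u s t))"]; (intro ballI)?)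
    fix h assume h: "h \<in> A"
    have hc: "continuous_on UNIV h" using tb_cfun_subset [OF A h] .
    let ?g = "\<lambda>t. \<Sum>s\<in>S. h s * complex_of_real (u s t)"
    have gc: "continuous_on UNIV ?g" by (intro continuous_on_sum continuous_on_mult continuous_on_const cu)
    have "cmod (h t - ?g t) < d * e" if t: "t \<in> K" for t
    proof -
      have "(\<Sum>s\<in>S. complex_of_real (u s t)) = 1" using u(7) t by (simp add: of_real_sum [symmetric])
      then have "(\<Sum>s\<in>S. h t * complex_of_real (u s t)) = h t" by (simp add: sum_distrib_left [symmetric])
      moreover have "(\<Sum>s\<in>S. (h t - h s) * complex_of_real (u s t)) = (\<Sum>s\<in>S. h t * complex_of_real (u s t)) - ?g t"
        by (simp add: sum_subtractf left_diff_distrib)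
      ultimately have "h t - ?g t = (\<Sum>s\<in>S. (h t - h s) * complex_of_real (u s t))" by simp
      then have "cmod (h t - ?g t) \<le> (\<Sum>s\<in>S. cmod ((h t - h s) * complex_of_real (u s t)))" by (simp add: norm_sum)
      also have "\<dots> \<le> (\<Sum>s\<in>S. (d * e / 2) * u s t)"
      proof (rule sum_mono)
        fix s assume s: "s \<in> S"
        show "cmod ((h t - h s) * complex_of_real (u s t)) \<le> (d * e / 2) * u s t"
        proof (cases "u s t = 0")
          case False
          then have "- s + t \<in> V" "s \<in> K" using u(2,5) s by auto
          then have "cmod (h (s + (- s + t)) - h s) < d * e / 2" using V(3) h by blast
          then have "cmod (h t - h s) \<le> d * e / 2" by simp
          then have "cmod (h t - h s) * u s t \<le> (d * e / 2) * u s t" using u(4) by (intro mult_right_mono) auto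
          then show ?thesis using u(4) by (simp add: norm_mult)
        qed simp
      qed
      also have "\<dots> = (d * e / 2) * (\<Sum>s\<in>S. u s t)" by (simp add: sum_distrib_left)
      also have "\<dots> = d * e / 2" using u(7) t by simp
      also have "\<dots> < d * e" using de by simp
      finally show ?thesis .
    qed
    moreover have "continuous_on UNIV (\<lambda>t. h t - ?g t)" by (intro continuous_on_diff hc gc)
    ultimately have "cmod (m (\<lambda>t. h t - ?g t)) < e" using K(3) e by blast
    then have "cmod (m h - m ?g) < e" by (simp only: measure_diff [OF m hc gc])
    moreover have "m ?g = (\<Sum>s\<in>S. h s * m (\<lambda>t. complex_of_real (u s t)))"
      by (rule measure_sum [OF m u(1) cu])
    ultimately show "cmod (m h - (\<Sum>s\<in>S. m (\<lambda>t. complex_of_real (u s t)) * h s)) < e" by (simp add: mult.commute)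
  qed (rule u)
qed

lemma continuous_on_if_clopen:
  assumes "open O1" "closed O1" "continuous_on UNIV (f :: 'g \<Rightarrow> complex)"
  shows "continuous_on UNIV (\<lambda>x. if x \<in> O1 then f x else 0)"
proof -
  have "continuous_on (O1 \<union> - O1) (\<lambda>x. if x \<in> O1 then f x else 0)"
    by (rule continuous_on_If) (use assms in \<open>auto intro: continuous_on_subset\<close>)
  then show ?thesis by simp
qed

text \<open>
A gliding hump. If the claim fails, choose functionals \<open>m n\<close> in \<open>B\<close> and functions \<open>h n\<close> that are tiny on
compact sets \<open>K n\<close> with \<open>m n (h n)\<close> not small, where \<open>K (n + 1)\<close> contains a neighbourhood of \<open>K n\<close> of a
fixed size and also a compact set that carries \<open>m n\<close>. The union of the \<open>K n\<close> is open and closed.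
Cutting \<open>h n\<close> off outside the union therefore leaves it continuous and leaves \<open>m n (h n)\<close> unchanged,
and even \<open>(n + 1) h n\<close> then tends to zero in \<open>C(G)\<close>. But \<open>B\<close> is uniformly bounded on this null sequence.
\<close>

lemma tb_measures_equicontinuous:
  fixes B :: "(('g \<Rightarrow> complex) \<Rightarrow> complex) set"
  assumes B: "totally_bounded_in (stereotype_dual continuous_functions) B" and e: "e > 0"
  shows "\<exists>K d. compact K \<and> d > 0 \<and> (\<forall>m\<in>B. \<forall>h. continuous_on UNIV h \<longrightarrow> (\<forall>x\<in>K. cmod (h x) < d) \<longrightarrow> cmod (m h) < e)"
proof (rule ccontr)
  note lC = locally_convex_space_cfun
  note lD = locally_convex_space_dual [OF lC]
  assume neg: "\<not> ?thesis"
  have Bm: "m \<in> radon_functionals" if "m \<in> B" for m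
    using subsetD [OF tb_subset_topspace [OF lD B] that] unfolding topspace_dual [OF lC] .
  have "\<exists>mh. fst mh \<in> B \<and> continuous_on UNIV (snd mh) \<and> (\<forall>x\<in>K. cmod (snd mh x) < d) \<and> cmod (fst mh (snd mh)) \<ge> e"
    if "compact K" "d > 0" for K d
  proof -
    have "\<not> (\<forall>m\<in>B. \<forall>h. continuous_on UNIV h \<longrightarrow> (\<forall>x\<in>K. cmod (h x) < d) \<longrightarrow> cmod (m h) < e)"
    proof
      assume "\<forall>m\<in>B. \<forall>h. continuous_on UNIV h \<longrightarrow> (\<forall>x\<in>K. cmod (h x) < d) \<longrightarrow> cmod (m h) < e"
      with that have "\<exists>K d. compact K \<and> d > 0 \<and> (\<forall>m\<in>B. \<forall>h. continuous_on UNIV h \<longrightarrow> (\<forall>x\<in>K. cmod (h x) < d) \<longrightarrow> cmod (m h) < e)"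
        by (intro exI [of _ K] exI [of _ d] conjI)
      with neg show False by (rule notE)
    qed
    then obtain m h where "m \<in> B" "continuous_on UNIV h" "\<forall>x\<in>K. cmod (h x) < d" "\<not> cmod (m h) < e"
      unfolding Ball_def [of B] not_all not_imp by (elim exE conjE)
    then show ?thesis by (intro exI [of _ "(m, h)"]) simp
  qed
  note ex = this
  define mh where "mh K d = (SOME mh. fst mh \<in> B \<and> continuous_on UNIV (snd mh) \<and> (\<forall>x\<in>K. cmod (snd mh x) < d) \<and>
      cmod (fst mh (snd mh)) \<ge> e)" for K d
  have mh: "fst (mh K d) \<in> B \<and> continuous_on UNIV (snd (mh K d)) \<and>
      (\<forall>x\<in>K. cmod (snd (mh K d) x) < d) \<and> cmod (fst (mh K d) (snd (mh K d))) \<ge> e" if "compact K" "d > 0" for K d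
    unfolding mh_def by (rule someI_ex [OF ex [OF that]])
  have "\<exists>L. compact L \<and> (\<forall>f g. continuous_on UNIV f \<longrightarrow> continuous_on UNIV g \<longrightarrow> (\<forall>x\<in>L. f x = g x) \<longrightarrow> m f = m g)"
    if m: "m \<in> B" for m
  proof -
    obtain K d where K: "compact K" "d > 0"
      "\<forall>h e. continuous_on UNIV h \<longrightarrow> e > 0 \<longrightarrow> (\<forall>x\<in>K. cmod (h x) < d * e) \<longrightarrow> cmod (m h) < e"
      using measure_bound [OF Bm [OF m]] .
    have "m f = m g" if f: "continuous_on UNIV f" and g: "continuous_on UNIV g" and eq: "\<forall>x\<in>K. f x = g x" for f g
    proof -
      have c: "continuous_on UNIV (\<lambda>x. f x - g x)" by (intro continuous_on_diff f g)
      have "cmod (m f - m g) \<le> 0 + e'" if e': "e' > 0" for e'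
      proof -
        have "\<forall>x\<in>K. cmod (f x - g x) < d * e'" using eq K(2) e' by simp
        then have "cmod (m (\<lambda>x. f x - g x)) < e'" using K(3) c e' by blast
        then show ?thesis unfolding measure_diff [OF Bm [OF m] f g] by simp
      qed
      then have "cmod (m f - m g) \<le> 0" by (rule field_le_epsilon)
      then show ?thesis by simp
    qed
    then show ?thesis using K(1) by blast
  qed
  then have "\<forall>m\<in>B. \<exists>L. compact L \<and> (\<forall>f g. continuous_on UNIV f \<longrightarrow> continuous_on UNIV g \<longrightarrow> (\<forall>x\<in>L. f x = g x) \<longrightarrow> m f = m g)"
    by (rule ballI)
  from bchoice [OF this] obtain L where L': "\<forall>m\<in>B. compact (L m) \<and>
      (\<forall>f g. continuous_on UNIV f \<longrightarrow> continuous_on UNIV g \<longrightarrow> (\<forall>x\<in>L m. f x = g x) \<longrightarrow> m f = m g)" ..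
  have L: "compact (L m)" "continuous_on UNIV f \<Longrightarrow> continuous_on UNIV g \<Longrightarrow> (\<forall>x\<in>L m. f x = g x) \<Longrightarrow> m f = m g"
    if "m \<in> B" for m f g using L' that by auto
  obtain U W where W: "open U" "compact W" "(0::'g) \<in> U" "U \<subseteq> W" using compact_neighbourhood [OF lc] .
  \<comment> \<open>small enough that \<open>(n + 1) h n\<close> still tends to zero\<close>
  define d where "d n = 1 / (real (Suc n))\<^sup>2" for n
  have d: "d n > 0" for n by (simp add: d_def)
  define K where "K = rec_nat ({}::'g set) (\<lambda>n K. {a + b | a b. a \<in> K \<union> L (fst (mh K (d n))) \<and> b \<in> W})"
  have K0: "K 0 = {}" by (simp add: K_def)
  have KS: "K (Suc n) = {a + b | a b. a \<in> K n \<union> L (fst (mh (K n) (d n))) \<and> b \<in> W}" for n by (simp add: K_def)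
  have Kc: "compact (K n)" for n
  proof (induction n)
    case 0 then show ?case by (simp add: K0)
  next
    case (Suc n)
    then have "compact (L (fst (mh (K n) (d n))))" using L(1) mh [OF Suc d] by simp
    then show ?case unfolding KS using Suc W by (intro compact_plus [OF lc] compact_Un)
  qed
  define m where "m n = fst (mh (K n) (d n))" for n
  define h where "h n = snd (mh (K n) (d n))" for n
  have mh': "m n \<in> B" "continuous_on UNIV (h n)" "\<forall>x\<in>K n. cmod (h n x) < d n" "cmod (m n (h n)) \<ge> e" for n
    using mh [OF Kc d, of n n] by (auto simp: m_def h_def)
  have KW: "a + b \<in> K (Suc n)" if "a \<in> K n \<union> L (m n)" "b \<in> W" for a b n
    using that unfolding KS m_def by blast
  have 0: "0 \<in> W" using W by auto
  have sub: "K n \<union> L (m n) \<subseteq> K (Suc n)" for n using KW [OF _ 0] by auto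
  have mono: "K n \<subseteq> K n'" if "n \<le> n'" for n n' 
  proof -
    have "K n \<subseteq> K (Suc n)" for n using sub [of n] by simp
    then show ?thesis using that by (rule lift_Suc_mono_le [of K])
  qed
  define O1 where "O1 = (\<Union>n. K n)"
  have int: "K n \<subseteq> interior (K (Suc n))" for n
  proof
    fix a assume a: "a \<in> K n"
    show "a \<in> interior (K (Suc n))"
    proof (rule interiorI)
      have "continuous_on UNIV (\<lambda>t. - a + t)" by (intro continuous_intros)
      from open_vimage [OF W(1) this] show "open {t. - a + t \<in> U}" by (simp add: vimage_def)
      show "a \<in> {t. - a + t \<in> U}" using W by simp
      show "{t. - a + t \<in> U} \<subseteq> K (Suc n)"
      proof
        fix t assume "t \<in> {t. - a + t \<in> U}"
        then have "a + (- a + t) \<in> K (Suc n)" using a W(4) by (intro KW) auto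
        then show "t \<in> K (Suc n)" by simp
      qed
    qed
  qed
  have O_int: "O1 = (\<Union>n. interior (K n))"
  proof
    show "O1 \<subseteq> (\<Union>n. interior (K n))"
    proof
      fix x assume "x \<in> O1"
      then obtain n where "x \<in> K n" by (auto simp: O1_def)
      then show "x \<in> (\<Union>n. interior (K n))" using int [of n] by auto
    qed
    show "(\<Union>n. interior (K n)) \<subseteq> O1" unfolding O1_def by (intro UN_mono interior_subset) simp
  qed
  have op: "open O1" unfolding O_int by auto
  have cl: "closed O1" unfolding closed_def
  proof (subst open_subopen, intro ballI)
    fix x assume x: "x \<in> - O1"
    let ?T = "{y. - y + x \<in> U}"
    have "continuous_on UNIV (\<lambda>y. - y + x)" by (intro continuous_intros)
    from open_vimage [OF W(1) this] have "open ?T" by (simp add: vimage_def)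
    moreover have "?T \<subseteq> - O1"
    proof
      fix y assume y: "y \<in> ?T"
      show "y \<in> - O1"
      proof
        assume "y \<in> O1"
        then obtain n where "y \<in> K n" by (auto simp: O1_def)
        then have "y + (- y + x) \<in> K (Suc n)" using y W(4) by (intro KW) auto
        then show False using x by (auto simp: O1_def add.assoc [symmetric])
      qed
    qed
    ultimately show "\<exists>T. open T \<and> x \<in> T \<and> T \<subseteq> - O1" using W(3) by (intro exI [of _ ?T]) simp
  qed
  define g where "g n = (\<lambda>x. if x \<in> O1 then complex_of_real (real (Suc n)) * h n x else 0)" for n
  have hc: "continuous_on UNIV (\<lambda>x. complex_of_real (real (Suc n)) * h n x)" for n using mh'(2) by (intro continuous_intros)
  have gc: "continuous_on UNIV (g n)" for n unfolding g_def by (rule continuous_on_if_clopen [OF op cl hc])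
  have "totally_bounded_in continuous_functions (range g)"
  proof (rule tb_null_sequence [OF lC])
    show "g n \<in> topspace continuous_functions" for n using gc by (simp add: topspace_cfun)
    fix P assume "zero_nbhd (continuous_functions :: ('g \<Rightarrow> complex) topology) P"
    then obtain Q \<epsilon> where Q: "compact Q" "\<epsilon> > 0" "{h \<in> cfun. \<forall>x\<in>Q. cmod (h x) < \<epsilon>} \<subseteq> P" unfolding zero_nbhd_cfun by auto
    have QO: "compact (Q \<inter> O1)" using Q(1) cl by (rule compact_Int_closed)
    have cov: "Q \<inter> O1 \<subseteq> (\<Union>n\<in>UNIV. interior (K n))" using O_int by auto
    obtain F where F: "F \<subseteq> UNIV" "finite F" "Q \<inter> O1 \<subseteq> (\<Union>n\<in>F. interior (K n))"
      by (rule compactE_image [OF QO _ cov]) auto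
    obtain N where N: "\<forall>n\<in>F. n \<le> N" using F(2) finite_nat_set_iff_bounded_le by auto
    have QK: "x \<in> K n" if "x \<in> Q" "x \<in> O1" "n \<ge> N" for x n
    proof -
      have "x \<in> (\<Union>n\<in>F. interior (K n))" using F(3) that by auto
      then obtain i where "i \<in> F" "x \<in> interior (K i)" by auto
      then show ?thesis using mono [of i n] N that(3) interior_subset [of "K i"] by fastforce
    qed
    obtain M where M: "1 / real (Suc M) < \<epsilon>" using nat_approx_posE [OF Q(2)] by metis
    have "g n \<in> P" if n: "n \<ge> max N M" for n
    proof (intro subsetD [OF Q(3)] CollectI conjI ballI gc)
      fix x assume x: "x \<in> Q"
      show "cmod (g n x) < \<epsilon>"
      proof (cases "x \<in> O1")
        case True
        then have "cmod (h n x) < d n" using QK [OF x True] mh'(3) n by auto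
        then have "real (Suc n) * cmod (h n x) \<le> real (Suc n) * d n" by (intro mult_left_mono) auto
        also have "\<dots> = 1 / real (Suc n)" by (simp add: d_def power2_eq_square)
        also have "\<dots> \<le> 1 / real (Suc M)" using n by (intro divide_left_mono) auto
        also have "\<dots> < \<epsilon>" by (rule M)
        finally have "cmod (complex_of_real (real (Suc n)) * h n x) < \<epsilon>" by (simp only: norm_mult norm_of_real abs_of_nat)
        then show ?thesis using True by (simp add: g_def)
      qed (use Q(2) in \<open>simp add: g_def\<close>)
    qed
    then show "\<exists>m. \<forall>n\<ge>m. g n \<in> P" by (intro exI [of _ "max N M"]) auto
  qed
  then have nb: "zero_nbhd (stereotype_dual continuous_functions) {m \<in> radon_functionals. \<forall>f\<in>range g. cmod (m f) < 1}"
    unfolding zero_nbhd_dual [OF lC] by (intro conjI exI [of _ "range g"] exI [of _ 1]) auto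
  obtain r where r: "r > 0"
    "\<forall>c. \<forall>a\<in>B. cmod c \<le> r \<longrightarrow> c *\<^sub>C a \<in> {m \<in> radon_functionals. \<forall>f\<in>range g. cmod (m f) < 1}"
    using tb_absorbed [OF lD B nb] .
  obtain n where n: "real n > 1 / (r * e)" using reals_Archimedean2 by auto
  have "complex_of_real r *\<^sub>C m n \<in> {m \<in> radon_functionals. \<forall>f\<in>range g. cmod (m f) < 1}" using r mh'(1) by simp
  then have "cmod ((complex_of_real r *\<^sub>C m n) (g n)) < 1" by simp
  then have 1: "r * cmod (m n (g n)) < 1" using r(1) by (simp add: scaleC_fun_def scaleC_complex_def norm_mult)
  have "m n (g n) = m n (\<lambda>x. complex_of_real (real (Suc n)) * h n x)"
    by (rule L(2) [OF mh'(1) gc hc]) (use sub in \<open>auto simp: g_def O1_def\<close>)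
  also have "\<dots> = complex_of_real (real (Suc n)) * m n (h n)" by (rule measure_scale [OF Bm [OF mh'(1)] mh'(2)])
  finally have "cmod (m n (g n)) = real (Suc n) * cmod (m n (h n))" by (simp only: norm_mult norm_of_real abs_of_nat)
  also have "\<dots> \<ge> real n * e" using mh'(4) [of n] e by (intro mult_mono) auto
  finally have "r * (real n * e) < 1" using 1 r(1) by (meson le_less_trans mult_left_mono less_imp_le)
  moreover have "r * (real n * e) > 1" using n r(1) e by (simp add: field_simps)
  ultimately show False by simp
qed

text \<open>
Point evaluations at the points of a compact set are equicontinuous and define the topology of \<open>C(G)\<close>.
A functional \<open>P\<close> on the dual is evaluation at \<open>f(t) = P(dirac t)\<close>: the function \<open>f\<close> is continuous since
totally bounded sets of functions are equicontinuous, and both sides agree on combinations of point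
evaluations, which are dense.
\<close>

theorem stereotype_space_cfun: "stereotype_space (continuous_functions :: ('g \<Rightarrow> complex) topology)"
proof (rule stereotype_spaceI [OF locally_convex_space_cfun])
  let ?C = "continuous_functions :: ('g \<Rightarrow> complex) topology"
  note lC = locally_convex_space_cfun
  note lD = locally_convex_space_dual [OF lC]
  note topD = topspace_dual [OF lC]
  show "\<exists>N. zero_nbhd ?C N \<and> (\<forall>x\<in>N. \<forall>f\<in>B. cmod (f x) < e)"
    if B: "totally_bounded_in (stereotype_dual ?C) B" and e: "e > 0" for B e
  proof -
    obtain K d where K: "compact K" "d > 0"
      "\<forall>m\<in>B. \<forall>h. continuous_on UNIV h \<longrightarrow> (\<forall>x\<in>K. cmod (h x) < d) \<longrightarrow> cmod (m h) < e"
      using tb_measures_equicontinuous [OF B e] by auto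
    then show ?thesis
      by (intro exI [of _ "{h \<in> cfun. \<forall>x\<in>K. cmod (h x) < d}"] conjI zero_nbhd_cfunI) auto
  qed
  show "\<exists>B e. totally_bounded_in (stereotype_dual ?C) B \<and> e > 0 \<and> (\<forall>x\<in>topspace ?C. (\<forall>f\<in>B. cmod (f x) < e) \<longrightarrow> x \<in> N)"
    if N: "zero_nbhd ?C N" for N
  proof -
    obtain K d where K: "compact K" "d > 0" "{h \<in> cfun. \<forall>x\<in>K. cmod (h x) < d} \<subseteq> N"
      using N unfolding zero_nbhd_cfun by auto
    have "h \<in> N" if "h \<in> topspace ?C" "\<forall>f\<in>dirac ` K. cmod (f h) < d" for h
      using that by (intro subsetD [OF K(3)]) (simp add: topspace_cfun dirac_def)
    then show ?thesis using tb_dirac [OF K(1)] K(2) by (intro exI [of _ "dirac ` K"] exI [of _ d]) simp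
  qed
  fix P assume P: "P \<in> cts_dual (stereotype_dual ?C)"
  define f where "f t = P (dirac t)" for t
  have nbP: "\<exists>A d. totally_bounded_in ?C A \<and> d > 0 \<and> (\<forall>m\<in>radon_functionals. (\<forall>h\<in>A. cmod (m h) < d) \<longrightarrow> cmod (P m) < e)"
    if e: "e > 0" for e
  proof -
    obtain N where N: "zero_nbhd (stereotype_dual ?C) N" "\<forall>m\<in>N. cmod (P m) < e" using dual_nbhd [OF lD P e] .
    then obtain A d where "totally_bounded_in ?C A" "d > 0" "{m \<in> radon_functionals. \<forall>h\<in>A. cmod (m h) < d} \<subseteq> N"
      unfolding zero_nbhd_dual [OF lC] by auto
    then show ?thesis using N(2) by (intro exI [of _ A] exI [of _ d]) auto
  qed
  have Pdiff: "P (m - m') = P m - P m'" if "m \<in> radon_functionals" "m' \<in> radon_functionals" for m m'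
    by (rule linear_on_diff [OF continuous_linear_mapsD(2) [OF P] lcs_subspace [OF lD]]) (use that in \<open>auto simp: topD\<close>)
  have mdiff: "m - m' \<in> radon_functionals" if "m \<in> radon_functionals" "m' \<in> radon_functionals" for m m'
    using complex_vector.subspace_diff [OF csubspace_continuous_linear_maps [OF lC locally_convex_space_complex] that] .
  have fc: "continuous_on UNIV f"
    unfolding continuous_on_topological
  proof (intro ballI allI impI)
    fix t and V :: "complex set" assume "open V" "f t \<in> V"
    then obtain e where e: "e > 0" "ball (f t) e \<subseteq> V" by (meson openE)
    obtain A d where A: "totally_bounded_in ?C A" "d > 0" "\<forall>m\<in>radon_functionals. (\<forall>h\<in>A. cmod (m h) < d) \<longrightarrow> cmod (P m) < e"
      using nbP [OF e(1)] by auto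
    obtain U where U: "open U" "t \<in> U" "\<forall>h\<in>A. \<forall>y\<in>U. cmod (h y - h t) < d" using tb_cfun_equicontinuous [OF lc A(1,2)] .
    have "f y \<in> V" if y: "y \<in> U" for y
    proof -
      have "\<forall>h\<in>A. cmod ((dirac y - dirac t) h) < d" using U(3) y tb_cfun_subset [OF A(1)] by (simp add: dirac_def)
      then have "cmod (P (dirac y - dirac t)) < e"
        using bspec [OF A(3) mdiff [OF dirac_in_measures dirac_in_measures]] by blast
      then have "cmod (f y - f t) < e" by (simp add: Pdiff [OF dirac_in_measures dirac_in_measures] f_def)
      then show ?thesis using e(2) by (auto simp: dist_norm norm_minus_commute)
    qed
    then show "\<exists>A. open A \<and> t \<in> A \<and> (\<forall>y\<in>UNIV. y \<in> A \<longrightarrow> f y \<in> V)" using U by auto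
  qed
  have "P m = m f" if m: "m \<in> radon_functionals" for m
  proof -
    have "cmod (P m - m f) \<le> 0 + e" if e: "e > 0" for e
    proof -
      have e2: "e / 2 > 0" using e by simp
      obtain A d where A: "totally_bounded_in ?C A" "d > 0" "\<forall>m\<in>radon_functionals. (\<forall>h\<in>A. cmod (m h) < d) \<longrightarrow> cmod (P m) < e/2"
        using nbP [OF e2] by auto
      have "totally_bounded_in ?C {f}" by (rule tb_finite [OF lC]) (auto simp: topspace_cfun fc)
      then have A': "totally_bounded_in ?C (A \<union> {f})" by (rule tb_Un [OF lC A(1)])
      have md: "min d (e/2) > 0" using A(2) e2 by simp
      obtain S c where S: "finite S" "\<forall>h\<in>A \<union> {f}. cmod (m h - (\<Sum>s\<in>S. c s * h s)) < min d (e/2)"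
        using measure_approx_point_masses [OF m A' md] .
      let ?n = "\<Sum>s\<in>S. c s *\<^sub>C dirac s"
      have nm: "?n \<in> radon_functionals"
        by (intro complex_vector.subspace_sum complex_vector.subspace_scale
            csubspace_continuous_linear_maps [OF lC locally_convex_space_complex] dirac_in_measures)
      have nh: "?n h = (\<Sum>s\<in>S. c s * h s)" if "continuous_on UNIV h" for h
        using that by (simp add: fun_sum_apply scaleC_fun_def scaleC_complex_def dirac_def)
      have "\<forall>h\<in>A. cmod ((m - ?n) h) < d" using S(2) tb_cfun_subset [OF A(1)] nh by simp
      then have "cmod (P (m - ?n)) < e/2" using bspec [OF A(3) mdiff [OF m nm]] by blast
      then have 1: "cmod (P m - P ?n) < e/2" by (simp only: Pdiff [OF m nm])
      have "P ?n = (\<Sum>s\<in>S. c s *\<^sub>C P (dirac s))"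
        by (rule linear_on_sum [OF continuous_linear_mapsD(2) [OF P] lcs_subspace [OF lD] S(1)])
          (simp add: topD dirac_in_measures)
      then have "P ?n = (\<Sum>s\<in>S. c s * f s)" by (simp add: f_def scaleC_complex_def)
      then have 2: "cmod (m f - P ?n) < e/2" using S(2) by simp
      have "cmod ((P m - P ?n) - (m f - P ?n)) \<le> e"
        using norm_triangle_ineq4 [of "P m - P ?n" "m f - P ?n"] 1 2 by linarith
      then show ?thesis by simp
    qed
    then have "cmod (P m - m f) \<le> 0" by (rule field_le_epsilon)
    then show ?thesis by simp
  qed
  then show "\<exists>x\<in>topspace ?C. \<forall>m\<in>radon_functionals. P m = m x" using fc by (intro bexI [of _ f]) (auto simp: topspace_cfun)
qed

end

section \<open>Covering numbers\<close>

primrec comb :: "('g::group_add \<Rightarrow> real) \<Rightarrow> (real \<times> 'g) list \<Rightarrow> 'g \<Rightarrow> real" where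
  "comb p [] t = 0"
| "comb p (x # xs) t = fst x * p (- snd x + t) + comb p xs t"

primrec weight :: "(real \<times> 'g) list \<Rightarrow> real" where
  "weight [] = 0"
| "weight (x # xs) = fst x + weight xs"

definition covers :: "('g::group_add \<Rightarrow> real) \<Rightarrow> ('g \<Rightarrow> real) \<Rightarrow> (real \<times> 'g) list \<Rightarrow> bool" where
  "covers f p xs \<longleftrightarrow> (\<forall>x\<in>set xs. 0 \<le> fst x) \<and> (\<forall>t. f t \<le> comb p xs t)"

text \<open>
Haar's covering number \<open>(f : p)\<close>: the least total weight of a positive combination of left translates
of \<open>p\<close> that dominates \<open>f\<close>. Combinations are lists of pairs of a weight and a translation, so that adding
them is concatenation.
\<close>

definition covering_number :: "('g::group_add \<Rightarrow> real) \<Rightarrow> ('g \<Rightarrow> real) \<Rightarrow> real" where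
  "covering_number f p = Inf (weight ` {xs. covers f p xs})"

lemma comb_append: "comb p (xs @ ys) t = comb p xs t + comb p ys t"
  by (induction xs) auto

lemma weight_append: "weight (xs @ ys) = weight xs + weight ys"
  by (induction xs) auto

lemma weight_nonneg: "\<forall>x\<in>set xs. 0 \<le> fst x \<Longrightarrow> 0 \<le> weight xs"
  by (induction xs) auto

lemma comb_nonneg: "\<forall>x\<in>set xs. 0 \<le> fst x \<Longrightarrow> \<forall>t. 0 \<le> p t \<Longrightarrow> 0 \<le> comb p xs t"
  by (induction xs) auto

lemma comb_map: "comb p (map (\<lambda>x. (c * fst x, a + snd x)) xs) t = c * comb p xs (- a + t)"
proof (induction xs)
  case (Cons x xs)
  have "- (a + snd x) + t = - snd x + (- a + t)" by (simp only: minus_add add.assoc)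
  then show ?case using Cons by (simp add: distrib_left mult.assoc del: minus_add_distrib)
qed simp

lemma weight_map: "weight (map (\<lambda>x. (c * fst x, a + snd x)) xs) = c * weight xs"
  by (induction xs) (auto simp: algebra_simps)

lemma comb_le_weight:
  assumes "\<forall>x\<in>set xs. 0 \<le> fst x" "\<forall>t. p t \<le> M" shows "comb p xs t \<le> weight xs * M"
  using assms(1)
proof (induction xs)
  case (Cons x xs)
  have "fst x * p (- snd x + t) \<le> fst x * M" using Cons.prems assms(2) by (intro mult_left_mono) auto
  then show ?case using Cons by (simp add: distrib_right)
qed simp

text \<open>
Covers \<open>f\<close> by translates of \<open>q\<close>, given a cover \<open>xs\<close> of \<open>f\<close> by translates of \<open>p\<close> and a cover \<open>ys\<close> of \<open>p\<close> by
translates of \<open>q\<close>.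
\<close>

primrec compose_cover :: "(real \<times> 'g::group_add) list \<Rightarrow> (real \<times> 'g) list \<Rightarrow> (real \<times> 'g) list" where
  "compose_cover [] ys = []"
| "compose_cover (x # xs) ys = map (\<lambda>y. (fst x * fst y, snd x + snd y)) ys @ compose_cover xs ys"

lemma weight_compose: "weight (compose_cover xs ys) = weight xs * weight ys"
  by (induction xs) (auto simp: weight_append weight_map distrib_right)

lemma nonneg_compose:
  "\<forall>x\<in>set xs. 0 \<le> fst x \<Longrightarrow> \<forall>x\<in>set ys. 0 \<le> fst x \<Longrightarrow> \<forall>x\<in>set (compose_cover xs ys). 0 \<le> fst x"
  by (induction xs) auto

lemma comb_compose:
  assumes "\<forall>x\<in>set xs. 0 \<le> fst x" "\<forall>t. p t \<le> comb q ys t"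
  shows "comb p xs t \<le> comb q (compose_cover xs ys) t"
  using assms(1)
proof (induction xs)
  case (Cons x xs)
  have "fst x * p (- snd x + t) \<le> fst x * comb q ys (- snd x + t)"
    using Cons.prems assms(2) by (intro mult_left_mono) auto
  then show ?case using Cons by (simp add: comb_append comb_map)
qed simp

lemma covering_number_le: "covers f p xs \<Longrightarrow> covering_number f p \<le> weight xs"
  unfolding covering_number_def
proof (rule cInf_lower)
  show "bdd_below (weight ` {xs. covers f p xs})"
    by (rule bdd_belowI2 [of _ 0]) (simp add: covers_def weight_nonneg)
qed simp

lemma covering_number_ge:
  assumes "covers f p ys" "\<And>xs. covers f p xs \<Longrightarrow> b \<le> weight xs" shows "b \<le> covering_number f p"
  unfolding covering_number_def by (rule cInf_greatest) (use assms in auto)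

text \<open>
The infimum in the definition of the covering number commutes with multiplication by a constant, here
in the form needed to take it inside an estimate.
\<close>

lemma covering_number_ge_mult:
  assumes ys: "covers f p ys" and le: "\<And>xs. covers f p xs \<Longrightarrow> a \<le> weight xs * c" and c: "0 \<le> c"
  shows "a \<le> covering_number f p * c"
proof (cases "c = 0")
  case True
  then show ?thesis using le [OF ys] by simp
next
  case False
  then have c': "c > 0" using c by simp
  have "a / c \<le> covering_number f p"
    by (rule covering_number_ge [OF ys]) (use le c' in \<open>simp add: pos_divide_le_eq\<close>)
  then show ?thesis using c' by (simp add: pos_divide_le_eq)
qed

definition Cc_pos :: "('g::topological_space \<Rightarrow> real) set" where
  "Cc_pos = {f. continuous_on UNIV f \<and> (\<forall>x. 0 \<le> f x) \<and> (\<exists>K. compact K \<and> (\<forall>x. x \<notin> K \<longrightarrow> f x = 0))}"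

lemma Cc_posD: "f \<in> Cc_pos \<Longrightarrow> continuous_on UNIV f" "f \<in> Cc_pos \<Longrightarrow> 0 \<le> f x"
  "f \<in> Cc_pos \<Longrightarrow> \<exists>K. compact K \<and> (\<forall>x. x \<notin> K \<longrightarrow> f x = 0)"
  by (auto simp: Cc_pos_def)

lemma Cc_posI:
  assumes "continuous_on UNIV f" "\<And>x. 0 \<le> f x" "compact K" "\<And>x. x \<notin> K \<Longrightarrow> f x = 0"
  shows "f \<in> Cc_pos"
  using assms by (auto simp: Cc_pos_def)

lemma Cc_pos_add:
  assumes "f \<in> Cc_pos" "g \<in> Cc_pos" shows "(\<lambda>x. f x + g x) \<in> Cc_pos"
proof -
  obtain K where K: "compact K" "\<forall>x. x \<notin> K \<longrightarrow> f x = 0" using Cc_posD(3) [OF assms(1)] by auto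
  obtain L where L: "compact L" "\<forall>x. x \<notin> L \<longrightarrow> g x = 0" using Cc_posD(3) [OF assms(2)] by auto
  show ?thesis
    by (rule Cc_posI [OF continuous_on_add [OF Cc_posD(1) [OF assms(1)] Cc_posD(1) [OF assms(2)]] _ compact_Un [OF K(1) L(1)]])
      (use K L Cc_posD(2) [OF assms(1)] Cc_posD(2) [OF assms(2)] in auto)
qed

lemma Cc_pos_mult:
  assumes "f \<in> Cc_pos" "continuous_on UNIV g" "\<And>x. 0 \<le> g x" shows "(\<lambda>x. g x * f x) \<in> Cc_pos"
proof -
  obtain K where K: "compact K" "\<forall>x. x \<notin> K \<longrightarrow> f x = 0" using Cc_posD(3) [OF assms(1)] by auto
  show ?thesis
    by (rule Cc_posI [OF continuous_on_mult [OF assms(2) Cc_posD(1) [OF assms(1)]] _ K(1)])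
      (use K assms(3) Cc_posD(2) [OF assms(1)] in auto)
qed

lemma Cc_pos_scale: "f \<in> Cc_pos \<Longrightarrow> 0 \<le> c \<Longrightarrow> (\<lambda>x. c * f x) \<in> Cc_pos"
  by (rule Cc_pos_mult) auto

lemma Cc_pos_bounded:
  assumes "f \<in> Cc_pos" obtains M where "M > 0" "\<forall>x. f x \<le> M"
proof -
  obtain K where K: "compact K" "\<forall>x. x \<notin> K \<longrightarrow> f x = 0" using Cc_posD(3) [OF assms] by auto
  have "compact (f ` K)"
    using K(1) by (intro compact_continuous_image continuous_on_subset [OF Cc_posD(1) [OF assms]]) auto
  then have "bounded (f ` K)" by (rule compact_imp_bounded)
  then obtain M where M: "M > 0" "\<forall>y\<in>f ` K. norm y \<le> M" unfolding bounded_pos by auto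
  have "f x \<le> M" for x
  proof (cases "x \<in> K")
    case True
    then have "norm (f x) \<le> M" using M(2) by auto
    then show ?thesis by simp
  qed (use K M in simp)
  then show ?thesis using that M by blast
qed

lemma Cc_pos_translate:
  fixes f :: "'g::{topological_group_add, t2_space} \<Rightarrow> real"
  assumes "f \<in> Cc_pos" shows "(\<lambda>x. f (a + x)) \<in> Cc_pos"
proof -
  obtain K where K: "compact K" "\<forall>x. x \<notin> K \<longrightarrow> f x = 0" using Cc_posD(3) [OF assms] by auto
  have "compact ((\<lambda>x. - a + x) ` K)" using K(1) by (intro compact_continuous_image continuous_intros)
  then show ?thesis
  proof (rule Cc_posI [OF continuous_on_left_translate [OF Cc_posD(1) [OF assms]] Cc_posD(2) [OF assms]])
    fix x assume x: "x \<notin> (\<lambda>x. - a + x) ` K"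
    show "f (a + x) = 0"
    proof (rule ccontr)
      assume "f (a + x) \<noteq> 0"
      then have "a + x \<in> K" using K(2) by auto
      then have "- a + (a + x) \<in> (\<lambda>x. - a + x) ` K" by (rule imageI)
      then show False using x by simp
    qed
  qed
qed

lemma covering_number_subadd:
  assumes f: "covers f p xs0" and g: "covers g p ys0"
  shows "covering_number (\<lambda>t. f t + g t) p \<le> covering_number f p + covering_number g p"
proof -
  have "covering_number (\<lambda>t. f t + g t) p - weight ys \<le> covering_number f p" if ys: "covers g p ys" for ys
  proof (rule covering_number_ge [OF f])
    fix xs assume xs: "covers f p xs"
    have "covers (\<lambda>t. f t + g t) p (xs @ ys)" using xs ys by (auto simp: covers_def comb_append add_mono)
    from covering_number_le [OF this] show "covering_number (\<lambda>t. f t + g t) p - weight ys \<le> weight xs"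
      by (simp add: weight_append)
  qed
  then have "covering_number (\<lambda>t. f t + g t) p - covering_number f p \<le> covering_number g p"
    by (intro covering_number_ge [OF g]) (simp add: algebra_simps)
  then show ?thesis by simp
qed

lemma covering_number_scale_le:
  assumes f: "covers f p xs0" and c: "0 \<le> c"
  shows "covering_number (\<lambda>t. c * f t) p \<le> covering_number f p * c"
proof (rule covering_number_ge_mult [OF f _ c])
  fix xs assume xs: "covers f p xs"
  have "covers (\<lambda>t. c * f t) p (map (\<lambda>x. (c * fst x, 0 + snd x)) xs)"
    using xs c unfolding covers_def comb_map by (auto simp: mult_left_mono)
  from covering_number_le [OF this] show "covering_number (\<lambda>t. c * f t) p \<le> weight xs * c"
    unfolding weight_map by (simp add: mult.commute)
qed

lemma covers_translate: "covers f p xs \<Longrightarrow> covers (\<lambda>t. f (a + t)) p (map (\<lambda>x. (1 * fst x, - a + snd x)) xs)"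
  unfolding covers_def comb_map by auto

lemma covering_number_translate_le:
  assumes f: "covers f p xs0"
  shows "covering_number (\<lambda>t. f (a + t)) p \<le> covering_number f p"
proof (rule covering_number_ge [OF f])
  fix xs assume xs: "covers f p xs"
  from covering_number_le [OF covers_translate [OF xs, of a]]
  show "covering_number (\<lambda>t. f (a + t)) p \<le> weight xs" unfolding weight_map by simp
qed

lemma covering_number_translate:
  assumes f: "covers f p xs0"
  shows "covering_number (\<lambda>t. f (a + t)) p = covering_number f p"
proof (rule antisym [OF covering_number_translate_le [OF f]])
  show "covering_number f p \<le> covering_number (\<lambda>t. f (a + t)) p"
    using covering_number_translate_le [OF covers_translate [OF f, of a], of "- a"] by simp
qed

lemma covering_number_trans:
  assumes f: "covers f p xs0" and p: "covers p q ys0"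
  shows "covering_number f q \<le> covering_number f p * covering_number p q"
proof (rule covering_number_ge_mult [OF f])
  show "0 \<le> covering_number p q"
    by (rule covering_number_ge [OF p]) (auto simp: covers_def intro: weight_nonneg)
  fix xs assume xs: "covers f p xs"
  have "covering_number f q \<le> covering_number p q * weight xs"
  proof (rule covering_number_ge_mult [OF p])
    fix ys assume ys: "covers p q ys"
    have "covers f q (compose_cover xs ys)"
      using xs ys nonneg_compose [of xs ys] comb_compose [of xs p q ys] order_trans unfolding covers_def by blast
    from covering_number_le [OF this] show "covering_number f q \<le> weight ys * weight xs"
      by (simp add: weight_compose mult.commute)
  qed (use xs in \<open>auto simp: covers_def intro: weight_nonneg\<close>)
  then show "covering_number f q \<le> weight xs * covering_number p q" by (simp add: mult.commute)
qed

text \<open>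
Where the translate of \<open>p\<close> by \<open>s\<close> is nonzero, \<open>u(t)\<close> may be replaced by \<open>u(s) + \<eta>\<close>. This turns a cover
of \<open>h\<close> into a cover of \<open>u h\<close> with weights multiplied by values of \<open>u\<close>.
\<close>

lemma comb_weighted:
  assumes "\<forall>x\<in>set xs. 0 \<le> fst x" "\<forall>r. 0 \<le> p r" "\<forall>s. p (- s + t) \<noteq> 0 \<longrightarrow> u t \<le> u s + \<eta>"
  shows "u t * comb p xs t \<le> comb p (map (\<lambda>x. (fst x * (u (snd x) + \<eta>), snd x)) xs) t"
  using assms(1)
proof (induction xs)
  case (Cons x xs)
  have "u t * (fst x * p (- snd x + t)) \<le> fst x * (u (snd x) + \<eta>) * p (- snd x + t)"
  proof (cases "p (- snd x + t) = 0")
    case False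
    then have "u t \<le> u (snd x) + \<eta>" using assms(3) by auto
    then have "u t * (fst x * p (- snd x + t)) \<le> (u (snd x) + \<eta>) * (fst x * p (- snd x + t))"
      using Cons.prems assms(2) by (intro mult_right_mono) auto
    then show ?thesis by (simp add: algebra_simps)
  qed simp
  then show ?case using Cons by (simp add: distrib_left)
qed simp

lemma weight_weighted:
  assumes "\<forall>x\<in>set xs. 0 \<le> fst x" "\<forall>s. u s + v s \<le> (1::real)"
  shows "weight (map (\<lambda>x. (fst x * (u (snd x) + \<eta>), snd x)) xs) + weight (map (\<lambda>x. (fst x * (v (snd x) + \<eta>), snd x)) xs)
     \<le> (1 + 2 * \<eta>) * weight xs"
  using assms(1)
proof (induction xs)
  case (Cons x xs)
  have "fst x * (u (snd x) + v (snd x) + 2 * \<eta>) \<le> fst x * (1 + 2 * \<eta>)"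
    using Cons.prems assms(2) by (intro mult_left_mono) auto
  then show ?case using Cons by (simp add: algebra_simps)
qed simp

section \<open>Existence of the Haar functional\<close>

context
  assumes lc: "locally_compact_space (euclidean :: 'g::{topological_group_add, t2_space} topology)"
begin

lemma covers_exist:
  assumes f: "(f :: 'g \<Rightarrow> real) \<in> Cc_pos" and p: "p \<in> Cc_pos" and a: "p a > 0"
  shows "\<exists>xs. covers f p xs"
proof -
  obtain K where K: "compact K" "\<forall>x. x \<notin> K \<longrightarrow> f x = 0" using Cc_posD(3) [OF f] by auto
  obtain M where M: "M > 0" "\<forall>x. f x \<le> M" using Cc_pos_bounded [OF f] .
  have opn: "open {t. p (- s + t) > p a / 2}" for s
    by (intro open_Collect_less continuous_on_left_translate [OF Cc_posD(1) [OF p]] continuous_intros)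
  have KS: "K \<subseteq> (\<Union>s\<in>UNIV. {t. p (- s + t) > p a / 2})"
  proof
    fix t assume "t \<in> K"
    have "- (t + - a) + t = a" by (simp add: minus_add add.assoc)
    then have "t \<in> {t'. p (- (t + - a) + t') > p a / 2}" using a by simp
    then show "t \<in> (\<Union>s\<in>UNIV. {t. p (- s + t) > p a / 2})" by blast
  qed
  obtain S where S: "S \<subseteq> UNIV" "finite S" "K \<subseteq> (\<Union>s\<in>S. {t. p (- s + t) > p a / 2})"
    by (rule compactE_image [OF K(1) opn KS])
  obtain ss where ss: "set ss = S" using finite_list [OF S(2)] by auto
  let ?c = "2 * M / p a"
  have c: "?c > 0" using M a by simp
  have ge: "?c * p (- s + t) \<le> comb p (map (\<lambda>s. (?c, s)) ss) t" if "s \<in> set ss" for s t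
    using that
  proof (induction ss)
    case (Cons s' ss)
    have "0 \<le> comb p (map (\<lambda>s. (?c, s)) ss) t" using c Cc_posD(2) [OF p] by (intro comb_nonneg) auto
    moreover have "0 \<le> ?c * p (- s' + t)" using c Cc_posD(2) [OF p] by (intro mult_nonneg_nonneg) auto
    ultimately show ?case using Cons by auto
  qed simp
  have "f t \<le> comb p (map (\<lambda>s. (?c, s)) ss) t" for t
  proof (cases "t \<in> K")
    case True
    have "t \<in> (\<Union>s\<in>S. {t. p (- s + t) > p a / 2})" using S(3) True by (rule subsetD)
    then obtain s where s: "s \<in> S" "p (- s + t) > p a / 2" by (elim UN_E CollectE)
    have "f t \<le> M" using M by simp
    also have "M = ?c * (p a / 2)" using a by simp
    also have "\<dots> \<le> ?c * p (- s + t)" using s c by (intro mult_left_mono) auto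
    also have "\<dots> \<le> comb p (map (\<lambda>s. (?c, s)) ss) t" using ge s ss by auto
    finally show ?thesis .
  next
    case False
    then show ?thesis using K(2) c Cc_posD(2) [OF p] comb_nonneg [of "map (\<lambda>s. (?c, s)) ss" p t] by auto
  qed
  then show ?thesis using c by (intro exI [of _ "map (\<lambda>s. (?c, s)) ss"]) (auto simp: covers_def)
qed

lemma covering_number_pos:
  assumes f: "(f :: 'g \<Rightarrow> real) \<in> Cc_pos" "f b > 0" and p: "p \<in> Cc_pos" "p a > 0"
  shows "covering_number f p > 0"
proof -
  obtain M where M: "M > 0" "\<forall>x. p x \<le> M" using Cc_pos_bounded [OF p(1)] .
  obtain xs0 where xs0: "covers f p xs0" using covers_exist [OF f(1) p] by auto
  have "f b / M \<le> covering_number f p"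
  proof (rule covering_number_ge [OF xs0])
    fix xs assume "covers f p xs"
    then have "f b \<le> weight xs * M" using comb_le_weight [of xs p M b] M(2) unfolding covers_def by (meson order_trans)
    then show "f b / M \<le> weight xs" using M(1) by (simp add: pos_divide_le_eq)
  qed
  then show ?thesis using f(2) M(1) by (smt (verit) divide_pos_pos)
qed

lemma left_uniformly_continuous:
  fixes u :: "'g \<Rightarrow> real"
  assumes u: "continuous_on UNIV u" and K: "compact K" "\<And>x. x \<notin> K \<Longrightarrow> u x = 0" and \<eta>: "\<eta> > 0"
  obtains V where "open V" "0 \<in> V" "\<forall>s t. - s + t \<in> V \<longrightarrow> \<bar>u t - u s\<bar> < \<eta>"
proof -
  have c1: "continuous_on UNIV (\<lambda>z :: 'g \<times> 'g. complex_of_real (u (fst z + snd z)))"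
    by (intro continuous_on_of_real continuous_on_compose2 [OF u] continuous_intros) auto
  have c2: "continuous_on UNIV (\<lambda>z :: 'g \<times> 'g. complex_of_real (u (fst z + - snd z)))"
    by (intro continuous_on_of_real continuous_on_compose2 [OF u] continuous_intros) auto
  obtain V1 where V1: "open V1" "0 \<in> V1" "\<forall>x\<in>K. \<forall>y\<in>V1. cmod (complex_of_real (u (fst (x, y) + snd (x, y))) - complex_of_real (u (fst (x, 0::'g) + snd (x, 0::'g)))) < \<eta>"
    by (rule compact_uniform [OF K(1) c1 \<eta>])
  obtain V2 where V2: "open V2" "0 \<in> V2" "\<forall>x\<in>K. \<forall>y\<in>V2. cmod (complex_of_real (u (fst (x, y) + - snd (x, y))) - complex_of_real (u (fst (x, 0::'g) + - snd (x, 0::'g)))) < \<eta>"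
    by (rule compact_uniform [OF K(1) c2 \<eta>])
  have 1: "\<bar>u (x + y) - u x\<bar> < \<eta>" if "x \<in> K" "y \<in> V1" for x y
  proof -
    have "cmod (complex_of_real (u (x + y)) - complex_of_real (u x)) < \<eta>" using V1(3) that by simp
    then show ?thesis by (simp only: of_real_diff [symmetric] norm_of_real)
  qed
  have 2: "\<bar>u (x + - y) - u x\<bar> < \<eta>" if "x \<in> K" "y \<in> V2" for x y
  proof -
    have "cmod (complex_of_real (u (x + - y)) - complex_of_real (u x)) < \<eta>" using V2(3) that by simp
    then show ?thesis by (simp only: of_real_diff [symmetric] norm_of_real)
  qed
  show ?thesis
  proof (rule that [of "V1 \<inter> V2"]; (intro allI impI)?)
    fix s t assume st: "- s + t \<in> V1 \<inter> V2"
    show "\<bar>u t - u s\<bar> < \<eta>"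
    proof (cases "s \<in> K")
      case True
      then show ?thesis using 1 [of s "- s + t"] st by simp
    next
      case s: False
      show ?thesis
      proof (cases "t \<in> K")
        case True
        have "t + - (- s + t) = s" by (simp add: minus_add add.assoc [symmetric])
        then have "\<bar>u s - u t\<bar> < \<eta>" using 2 [OF True, of "- s + t"] st by simp
        then show ?thesis by simp
      qed (use s K \<eta> in simp)
    qed
  qed (use V1 V2 in auto)
qed

text \<open>
Put \<open>h = f + g + \<delta> w\<close> with a cutoff \<open>w\<close>, and write \<open>f = u h\<close>, \<open>g = v h\<close> with \<open>u + v \<le> 1\<close>. If the support
of \<open>p\<close> is small, \<open>u\<close> and \<open>v\<close> are nearly constant on its translates. Hence a cover of \<open>h\<close> with weights
\<open>c\<^sub>i\<close> yields covers of \<open>f\<close> and \<open>g\<close> with weights about \<open>u(s\<^sub>i) c\<^sub>i\<close> and \<open>v(s\<^sub>i) c\<^sub>i\<close>, of total weight at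
most about that of the cover of \<open>h\<close>.
\<close>

lemma covering_number_almost_additive:
  assumes f: "(f :: 'g \<Rightarrow> real) \<in> Cc_pos" and g: "g \<in> Cc_pos" and f0: "f0 \<in> Cc_pos" "f0 a > 0" and \<epsilon>: "\<epsilon> > 0"
  obtains V where "open V" "0 \<in> V"
    "\<forall>p\<in>Cc_pos. \<forall>b. p b > 0 \<longrightarrow> (\<forall>x. p x \<noteq> 0 \<longrightarrow> x \<in> V) \<longrightarrow>
       covering_number f p + covering_number g p \<le> covering_number (\<lambda>t. f t + g t) p + \<epsilon> * covering_number f0 p"
proof -
  obtain K where K: "compact K" "\<forall>x. x \<notin> K \<longrightarrow> f x = 0" using Cc_posD(3) [OF f] by auto
  obtain L where L: "compact L" "\<forall>x. x \<notin> L \<longrightarrow> g x = 0" using Cc_posD(3) [OF g] by auto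
  note KL = compact_Un [OF K(1) L(1)]
  obtain w :: "'g \<Rightarrow> real" and Q where w: "continuous_on UNIV w" "\<forall>x. 0 \<le> w x \<and> w x \<le> 1" "\<forall>x\<in>K \<union> L. w x = 1"
    "compact Q" "\<forall>x. x \<notin> UNIV \<inter> Q \<longrightarrow> w x = 0"
    using bump_function [OF lc KL open_UNIV subset_UNIV] .
  have wC: "w \<in> Cc_pos" by (rule Cc_posI [OF w(1) _ w(4)]) (use w in auto)
  have fg: "(\<lambda>t. f t + g t) \<in> Cc_pos" by (rule Cc_pos_add [OF f g])
  define B where "B = covering_number (\<lambda>t. f t + g t) f0"
  define C where "C = covering_number w f0"
  obtain xB where xB: "covers (\<lambda>t. f t + g t) f0 xB" using covers_exist [OF fg f0] by auto
  obtain xC where xC: "covers w f0 xC" using covers_exist [OF wC f0] by auto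
  have B0: "B \<ge> 0" unfolding B_def by (rule covering_number_ge [OF xB]) (auto simp: covers_def intro: weight_nonneg)
  have C0: "C \<ge> 0" unfolding C_def by (rule covering_number_ge [OF xC]) (auto simp: covers_def intro: weight_nonneg)
  define \<eta> where "\<eta> = min 1 (\<epsilon> / (4 * (B + 1)))"
  define \<delta> where "\<delta> = \<epsilon> / (6 * (C + 1))"
  have \<eta>: "\<eta> > 0" "\<eta> \<le> 1" "2 * \<eta> * B \<le> \<epsilon> / 2"
  proof -
    show "\<eta> > 0" "\<eta> \<le> 1" using \<epsilon> B0 by (auto simp: \<eta>_def)
    have "2 * \<eta> * B \<le> 2 * (\<epsilon> / (4 * (B + 1))) * B" using B0 by (intro mult_right_mono mult_left_mono) (auto simp: \<eta>_def)
    also have "\<dots> = (\<epsilon> / 2) * (B / (B + 1))" using B0 by (simp add: field_simps)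
    also have "\<dots> \<le> (\<epsilon> / 2) * 1" using B0 \<epsilon> by (intro mult_left_mono) auto
    finally show "2 * \<eta> * B \<le> \<epsilon> / 2" by simp
  qed
  have \<delta>: "\<delta> > 0" "3 * \<delta> * C \<le> \<epsilon> / 2"
  proof -
    show "\<delta> > 0" using \<epsilon> C0 by (auto simp: \<delta>_def)
    have "3 * \<delta> * C = (\<epsilon> / 2) * (C / (C + 1))" using C0 by (simp add: \<delta>_def field_simps)
    also have "\<dots> \<le> (\<epsilon> / 2) * 1" using C0 \<epsilon> by (intro mult_left_mono) auto
    finally show "3 * \<delta> * C \<le> \<epsilon> / 2" by simp
  qed
  define h where "h t = f t + g t + \<delta> * w t" for t
  define D where "D t = max \<delta> (h t)" for t
  define u where "u t = f t / D t" for t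
  define v where "v t = g t / D t" for t
  have hC: "h \<in> Cc_pos" unfolding h_def by (intro Cc_pos_add [OF fg] Cc_pos_scale wC) (use \<delta> in simp)
  have D0: "D t > 0" for t using \<delta> by (auto simp: D_def less_max_iff_disj)
  have cD: "continuous_on UNIV D" unfolding D_def using Cc_posD(1) [OF hC] by (intro continuous_on_max continuous_on_const)
  have cu: "continuous_on UNIV u" unfolding u_def
    using D0 by (intro continuous_on_divide Cc_posD(1) [OF f] cD) (auto simp: less_imp_neq [symmetric])
  have cv: "continuous_on UNIV v" unfolding v_def
    using D0 by (intro continuous_on_divide Cc_posD(1) [OF g] cD) (auto simp: less_imp_neq [symmetric])
  have fgh: "f t + g t \<le> h t" for t using \<delta> w(2) by (simp add: h_def)
  have Dh: "D t = h t" if "t \<in> K \<union> L" for t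
  proof -
    have "w t = 1" using w(3) that by blast
    then have "\<delta> \<le> h t" using Cc_posD(2) [OF fg, of t] by (simp add: h_def)
    then show ?thesis by (simp add: D_def max_def)
  qed
  \<comment> \<open>truncating the divisor at \<open>\<delta>\<close> makes the quotients continuous; on the supports nothing is cut off\<close>
  have fu: "f t = u t * h t" for t
  proof (cases "t \<in> K")
    case True
    then show ?thesis using Dh [of t] D0 [of t] by (simp add: u_def)
  qed (use K in \<open>simp add: u_def\<close>)
  have gv: "g t = v t * h t" for t
  proof (cases "t \<in> L")
    case True
    then show ?thesis using Dh [of t] D0 [of t] by (simp add: v_def)
  qed (use L in \<open>simp add: v_def\<close>)
  have uv: "\<forall>t. u t + v t \<le> 1"
  proof
    fix t
    have "f t + g t \<le> D t" using fgh [of t] by (simp add: D_def le_max_iff_disj)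
    then show "u t + v t \<le> 1" using D0 [of t] by (simp add: u_def v_def add_divide_distrib [symmetric])
  qed
  have u0: "u x = 0" if "x \<notin> K" for x using K that by (simp add: u_def)
  have v0: "v x = 0" if "x \<notin> L" for x using L that by (simp add: v_def)
  obtain V1 where V1: "open V1" "0 \<in> V1" "\<forall>s t. - s + t \<in> V1 \<longrightarrow> \<bar>u t - u s\<bar> < \<eta>"
    using left_uniformly_continuous [OF cu K(1) u0 \<eta>(1)] .
  obtain V2 where V2: "open V2" "0 \<in> V2" "\<forall>s t. - s + t \<in> V2 \<longrightarrow> \<bar>v t - v s\<bar> < \<eta>"
    using left_uniformly_continuous [OF cv L(1) v0 \<eta>(1)] .
  show ?thesis
  proof (rule that [of "V1 \<inter> V2"]; (intro ballI allI impI)?)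
    fix p b assume p: "p \<in> Cc_pos" "p b > 0" and supp: "\<forall>x. p x \<noteq> 0 \<longrightarrow> x \<in> V1 \<inter> V2"
    have p0: "\<forall>r. 0 \<le> p r" using Cc_posD(2) [OF p(1)] by simp
    have su: "\<forall>s. p (- s + t) \<noteq> 0 \<longrightarrow> u t \<le> u s + \<eta>" for t
    proof (intro allI impI)
      fix s assume "p (- s + t) \<noteq> 0"
      then have "\<bar>u t - u s\<bar> < \<eta>" using supp V1(3) by blast
      then show "u t \<le> u s + \<eta>" by simp
    qed
    have sv: "\<forall>s. p (- s + t) \<noteq> 0 \<longrightarrow> v t \<le> v s + \<eta>" for t
    proof (intro allI impI)
      fix s assume "p (- s + t) \<noteq> 0"
      then have "\<bar>v t - v s\<bar> < \<eta>" using supp V2(3) by blast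
      then show "v t \<le> v s + \<eta>" by simp
    qed
    have upos: "u s \<ge> 0" "v s \<ge> 0" for s
      using Cc_posD(2) [OF f] Cc_posD(2) [OF g] D0 by (auto simp: u_def v_def less_imp_le)
    obtain xh where xh: "covers h p xh" using covers_exist [OF hC p] by auto
    obtain xfg where xfg: "covers (\<lambda>t. f t + g t) p xfg" using covers_exist [OF fg p] by auto
    obtain xw where xw: "covers w p xw" using covers_exist [OF wC p] by auto
    obtain xf0 where xf0: "covers f0 p xf0" using covers_exist [OF f0(1) p] by auto
    have f0p: "covering_number f0 p \<ge> 0" by (rule covering_number_ge [OF xf0]) (auto simp: covers_def intro: weight_nonneg)
    have "covering_number f p + covering_number g p \<le> covering_number h p * (1 + 2 * \<eta>)"
    proof (rule covering_number_ge_mult [OF xh])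
      fix xs assume xs: "covers h p xs"
      then have nn: "\<forall>x\<in>set xs. 0 \<le> fst x" and hxs: "\<forall>t. h t \<le> comb p xs t" by (auto simp: covers_def)
      let ?xu = "map (\<lambda>x. (fst x * (u (snd x) + \<eta>), snd x)) xs"
      let ?xv = "map (\<lambda>x. (fst x * (v (snd x) + \<eta>), snd x)) xs"
      have "f t \<le> comb p ?xu t" for t
      proof -
        have "f t \<le> u t * comb p xs t" unfolding fu [of t] using hxs upos by (intro mult_left_mono) auto
        also have "\<dots> \<le> comb p ?xu t" by (rule comb_weighted [OF nn p0 su])
        finally show ?thesis .
      qed
      then have "covers f p ?xu" using nn upos \<eta>(1) by (auto simp: covers_def intro!: mult_nonneg_nonneg add_nonneg_nonneg)
      moreover have "g t \<le> comb p ?xv t" for t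
      proof -
        have "g t \<le> v t * comb p xs t" unfolding gv [of t] using hxs upos by (intro mult_left_mono) auto
        also have "\<dots> \<le> comb p ?xv t" by (rule comb_weighted [OF nn p0 sv])
        finally show ?thesis .
      qed
      then have "covers g p ?xv" using nn upos \<eta>(1) by (auto simp: covers_def intro!: mult_nonneg_nonneg add_nonneg_nonneg)
      ultimately have "covering_number f p + covering_number g p \<le> weight ?xu + weight ?xv"
        by (intro add_mono covering_number_le)
      also have "\<dots> \<le> (1 + 2 * \<eta>) * weight xs" by (rule weight_weighted [OF nn uv])
      finally show "covering_number f p + covering_number g p \<le> weight xs * (1 + 2 * \<eta>)" by (simp add: mult.commute)
    qed (use \<eta>(1) in simp)
    also have "\<dots> \<le> (covering_number (\<lambda>t. f t + g t) p + covering_number w p * \<delta>) * (1 + 2 * \<eta>)"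
    proof (rule mult_right_mono)
      have xdw: "covers (\<lambda>t. \<delta> * w t) p (map (\<lambda>x. (\<delta> * fst x, 0 + snd x)) xw)"
        using xw \<delta>(1) unfolding covers_def comb_map by (auto simp: mult_left_mono)
      have "covering_number h p \<le> covering_number (\<lambda>t. f t + g t) p + covering_number (\<lambda>t. \<delta> * w t) p"
        using covering_number_subadd [OF xfg xdw] unfolding h_def .
      also have "covering_number (\<lambda>t. \<delta> * w t) p \<le> covering_number w p * \<delta>"
        by (rule covering_number_scale_le [OF xw]) (use \<delta> in simp)
      finally show "covering_number h p \<le> covering_number (\<lambda>t. f t + g t) p + covering_number w p * \<delta>" by simp
    qed (use \<eta>(1) in simp)
    also have "\<dots> = covering_number (\<lambda>t. f t + g t) p + 2 * \<eta> * covering_number (\<lambda>t. f t + g t) p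
        + (1 + 2 * \<eta>) * \<delta> * covering_number w p" by (simp add: algebra_simps)
    also have "\<dots> \<le> covering_number (\<lambda>t. f t + g t) p + 2 * \<eta> * (B * covering_number f0 p) + 3 * \<delta> * (C * covering_number f0 p)"
    proof (intro add_mono order_refl mult_left_mono mult_mono)
      show "covering_number (\<lambda>t. f t + g t) p \<le> B * covering_number f0 p"
        unfolding B_def by (rule covering_number_trans [OF xB xf0])
      show "covering_number w p \<le> C * covering_number f0 p"
        unfolding C_def by (rule covering_number_trans [OF xC xf0])
      show "0 \<le> covering_number w p" by (rule covering_number_ge [OF xw]) (auto simp: covers_def intro: weight_nonneg)
    qed (use \<eta> \<delta> in auto)
    also have "\<dots> = covering_number (\<lambda>t. f t + g t) p + (2 * \<eta> * B + 3 * \<delta> * C) * covering_number f0 p" by (simp add: algebra_simps)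
    also have "\<dots> \<le> covering_number (\<lambda>t. f t + g t) p + \<epsilon> * covering_number f0 p"
      using \<eta>(3) \<delta>(2) f0p by (intro add_left_mono mult_right_mono) auto
    finally show "covering_number f p + covering_number g p \<le> covering_number (\<lambda>t. f t + g t) p + \<epsilon> * covering_number f0 p" .
  qed (use V1 V2 in auto)
qed

text \<open>
The quotients \<open>(f : p) / (f0 : p)\<close> are invariant, subadditive and bounded by \<open>(f : f0)\<close>, and additive up
to an error that vanishes as the support of \<open>p\<close> shrinks to zero. By Tychonoff's theorem they have a
cluster point, and closed conditions that hold for all small supports pass to it.
\<close>

theorem haar_functional_pos:
  obtains I :: "('g \<Rightarrow> real) \<Rightarrow> real" where
    "\<forall>f\<in>Cc_pos. 0 \<le> I f"
    "\<forall>f\<in>Cc_pos. \<forall>g\<in>Cc_pos. I (\<lambda>t. f t + g t) = I f + I g"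
    "\<forall>f\<in>Cc_pos. \<forall>c\<ge>0. I (\<lambda>t. c * f t) = c * I f"
    "\<forall>f\<in>Cc_pos. \<forall>a. I (\<lambda>t. f (a + t)) = I f"
    "\<forall>f\<in>Cc_pos. \<forall>a. f a > 0 \<longrightarrow> I f > 0"
proof -
  obtain f0 :: "'g \<Rightarrow> real" and Q where w: "continuous_on UNIV f0" "\<forall>x. 0 \<le> f0 x \<and> f0 x \<le> 1" "\<forall>x\<in>{0}. f0 x = 1"
    "compact Q" "\<forall>x. x \<notin> UNIV \<inter> Q \<longrightarrow> f0 x = 0"
    using bump_function [OF lc compact_sing open_UNIV subset_UNIV] .
  have f0: "f0 \<in> Cc_pos" "f0 0 > 0" using w by (auto intro: Cc_posI [OF w(1) _ w(4)])
  define J where "J p f = (if f \<in> Cc_pos then covering_number f p / covering_number f0 p else 0)" for p f :: "'g \<Rightarrow> real"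
  define \<Phi> where "\<Phi> V = {p :: 'g \<Rightarrow> real. p \<in> Cc_pos \<and> (\<exists>b. p b > 0) \<and> (\<forall>x. p x \<noteq> 0 \<longrightarrow> x \<in> V)}" for V
  define B where "B f = (if f \<in> Cc_pos then {0..covering_number f f0} else {0})" for f :: "'g \<Rightarrow> real"
  have ex: "\<exists>xs. covers f p xs" if "f \<in> Cc_pos" "p \<in> \<Phi> V" for f p V
    using that covers_exist [OF that(1)] by (auto simp: \<Phi>_def)
  have f0p: "covering_number f0 p > 0" if "p \<in> \<Phi> V" for p V
    using that covering_number_pos [OF f0] by (auto simp: \<Phi>_def)
  have cn0: "0 \<le> covering_number f p" if fp: "f \<in> Cc_pos" "p \<in> \<Phi> V" for f p V
  proof -
    obtain xs where "covers f p xs" using ex [OF fp] by auto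
    then show ?thesis by (rule covering_number_ge) (auto simp: covers_def intro: weight_nonneg)
  qed
  have JB: "J p \<in> PiE UNIV B" if p: "p \<in> \<Phi> V" for p V
  proof -
    have "J p f \<in> B f" for f
    proof (cases "f \<in> Cc_pos")
      case True
      obtain xs where xs: "covers f f0 xs" using covers_exist [OF True f0] by auto
      obtain ys where ys: "covers f0 p ys" using ex [OF f0(1) p] by auto
      have "covering_number f p \<le> covering_number f f0 * covering_number f0 p" by (rule covering_number_trans [OF xs ys])
      then show ?thesis using True f0p [OF p] cn0 [OF True p] by (simp add: J_def B_def pos_divide_le_eq)
    qed (simp add: J_def B_def)
    then show ?thesis by auto
  qed
  have "compact (PiE UNIV B)"
  proof -
    have "compactin (product_topology (\<lambda>_. euclidean) UNIV) (PiE UNIV B)"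
      unfolding compactin_PiE by (auto simp: B_def)
    then show ?thesis by (simp add: euclidean_product_topology)
  qed
  note cpt = this
  define \<V> where "\<V> = {V :: 'g set. open V \<and> 0 \<in> V}"
  have fip: "PiE UNIV B \<inter> \<Inter>F' \<noteq> {}" if F': "finite F'" "F' \<subseteq> (\<lambda>V. closure (J ` \<Phi> V)) ` \<V>" for F'
  proof -
    obtain W where W: "W \<subseteq> \<V>" "finite W" "F' = (\<lambda>V. closure (J ` \<Phi> V)) ` W" using finite_subset_image [OF F'] by auto
    have op: "open (\<Inter>W)" "{0} \<subseteq> \<Inter>W" using W by (auto simp: \<V>_def)
    obtain p :: "'g \<Rightarrow> real" and L where p: "continuous_on UNIV p" "\<forall>x. 0 \<le> p x \<and> p x \<le> 1" "\<forall>x\<in>{0}. p x = 1"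
      "compact L" "\<forall>x. x \<notin> \<Inter>W \<inter> L \<longrightarrow> p x = 0"
      using bump_function [OF lc compact_sing op] .
    have pC: "p \<in> Cc_pos" by (rule Cc_posI [OF p(1) _ p(4)]) (use p in auto)
    have "p 0 > 0" using p(3) by simp
    moreover have "p x = 0" if "x \<notin> V" "V \<in> W" for x V using p(5) that by blast
    ultimately have "p \<in> \<Phi> V" if "V \<in> W" for V using pC that unfolding \<Phi>_def by blast
    moreover have "p \<in> \<Phi> UNIV" using pC \<open>p 0 > 0\<close> by (auto simp: \<Phi>_def)
    ultimately have pW: "\<And>V. V \<in> W \<Longrightarrow> p \<in> \<Phi> V" and pU: "p \<in> \<Phi> UNIV" by auto
    have "J p \<in> closure (J ` \<Phi> V)" if "V \<in> W" for V
      by (rule subsetD [OF closure_subset imageI [OF pW [OF that]]])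
    then have "J p \<in> \<Inter>F'" unfolding W(3) by (rule INT_I)
    then have "J p \<in> PiE UNIV B \<inter> \<Inter>F'" using JB [OF pU] by (rule IntI [rotated])
    then show ?thesis by (metis emptyE)
  qed
  have "PiE UNIV B \<inter> \<Inter>((\<lambda>V. closure (J ` \<Phi> V)) ` \<V>) \<noteq> {}"
  proof (rule compact_imp_fip [OF cpt _ fip])
    fix T assume "T \<in> (\<lambda>V. closure (J ` \<Phi> V)) ` \<V>"
    then obtain V where "T = closure (J ` \<Phi> V)" by (rule imageE)
    then show "closed T" by simp
  qed
  then obtain I where "I \<in> \<Inter>((\<lambda>V. closure (J ` \<Phi> V)) ` \<V>)" by (metis IntD2 ex_in_conv)
  then have I: "I \<in> closure (J ` \<Phi> V)" if "open V" "0 \<in> V" for V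
    using that unfolding \<V>_def by (elim INT_E) auto
  have transfer: "I \<in> S" if V: "open V" "0 \<in> V" and S: "closed S" "\<And>p. p \<in> \<Phi> V \<Longrightarrow> J p \<in> S" for V S
  proof -
    have "J ` \<Phi> V \<subseteq> S" using S(2) by (rule image_subsetI)
    from closure_minimal [OF this S(1)] I [OF V] show ?thesis by (rule subsetD)
  qed
  have coord: "continuous_on UNIV (\<lambda>x::('g \<Rightarrow> real) \<Rightarrow> real. x f)" for f by simp
  have pos: "0 \<le> I f" if f: "f \<in> Cc_pos" for f
  proof -
    have "I \<in> {x. 0 \<le> x f}"
    proof (rule transfer [OF open_UNIV UNIV_I])
      show "closed {x::('g \<Rightarrow> real) \<Rightarrow> real. 0 \<le> x f}" by (intro closed_Collect_le continuous_on_const coord)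
      show "J p \<in> {x. 0 \<le> x f}" if "p \<in> \<Phi> UNIV" for p
        using f cn0 [OF f that] f0p [OF that] by (simp add: J_def)
    qed
    then show ?thesis by simp
  qed
  have one: "I f0 = 1"
  proof -
    have "I \<in> {x. x f0 = 1}"
    proof (rule transfer [OF open_UNIV UNIV_I])
      show "closed {x::('g \<Rightarrow> real) \<Rightarrow> real. x f0 = 1}" by (intro closed_Collect_eq continuous_on_const coord)
      show "J p \<in> {x. x f0 = 1}" if "p \<in> \<Phi> UNIV" for p
        using f0 f0p [OF that] by (simp add: J_def)
    qed
    then show ?thesis by simp
  qed
  have transl: "I (\<lambda>t. f (a + t)) = I f" if f: "f \<in> Cc_pos" for f a
  proof -
    have "I \<in> {x. x (\<lambda>t. f (a + t)) = x f}"
    proof (rule transfer [OF open_UNIV UNIV_I])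
      show "closed {x::('g \<Rightarrow> real) \<Rightarrow> real. x (\<lambda>t. f (a + t)) = x f}" by (intro closed_Collect_eq coord)
      fix p assume p: "p \<in> \<Phi> UNIV"
      obtain xs where "covers f p xs" using ex [OF f p] by auto
      from covering_number_translate [OF this, of a] show "J p \<in> {x. x (\<lambda>t. f (a + t)) = x f}"
        using f Cc_pos_translate [OF f] by (simp add: J_def)
    qed
    then show ?thesis by simp
  qed
  have scale: "I (\<lambda>t. c * f t) = c * I f" if f: "f \<in> Cc_pos" and c: "c \<ge> 0" for f c
  proof -
    have "I \<in> {x. x (\<lambda>t. c * f t) = c * x f}"
    proof (rule transfer [OF open_UNIV UNIV_I])
      show "closed {x::('g \<Rightarrow> real) \<Rightarrow> real. x (\<lambda>t. c * f t) = c * x f}"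
        by (intro closed_Collect_eq coord continuous_on_mult_left)
      fix p assume p: "p \<in> \<Phi> UNIV"
      note cf = Cc_pos_scale [OF f c]
      obtain xs where xs: "covers f p xs" using ex [OF f p] by auto
      obtain ys where ys: "covers (\<lambda>t. c * f t) p ys" using ex [OF cf p] by auto
      have 1: "covering_number (\<lambda>t. c * f t) p \<le> covering_number f p * c" by (rule covering_number_scale_le [OF xs c])
      have "covering_number (\<lambda>t. c * f t) p = c * covering_number f p"
      proof (cases "c = 0")
        case True
        then show ?thesis using 1 cn0 [OF cf p] by simp
      next
        case False
        then have "covering_number f p \<le> covering_number (\<lambda>t. c * f t) p * (1 / c)"
          using covering_number_scale_le [OF ys, of "1 / c"] c by simp
        then have "c * covering_number f p \<le> covering_number (\<lambda>t. c * f t) p" using False c by (simp add: field_simps)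
        then show ?thesis using 1 by (simp add: mult.commute)
      qed
      then show "J p \<in> {x. x (\<lambda>t. c * f t) = c * x f}" using f cf by (simp add: J_def)
    qed
    then show ?thesis by simp
  qed
  have add: "I (\<lambda>t. f t + g t) = I f + I g" if f: "f \<in> Cc_pos" and g: "g \<in> Cc_pos" for f g
  proof -
    note fg = Cc_pos_add [OF f g]
    have "I (\<lambda>t. f t + g t) \<le> I f + I g \<and> I f + I g \<le> I (\<lambda>t. f t + g t) + \<epsilon>" if \<epsilon>: "\<epsilon> > 0" for \<epsilon>
    proof -
      obtain V where V: "open V" "0 \<in> V"
        "\<forall>p\<in>Cc_pos. \<forall>b. p b > 0 \<longrightarrow> (\<forall>x. p x \<noteq> 0 \<longrightarrow> x \<in> V) \<longrightarrow>
           covering_number f p + covering_number g p \<le> covering_number (\<lambda>t. f t + g t) p + \<epsilon> * covering_number f0 p"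
        using covering_number_almost_additive [OF f g f0 \<epsilon>] .
      have "I \<in> {x. x (\<lambda>t. f t + g t) \<le> x f + x g} \<inter> {x. x f + x g \<le> x (\<lambda>t. f t + g t) + \<epsilon>}"
      proof (rule transfer [OF V(1,2)])
        show "closed ({x::('g \<Rightarrow> real) \<Rightarrow> real. x (\<lambda>t. f t + g t) \<le> x f + x g} \<inter> {x. x f + x g \<le> x (\<lambda>t. f t + g t) + \<epsilon>})"
          by (intro closed_Int closed_Collect_le coord continuous_on_add continuous_on_const)
        fix p assume p: "p \<in> \<Phi> V"
        obtain xs where xs: "covers f p xs" using ex [OF f p] by auto
        obtain ys where ys: "covers g p ys" using ex [OF g p] by auto
        have 1: "covering_number (\<lambda>t. f t + g t) p \<le> covering_number f p + covering_number g p"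
          by (rule covering_number_subadd [OF xs ys])
        have 2: "covering_number f p + covering_number g p \<le> covering_number (\<lambda>t. f t + g t) p + \<epsilon> * covering_number f0 p"
          using V(3) p unfolding \<Phi>_def by blast
        have d: "covering_number f0 p > 0" by (rule f0p [OF p])
        have "covering_number (\<lambda>t. f t + g t) p / covering_number f0 p \<le> covering_number f p / covering_number f0 p + covering_number g p / covering_number f0 p"
          using 1 d by (simp add: add_divide_distrib [symmetric] divide_right_mono)
        moreover have "(covering_number f p + covering_number g p) / covering_number f0 p \<le> (covering_number (\<lambda>t. f t + g t) p + \<epsilon> * covering_number f0 p) / covering_number f0 p"
          using 2 d by (intro divide_right_mono) auto
        then have "covering_number f p / covering_number f0 p + covering_number g p / covering_number f0 p \<le> covering_number (\<lambda>t. f t + g t) p / covering_number f0 p + \<epsilon>"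
          using d by (simp add: add_divide_distrib)
        ultimately show "J p \<in> {x. x (\<lambda>t. f t + g t) \<le> x f + x g} \<inter> {x. x f + x g \<le> x (\<lambda>t. f t + g t) + \<epsilon>}"
          using f g fg by (simp add: J_def)
      qed
      then show ?thesis by simp
    qed
    note 3 = this
    have "I (\<lambda>t. f t + g t) \<le> I f + I g" using 3 [OF zero_less_one] by simp
    moreover have "I f + I g \<le> I (\<lambda>t. f t + g t)" by (rule field_le_epsilon) (use 3 in simp)
    ultimately show ?thesis by simp
  qed
  have strict: "I f > 0" if f: "f \<in> Cc_pos" and a: "f a > 0" for f a
  proof -
    obtain xs where xs: "covers f0 f xs" using covers_exist [OF f0(1) f a] by auto
    have mono: "I g \<le> I h" if g: "g \<in> Cc_pos" and h: "h \<in> Cc_pos" and le: "\<And>t. g t \<le> h t" for g h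
    proof -
      have "(\<lambda>t. h t - g t) \<in> Cc_pos"
      proof -
        obtain K where K: "compact K" "\<forall>x. x \<notin> K \<longrightarrow> h x = 0" using Cc_posD(3) [OF h] by auto
        have "g x = 0" if "x \<notin> K" for x using le [of x] Cc_posD(2) [OF g, of x] K that by simp
        then show ?thesis using K le
          by (intro Cc_posI [OF continuous_on_diff [OF Cc_posD(1) [OF h] Cc_posD(1) [OF g]] _ K(1)]) auto
      qed
      from add [OF this g] pos [OF this] show ?thesis by simp
    qed
    \<comment> \<open>invariance gives \<open>1 = I f0 \<le> weight xs * I f\<close> for every cover \<open>xs\<close> of \<open>f0\<close> by translates of \<open>f\<close>\<close>
    have "comb f xs \<in> Cc_pos \<and> I (comb f xs) = weight xs * I f" if "\<forall>x\<in>set xs. 0 \<le> fst x" for xs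
      using that
    proof (induction xs)
      case Nil
      have z: "(\<lambda>t. 0 * f t) \<in> Cc_pos" by (rule Cc_pos_scale [OF f]) simp
      have "comb f [] = (\<lambda>t. 0 * f t)" by (auto simp: fun_eq_iff)
      then show ?case using z scale [OF f, of 0] by simp
    next
      case (Cons x xs)
      note t = Cc_pos_translate [OF f, of "- snd x"]
      have x: "(\<lambda>t. fst x * f (- snd x + t)) \<in> Cc_pos" using Cons.prems by (intro Cc_pos_scale t) auto
      have eq: "comb f (x # xs) = (\<lambda>t. fst x * f (- snd x + t) + comb f xs t)" by (auto simp: fun_eq_iff)
      have IH: "comb f xs \<in> Cc_pos" "I (comb f xs) = weight xs * I f" using Cons by auto
      have "I (\<lambda>t. fst x * f (- snd x + t)) = fst x * I f"
        using scale [OF t, of "fst x"] transl [OF f, of "- snd x"] Cons.prems by auto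
      then show ?case unfolding eq using Cc_pos_add [OF x IH(1)] add [OF x IH(1)] IH(2) by (simp add: distrib_right)
    qed
    then have c: "comb f xs \<in> Cc_pos" "I (comb f xs) = weight xs * I f" using xs by (auto simp: covers_def)
    have "1 \<le> weight xs * I f" using mono [OF f0(1) c(1)] xs one c(2) by (auto simp: covers_def)
    then show ?thesis using pos [OF f] by (cases "I f = 0") auto
  qed
  show ?thesis by (rule that [of I]) (use pos add scale transl strict in auto)
qed

end

section \<open>Complex extension of the Haar functional\<close>

definition Cc :: "('g::topological_space \<Rightarrow> complex) set" where
  "Cc = {F. continuous_on UNIV F \<and> (\<exists>K. compact K \<and> (\<forall>x. x \<notin> K \<longrightarrow> F x = 0))}"

lemma CcI: "continuous_on UNIV F \<Longrightarrow> compact K \<Longrightarrow> (\<And>x. x \<notin> K \<Longrightarrow> F x = 0) \<Longrightarrow> F \<in> Cc"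
  by (auto simp: Cc_def)

lemma CcE:
  assumes "F \<in> Cc" obtains K where "continuous_on UNIV F" "compact K" "\<forall>x. x \<notin> K \<longrightarrow> F x = 0"
  using assms by (auto simp: Cc_def)

lemma Cc_add:
  assumes "F \<in> Cc" "G \<in> Cc" shows "(\<lambda>x. F x + G x) \<in> Cc"
proof -
  obtain K where K: "continuous_on UNIV F" "compact K" "\<forall>x. x \<notin> K \<longrightarrow> F x = 0" using CcE [OF assms(1)] .
  obtain L where L: "continuous_on UNIV G" "compact L" "\<forall>x. x \<notin> L \<longrightarrow> G x = 0" using CcE [OF assms(2)] .
  show ?thesis by (rule CcI [OF continuous_on_add [OF K(1) L(1)] compact_Un [OF K(2) L(2)]]) (use K L in auto)
qed

lemma Cc_mult:
  assumes "F \<in> Cc" "continuous_on UNIV g" shows "(\<lambda>x. g x * F x) \<in> Cc"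
proof -
  obtain K where K: "continuous_on UNIV F" "compact K" "\<forall>x. x \<notin> K \<longrightarrow> F x = 0" using CcE [OF assms(1)] .
  show ?thesis by (rule CcI [OF continuous_on_mult [OF assms(2) K(1)] K(2)]) (use K in auto)
qed

lemma Cc_of_real: "p \<in> Cc_pos \<Longrightarrow> (\<lambda>x. complex_of_real (p x)) \<in> Cc"
  using Cc_posD(1,3) [of p] by (auto intro!: CcI continuous_on_of_real)

text \<open>
\<open>J\<close> is the complex extension of the positive functional \<open>I\<close>. The bound with factor \<open>2\<close> is what splitting
into real and imaginary parts gives directly.
\<close>

definition haar_pair :: "(('g::{topological_group_add, t2_space} \<Rightarrow> real) \<Rightarrow> real) \<Rightarrow> (('g \<Rightarrow> complex) \<Rightarrow> complex) \<Rightarrow> bool" where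
  "haar_pair I J \<longleftrightarrow>
     (\<forall>f\<in>Cc_pos. 0 \<le> I f) \<and>
     (\<forall>f\<in>Cc_pos. \<forall>g\<in>Cc_pos. I (\<lambda>t. f t + g t) = I f + I g) \<and>
     (\<forall>f\<in>Cc_pos. \<forall>c\<ge>0. I (\<lambda>t. c * f t) = c * I f) \<and>
     (\<forall>f\<in>Cc_pos. \<forall>a. I (\<lambda>t. f (a + t)) = I f) \<and>
     (\<forall>f\<in>Cc_pos. \<forall>a. f a > 0 \<longrightarrow> I f > 0) \<and>
     (\<forall>f\<in>Cc_pos. \<forall>g\<in>Cc_pos. (\<forall>t. f t \<le> g t) \<longrightarrow> I f \<le> I g) \<and>
     (\<forall>F\<in>Cc. \<forall>G\<in>Cc. J (\<lambda>t. F t + G t) = J F + J G) \<and>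
     (\<forall>F\<in>Cc. \<forall>c. J (\<lambda>t. c * F t) = c * J F) \<and>
     (\<forall>F\<in>Cc. \<forall>p\<in>Cc_pos. (\<forall>t. cmod (F t) \<le> p t) \<longrightarrow> cmod (J F) \<le> 2 * I p) \<and>
     (\<forall>F\<in>Cc. \<forall>a. J (\<lambda>t. F (a + t)) = J F) \<and>
     (\<forall>p\<in>Cc_pos. J (\<lambda>t. complex_of_real (p t)) = complex_of_real (I p))"

text \<open>
An additive functional on the cone of positive functions extends to differences: if \<open>h = a - b\<close> with
\<open>a, b\<close> in the cone, then \<open>I a - I b\<close> depends only on \<open>h\<close>. The complex case is the real case applied to
real and imaginary parts.
\<close>

theorem haar_pair_exists:
  assumes lc: "locally_compact_space (euclidean :: 'g::{topological_group_add, t2_space} topology)"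
  obtains I J where "haar_pair (I :: ('g \<Rightarrow> real) \<Rightarrow> real) J"
proof -
  obtain I :: "('g \<Rightarrow> real) \<Rightarrow> real" where I:
    "\<forall>f\<in>Cc_pos. 0 \<le> I f"
    "\<forall>f\<in>Cc_pos. \<forall>g\<in>Cc_pos. I (\<lambda>t. f t + g t) = I f + I g"
    "\<forall>f\<in>Cc_pos. \<forall>c\<ge>0. I (\<lambda>t. c * f t) = c * I f"
    "\<forall>f\<in>Cc_pos. \<forall>a. I (\<lambda>t. f (a + t)) = I f"
    "\<forall>f\<in>Cc_pos. \<forall>a. f a > 0 \<longrightarrow> I f > 0"
    using haar_functional_pos [OF lc] .
  have Ia: "I (\<lambda>t. f t + g t) = I f + I g" if "f \<in> Cc_pos" "g \<in> Cc_pos" for f g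
    using I(2) [rule_format, OF that] .
  have Is: "I (\<lambda>t. c * f t) = c * I f" if "f \<in> Cc_pos" "0 \<le> c" for f c
    using I(3) [rule_format, OF that] .
  have mono: "I g \<le> I h" if g: "g \<in> Cc_pos" and h: "h \<in> Cc_pos" and le: "\<forall>t. g t \<le> h t" for g h
  proof -
    obtain K where K: "compact K" "\<forall>x. x \<notin> K \<longrightarrow> h x = 0" using Cc_posD(3) [OF h] by auto
    have g0: "g x = 0" if "x \<notin> K" for x using spec [OF le, of x] Cc_posD(2) [OF g, of x] K that by simp
    have d: "(\<lambda>t. h t - g t) \<in> Cc_pos"
      by (rule Cc_posI [OF continuous_on_diff [OF Cc_posD(1) [OF h] Cc_posD(1) [OF g]] _ K(1)]) (use K le g0 in auto)
    have "I (\<lambda>t. (h t - g t) + g t) = I (\<lambda>t. h t - g t) + I g" by (rule Ia [OF d g])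
    moreover have "0 \<le> I (\<lambda>t. h t - g t)" using I(1) d by blast
    ultimately show ?thesis by simp
  qed
  define C where "C = {h :: 'g \<Rightarrow> real. continuous_on UNIV h \<and> (\<exists>K. compact K \<and> (\<forall>x. x \<notin> K \<longrightarrow> h x = 0))}"
  define P where "P h = (\<lambda>x. max 0 (h x))" for h :: "'g \<Rightarrow> real"
  define N where "N h = (\<lambda>x. max 0 (- h x))" for h :: "'g \<Rightarrow> real"
  define R where "R h = I (P h) - I (N h)" for h
  have PC: "P h \<in> Cc_pos" and NC: "N h \<in> Cc_pos" if "h \<in> C" for h
  proof -
    obtain K where K: "compact K" "\<forall>x. x \<notin> K \<longrightarrow> h x = 0" and c: "continuous_on UNIV h" using \<open>h \<in> C\<close> unfolding C_def by auto
    show "P h \<in> Cc_pos" unfolding P_def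
      by (rule Cc_posI [OF continuous_on_max [OF continuous_on_const c] _ K(1)]) (use K in auto)
    show "N h \<in> Cc_pos" unfolding N_def
      by (rule Cc_posI [OF continuous_on_max [OF continuous_on_const continuous_on_minus [OF c]] _ K(1)]) (use K in auto)
  qed
  have CposC: "f \<in> C" if "f \<in> Cc_pos" for f using that by (auto simp: C_def Cc_pos_def)
  have CdiffC: "(\<lambda>x. a x - b x) \<in> C" if ab: "a \<in> Cc_pos" "b \<in> Cc_pos" for a b
  proof -
    obtain K where K: "compact K" "\<forall>x. x \<notin> K \<longrightarrow> a x = 0" using Cc_posD(3) [OF ab(1)] by auto
    obtain L where L: "compact L" "\<forall>x. x \<notin> L \<longrightarrow> b x = 0" using Cc_posD(3) [OF ab(2)] by auto
    have "continuous_on UNIV (\<lambda>x. a x - b x)" by (intro continuous_on_diff Cc_posD(1) ab)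
    then show ?thesis using compact_Un [OF K(1) L(1)] K(2) L(2) unfolding C_def by auto
  qed
  have Rdiff: "R (\<lambda>x. a x - b x) = I a - I b" if ab: "a \<in> Cc_pos" "b \<in> Cc_pos" for a b
  proof -
    let ?h = "\<lambda>x. a x - b x"
    have "(\<lambda>x. P ?h x + b x) = (\<lambda>x. N ?h x + a x)" by (auto simp: P_def N_def fun_eq_iff max_def)
    then have "I (\<lambda>x. P ?h x + b x) = I (\<lambda>x. N ?h x + a x)" by simp
    moreover have "I (\<lambda>x. P ?h x + b x) = I (P ?h) + I b" by (rule Ia [OF PC [OF CdiffC [OF ab]] ab(2)])
    moreover have "I (\<lambda>x. N ?h x + a x) = I (N ?h) + I a" by (rule Ia [OF NC [OF CdiffC [OF ab]] ab(1)])
    ultimately show ?thesis by (simp add: R_def)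
  qed
  have PN: "h = (\<lambda>x. P h x - N h x)" for h by (auto simp: P_def N_def fun_eq_iff max_def)
  have Radd: "R (\<lambda>x. h x + k x) = R h + R k" if hk: "h \<in> C" "k \<in> C" for h k
  proof -
    have "(\<lambda>x. h x + k x) = (\<lambda>x. (P h x + P k x) - (N h x + N k x))" by (auto simp: P_def N_def fun_eq_iff max_def)
    then have "R (\<lambda>x. h x + k x) = I (\<lambda>x. P h x + P k x) - I (\<lambda>x. N h x + N k x)"
      using Rdiff [OF Cc_pos_add Cc_pos_add] PC NC hk by simp
    moreover have "I (\<lambda>x. P h x + P k x) = I (P h) + I (P k)" "I (\<lambda>x. N h x + N k x) = I (N h) + I (N k)"
      using Ia [OF PC PC] Ia [OF NC NC] hk by simp_all
    ultimately show ?thesis by (simp add: R_def)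
  qed
  have Rscale: "R (\<lambda>x. c * h x) = c * R h" if h: "h \<in> C" for c h
  proof (cases "c \<ge> 0")
    case True
    have "(\<lambda>x. c * h x) = (\<lambda>x. c * P h x - c * N h x)"
      unfolding right_diff_distrib [symmetric] by (subst PN [of h]) simp
    then have "R (\<lambda>x. c * h x) = I (\<lambda>x. c * P h x) - I (\<lambda>x. c * N h x)"
      using Rdiff [OF Cc_pos_scale Cc_pos_scale] PC [OF h] NC [OF h] True by simp
    moreover have "I (\<lambda>x. c * P h x) = c * I (P h)" "I (\<lambda>x. c * N h x) = c * I (N h)"
      using Is [OF PC [OF h] True] Is [OF NC [OF h] True] .
    ultimately show ?thesis by (simp add: R_def right_diff_distrib)
  next
    case False
    then have c: "0 \<le> - c" by simp
    have "(\<lambda>x. c * h x) = (\<lambda>x. (- c) * N h x - (- c) * P h x)"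
      unfolding right_diff_distrib [symmetric] by (subst PN [of h]) (simp add: algebra_simps)
    then have "R (\<lambda>x. c * h x) = I (\<lambda>x. (- c) * N h x) - I (\<lambda>x. (- c) * P h x)"
      using Rdiff [OF Cc_pos_scale [OF NC [OF h] c] Cc_pos_scale [OF PC [OF h] c]] by simp
    moreover have "I (\<lambda>x. (- c) * P h x) = (- c) * I (P h)" "I (\<lambda>x. (- c) * N h x) = (- c) * I (N h)"
      using Is [OF PC [OF h] c] Is [OF NC [OF h] c] .
    ultimately show ?thesis by (simp add: R_def algebra_simps)
  qed
  have Rbound: "\<bar>R h\<bar> \<le> I p" if h: "h \<in> C" and p: "p \<in> Cc_pos" and le: "\<And>x. \<bar>h x\<bar> \<le> p x" for h p
  proof -
    have "I (\<lambda>x. P h x + N h x) = I (P h) + I (N h)" by (rule Ia [OF PC [OF h] NC [OF h]])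
    moreover have "I (\<lambda>x. P h x + N h x) \<le> I p"
    proof (rule mono [OF Cc_pos_add [OF PC [OF h] NC [OF h]] p], intro allI)
      show "P h t + N h t \<le> p t" for t using le [of t] by (auto simp: P_def N_def max_def)
    qed
    moreover have "0 \<le> I (P h)" "0 \<le> I (N h)" using I(1) PC [OF h] NC [OF h] by blast+
    ultimately show ?thesis by (simp add: R_def)
  qed
  have Rtrans: "R (\<lambda>x. h (a + x)) = R h" if h: "h \<in> C" for h a
  proof -
    have "P (\<lambda>x. h (a + x)) = (\<lambda>x. P h (a + x))" "N (\<lambda>x. h (a + x)) = (\<lambda>x. N h (a + x))" by (auto simp: P_def N_def)
    then show ?thesis using I(4) PC [OF h] NC [OF h] by (simp add: R_def)
  qed
  define J where "J F = complex_of_real (R (\<lambda>x. Re (F x))) + \<i> * complex_of_real (R (\<lambda>x. Im (F x)))" for F :: "'g \<Rightarrow> complex"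
  have ReC: "(\<lambda>x. Re (F x)) \<in> C" and ImC: "(\<lambda>x. Im (F x)) \<in> C" if "F \<in> Cc" for F
    using that unfolding Cc_def C_def by (auto intro!: continuous_intros)
  have cC: "(\<lambda>x. c * h x) \<in> C" if "h \<in> C" for c h using that unfolding C_def by (auto intro!: continuous_intros)
  have Jadd: "J (\<lambda>t. F t + G t) = J F + J G" if "F \<in> Cc" "G \<in> Cc" for F G
    using Radd [OF ReC ReC] Radd [OF ImC ImC] that by (simp add: J_def algebra_simps)
  have Jscale: "J (\<lambda>t. c * F t) = c * J F" if F: "F \<in> Cc" for c F
  proof -
    have "R (\<lambda>x. Re c * Re (F x) + (- Im c) * Im (F x)) = Re c * R (\<lambda>x. Re (F x)) + (- Im c) * R (\<lambda>x. Im (F x))"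
      using Radd [OF cC [OF ReC [OF F]] cC [OF ImC [OF F]]] Rscale [OF ReC [OF F]] Rscale [OF ImC [OF F]] by metis
    moreover have "R (\<lambda>x. Re c * Im (F x) + Im c * Re (F x)) = Re c * R (\<lambda>x. Im (F x)) + Im c * R (\<lambda>x. Re (F x))"
      using Radd [OF cC [OF ImC [OF F]] cC [OF ReC [OF F]]] Rscale [OF ReC [OF F]] Rscale [OF ImC [OF F]] by metis
    ultimately show ?thesis by (simp add: J_def complex_eq_iff)
  qed
  have Jbound: "cmod (J F) \<le> 2 * I p" if F: "F \<in> Cc" and p: "p \<in> Cc_pos" and le: "\<forall>t. cmod (F t) \<le> p t" for F p
  proof -
    have "\<bar>Re (F x)\<bar> \<le> p x" "\<bar>Im (F x)\<bar> \<le> p x" for x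
      using abs_Re_le_cmod [of "F x"] abs_Im_le_cmod [of "F x"] spec [OF le, of x] by linarith+
    then have "\<bar>R (\<lambda>x. Re (F x))\<bar> \<le> I p" "\<bar>R (\<lambda>x. Im (F x))\<bar> \<le> I p" using Rbound ReC [OF F] ImC [OF F] p by auto
    moreover have "cmod (J F) \<le> \<bar>Re (J F)\<bar> + \<bar>Im (J F)\<bar>" by (rule cmod_le)
    ultimately show ?thesis by (simp add: J_def)
  qed
  have Jtrans: "J (\<lambda>t. F (a + t)) = J F" if "F \<in> Cc" for F a
    using Rtrans [OF ReC [OF that]] Rtrans [OF ImC [OF that]] by (simp add: J_def)
  have Jreal: "J (\<lambda>t. complex_of_real (p t)) = complex_of_real (I p)" if p: "p \<in> Cc_pos" for p
  proof -
    have z: "(\<lambda>x. 0 * p x) \<in> Cc_pos" by (rule Cc_pos_scale [OF p]) simp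
    have "I (\<lambda>x. 0 * p x) = 0 * I p" by (rule Is [OF p]) simp
    then have I0: "I (\<lambda>x. 0) = 0" by simp
    have "R (\<lambda>x. p x - 0 * p x) = I p - I (\<lambda>x. 0 * p x)" by (rule Rdiff [OF p z])
    then have "R p = I p" using I0 by simp
    moreover have "R (\<lambda>x. 0 * p x - 0 * p x) = 0" using Rdiff [OF z z] by simp
    then have "R (\<lambda>x. 0) = 0" by simp
    ultimately show ?thesis by (simp add: J_def)
  qed
  have "haar_pair I J" unfolding haar_pair_def
    by (intro conjI I) ((intro ballI allI impI, rule mono Jadd Jscale Jbound Jtrans Jreal; assumption)+)
  then show ?thesis by (rule that)
qed

section \<open>Approximation of the identity by convolutions\<close>

definition thicken :: "'g::plus set \<Rightarrow> 'g set \<Rightarrow> 'g set" where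
  "thicken W Q = {a + b | a b. a \<in> W \<and> b \<in> Q}"

context
  fixes I :: "('g::{topological_group_add, t2_space} \<Rightarrow> real) \<Rightarrow> real" and J
  assumes lc: "locally_compact_space (euclidean :: 'g topology)" and haar: "haar_pair I J"
begin

lemma I_pos: "f \<in> Cc_pos \<Longrightarrow> 0 \<le> I f"
  and I_add: "f \<in> Cc_pos \<Longrightarrow> g \<in> Cc_pos \<Longrightarrow> I (\<lambda>t. f t + g t) = I f + I g"
  and I_scale: "f \<in> Cc_pos \<Longrightarrow> c \<ge> 0 \<Longrightarrow> I (\<lambda>t. c * f t) = c * I f"
  and I_translate: "f \<in> Cc_pos \<Longrightarrow> I (\<lambda>t. f (a + t)) = I f"
  and I_strict: "f \<in> Cc_pos \<Longrightarrow> f a > 0 \<Longrightarrow> I f > 0"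
  and I_mono: "f \<in> Cc_pos \<Longrightarrow> g \<in> Cc_pos \<Longrightarrow> (\<And>t. f t \<le> g t) \<Longrightarrow> I f \<le> I g"
  and J_add: "F \<in> Cc \<Longrightarrow> G \<in> Cc \<Longrightarrow> J (\<lambda>t. F t + G t) = J F + J G"
  and J_scale: "F \<in> Cc \<Longrightarrow> J (\<lambda>t. z * F t) = z * J F"
  and J_bound: "F \<in> Cc \<Longrightarrow> p \<in> Cc_pos \<Longrightarrow> (\<And>t. cmod (F t) \<le> p t) \<Longrightarrow> cmod (J F) \<le> 2 * I p"
  and J_translate: "F \<in> Cc \<Longrightarrow> J (\<lambda>t. F (a + t)) = J F"
  and J_of_real: "p \<in> Cc_pos \<Longrightarrow> J (\<lambda>t. complex_of_real (p t)) = complex_of_real (I p)"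
  using haar unfolding haar_pair_def by (simp_all, blast)

lemma J_diff: "F \<in> Cc \<Longrightarrow> G \<in> Cc \<Longrightarrow> J (\<lambda>t. F t - G t) = J F - J G"
  using J_add [of F "\<lambda>t. (-1) * G t"] J_scale [of G "-1"] Cc_mult [of G "\<lambda>_. -1"] by simp

lemma I_sum:
  "finite S \<Longrightarrow> (\<And>s. s \<in> S \<Longrightarrow> u s \<in> Cc_pos) \<Longrightarrow> S \<noteq> {} \<Longrightarrow>
    (\<lambda>x. \<Sum>s\<in>S. u s x) \<in> Cc_pos \<and> I (\<lambda>x. \<Sum>s\<in>S. u s x) = (\<Sum>s\<in>S. I (u s))"
proof (induction S rule: finite_induct)
  case (insert s S)
  show ?case
  proof (cases "S = {}")
    case False
    then have IH: "(\<lambda>x. \<Sum>s\<in>S. u s x) \<in> Cc_pos" "I (\<lambda>x. \<Sum>s\<in>S. u s x) = (\<Sum>s\<in>S. I (u s))" using insert by auto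
    have us: "u s \<in> Cc_pos" using insert by auto
    show ?thesis using Cc_pos_add [OF us IH(1)] I_add [OF us IH(1)] IH(2) insert by simp
  qed (use insert in simp)
qed simp

lemma J_sum:
  "finite S \<Longrightarrow> (\<And>s. s \<in> S \<Longrightarrow> F s \<in> Cc) \<Longrightarrow>
    (\<lambda>x. \<Sum>s\<in>S. F s x) \<in> Cc \<and> J (\<lambda>x. \<Sum>s\<in>S. F s x) = (\<Sum>s\<in>S. J (F s))"
proof (induction S rule: finite_induct)
  case empty
  have z: "(\<lambda>x::'g. 0::complex) \<in> Cc" by (rule CcI [OF _ compact_empty]) auto
  then show ?case using J_scale [OF z, of 0] by simp
next
  case (insert s S)
  then have IH: "(\<lambda>x. \<Sum>s\<in>S. F s x) \<in> Cc" "J (\<lambda>x. \<Sum>s\<in>S. F s x) = (\<Sum>s\<in>S. J (F s))" by auto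
  have Fs: "F s \<in> Cc" using insert by auto
  show ?case using Cc_add [OF Fs IH(1)] J_add [OF Fs IH(1)] IH(2) insert by simp
qed

text \<open>
The operator \<open>f \<mapsto> (t \<mapsto> \<integral> p(s) f(t + s) ds)\<close>, that is, convolution from the right by a measure with
density \<open>p\<close>.
\<close>

definition conv_op :: "('g \<Rightarrow> real) \<Rightarrow> ('g \<Rightarrow> complex) \<Rightarrow> 'g \<Rightarrow> complex" where
  "conv_op p f = (if continuous_on UNIV f then (\<lambda>t. J (\<lambda>s. complex_of_real (p s) * f (t + s))) else 0)"

lemma conv_in_Cc:
  fixes p :: "'g \<Rightarrow> real"
  assumes p: "p \<in> Cc_pos" and f: "continuous_on UNIV f"
  shows "(\<lambda>s. complex_of_real (p s) * f (t + s)) \<in> Cc"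
  using Cc_mult [OF Cc_of_real [OF p] continuous_on_left_translate [OF f, of t]] by (simp add: mult.commute)

lemma conv_op_bound:
  fixes p :: "'g \<Rightarrow> real"
  assumes p: "p \<in> Cc_pos" and f: "continuous_on UNIV f" and g: "continuous_on UNIV g"
    and le: "\<And>s. p s \<noteq> 0 \<Longrightarrow> cmod (f (t + s) - g (t' + s)) \<le> e" and e: "0 \<le> e"
  shows "cmod (conv_op p f t - conv_op p g t') \<le> 2 * (e * I p)"
proof -
  let ?F = "\<lambda>s. complex_of_real (p s) * f (t + s) - complex_of_real (p s) * g (t' + s)"
  have eq: "conv_op p f t - conv_op p g t' = J ?F"
    unfolding conv_op_def using J_diff [OF conv_in_Cc [OF p f, of t] conv_in_Cc [OF p g, of t']] f g by simp
  have F: "?F \<in> Cc"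
    using Cc_add [OF conv_in_Cc [OF p f, of t] Cc_mult [OF conv_in_Cc [OF p g, of t'], of "\<lambda>_. -1"]] by simp
  have "cmod (?F s) \<le> e * p s" for s
  proof (cases "p s = 0")
    case False
    have "?F s = complex_of_real (p s) * (f (t + s) - g (t' + s))" by (simp add: right_diff_distrib)
    then have "cmod (?F s) = p s * cmod (f (t + s) - g (t' + s))" using Cc_posD(2) [OF p, of s] by (simp add: norm_mult)
    also have "\<dots> \<le> p s * e" using le [OF False] Cc_posD(2) [OF p, of s] by (intro mult_left_mono)
    finally show ?thesis by (simp add: mult.commute)
  qed simp
  then have "cmod (J ?F) \<le> 2 * I (\<lambda>s. e * p s)" by (rule J_bound [OF F Cc_pos_scale [OF p e]])
  then show ?thesis unfolding eq I_scale [OF p e] .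
qed

lemma conv_op_zero: "conv_op p (\<lambda>_. 0) t = 0"
proof -
  have z: "(\<lambda>x::'g. 0::complex) \<in> Cc" by (rule CcI [OF _ compact_empty]) auto
  show ?thesis using J_scale [OF z, of 0] by (simp add: conv_op_def)
qed

lemma conv_op_bound1:
  assumes p: "p \<in> Cc_pos" and f: "continuous_on UNIV f"
    and le: "\<And>s. p s \<noteq> 0 \<Longrightarrow> cmod (f (t + s)) \<le> e" and e: "0 \<le> e"
  shows "cmod (conv_op p f t) \<le> 2 * (e * I p)"
  using conv_op_bound [where p = p and f = f and g = "\<lambda>_. 0" and t = t and t' = t and e = e, OF p f continuous_on_const _ e] le
  by (simp add: conv_op_zero)

lemma translates_equicontinuous:
  assumes f: "continuous_on UNIV (f :: 'g \<Rightarrow> complex)" and W: "compact W" and e: "e > 0"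
  obtains U where "open U" "t \<in> U" "\<forall>s\<in>W. \<forall>y\<in>U. cmod (f (y + s) - f (t + s)) < e"
proof -
  have "continuous_on UNIV (\<lambda>z :: 'g \<times> 'g. f (snd z + fst z))"
    by (intro continuous_on_compose2 [OF f] continuous_intros) auto
  from compact_uniform [OF W this e, of t] show ?thesis using that by simp metis
qed

text \<open>
For operators that are given by formulas it is convenient to have the algebraic conditions pointwise
and the continuity in terms of suprema over compact sets.
\<close>

lemma cfun_operatorI:
  fixes T :: "('g \<Rightarrow> complex) \<Rightarrow> 'g \<Rightarrow> complex"
  assumes cont: "\<And>f. continuous_on UNIV f \<Longrightarrow> continuous_on UNIV (T f)"
    and add: "\<And>f g. continuous_on UNIV f \<Longrightarrow> continuous_on UNIV g \<Longrightarrow> T (\<lambda>x. f x + g x) = (\<lambda>x. T f x + T g x)"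
    and scale: "\<And>f c. continuous_on UNIV f \<Longrightarrow> T (\<lambda>x. c * f x) = (\<lambda>x. c * T f x)"
    and zero: "\<And>f. \<not> continuous_on UNIV f \<Longrightarrow> T f = 0"
    and bd: "\<And>K e. compact K \<Longrightarrow> e > 0 \<Longrightarrow> \<exists>L d. compact L \<and> d > 0 \<and>
      (\<forall>f. continuous_on UNIV f \<longrightarrow> (\<forall>x\<in>L. cmod (f x) < d) \<longrightarrow> (\<forall>x\<in>K. cmod (T f x) < e))"
  shows "T \<in> continuous_linear_maps continuous_functions continuous_functions"
proof (rule continuous_linear_mapsI [OF locally_convex_space_cfun locally_convex_space_cfun])
  show "T \<in> topspace continuous_functions \<rightarrow> topspace continuous_functions" using cont by (simp add: topspace_cfun)
  show "linear_on (topspace continuous_functions) T"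
    using add scale by (simp add: linear_on_def topspace_cfun plus_fun_def scaleC_fun_def scaleC_complex_def)
  show "T x = 0" if "x \<notin> topspace continuous_functions" for x using zero that by (simp add: topspace_cfun)
  fix P assume "zero_nbhd (continuous_functions :: ('g \<Rightarrow> complex) topology) P"
  then obtain K e where K: "compact K" "e > 0" "{h \<in> cfun. \<forall>x\<in>K. cmod (h x) < e} \<subseteq> P" unfolding zero_nbhd_cfun by auto
  obtain L d where L: "compact L" "d > 0"
    "\<forall>f. continuous_on UNIV f \<longrightarrow> (\<forall>x\<in>L. cmod (f x) < d) \<longrightarrow> (\<forall>x\<in>K. cmod (T f x) < e)" using bd [OF K(1,2)] by auto
  have "T f \<in> P" if "f \<in> {h \<in> cfun. \<forall>x\<in>L. cmod (h x) < d}" for f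
    using that L(3) cont by (intro subsetD [OF K(3)]) simp
  then show "\<exists>M. zero_nbhd continuous_functions M \<and> T ` M \<subseteq> P"
    using zero_nbhd_cfunI [OF L(1,2)] by (intro exI [of _ "{h \<in> cfun. \<forall>x\<in>L. cmod (h x) < d}"]) auto
qed

text \<open>
Two applications of Ascoli's theorem: to the operators, and for each \<open>f\<close> to the functions \<open>T f\<close>.
\<close>

lemma tb_cfun_operators:
  fixes H :: "(('g \<Rightarrow> complex) \<Rightarrow> 'g \<Rightarrow> complex) set"
  assumes H: "H \<subseteq> continuous_linear_maps continuous_functions continuous_functions"
    and bd: "\<And>K e. compact K \<Longrightarrow> e > 0 \<Longrightarrow> \<exists>L d. compact L \<and> d > 0 \<and>
      (\<forall>T\<in>H. \<forall>f. continuous_on UNIV f \<longrightarrow> (\<forall>x\<in>L. cmod (f x) < d) \<longrightarrow> (\<forall>x\<in>K. cmod (T f x) < e))"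
    and equi: "\<And>f t e. continuous_on UNIV f \<Longrightarrow> e > 0 \<Longrightarrow>
      \<exists>U. open U \<and> t \<in> U \<and> (\<forall>T\<in>H. \<forall>y\<in>U. cmod (T f y - T f t) < e)"
    and pw: "\<And>f t. continuous_on UNIV f \<Longrightarrow> \<exists>C. \<forall>T\<in>H. cmod (T f t) \<le> C"
  shows "totally_bounded_in (operator_space continuous_functions continuous_functions) H"
proof (rule tb_operator_space [OF locally_convex_space_cfun locally_convex_space_cfun H])
  fix P assume "zero_nbhd (continuous_functions :: ('g \<Rightarrow> complex) topology) P"
  then obtain K e where K: "compact K" "e > 0" "{h \<in> cfun. \<forall>x\<in>K. cmod (h x) < e} \<subseteq> P" unfolding zero_nbhd_cfun by auto
  obtain L d where L: "compact L" "d > 0"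
    "\<forall>T\<in>H. \<forall>f. continuous_on UNIV f \<longrightarrow> (\<forall>x\<in>L. cmod (f x) < d) \<longrightarrow> (\<forall>x\<in>K. cmod (T f x) < e)" using bd [OF K(1,2)] by auto
  have "T f \<in> P" if T: "T \<in> H" and f: "f \<in> {h \<in> cfun. \<forall>x\<in>L. cmod (h x) < d}" for T f
  proof (rule subsetD [OF K(3)])
    have "T f \<in> cfun" using continuous_linear_maps_in [OF locally_convex_space_cfun subsetD [OF H T], of f] by (simp add: topspace_cfun)
    then show "T f \<in> {h \<in> cfun. \<forall>x\<in>K. cmod (h x) < e}" using L(3) T f by simp
  qed
  then show "\<exists>M. zero_nbhd continuous_functions M \<and> (\<forall>h\<in>H. \<forall>x\<in>M. h x \<in> P)"
    using zero_nbhd_cfunI [OF L(1,2)] by (intro exI [of _ "{h \<in> cfun. \<forall>x\<in>L. cmod (h x) < d}"]) auto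
next
  fix f assume "f \<in> topspace (continuous_functions :: ('g \<Rightarrow> complex) topology)"
  then have f: "continuous_on UNIV f" by (simp add: topspace_cfun)
  show "totally_bounded_in continuous_functions ((\<lambda>T. T f) ` H)"
  proof (rule tb_cfunI)
    show "(\<lambda>T. T f) ` H \<subseteq> cfun"
      using continuous_linear_maps_in [OF locally_convex_space_cfun subsetD [OF H], of _ f] by (auto simp: topspace_cfun)
    show "\<exists>U. open U \<and> t \<in> U \<and> (\<forall>h\<in>(\<lambda>T. T f) ` H. \<forall>y\<in>U. cmod (h y - h t) < e)" if "e > 0" for t e
      using equi [OF f that, of t] by auto
    show "\<exists>C. \<forall>h\<in>(\<lambda>T. T f) ` H. cmod (h t) \<le> C" for t using pw [OF f, of t] by auto
  qed
qed

lemma conv_op_uniform_bound: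
  assumes W: "compact W" and K: "compact K" and C: "C > 0" and e: "e > 0"
  shows "\<exists>L d. compact L \<and> d > 0 \<and> (\<forall>p\<in>Cc_pos. I p \<le> C \<longrightarrow> (\<forall>x. p x \<noteq> 0 \<longrightarrow> x \<in> W) \<longrightarrow>
      (\<forall>f. continuous_on UNIV f \<longrightarrow> (\<forall>x\<in>L. cmod (f x) < d) \<longrightarrow> (\<forall>x\<in>K. cmod (conv_op p f x) < e)))"
proof (intro exI conjI ballI allI impI)
  show "compact {a + b | a b. a \<in> K \<and> b \<in> W}" by (rule compact_plus [OF lc K W])
  \<comment> \<open>below \<open>e / (2 * C)\<close>, as the bound for \<open>J\<close> has the factor \<open>2\<close>\<close>
  show d: "e / (3 * C) > 0" using e C by simp
  fix p f x assume p: "p \<in> Cc_pos" "I p \<le> C" "\<forall>x. p x \<noteq> 0 \<longrightarrow> x \<in> W" and f: "continuous_on UNIV f"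
    and le: "\<forall>x\<in>{a + b | a b. a \<in> K \<and> b \<in> W}. cmod (f x) < e / (3 * C)" and x: "x \<in> K"
  have "cmod (f (x + s)) \<le> e / (3 * C)" if "p s \<noteq> 0" for s
  proof -
    have "x + s \<in> {a + b | a b. a \<in> K \<and> b \<in> W}" using p(3) x that by blast
    then show ?thesis using le by (blast intro: less_imp_le)
  qed
  from conv_op_bound1 [OF p(1) f this less_imp_le [OF d]]
  have "cmod (conv_op p f x) \<le> 2 * (e / (3 * C) * I p)" by simp
  also have "\<dots> \<le> 2 * (e / (3 * C) * C)" using p(2) d by (intro mult_left_mono) auto
  also have "\<dots> < e" using C e by simp
  finally show "cmod (conv_op p f x) < e" .
qed

lemma conv_op_equicontinuous:
  assumes W: "compact W" and C: "C > 0" and f: "continuous_on UNIV f" and e: "e > 0"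
  obtains U where "open U" "t \<in> U"
    "\<forall>p\<in>Cc_pos. I p \<le> C \<longrightarrow> (\<forall>x. p x \<noteq> 0 \<longrightarrow> x \<in> W) \<longrightarrow> (\<forall>y\<in>U. cmod (conv_op p f y - conv_op p f t) < e)"
proof -
  have d: "e / (3 * C) > 0" using e C by simp
  obtain U where U: "open U" "t \<in> U" "\<forall>s\<in>W. \<forall>y\<in>U. cmod (f (y + s) - f (t + s)) < e / (3 * C)"
    using translates_equicontinuous [OF f W d] .
  show ?thesis
  proof (rule that [OF U(1,2)], intro ballI impI)
    fix p y assume p: "p \<in> Cc_pos" "I p \<le> C" "\<forall>x. p x \<noteq> 0 \<longrightarrow> x \<in> W" and y: "y \<in> U"
    have "cmod (f (y + s) - f (t + s)) \<le> e / (3 * C)" if "p s \<noteq> 0" for s using U(3) y p(3) that by (blast intro: less_imp_le)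
    from conv_op_bound [OF p(1) f f this less_imp_le [OF d]]
    have "cmod (conv_op p f y - conv_op p f t) \<le> 2 * (e / (3 * C) * I p)" by simp
    also have "\<dots> \<le> 2 * (e / (3 * C) * C)" using p(2) d by (intro mult_left_mono) auto
    also have "\<dots> < e" using C e by simp
    finally show "cmod (conv_op p f y - conv_op p f t) < e" .
  qed
qed

lemma conv_op_continuous_linear:
  assumes p: "p \<in> Cc_pos"
  shows "conv_op p \<in> continuous_linear_maps continuous_functions continuous_functions"
proof -
  obtain W where W: "compact W" "\<forall>x. x \<notin> W \<longrightarrow> p x = 0" using Cc_posD(3) [OF p] by auto
  have pW: "\<forall>x. p x \<noteq> 0 \<longrightarrow> x \<in> W" using W by auto
  have C: "I p + 1 > 0" "I p \<le> I p + 1" using I_pos [OF p] by auto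
  show ?thesis
  proof (rule cfun_operatorI)
    fix f :: "'g \<Rightarrow> complex" assume f: "continuous_on UNIV f"
    show "continuous_on UNIV (conv_op p f)" unfolding continuous_on_topological
    proof (intro ballI allI impI)
      fix t V assume "open V" "conv_op p f t \<in> V"
      then obtain e where e: "e > 0" "ball (conv_op p f t) e \<subseteq> V" by (meson openE)
      obtain U where U: "open U" "t \<in> U"
        "\<forall>q\<in>Cc_pos. I q \<le> I p + 1 \<longrightarrow> (\<forall>x. q x \<noteq> 0 \<longrightarrow> x \<in> W) \<longrightarrow> (\<forall>y\<in>U. cmod (conv_op q f y - conv_op q f t) < e)"
        using conv_op_equicontinuous [OF W(1) C(1) f e(1)] .
      have "conv_op p f y \<in> V" if "y \<in> U" for y
      proof (rule subsetD [OF e(2)])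
        show "conv_op p f y \<in> ball (conv_op p f t) e" using U(3) p C(2) pW that by (simp add: dist_norm norm_minus_commute [of "conv_op p f t"])
      qed
      then show "\<exists>A. open A \<and> t \<in> A \<and> (\<forall>y\<in>UNIV. y \<in> A \<longrightarrow> conv_op p f y \<in> V)" using U by auto
    qed
    show "conv_op p (\<lambda>x. c * f x) = (\<lambda>x. c * conv_op p f x)" for c
      using J_scale [OF conv_in_Cc [OF p f], where z = c] f continuous_on_mult [OF continuous_on_const f, of c]
      by (simp add: conv_op_def fun_eq_iff mult.left_commute)
    fix g :: "'g \<Rightarrow> complex" assume g: "continuous_on UNIV g"
    show "conv_op p (\<lambda>x. f x + g x) = (\<lambda>x. conv_op p f x + conv_op p g x)"
      using J_add [OF conv_in_Cc [OF p f] conv_in_Cc [OF p g]] f g continuous_on_add [OF f g]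
      by (simp add: conv_op_def fun_eq_iff distrib_left)
  next
    show "\<exists>L d. compact L \<and> d > 0 \<and> (\<forall>f. continuous_on UNIV f \<longrightarrow> (\<forall>x\<in>L. cmod (f x) < d) \<longrightarrow> (\<forall>x\<in>K. cmod (conv_op p f x) < e))"
      if K: "compact K" and e: "e > 0" for K e
    proof -
      obtain L d where "compact L" "d > 0" "\<forall>q\<in>Cc_pos. I q \<le> I p + 1 \<longrightarrow> (\<forall>x. q x \<noteq> 0 \<longrightarrow> x \<in> W) \<longrightarrow>
          (\<forall>f. continuous_on UNIV f \<longrightarrow> (\<forall>x\<in>L. cmod (f x) < d) \<longrightarrow> (\<forall>x\<in>K. cmod (conv_op q f x) < e))"
        using conv_op_uniform_bound [OF W(1) K C(1) e] by (elim exE conjE)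
      then show ?thesis using p C(2) pW by (intro exI [of _ L] exI [of _ d]) simp
    qed
  qed (simp add: conv_op_def)
qed

text \<open>
The modulus of continuity of \<open>conv_op p f\<close> at \<open>t\<close> is controlled by that of the translates of \<open>f\<close> by
elements of \<open>W\<close>, so it does not depend on \<open>p\<close>.
\<close>

lemma tb_conv_ops:
  assumes W: "compact W"
  shows "totally_bounded_in (operator_space continuous_functions continuous_functions)
     (conv_op ` {p \<in> Cc_pos. I p = 1 \<and> (\<forall>x. p x \<noteq> 0 \<longrightarrow> x \<in> W)})"
proof (rule tb_cfun_operators)
  show "conv_op ` {p \<in> Cc_pos. I p = 1 \<and> (\<forall>x. p x \<noteq> 0 \<longrightarrow> x \<in> W)} \<subseteq> continuous_linear_maps continuous_functions continuous_functions"
    using conv_op_continuous_linear by auto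
next
  fix K :: "'g set" and e :: real assume K: "compact K" and e: "e > 0"
  obtain L d where "compact L" "d > 0" "\<forall>p\<in>Cc_pos. I p \<le> 1 \<longrightarrow> (\<forall>x. p x \<noteq> 0 \<longrightarrow> x \<in> W) \<longrightarrow>
      (\<forall>f. continuous_on UNIV f \<longrightarrow> (\<forall>x\<in>L. cmod (f x) < d) \<longrightarrow> (\<forall>x\<in>K. cmod (conv_op p f x) < e))"
    using conv_op_uniform_bound [OF W K zero_less_one e] by (elim exE conjE)
  then show "\<exists>L d. compact L \<and> d > 0 \<and> (\<forall>T\<in>conv_op ` {p \<in> Cc_pos. I p = 1 \<and> (\<forall>x. p x \<noteq> 0 \<longrightarrow> x \<in> W)}.
      \<forall>f. continuous_on UNIV f \<longrightarrow> (\<forall>x\<in>L. cmod (f x) < d) \<longrightarrow> (\<forall>x\<in>K. cmod (T f x) < e))"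
    by (intro exI [of _ L] exI [of _ d]) simp
next
  fix f :: "'g \<Rightarrow> complex" and t and e :: real assume f: "continuous_on UNIV f" and e: "e > 0"
  obtain U where "open U" "t \<in> U"
    "\<forall>p\<in>Cc_pos. I p \<le> 1 \<longrightarrow> (\<forall>x. p x \<noteq> 0 \<longrightarrow> x \<in> W) \<longrightarrow> (\<forall>y\<in>U. cmod (conv_op p f y - conv_op p f t) < e)"
    using conv_op_equicontinuous [OF W zero_less_one f e] .
  then show "\<exists>U. open U \<and> t \<in> U \<and> (\<forall>T\<in>conv_op ` {p \<in> Cc_pos. I p = 1 \<and> (\<forall>x. p x \<noteq> 0 \<longrightarrow> x \<in> W)}.
      \<forall>y\<in>U. cmod (T f y - T f t) < e)" by (intro exI [of _ U]) simp
next
  fix f :: "'g \<Rightarrow> complex" and t assume f: "continuous_on UNIV f"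
  have "compact ((\<lambda>s. t + s) ` W)" using W by (intro compact_continuous_image continuous_intros)
  then obtain C where C: "C > 0" "\<forall>x\<in>(\<lambda>s. t + s) ` W. cmod (f x) \<le> C" using cfun_bounded_on_compact [OF f] by metis
  have "cmod (conv_op p f t) \<le> 2 * C" if p: "p \<in> Cc_pos" "I p = 1" "\<forall>x. p x \<noteq> 0 \<longrightarrow> x \<in> W" for p
    using conv_op_bound1 [OF p(1) f, of t C] C p(2,3) by auto
  then show "\<exists>C. \<forall>T\<in>conv_op ` {p \<in> Cc_pos. I p = 1 \<and> (\<forall>x. p x \<noteq> 0 \<longrightarrow> x \<in> W)}. cmod (T f t) \<le> C"
    by (intro exI [of _ "2 * C"]) simp
qed

section \<open>Approximation of convolutions by Riemann sums\<close>

text \<open>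
A Riemann sum for \<open>conv_op p\<close>, with masses \<open>c s\<close> at the points of \<open>S\<close>.
\<close>

definition sum_op :: "('g \<Rightarrow> real) \<Rightarrow> 'g set \<Rightarrow> ('g \<Rightarrow> real) \<Rightarrow> ('g \<Rightarrow> complex) \<Rightarrow> 'g \<Rightarrow> complex" where
  "sum_op p S c f = (if continuous_on UNIV f
     then (\<lambda>t. \<Sum>s\<in>S. complex_of_real (c s) * (complex_of_real (p (- t + s)) * f s)) else 0)"

text \<open>
Translates of \<open>Q\<close> carry at most mass \<open>C\<close>, uniformly in the translation. Total mass would be too
restrictive: it grows without bound as the sums approximate the Haar integral on larger compact sets.
\<close>

definition bounded_mass :: "'g set \<Rightarrow> real \<Rightarrow> 'g set \<Rightarrow> ('g \<Rightarrow> real) \<Rightarrow> bool" where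
  "bounded_mass Q C S c \<longleftrightarrow> finite S \<and> (\<forall>s. 0 \<le> c s) \<and> (\<forall>t. (\<Sum>s\<in>S \<inter> {s. - t + s \<in> Q}. c s) \<le> C)"

lemma bounded_mass_sum:
  assumes m: "bounded_mass Q C S c" and z: "\<And>s. - t + s \<notin> Q \<Longrightarrow> z s = 0"
    and b: "\<And>s. - t + s \<in> Q \<Longrightarrow> cmod (z s) \<le> b" "0 \<le> b"
  shows "cmod (\<Sum>s\<in>S. complex_of_real (c s) * z s) \<le> C * b"
proof -
  have S: "finite S" and c: "\<And>s. 0 \<le> c s" and le: "(\<Sum>s\<in>S \<inter> {s. - t + s \<in> Q}. c s) \<le> C"
    using m by (auto simp: bounded_mass_def)
  have "(\<Sum>s\<in>S. complex_of_real (c s) * z s) = (\<Sum>s\<in>S \<inter> {s. - t + s \<in> Q}. complex_of_real (c s) * z s)"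
    by (rule sum.mono_neutral_right [OF S]) (use z in auto)
  also have "cmod \<dots> \<le> (\<Sum>s\<in>S \<inter> {s. - t + s \<in> Q}. c s * b)"
  proof (rule sum_norm_le)
    fix s assume "s \<in> S \<inter> {s. - t + s \<in> Q}"
    then have "cmod (z s) \<le> b" using b(1) by auto
    then show "cmod (complex_of_real (c s) * z s) \<le> c s * b" using c [of s] by (simp add: norm_mult mult_left_mono)
  qed
  also have "\<dots> = (\<Sum>s\<in>S \<inter> {s. - t + s \<in> Q}. c s) * b" by (simp add: sum_distrib_right)
  also have "\<dots> \<le> C * b" using le b(2) by (rule mult_right_mono)
  finally show ?thesis .
qed

context
  fixes p :: "'g \<Rightarrow> real" and Q W U0 :: "'g set" and M C :: real
  assumes p: "p \<in> Cc_pos" and Q: "compact Q" "\<And>x. p x \<noteq> 0 \<Longrightarrow> x \<in> Q"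
    and M: "M > 0" "\<And>x. p x \<le> M" and W: "compact W" "open U0" "0 \<in> U0" "U0 \<subseteq> W" and C: "C > 0"
begin

lemma compact_thicken: "compact (thicken W Q)"
  unfolding thicken_def by (rule compact_plus [OF lc W(1) Q(1)])

lemma subset_thicken: "x \<in> Q \<Longrightarrow> x \<in> thicken W Q"
  unfolding thicken_def using W(3,4) by (intro CollectI exI [of _ 0] exI [of _ x]) auto

lemma sum_op_bound:
  assumes m: "bounded_mass (thicken W Q) C S c" and f: "continuous_on UNIV f"
    and b: "\<And>s. - t + s \<in> thicken W Q \<Longrightarrow> cmod (f s) \<le> b" "0 \<le> b"
  shows "cmod (sum_op p S c f t) \<le> C * (M * b)"
proof -
  have "cmod (\<Sum>s\<in>S. complex_of_real (c s) * (complex_of_real (p (- t + s)) * f s)) \<le> C * (M * b)"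
  proof (rule bounded_mass_sum [OF m])
    fix s
    show "complex_of_real (p (- t + s)) * f s = 0" if "- t + s \<notin> thicken W Q"
    proof -
      have "p (- t + s) = 0" using Q(2) subset_thicken that by blast
      then show ?thesis by simp
    qed
    show "cmod (complex_of_real (p (- t + s)) * f s) \<le> M * b" if "- t + s \<in> thicken W Q"
      using b(1) [OF that] M(2) [of "- t + s"] Cc_posD(2) [OF p, of "- t + s"] M(1)
      by (simp add: norm_mult mult_mono)
  qed (use M b(2) in simp)
  then show ?thesis using f by (simp add: sum_op_def)
qed

lemma sum_op_uniform_bound:
  assumes K: "compact K" and e: "e > 0"
  obtains L d where "compact L" "d > 0"
    "\<forall>S c f. bounded_mass (thicken W Q) C S c \<longrightarrow> continuous_on UNIV f \<longrightarrow> (\<forall>x\<in>L. cmod (f x) < d) \<longrightarrow> (\<forall>x\<in>K. cmod (sum_op p S c f x) < e)"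
proof (rule that)
  show "compact {a + b | a b. a \<in> K \<and> b \<in> thicken W Q}" by (rule compact_plus [OF lc K compact_thicken])
  show d: "e / (2 * C * M) > 0" using e C M by simp
  show "\<forall>S c f. bounded_mass (thicken W Q) C S c \<longrightarrow> continuous_on UNIV f \<longrightarrow> (\<forall>x\<in>{a + b | a b. a \<in> K \<and> b \<in> thicken W Q}. cmod (f x) < e / (2 * C * M)) \<longrightarrow>
     (\<forall>x\<in>K. cmod (sum_op p S c f x) < e)"
  proof (intro allI impI ballI)
    fix S c f x assume m: "bounded_mass (thicken W Q) C S c" and f: "continuous_on UNIV f"
      and le: "\<forall>x\<in>{a + b | a b. a \<in> K \<and> b \<in> thicken W Q}. cmod (f x) < e / (2 * C * M)" and x: "x \<in> K"
    have "cmod (f s) \<le> e / (2 * C * M)" if "- x + s \<in> thicken W Q" for s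
    proof -
      have "x + (- x + s) \<in> {a + b | a b. a \<in> K \<and> b \<in> thicken W Q}" using x that by blast
      then have "s \<in> {a + b | a b. a \<in> K \<and> b \<in> thicken W Q}" by simp
      then show ?thesis using le by (blast intro: less_imp_le)
    qed
    from sum_op_bound [OF m f this less_imp_le [OF d]]
    have "cmod (sum_op p S c f x) \<le> C * (M * (e / (2 * C * M)))" by simp
    also have "\<dots> = e / 2" using C M by (simp add: field_simps)
    finally show "cmod (sum_op p S c f x) < e" using e by simp
  qed
qed

lemma compact_translate_thicken: "compact ((\<lambda>s. t + s) ` (thicken W Q))"
  by (intro compact_continuous_image continuous_intros compact_thicken)

lemma in_translate_thicken: "- t + s \<in> thicken W Q \<Longrightarrow> s \<in> (\<lambda>s. t + s) ` (thicken W Q)"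
  by (rule image_eqI [of _ _ "- t + s"]) auto

text \<open>
For \<open>y\<close> close to \<open>t\<close> only the points \<open>s\<close> with \<open>-t + s \<in> W + Q\<close> contribute to the difference, and their
mass is bounded by assumption; the rest is the continuity of \<open>p\<close>.
\<close>

lemma sum_op_equicontinuous:
  assumes f: "continuous_on UNIV f" and e: "e > 0"
  obtains U where "open U" "t \<in> U"
    "\<forall>S c. bounded_mass (thicken W Q) C S c \<longrightarrow> (\<forall>y\<in>U. cmod (sum_op p S c f y - sum_op p S c f t) < e)"
proof -
  obtain B where B: "B > 0" "\<forall>x\<in>(\<lambda>s. t + s) ` (thicken W Q). cmod (f x) \<le> B"
    using cfun_bounded_on_compact [OF f compact_translate_thicken] by metis
  define \<eta> where "\<eta> = e / (2 * C * B)"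
  have \<eta>: "\<eta> > 0" using e C B by (simp add: \<eta>_def)
  have "continuous_on UNIV (\<lambda>z :: 'g \<times> 'g. complex_of_real (p (- snd z + fst z)))"
    by (intro continuous_on_of_real continuous_on_compose2 [OF Cc_posD(1) [OF p]] continuous_intros) auto
  then obtain U1 where U1: "open U1" "t \<in> U1" "\<forall>s\<in>(\<lambda>s. t + s) ` (thicken W Q). \<forall>y\<in>U1.
      cmod (complex_of_real (p (- snd (s, y) + fst (s, y))) - complex_of_real (p (- snd (s, t) + fst (s, t)))) < \<eta>"
    by (rule compact_uniform [OF compact_translate_thicken _ \<eta>])
  have "continuous_on UNIV (\<lambda>y. - t + y)" by (intro continuous_intros)
  from open_vimage [OF W(2) this] have op: "open {y. - t + y \<in> U0}" by (simp add: vimage_def)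
  show ?thesis
  proof (rule that [of "U1 \<inter> {y. - t + y \<in> U0}"]; (intro allI impI ballI)?)
    show "open (U1 \<inter> {y. - t + y \<in> U0})" using U1 op by auto
    show "t \<in> U1 \<inter> {y. - t + y \<in> U0}" using U1 W by simp
    fix S c y assume m: "bounded_mass (thicken W Q) C S c" and y: "y \<in> U1 \<inter> {y. - t + y \<in> U0}"
    have "sum_op p S c f y - sum_op p S c f t =
        (\<Sum>s\<in>S. complex_of_real (c s) * ((complex_of_real (p (- y + s)) - complex_of_real (p (- t + s))) * f s))"
      using f by (simp add: sum_op_def sum_subtractf [symmetric] left_diff_distrib right_diff_distrib)
    also have "cmod \<dots> \<le> C * (\<eta> * B)"
    proof (rule bounded_mass_sum [OF m])
      fix s
      show "(complex_of_real (p (- y + s)) - complex_of_real (p (- t + s))) * f s = 0" if s: "- t + s \<notin> thicken W Q"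
      proof -
        have 1: "p (- t + s) = 0" using Q(2) subset_thicken s by blast
        have "p (- y + s) = 0"
        proof (rule ccontr)
          assume "p (- y + s) \<noteq> 0"
          then have "- y + s \<in> Q" by (rule Q(2))
          moreover have "- t + y \<in> W" using y W(4) by auto
          ultimately have "(- t + y) + (- y + s) \<in> thicken W Q" unfolding thicken_def by blast
          then show False using s by (simp add: add.assoc)
        qed
        then show ?thesis using 1 by simp
      qed
      show "cmod ((complex_of_real (p (- y + s)) - complex_of_real (p (- t + s))) * f s) \<le> \<eta> * B" if "- t + s \<in> thicken W Q"
      proof -
        have s: "s \<in> (\<lambda>s. t + s) ` (thicken W Q)" by (rule in_translate_thicken [OF that])
        have "cmod (complex_of_real (p (- y + s)) - complex_of_real (p (- t + s))) \<le> \<eta>"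
          using bspec [OF bspec [OF U1(3) s], of y] y by simp
        moreover have "cmod (f s) \<le> B" using B(2) s by blast
        ultimately show ?thesis unfolding norm_mult using \<eta> by (intro mult_mono) auto
      qed
    qed (use \<eta> B in simp)
    also have "C * (\<eta> * B) = e / 2" using C B by (simp add: \<eta>_def field_simps)
    finally show "cmod (sum_op p S c f y - sum_op p S c f t) < e" using e by simp
  qed
qed

lemma sum_op_finite_rank:
  assumes m: "bounded_mass (thicken W Q) C S c"
  shows "sum_op p S c \<in> finite_rank_operators continuous_functions"
proof (rule finite_rank_operatorsI)
  show S: "finite S" using m by (simp add: bounded_mass_def)
  show "sum_op p S c f = (\<Sum>s\<in>S. f s *\<^sub>C (\<lambda>t. complex_of_real (c s * p (- t + s))))"
    if "f \<in> topspace continuous_functions" for f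
    using that by (simp add: sum_op_def topspace_cfun fun_eq_iff fun_sum_apply scaleC_fun_def scaleC_complex_def mult.commute mult.left_commute)
  show "sum_op p S c \<in> continuous_linear_maps continuous_functions continuous_functions"
  proof (rule cfun_operatorI)
    fix f :: "'g \<Rightarrow> complex" assume f: "continuous_on UNIV f"
    have "continuous_on UNIV (\<lambda>t. p (- t + s))" for s
      by (intro continuous_on_compose2 [OF Cc_posD(1) [OF p]] continuous_intros) auto
    then show "continuous_on UNIV (sum_op p S c f)"
      using f by (simp add: sum_op_def) (intro continuous_on_sum continuous_on_mult continuous_on_const continuous_on_of_real)
    show "sum_op p S c (\<lambda>x. d * f x) = (\<lambda>x. d * sum_op p S c f x)" for d
      using f continuous_on_mult [OF continuous_on_const f, of d]
      by (simp add: sum_op_def fun_eq_iff sum_distrib_left mult.left_commute)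
    fix g :: "'g \<Rightarrow> complex" assume g: "continuous_on UNIV g"
    show "sum_op p S c (\<lambda>x. f x + g x) = (\<lambda>x. sum_op p S c f x + sum_op p S c g x)"
      using f g continuous_on_add [OF f g] by (simp add: sum_op_def fun_eq_iff distrib_left sum.distrib)
  next
    fix K :: "'g set" and e :: real assume K: "compact K" and e: "e > 0"
    obtain L d where "compact L" "d > 0" "\<forall>S c f. bounded_mass (thicken W Q) C S c \<longrightarrow> continuous_on UNIV f \<longrightarrow>
        (\<forall>x\<in>L. cmod (f x) < d) \<longrightarrow> (\<forall>x\<in>K. cmod (sum_op p S c f x) < e)"
      using sum_op_uniform_bound [OF K e] .
    then show "\<exists>L d. compact L \<and> d > 0 \<and> (\<forall>f. continuous_on UNIV f \<longrightarrow> (\<forall>x\<in>L. cmod (f x) < d) \<longrightarrow> (\<forall>x\<in>K. cmod (sum_op p S c f x) < e))"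
      using m by (intro exI [of _ L] exI [of _ d]) simp
  qed (simp add: sum_op_def)
qed

lemma tb_sum_ops:
  "totally_bounded_in (operator_space continuous_functions continuous_functions) {sum_op p S c | S c. bounded_mass (thicken W Q) C S c}"
proof (rule tb_cfun_operators)
  show "{sum_op p S c | S c. bounded_mass (thicken W Q) C S c} \<subseteq> continuous_linear_maps continuous_functions continuous_functions"
    using sum_op_finite_rank finite_rank_subset by blast
next
  fix K :: "'g set" and e :: real assume K: "compact K" and e: "e > 0"
  obtain L d where "compact L" "d > 0" "\<forall>S c f. bounded_mass (thicken W Q) C S c \<longrightarrow> continuous_on UNIV f \<longrightarrow>
      (\<forall>x\<in>L. cmod (f x) < d) \<longrightarrow> (\<forall>x\<in>K. cmod (sum_op p S c f x) < e)"
    using sum_op_uniform_bound [OF K e] .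
  then show "\<exists>L d. compact L \<and> d > 0 \<and> (\<forall>T\<in>{sum_op p S c | S c. bounded_mass (thicken W Q) C S c}.
      \<forall>f. continuous_on UNIV f \<longrightarrow> (\<forall>x\<in>L. cmod (f x) < d) \<longrightarrow> (\<forall>x\<in>K. cmod (T f x) < e))"
    by (intro exI [of _ L] exI [of _ d]) auto
next
  fix f :: "'g \<Rightarrow> complex" and t and e :: real assume f: "continuous_on UNIV f" and e: "e > 0"
  obtain U where "open U" "t \<in> U"
    "\<forall>S c. bounded_mass (thicken W Q) C S c \<longrightarrow> (\<forall>y\<in>U. cmod (sum_op p S c f y - sum_op p S c f t) < e)"
    using sum_op_equicontinuous [OF f e] .
  then show "\<exists>U. open U \<and> t \<in> U \<and> (\<forall>T\<in>{sum_op p S c | S c. bounded_mass (thicken W Q) C S c}. \<forall>y\<in>U. cmod (T f y - T f t) < e)"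
    by (intro exI [of _ U]) auto
next
  fix f :: "'g \<Rightarrow> complex" and t assume f: "continuous_on UNIV f"
  obtain B where B: "B > 0" "\<forall>x\<in>(\<lambda>s. t + s) ` (thicken W Q). cmod (f x) \<le> B"
    using cfun_bounded_on_compact [OF f compact_translate_thicken] by metis
  have "cmod (sum_op p S c f t) \<le> C * (M * B)" if "bounded_mass (thicken W Q) C S c" for S c
    by (rule sum_op_bound [OF that f bspec [OF B(2) in_translate_thicken]]) (use B in auto)
  then show "\<exists>D. \<forall>T\<in>{sum_op p S c | S c. bounded_mass (thicken W Q) C S c}. cmod (T f t) \<le> D" by (intro exI [of _ "C * (M * B)"]) auto
qed

end

lemma Cc_pos_of_bump:
  "continuous_on UNIV p \<Longrightarrow> \<forall>x. 0 \<le> p x \<and> p x \<le> (1::real) \<Longrightarrow> compact L \<Longrightarrow> \<forall>x. x \<notin> V \<inter> L \<longrightarrow> p x = 0 \<Longrightarrow> p \<in> Cc_pos"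
  by (rule Cc_posI [of p L]) auto

lemma cutoff:
  assumes "compact (K :: 'g set)"
  obtains w where "w \<in> Cc_pos" "\<forall>x. w x \<le> 1" "\<forall>x\<in>K. w x = 1"
proof -
  obtain w :: "'g \<Rightarrow> real" and L where w: "continuous_on UNIV w" "\<forall>x. 0 \<le> w x \<and> w x \<le> 1" "\<forall>x\<in>K. w x = 1"
    "compact L" "\<forall>x. x \<notin> UNIV \<inter> L \<longrightarrow> w x = 0"
    using bump_function [OF lc assms open_UNIV subset_UNIV] .
  show ?thesis by (rule that [OF Cc_pos_of_bump [OF w(1,2,4,5)]]) (use w in auto)
qed

text \<open>
By left invariance \<open>conv_op p h t\<close> is the integral of \<open>G(s) = p(-t + s) h(s)\<close>, and \<open>G\<close> vanishes outside
\<open>K + Q\<close>. With a fine partition of unity \<open>u\<^sub>s\<close> on this set, \<open>G\<close> is uniformly close to \<open>\<Sum>\<^sub>s G(s) u\<^sub>s\<close>,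
whose integral is the Riemann sum with masses \<open>I(u\<^sub>s)\<close>. The mass that falls into a translate of \<open>Q2\<close> is
the integral of a function that is dominated by a translate of \<open>w2\<close>, so it is at most \<open>I w2\<close>.
\<close>

lemma quadrature:
  assumes p: "p \<in> Cc_pos" and Q: "compact Q" "\<And>x. p x \<noteq> 0 \<Longrightarrow> x \<in> Q"
    and W: "compact W" "open U0" "0 \<in> U0" "U0 \<subseteq> W" and Q2: "compact Q2"
    and w2: "w2 \<in> Cc_pos" "\<forall>x\<in>{a + b | a b. a \<in> Q2 \<and> b \<in> W}. w2 x = 1"
    and A: "totally_bounded_in continuous_functions A" and K: "compact K" and e: "e > 0"
  obtains S c where "bounded_mass Q2 (I w2) S c" "\<forall>h\<in>A. \<forall>t\<in>K. cmod (sum_op p S c h t - conv_op p h t) < e"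
proof -
  obtain M where M: "M > 0" "\<forall>x. p x \<le> M" using Cc_pos_bounded [OF p] .
  define L where "L = {a + b | a b. a \<in> K \<and> b \<in> Q}"
  have L: "compact L" unfolding L_def by (rule compact_plus [OF lc K Q(1)])
  obtain w where w: "w \<in> Cc_pos" "\<forall>x. w x \<le> 1" "\<forall>x\<in>{a + b | a b. a \<in> L \<and> b \<in> W}. w x = 1"
    using cutoff [OF compact_plus [OF lc L W(1)]] .
  obtain B where B: "B > 0" "\<forall>h\<in>A. \<forall>x\<in>L. cmod (h x) \<le> B" using tb_cfun_bounded [OF A L] .
  \<comment> \<open>the error is at most \<open>2 d\<close> on the support of \<open>w\<close>, hence \<open>4 d I w < e\<close> after integration\<close>
  define d where "d = e / (8 * (I w + 1))"
  have Iw: "I w \<ge> 0" by (rule I_pos [OF w(1)])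
  have d: "d > 0" using e Iw by (simp add: d_def)
  have d1: "d / M > 0" "d / B > 0" using d M B by auto
  \<comment> \<open>\<open>G\<close> is a product: \<open>V1\<close> controls the factor \<open>h\<close>, \<open>V2\<close> the factor \<open>p\<close>\<close>
  obtain V1 where V1: "open V1" "0 \<in> V1" "\<forall>h\<in>A. \<forall>s\<in>L. \<forall>v\<in>V1. cmod (h (s + v) - h s) < d / M"
    using tb_cfun_right_uniform [OF lc A d1(1) L] .
  have p0: "\<And>x. x \<notin> Q \<Longrightarrow> p x = 0" using Q(2) by blast
  obtain V2 where V2: "open V2" "0 \<in> V2" "\<forall>s t. - s + t \<in> V2 \<longrightarrow> \<bar>p t - p s\<bar> < d / B"
    using left_uniformly_continuous [OF lc Cc_posD(1) [OF p] Q(1) p0 d1(2)] .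
  define V where "V = V1 \<inter> V2 \<inter> U0"
  have V: "open V" "0 \<in> V" using V1 V2 W by (auto simp: V_def)
  obtain S :: "'g set" and u :: "'g \<Rightarrow> 'g \<Rightarrow> real" and L' where
    u: "finite S" "S \<subseteq> L" "\<forall>s. continuous_on UNIV (u s)" "\<forall>s t. 0 \<le> u s t"
    "\<forall>s t. u s t \<noteq> 0 \<longrightarrow> - s + t \<in> V \<inter> L'" "compact L'" "\<forall>t\<in>L. (\<Sum>s\<in>S. u s t) = 1" "\<forall>t. (\<Sum>s\<in>S. u s t) \<le> 1"
    using partition_of_unity [OF lc L V] .
  have uC: "u s \<in> Cc_pos" for s
  proof -
    have "compact ((\<lambda>x. s + x) ` L')" using u(6) by (intro compact_continuous_image continuous_intros)
    then show ?thesis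
    proof (rule Cc_posI [OF spec [OF u(3)] spec [OF spec [OF u(4)]]])
      fix x assume x: "x \<notin> (\<lambda>x. s + x) ` L'"
      show "u s x = 0"
      proof (rule ccontr)
        assume "u s x \<noteq> 0"
        then have "- s + x \<in> L'" using u(5) by blast
        then have "s + (- s + x) \<in> (\<lambda>x. s + x) ` L'" by (rule imageI)
        then show False using x by simp
      qed
    qed
  qed
  have uV: "- s + x \<in> V" if "u s x \<noteq> 0" for s x using u(5) that by blast
  define c where "c s = I (u s)" for s
  have mass: "bounded_mass Q2 (I w2) S c" unfolding bounded_mass_def
  proof (intro conjI allI u(1))
    show "0 \<le> c s" for s unfolding c_def by (rule I_pos [OF uC])
    fix t
    let ?S = "S \<inter> {s. - t + s \<in> Q2}"
    show "(\<Sum>s\<in>?S. c s) \<le> I w2"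
    proof (cases "?S = {}")
      case True
      then show ?thesis using I_pos [OF w2(1)] by simp
    next
      case False
      have fin: "finite ?S" using u(1) by simp
      note sm = I_sum [OF fin uC False]
      have "(\<Sum>s\<in>?S. c s) = I (\<lambda>x. \<Sum>s\<in>?S. u s x)" using sm by (simp add: c_def)
      also have "\<dots> \<le> I (\<lambda>x. w2 (- t + x))"
      proof (rule I_mono [OF conjunct1 [OF sm] Cc_pos_translate [OF w2(1)]])
        fix x
        show "(\<Sum>s\<in>?S. u s x) \<le> w2 (- t + x)"
        proof (cases "\<exists>s\<in>?S. u s x \<noteq> 0")
          case True
          then obtain s where s: "s \<in> ?S" "u s x \<noteq> 0" by auto
          have "- t + s \<in> Q2" using s(1) by simp
          moreover have "- s + x \<in> W" using uV [OF s(2)] W(4) by (auto simp: V_def)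
          ultimately have "(- t + s) + (- s + x) \<in> {a + b | a b. a \<in> Q2 \<and> b \<in> W}" by blast
          then have "w2 ((- t + s) + (- s + x)) = 1" by (rule bspec [OF w2(2)])
          then have "w2 (- t + x) = 1" by (simp add: add.assoc)
          moreover have "(\<Sum>s\<in>?S. u s x) \<le> (\<Sum>s\<in>S. u s x)" using u(1,4) by (intro sum_mono2) auto
          ultimately show ?thesis using spec [OF u(8), of x] by simp
        next
          case False
          then have "(\<Sum>s\<in>?S. u s x) = 0" by (intro sum.neutral) simp
          then show ?thesis using Cc_posD(2) [OF w2(1)] by simp
        qed
      qed
      also have "\<dots> = I w2" by (rule I_translate [OF w2(1)])
      finally show ?thesis .
    qed
  qed
  show ?thesis
  proof (rule that [OF mass], intro ballI)
    fix h t assume h: "h \<in> A" and t: "t \<in> K"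
    have hc: "continuous_on UNIV h" by (rule tb_cfun_subset [OF A h])
    define G where "G s = complex_of_real (p (- t + s)) * h s" for s
    have supp: "s \<in> L" if "p (- t + s) \<noteq> 0" for s
    proof -
      have "t + (- t + s) \<in> L" unfolding L_def using t Q(2) [OF that] by blast
      then show ?thesis by simp
    qed
    have GC: "G \<in> Cc"
      using Cc_mult [OF Cc_of_real [OF Cc_pos_translate [OF p, of "- t"]] hc]
      unfolding G_def by (simp add: mult.commute)
    have "J G = J (\<lambda>s. G (t + s))" by (rule J_translate [OF GC, symmetric])
    also have "\<dots> = conv_op p h t" using hc by (simp add: conv_op_def G_def)
    finally have JG: "conv_op p h t = J G" ..
    have SO: "sum_op p S c h t = (\<Sum>s\<in>S. complex_of_real (c s) * G s)" using hc by (simp add: sum_op_def G_def)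
    let ?F = "\<lambda>s x. (G s - G x) * complex_of_real (u s x)"
    have Gc: "continuous_on UNIV G" using CcE [OF GC] by metis
    have cF: "continuous_on UNIV (\<lambda>x. G s - G x)" for s by (intro continuous_on_diff continuous_on_const Gc)
    have FC: "?F s \<in> Cc" for s by (rule Cc_mult [OF Cc_of_real [OF uC] cF])
    have GuC: "(\<lambda>x. G s * complex_of_real (u s x)) \<in> Cc" for s by (rule Cc_mult [OF Cc_of_real [OF uC] continuous_on_const])
    note sF = J_sum [OF u(1), where F = ?F, OF FC]
      and sG = J_sum [OF u(1), where F = "\<lambda>s x. G s * complex_of_real (u s x)", OF GuC]
    have "J (\<lambda>x. \<Sum>s\<in>S. G s * complex_of_real (u s x)) = (\<Sum>s\<in>S. J (\<lambda>x. G s * complex_of_real (u s x)))" using sG by simp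
    also have "\<dots> = (\<Sum>s\<in>S. G s * complex_of_real (c s))"
      unfolding c_def J_scale [OF Cc_of_real [OF uC]] J_of_real [OF uC] ..
    finally have 1: "sum_op p S c h t = J (\<lambda>x. \<Sum>s\<in>S. G s * complex_of_real (u s x))" unfolding SO by (simp add: mult.commute)
    have Gsum: "G x = (\<Sum>s\<in>S. G x * complex_of_real (u s x))" for x
    proof (cases "x \<in> L")
      case True
      then have "(\<Sum>s\<in>S. complex_of_real (u s x)) = 1" using u(7) by (simp add: of_real_sum [symmetric])
      then show ?thesis by (simp add: sum_distrib_left [symmetric])
    next
      case False
      then have "G x = 0" using supp [of x] by (auto simp: G_def)
      then show ?thesis by simp
    qed
    have "(\<lambda>x. (\<Sum>s\<in>S. G s * complex_of_real (u s x)) - G x) = (\<lambda>x. \<Sum>s\<in>S. ?F s x)"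
    proof
      fix x
      have "(\<Sum>s\<in>S. ?F s x) = (\<Sum>s\<in>S. G s * complex_of_real (u s x)) - (\<Sum>s\<in>S. G x * complex_of_real (u s x))"
        by (simp add: left_diff_distrib sum_subtractf)
      then show "(\<Sum>s\<in>S. G s * complex_of_real (u s x)) - G x = (\<Sum>s\<in>S. ?F s x)" using Gsum [of x] by simp
    qed
    then have 2: "sum_op p S c h t - conv_op p h t = J (\<lambda>x. \<Sum>s\<in>S. ?F s x)"
      unfolding 1 JG using J_diff [OF conjunct1 [OF sG] GC] by simp
    have "cmod (\<Sum>s\<in>S. ?F s x) \<le> (2 * d) * w x" for x
    proof (cases "\<exists>s\<in>S. u s x \<noteq> 0")
      case False
      then have "(\<Sum>s\<in>S. ?F s x) = 0" by (intro sum.neutral) simp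
      then show ?thesis using Cc_posD(2) [OF w(1), of x] d by simp
    next
      case True
      then obtain s0 where s0: "s0 \<in> S" "u s0 x \<noteq> 0" by auto
      have "- s0 + x \<in> W" using uV [OF s0(2)] W(4) by (auto simp: V_def)
      then have "s0 + (- s0 + x) \<in> {a + b | a b. a \<in> L \<and> b \<in> W}" using s0(1) u(2) by blast
      then have "w (s0 + (- s0 + x)) = 1" by (rule bspec [OF w(3)])
      then have w1: "w x = 1" by simp
      have "cmod (\<Sum>s\<in>S. ?F s x) \<le> (\<Sum>s\<in>S. (2 * d) * u s x)"
      proof (rule sum_norm_le)
        fix s assume s: "s \<in> S"
        show "cmod (?F s x) \<le> (2 * d) * u s x"
        proof (cases "u s x = 0")
          case False
          have v: "- s + x \<in> V1" "- s + x \<in> V2" using uV [OF False] by (auto simp: V_def)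
          have sL: "s \<in> L" using s u(2) by auto
          have "cmod (h (s + (- s + x)) - h s) < d / M" using V1(3) h sL v(1) by blast
          then have hd: "cmod (h x - h s) \<le> d / M" by simp
          have "- (- t + s) + (- t + x) = - s + x" by (simp only: minus_add minus_minus add.assoc add_minus_cancel)
          then have "\<bar>p (- t + x) - p (- t + s)\<bar> < d / B" using V2(3) v(2) by metis
          then have pd: "cmod (complex_of_real (p (- t + x)) - complex_of_real (p (- t + s))) \<le> d / B"
            by (simp only: of_real_diff [symmetric] norm_of_real)
          have hB: "cmod (h s) \<le> B" using B(2) h sL by blast
          have "G x - G s = complex_of_real (p (- t + x)) * (h x - h s) + (complex_of_real (p (- t + x)) - complex_of_real (p (- t + s))) * h s"
            by (simp add: G_def algebra_simps)
          then have "cmod (G x - G s) \<le> cmod (complex_of_real (p (- t + x)) * (h x - h s)) + cmod ((complex_of_real (p (- t + x)) - complex_of_real (p (- t + s))) * h s)"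
            by (simp only: norm_triangle_ineq)
          also have "\<dots> \<le> M * (d / M) + (d / B) * B"
            unfolding norm_mult using hd pd hB M(2) Cc_posD(2) [OF p] M(1) d1 d by (intro add_mono mult_mono) auto
          also have "\<dots> = 2 * d" using M B by simp
          finally have "cmod (G s - G x) \<le> 2 * d" by (simp only: norm_minus_commute [of "G s"])
          then have "cmod (G s - G x) * u s x \<le> (2 * d) * u s x" using u(4) by (intro mult_right_mono) auto
          then show ?thesis using u(4) by (simp add: norm_mult)
        qed simp
      qed
      also have "\<dots> = (2 * d) * (\<Sum>s\<in>S. u s x)" by (simp add: sum_distrib_left)
      also have "\<dots> \<le> (2 * d) * 1" using u(8) d by (intro mult_left_mono) auto
      finally show ?thesis using w1 by simp
    qed
    moreover have "0 \<le> 2 * d" using d by simp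
    ultimately have "cmod (J (\<lambda>x. \<Sum>s\<in>S. ?F s x)) \<le> 2 * I (\<lambda>x. (2 * d) * w x)"
      by (intro J_bound [OF conjunct1 [OF sF] Cc_pos_scale [OF w(1)]])
    also have "\<dots> = 4 * d * I w" using I_scale [OF w(1), of "2 * d"] d by simp
    also have "\<dots> = (e / 2) * (I w / (I w + 1))" using Iw by (simp add: d_def field_simps)
    also have "\<dots> \<le> (e / 2) * 1" using Iw e by (intro mult_left_mono) auto
    also have "\<dots> < e" using e by simp
    finally show "cmod (sum_op p S c h t - conv_op p h t) < e" unfolding 2 .
  qed
qed

text \<open>
The bound \<open>I w + 1\<close> on the masses comes from the support of \<open>p\<close> alone, so all approximating sums lie in
one totally bounded set.
\<close>

lemma conv_op_in_closure:
  assumes p: "p \<in> Cc_pos"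
  shows "conv_op p \<in> tb_topology (operator_space continuous_functions continuous_functions)
     closure_of finite_rank_operators continuous_functions"
proof -
  let ?C = "continuous_functions :: ('g \<Rightarrow> complex) topology"
  let ?Y = "operator_space ?C ?C"
  note lY = locally_convex_space_operator_space [OF locally_convex_space_cfun locally_convex_space_cfun]
  note topY = topspace_operator_space [OF locally_convex_space_cfun locally_convex_space_cfun]
  obtain Q where Q: "compact Q" "\<forall>x. x \<notin> Q \<longrightarrow> p x = 0" using Cc_posD(3) [OF p] by auto
  have pQ: "\<And>x. p x \<noteq> 0 \<Longrightarrow> x \<in> Q" using Q(2) by blast
  obtain M where M: "M > 0" "\<forall>x. p x \<le> M" using Cc_pos_bounded [OF p] .
  obtain U0 W where W: "open U0" "compact W" "(0::'g) \<in> U0" "U0 \<subseteq> W" using compact_neighbourhood [OF lc] .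
  define Q2 where "Q2 = {a + b | a b. a \<in> W \<and> b \<in> Q}"
  have Q2: "compact Q2" unfolding Q2_def by (rule compact_plus [OF lc W(2) Q(1)])
  obtain w where w: "w \<in> Cc_pos" "\<forall>x. w x \<le> 1" "\<forall>x\<in>{a + b | a b. a \<in> Q2 \<and> b \<in> W}. w x = 1"
    using cutoff [OF compact_plus [OF lc Q2 W(2)]] .
  have C: "I w + 1 > 0" using I_pos [OF w(1)] by simp
  have mass: "bounded_mass Q2 (I w + 1) S c" if "bounded_mass Q2 (I w) S c" for S c
    using that unfolding bounded_mass_def by (auto intro: order_trans)
  note ctx = p Q(1) pQ M(1) spec [OF M(2)] W(2,1,3,4) C
  have eqQ: "thicken W Q = Q2" unfolding thicken_def Q2_def ..
  let ?A = "{sum_op p S c | S c. bounded_mass Q2 (I w + 1) S c}"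
  have tb: "totally_bounded_in ?Y ?A" using tb_sum_ops [OF ctx] unfolding eqQ .
  have fr: "?A \<subseteq> finite_rank_operators ?C" using sum_op_finite_rank [OF ctx] unfolding eqQ by blast
  have sub: "finite_rank_operators ?C \<subseteq> topspace ?Y" using finite_rank_subset topY by metis
  show ?thesis
  proof (rule tb_topology_closure_approx [OF lY tb sub])
    have "?A \<inter> finite_rank_operators ?C = ?A" using fr by blast
    moreover have "conv_op p \<in> ?Y closure_of ?A"
      unfolding in_closure_of_iff_zero_nbhd [OF lY order_trans [OF fr sub]]
    proof (intro conjI allI impI)
      show "conv_op p \<in> topspace ?Y" unfolding topY by (rule conv_op_continuous_linear [OF p])
      fix N assume "zero_nbhd ?Y N"
      then obtain A P where A: "totally_bounded_in ?C A" and P: "zero_nbhd ?C P"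
        and N: "{h \<in> continuous_linear_maps ?C ?C. \<forall>x\<in>A. h x \<in> P} \<subseteq> N"
        unfolding zero_nbhd_operator_space [OF locally_convex_space_cfun locally_convex_space_cfun] by auto
      obtain K e where K: "compact K" "e > 0" "{h \<in> cfun. \<forall>x\<in>K. cmod (h x) < e} \<subseteq> P" using P unfolding zero_nbhd_cfun by auto
      obtain S c where S: "bounded_mass Q2 (I w) S c" "\<forall>h\<in>A. \<forall>t\<in>K. cmod (sum_op p S c h t - conv_op p h t) < e"
        using quadrature [OF p Q(1) pQ W(2,1,3,4) Q2 w(1,3) A K(1,2)] .
      have inA: "sum_op p S c \<in> ?A" using mass [OF S(1)] by blast
      have D: "sum_op p S c - conv_op p \<in> continuous_linear_maps ?C ?C"
        by (rule complex_vector.subspace_diff [OF csubspace_continuous_linear_maps [OF locally_convex_space_cfun locally_convex_space_cfun]])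
          (use inA fr finite_rank_subset conv_op_continuous_linear [OF p] in blast)+
      have "(sum_op p S c - conv_op p) h \<in> P" if h: "h \<in> A" for h
      proof (rule subsetD [OF K(3)])
        have "(sum_op p S c - conv_op p) h \<in> cfun" using continuous_linear_maps_in [OF locally_convex_space_cfun D, of h] by (simp add: topspace_cfun)
        then show "(sum_op p S c - conv_op p) h \<in> {h \<in> cfun. \<forall>x\<in>K. cmod (h x) < e}" using S(2) h by simp
      qed
      then have "sum_op p S c - conv_op p \<in> N" using D by (intro subsetD [OF N]) simp
      then show "\<exists>y\<in>?A. y - conv_op p \<in> N" using inA by (rule bexI)
    qed
    ultimately show "conv_op p \<in> ?Y closure_of (?A \<inter> finite_rank_operators ?C)" by simp
  qed
qed

text \<open>
The operators \<open>conv_op p\<close> lie in the closure of the finite rank operators and in one totally bounded set,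
and they approximate the identity when the support of \<open>p\<close> shrinks; the closure is closed.
\<close>

theorem tb_approximation_property_cfun: "tb_approximation_property (continuous_functions :: ('g \<Rightarrow> complex) topology)"
proof (rule tb_approximation_propertyI [OF locally_convex_space_cfun])
  let ?C = "continuous_functions :: ('g \<Rightarrow> complex) topology"
  let ?Y = "operator_space ?C ?C"
  let ?one = "\<lambda>f. if f \<in> topspace ?C then f else 0"
  note lC = locally_convex_space_cfun
  note lY = locally_convex_space_operator_space [OF lC lC]
  note topY = topspace_operator_space [OF lC lC]
  let ?F = "tb_topology ?Y closure_of finite_rank_operators ?C"
  obtain U0 W where W: "open U0" "compact W" "(0::'g) \<in> U0" "U0 \<subseteq> W" using compact_neighbourhood [OF lc] .
  let ?A = "conv_op ` {p \<in> Cc_pos. I p = 1 \<and> (\<forall>x. p x \<noteq> 0 \<longrightarrow> x \<in> W)}"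
  have AF: "?A \<subseteq> ?F" using conv_op_in_closure by auto
  have FY: "?F \<subseteq> topspace ?Y" using closure_of_subset_topspace [of "tb_topology ?Y"] topspace_tb_topology [OF lY] by metis
  have one: "?one \<in> continuous_linear_maps ?C ?C"
    by (rule cfun_operatorI) (auto simp: topspace_cfun continuous_on_add continuous_on_mult_left)
  have "?one \<in> ?Y closure_of ?A"
    unfolding in_closure_of_iff_zero_nbhd [OF lY order_trans [OF AF FY]]
  proof (intro conjI allI impI)
    show "?one \<in> topspace ?Y" unfolding topY by (rule one)
    fix N assume "zero_nbhd ?Y N"
    then obtain A P where A: "totally_bounded_in ?C A" and P: "zero_nbhd ?C P"
      and N: "{h \<in> continuous_linear_maps ?C ?C. \<forall>x\<in>A. h x \<in> P} \<subseteq> N"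
      unfolding zero_nbhd_operator_space [OF lC lC] by auto
    obtain K e where K: "compact K" "e > 0" "{h \<in> cfun. \<forall>x\<in>K. cmod (h x) < e} \<subseteq> P" using P unfolding zero_nbhd_cfun by auto
    have e4: "e / 4 > 0" using K(2) by simp
    obtain U where U: "open U" "0 \<in> U" "\<forall>h\<in>A. \<forall>t\<in>K. \<forall>s\<in>U. cmod (h (t + s) - h t) < e / 4"
      using tb_cfun_right_uniform [OF lc A e4 K(1)] .
    have UU: "open (U \<inter> U0)" "{0} \<subseteq> U \<inter> U0" using U W by auto
    obtain q :: "'g \<Rightarrow> real" and L where q: "continuous_on UNIV q" "\<forall>x. 0 \<le> q x \<and> q x \<le> 1" "\<forall>x\<in>{0}. q x = 1"
      "compact L" "\<forall>x. x \<notin> (U \<inter> U0) \<inter> L \<longrightarrow> q x = 0"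
      using bump_function [OF lc compact_sing UU] .
    have qC: "q \<in> Cc_pos" by (rule Cc_pos_of_bump [OF q(1,2,4,5)])
    have Iq: "I q > 0" by (rule I_strict [OF qC, of 0]) (use q(3) in simp)
    define p where "p x = (1 / I q) * q x" for x
    have pC: "p \<in> Cc_pos" unfolding p_def by (rule Cc_pos_scale [OF qC]) (use Iq in simp)
    have "I p = (1 / I q) * I q" unfolding p_def by (rule I_scale [OF qC]) (use Iq in simp)
    then have Ip: "I p = 1" using Iq by simp
    have pU: "x \<in> U \<inter> U0" if "p x \<noteq> 0" for x using q(5) that unfolding p_def by (metis IntD1 mult_zero_right)
    have inA: "conv_op p \<in> ?A" using pC Ip pU W(4) by (intro imageI CollectI conjI allI impI) auto
    have D: "conv_op p - ?one \<in> continuous_linear_maps ?C ?C"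
      by (rule complex_vector.subspace_diff [OF csubspace_continuous_linear_maps [OF lC lC] conv_op_continuous_linear [OF pC] one])
    have "(conv_op p - ?one) h \<in> P" if h: "h \<in> A" for h
    proof (rule subsetD [OF K(3)])
      have hc: "continuous_on UNIV h" by (rule tb_cfun_subset [OF A h])
      have "(conv_op p - ?one) h \<in> cfun" using continuous_linear_maps_in [OF lC D, of h] by (simp add: topspace_cfun)
      moreover have "cmod ((conv_op p - ?one) h t) < e" if t: "t \<in> K" for t
      proof -
        let ?k = "\<lambda>_::'g. h t"
        have kc: "continuous_on UNIV ?k" by (rule continuous_on_const)
        have "conv_op p ?k t = J (\<lambda>s. h t * complex_of_real (p s))" by (simp add: conv_op_def mult.commute)
        also have "\<dots> = h t" unfolding J_scale [OF Cc_of_real [OF pC]] J_of_real [OF pC] Ip by simp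
        finally have k: "conv_op p ?k t = h t" .
        have "cmod (h (t + s) - ?k (t + s)) \<le> e / 4" if "p s \<noteq> 0" for s
          using U(3) h t pU [OF that] by (blast intro: less_imp_le)
        from conv_op_bound [OF pC hc kc this less_imp_le [OF e4]]
        have "cmod (conv_op p h t - conv_op p ?k t) \<le> 2 * (e / 4 * I p)" .
        then have "cmod (conv_op p h t - h t) < e" using K(2) by (simp add: k Ip)
        then show ?thesis using hc by (simp add: topspace_cfun)
      qed
      ultimately show "(conv_op p - ?one) h \<in> {h \<in> cfun. \<forall>x\<in>K. cmod (h x) < e}" by simp
    qed
    then have "conv_op p - ?one \<in> N" using D by (intro subsetD [OF N] CollectI conjI ballI)
    then show "\<exists>y\<in>?A. y - ?one \<in> N" using inA by (rule bexI)
  qed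
  moreover have "?A \<inter> ?F = ?A" using AF by blast
  ultimately have "?one \<in> tb_topology ?Y closure_of ?F"
    by (intro tb_topology_closure_approx [OF lY tb_conv_ops [OF W(2)] FY]) simp
  then show "?one \<in> ?F" by (simp add: closure_of_closure_of)
qed

end

theorem theorem1:
  assumes "locally_compact_space (euclidean :: 'g::{topological_group_add, t2_space} topology)"
  shows "stereotype_approximation_property (continuous_functions :: ('g \<Rightarrow> complex) topology) \<and>
         stereotype_approximation_property
           (compact_support_measures :: (('g \<Rightarrow> complex) \<Rightarrow> complex) topology)"
proof -
  let ?C = "continuous_functions :: ('g \<Rightarrow> complex) topology"
  obtain I :: "('g \<Rightarrow> real) \<Rightarrow> real" and J where "haar_pair I J" using haar_pair_exists [OF assms] .
  then have ap: "tb_approximation_property ?C" by (rule tb_approximation_property_cfun [OF assms])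
  have st: "stereotype_space ?C" by (rule stereotype_space_cfun [OF assms])
  show ?thesis
    unfolding compact_support_measures_def
    by (intro conjI stereotype_approximation_propertyI st ap stereotype_space_dual tb_approximation_property_dual)
qed

end
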